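(* Let $W_i=(\psi_i,Y_i(0),Y_i(1))$, $i\ge1$, be i.i.d. with $E[Y(d)^2]<\infty$ for $d=0,1$. Let $q(\psi)\in(0,1]$ and $p(\psi)\in(0,1)$ be propensities each taking finitely many rational values. Suppose sampling and assignment are locally randomized, $T_{1:n}\sim \mathrm{Loc}(\psi,q(\psi))$ and $D_{1:n}\sim\mathrm{Loc}(\psi,p(\psi))$ (defined in the context). Let $Y_i=T_i[D_iY_i(1)+(1-D_i)Y_i(0)]$, $n_T=\sum_{i=1}^nT_i$, $\mathrm{ATE}=E[Y(1)-Y(0)]$ and $$\hat\theta=\frac1n\sum_{i=1}^n\frac{T_i}{q(\psi_i)}\left(\frac{D_iY_i}{p(\psi_i)}-\frac{(1-D_i)Y_i}{1-p(\psi_i)}\right).$$ Then $\sqrt{n_T}(\hat\theta-\mathrm{ATE})$ converges in distribution to $\mathcal{N}(0,V)$ as $n\to\infty$, where $$V=E[q(\psi)]\left(\mathrm{Var}(c(\psi))+E\left[\frac1{q(\psi)}\left(\frac{\sigma_1^2(\psi)}{p(\psi)}+\frac{\sigma_0^2(\psi)}{1-p(\psi)}\right)\right]\right),$$ with $c(\psi)=E[Y(1)-Y(0)\mid\psi]$ and $\sigma_d^2(\psi)=\mathrm{Var}(Y(d)\mid\psi)$.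
   Context: Local randomization. For each $n$ let $\pi_n$ be a random element independent of $W_{1:n}$ (used for tie-breaking in group formation). Sampling: let $q$ take values in $\{a_l/k_l:l=1,\dots,L\}$ (integers $1\le a_l\le k_l$). $T_{1:n}=(T_i)_{i=1}^n\sim\mathrm{Loc}(\psi,q(\psi))$ means there is a partition $\mathcal{G}_n^T$ of $\{1,\dots,n\}$ that is a function of $(\psi_{1:n},\pi_n)$ such that: (1) tight matching: $n^{-1}\sum_{g\in\mathcal{G}_n^T}\sum_{i\in g}|\psi_i-\bar\psi_g|_2^2=o_p(1)$, where $\bar\psi_g=|g|^{-1}\sum_{i\in g}\psi_i$; (2) complete randomization: units in the same group have the same value $q(\psi_i)=a_l/k_l$ for some $l$; each group at level $l$ has exactly $k_l$ units, except for at most one remainder group per level, which has fewer than $k_l$ units. Conditional on $(W_{1:n},\pi_n)$, the vectors $(T_i)_{i\in g}$ are independent across groups; in a full group, $(T_i)_{i\in g}$ is uniform over binary vectors in $\{0,1\}^{k_l}$ with exactly $a_l$ ones; in a remainder group the $T_i$ are i.i.d. Bernoulli$(a_l/k_l)$. Assignment: $D_{1:n}\sim\mathrm{Loc}(\psi,p(\psi))$ is defined in the same way for the sampled units: the partition $\mathcal{G}_n^D$ is a partition of $\{i:T_i=1\}$ that is a function of $(\psi_{1:n},T_{1:n},\pi_n)$, it satisfies $n^{-1}\sum_{g\in\mathcal{G}_n^D}\sum_{i\in g}|\psi_i-\bar\psi_g|_2^2=o_p(1)$, and the complete randomization in (2), with $p$ in place of $q$ and $D$ in place of $T$, holds conditional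 on $(W_{1:n},\pi_n,T_{1:n})$. (Values of $D_i$ for $T_i=0$ are irrelevant.) *)

theory Defs
  imports "HOL-Probability.Probability"
begin

definition tends_to_zero_in_prob :: "'w measure \<Rightarrow> (nat \<Rightarrow> 'w \<Rightarrow> real) \<Rightarrow> bool" where
  "tends_to_zero_in_prob M X \<longleftrightarrow>
     (\<forall>\<epsilon>>0. (\<lambda>n. measure M {\<omega> \<in> space M. \<bar>X n \<omega>\<bar> > \<epsilon>}) \<longlonglongrightarrow> 0)"

(* N(m, v) as the law of m + sqrt v * Z with Z standard normal.  Unlike the Lebesgue density
   normal_density m (sqrt v), this also gives the right measure (a point mass) for v = 0. *)
definition normal_law :: "real \<Rightarrow> real \<Rightarrow> real measure" where
  "normal_law m v = distr std_normal_distribution borel (\<lambda>z. m + sqrt v * z)"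

definition real_cond_var :: "'w measure \<Rightarrow> 'w measure \<Rightarrow> ('w \<Rightarrow> real) \<Rightarrow> 'w \<Rightarrow> real" where
  "real_cond_var M F X = real_cond_exp M F (\<lambda>\<omega>. (X \<omega> - real_cond_exp M F X \<omega>)\<^sup>2)"

(* The sigma-algebra on M generated by the random element X with values in N. *)
definition gen_by :: "'w measure \<Rightarrow> ('w \<Rightarrow> 'b) \<Rightarrow> 'b measure \<Rightarrow> 'w measure" where
  "gen_by M X N = vimage_algebra (space M) X N"

(* K is a regular conditional distribution of X given F.  A pmf suffices because it is only used
   for random elements X with finitely many values. *)
definition cond_law :: "'w measure \<Rightarrow> 'w measure \<Rightarrow> ('w \<Rightarrow> 'b) \<Rightarrow> ('w \<Rightarrow> 'b pmf) \<Rightarrow> bool" where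
  "cond_law M F X K \<longleftrightarrow>
     (\<forall>A. (\<lambda>\<omega>. measure_pmf.prob (K \<omega>) A) \<in> borel_measurable F \<and>
          (AE \<omega> in M. real_cond_exp M F (indicator {\<omega> \<in> space M. X \<omega> \<in> A}) \<omega>
                        = measure_pmf.prob (K \<omega>) A))"

(* A pair (a, k) in lev stands for the propensity level a/k with group size k.  The pair need not
   be in lowest terms.  Distinct pairs are meant to have distinct values a/k, but this is not
   required: if they do not, the group conditions below are imposed for every matching pair. *)
definition propensity_levels :: "('a::euclidean_space \<Rightarrow> real) \<Rightarrow> (nat \<times> nat) set \<Rightarrow> bool" where
  "propensity_levels q lev \<longleftrightarrow>
     q \<in> borel_measurable borel \<and> finite lev \<and>
     (\<forall>(a, k) \<in> lev. 1 \<le> a \<and> a \<le> k) \<and>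
     (\<forall>x. \<exists>(a, k) \<in> lev. q x = real a / real k)"

definition group_mean :: "(nat \<Rightarrow> 'a::euclidean_space) \<Rightarrow> nat set \<Rightarrow> 'a" where
  "group_mean x g = (\<Sum>i\<in>g. x i) /\<^sub>R real (card g)"

definition match_loss :: "nat \<Rightarrow> (nat \<Rightarrow> 'a::euclidean_space) \<Rightarrow> nat set set \<Rightarrow> real" where
  "match_loss n x G = (1 / real n) * (\<Sum>g\<in>G. \<Sum>i\<in>g. (norm (x i - group_mean x g))\<^sup>2)"

definition level_groups ::
  "('a \<Rightarrow> real) \<Rightarrow> (nat \<Rightarrow> 'a) \<Rightarrow> nat set set \<Rightarrow> nat \<times> nat \<Rightarrow> nat set set" where
  "level_groups q x G l = {g \<in> G. \<forall>i\<in>g. q (x i) = real (fst l) / real (snd l)}"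

definition valid_grouping ::
  "('a \<Rightarrow> real) \<Rightarrow> (nat \<times> nat) set \<Rightarrow> (nat \<Rightarrow> 'a) \<Rightarrow> nat set \<Rightarrow> nat set set \<Rightarrow> bool" where
  "valid_grouping q lev x S G \<longleftrightarrow>
     partition_on S G \<and>
     (\<forall>g\<in>G. \<exists>l\<in>lev. g \<in> level_groups q x G l) \<and>
     (\<forall>l\<in>lev. (\<forall>g\<in>level_groups q x G l. card g \<le> snd l) \<and>
              card {g \<in> level_groups q x G l. card g < snd l} \<le> 1)"

(* The law of the binary vector indexed by a group g at level a/k: uniform on the vectors with
   exactly a ones if g is a full group, i.i.d. Bernoulli(a/k) if g is a remainder group. *)
definition group_law :: "nat \<times> nat \<Rightarrow> nat set \<Rightarrow> (nat \<Rightarrow> bool) pmf" where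
  "group_law l g =
     (if card g = snd l
      then pmf_of_set {t \<in> g \<rightarrow>\<^sub>E (UNIV :: bool set). card {i \<in> g. t i} = fst l}
      else Pi_pmf g undefined (\<lambda>_. bernoulli_pmf (real (fst l) / real (snd l))))"

(* Conditionally on F, the subvectors of (X_1, ..., X_n) indexed by the groups of the (random)
   partition G are independent across groups and have the laws given by group_law. *)
definition completely_randomized ::
  "'w measure \<Rightarrow> 'w measure \<Rightarrow> nat \<Rightarrow> ('a \<Rightarrow> real) \<Rightarrow> (nat \<times> nat) set \<Rightarrow>
   (nat \<Rightarrow> 'w \<Rightarrow> 'a) \<Rightarrow> ('w \<Rightarrow> nat set set) \<Rightarrow> (nat \<Rightarrow> 'w \<Rightarrow> bool) \<Rightarrow> bool" where
  "completely_randomized M F n q lev \<psi> G X \<longleftrightarrow>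
     (\<exists>K. cond_law M F (\<lambda>\<omega>. \<lambda>i\<in>{1..n}. X i \<omega>) K \<and>
       (AE \<omega> in M.
          prob_space.indep_vars (measure_pmf (K \<omega>)) (\<lambda>_. count_space UNIV)
            (\<lambda>g t. restrict t g) (G \<omega>) \<and>
          (\<forall>l\<in>lev. \<forall>g\<in>level_groups q (\<lambda>i. \<psi> i \<omega>) (G \<omega>) l.
             map_pmf (\<lambda>t. restrict t g) (K \<omega>) = group_law l g)))"

(* The scheme common to sampling and assignment.  For each n,
     S n    is the (random) set of units to be grouped,
     Z n    is the information, with values in Q n, that the partition is a function of,
     C n    is the information, with values in R n, that the randomization is conditional on. *)
definition locally_randomized ::
  "'w measure \<Rightarrow> (nat \<Rightarrow> 'w \<Rightarrow> nat set) \<Rightarrow> (nat \<Rightarrow> 'w \<Rightarrow> 'z) \<Rightarrow> (nat \<Rightarrow> 'z measure) \<Rightarrow>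
   (nat \<Rightarrow> 'w \<Rightarrow> 'c) \<Rightarrow> (nat \<Rightarrow> 'c measure) \<Rightarrow>
   (nat \<Rightarrow> 'w \<Rightarrow> 'a::euclidean_space) \<Rightarrow> ('a \<Rightarrow> real) \<Rightarrow> (nat \<times> nat) set \<Rightarrow>
   (nat \<Rightarrow> nat \<Rightarrow> 'w \<Rightarrow> bool) \<Rightarrow> bool" where
  "locally_randomized M S Z Q C R \<psi> q lev X \<longleftrightarrow>
     (\<exists>G :: nat \<Rightarrow> 'w \<Rightarrow> nat set set.
        (\<forall>n\<ge>1.
           (\<exists>h \<in> measurable (Q n) (count_space UNIV). \<forall>\<omega>\<in>space M. G n \<omega> = h (Z n \<omega>)) \<and>
           (\<forall>\<omega>\<in>space M. valid_grouping q lev (\<lambda>i. \<psi> i \<omega>) (S n \<omega>) (G n \<omega>)) \<and>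
           completely_randomized M (gen_by M (C n) (R n)) n q lev \<psi> (G n) (X n)) \<and>
        tends_to_zero_in_prob M (\<lambda>n \<omega>. match_loss n (\<lambda>i. \<psi> i \<omega>) (G n \<omega>)))"

abbreviation vec_upto :: "nat \<Rightarrow> (nat \<Rightarrow> 'w \<Rightarrow> 'b) \<Rightarrow> 'w \<Rightarrow> nat \<Rightarrow> 'b" where
  "vec_upto n X \<equiv> \<lambda>\<omega>. \<lambda>i\<in>{1..n}. X i \<omega>"

abbreviation borel_upto :: "nat \<Rightarrow> (nat \<Rightarrow> 'b::topological_space) measure" where
  "borel_upto n \<equiv> PiM {1..n} (\<lambda>_. borel)"

abbreviation bool_upto :: "nat \<Rightarrow> (nat \<Rightarrow> bool) measure" where
  "bool_upto n \<equiv> PiM {1..n} (\<lambda>_. count_space UNIV)"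

(* T_{1:n} ~ Loc(psi, q(psi)); W i = (psi i, Y_i(0), Y_i(1)) and rnd n is the tie-breaking
   random element, with values in N n. *)
definition Loc_sampling ::
  "'w measure \<Rightarrow> (nat \<Rightarrow> 'w \<Rightarrow> 'a::euclidean_space \<times> real \<times> real) \<Rightarrow>
   (nat \<Rightarrow> 'w \<Rightarrow> 'r) \<Rightarrow> (nat \<Rightarrow> 'r measure) \<Rightarrow>
   ('a \<Rightarrow> real) \<Rightarrow> (nat \<times> nat) set \<Rightarrow> (nat \<Rightarrow> nat \<Rightarrow> 'w \<Rightarrow> bool) \<Rightarrow> bool" where
  "Loc_sampling M W rnd N q lev T \<longleftrightarrow>
     locally_randomized M
       (\<lambda>n \<omega>. {1..n})
       (\<lambda>n \<omega>. (vec_upto n (\<lambda>i \<omega>. fst (W i \<omega>)) \<omega>, rnd n \<omega>))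
       (\<lambda>n. borel_upto n \<Otimes>\<^sub>M N n)
       (\<lambda>n \<omega>. (vec_upto n W \<omega>, rnd n \<omega>))
       (\<lambda>n. borel_upto n \<Otimes>\<^sub>M N n)
       (\<lambda>i \<omega>. fst (W i \<omega>)) q lev T"

(* D_{1:n} ~ Loc(psi, p(psi)), randomized among the sampled units. *)
definition Loc_assignment ::
  "'w measure \<Rightarrow> (nat \<Rightarrow> 'w \<Rightarrow> 'a::euclidean_space \<times> real \<times> real) \<Rightarrow>
   (nat \<Rightarrow> 'w \<Rightarrow> 'r) \<Rightarrow> (nat \<Rightarrow> 'r measure) \<Rightarrow> (nat \<Rightarrow> nat \<Rightarrow> 'w \<Rightarrow> bool) \<Rightarrow>
   ('a \<Rightarrow> real) \<Rightarrow> (nat \<times> nat) set \<Rightarrow> (nat \<Rightarrow> nat \<Rightarrow> 'w \<Rightarrow> bool) \<Rightarrow> bool" where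
  "Loc_assignment M W rnd N T p lev D \<longleftrightarrow>
     locally_randomized M
       (\<lambda>n \<omega>. {i \<in> {1..n}. T n i \<omega>})
       (\<lambda>n \<omega>. (vec_upto n (\<lambda>i \<omega>. fst (W i \<omega>)) \<omega>, vec_upto n (T n) \<omega>, rnd n \<omega>))
       (\<lambda>n. borel_upto n \<Otimes>\<^sub>M bool_upto n \<Otimes>\<^sub>M N n)
       (\<lambda>n \<omega>. (vec_upto n W \<omega>, rnd n \<omega>, vec_upto n (T n) \<omega>))
       (\<lambda>n. borel_upto n \<Otimes>\<^sub>M N n \<Otimes>\<^sub>M bool_upto n)
       (\<lambda>i \<omega>. fst (W i \<omega>)) p lev D"

definition obs_outcome :: "bool \<Rightarrow> bool \<Rightarrow> real \<Rightarrow> real \<Rightarrow> real" where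
  "obs_outcome t d y0 y1 = of_bool t * (of_bool d * y1 + (1 - of_bool d) * y0)"

definition n_sampled :: "nat \<Rightarrow> (nat \<Rightarrow> bool) \<Rightarrow> real" where
  "n_sampled n t = (\<Sum>i=1..n. of_bool (t i))"

definition theta_hat ::
  "nat \<Rightarrow> ('a \<Rightarrow> real) \<Rightarrow> ('a \<Rightarrow> real) \<Rightarrow> (nat \<Rightarrow> 'a) \<Rightarrow> (nat \<Rightarrow> bool) \<Rightarrow> (nat \<Rightarrow> bool) \<Rightarrow>
   (nat \<Rightarrow> real) \<Rightarrow> real" where
  "theta_hat n q p x t d y =
     (1 / real n) * (\<Sum>i=1..n. (of_bool (t i) / q (x i)) *
        (of_bool (d i) * y i / p (x i) - (1 - of_bool (d i)) * y i / (1 - p (x i))))"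

end

theory Submission
  imports Defs
begin

text \<open>
  Let \<open>m\<^sub>d(\<psi>) = E[Y(d) | \<psi>]\<close>, \<open>e\<^sub>d = Y(d) - m\<^sub>d(\<psi>)\<close> and \<open>c = m\<^sub>1 - m\<^sub>0\<close>. Unit by unit, the error
  \<open>\<surd>n (\<theta> - ATE)\<close> of the estimator is \<open>1/\<surd>n\<close> times the sum of the four terms
  \<open>c - ATE\<close>, \<open>(T - q) c/q\<close>, \<open>T (D - p) (m\<^sub>1/p + m\<^sub>0/(1 - p))/q\<close> and
  \<open>T/q (D e\<^sub>1/p - (1 - D) e\<^sub>0/(1 - p))\<close>.

  The second and third sums vanish in probability. In a full group the deviations \<open>T - q\<close> (or
  \<open>D - p\<close>) add up to zero, so that only the variation of the integrand within the group matters. For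
  a Lipschitz integrand this is the matching loss, and the general case follows by approximation in
  \<open>L\<^sup>2\<close>; there are boundedly many remainder groups.

  Given the covariates and the design, the errors \<open>e\<^sub>d\<close> are still independent and centred, because
  the conditional law of the design depends on the covariates only. In the characteristic function
  their factors can thus be replaced by Gaussian ones, one at a time. The average of the conditional
  variances in the exponent obeys a law of large numbers, and the first sum obeys the classical
  central limit theorem. As the rescaling by the sampled fraction is a function of the design, it can
  be carried along in the characteristic function.
\<close>

subsection \<open>Second moments under complete randomization\<close>

text \<open>The design couples all units: the states of one unit and the sampled fraction depend on
  the covariates of every unit. Nor is there a kernel for the real-valued outcomes given the design.
  Only the finite-valued design has one, so "centred given the design" is expressed by vanishing
  integrals over events, which is all that the replacement needs. The information kept when unit i
  is exchanged consists of its covariate, the complete data of the other units, the tie-breaker and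
  all states, but not the outcomes of unit i. That these outcomes stay centred is the crux. It is
  shown by integrating the design out backwards, the assignment given the sampling and then the
  sampling: each time the conditional probability of a fixed state vector is a function of
  covariates and tie-breaker alone. Two scarcities shape the estimates. The matching loss comes
  without a rate, so the Lipschitz approximation is fixed before n grows. The conditional variances
  are merely integrable, so their averages are treated by truncation, and the Taylor remainders
  appear as minima whose first entry needs second moments only.\<close>

text \<open>Exchanging two coordinates permutes the vectors with \<open>a\<close> ones, so every
  coordinate has the same total. Counting all ones in two orders gives \<open>card g\<close> times
  this total as \<open>a * card \<Omega>\<close>.\<close>

lemma sum_uniform_ones:
  fixes g :: "nat set" and a :: nat
  assumes "finite g" and "i \<in> g"
  defines "\<Omega> \<equiv> {t \<in> g \<rightarrow>\<^sub>E (UNIV :: bool set). card {i \<in> g. t i} = a}"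
  shows "(\<Sum>t\<in>\<Omega>. of_bool (t i) :: real) = real a / real (card g) * real (card \<Omega>)"
proof -
  have swap: "(\<Sum>t\<in>\<Omega>. of_bool (t j) :: real) = (\<Sum>t\<in>\<Omega>. of_bool (t i))" if j: "j \<in> g" for j
  proof -
    let ?s = "Transposition.transpose i j"
    have closed: "t \<circ> ?s \<in> \<Omega>" if "t \<in> \<Omega>" for t
    proof -
      have "bij_betw (?s) {k \<in> g. (t \<circ> ?s) k} {k \<in> g. t k}"
        using assms(2) j by (auto simp: bij_betw_def inj_on_def Transposition.transpose_def image_iff)
      then have "card {k \<in> g. (t \<circ> ?s) k} = card {k \<in> g. t k}"
        by (rule bij_betw_same_card)
      moreover have "t \<circ> ?s \<in> g \<rightarrow>\<^sub>E UNIV"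
        using that assms(2) j by (auto simp: \<Omega>_def PiE_def extensional_def Transposition.transpose_def)
      ultimately show ?thesis using that by (simp add: \<Omega>_def)
    qed
    show ?thesis
      by (rule sum.reindex_bij_witness[where i="\<lambda>t. t \<circ> ?s" and j="\<lambda>t. t \<circ> ?s"])
         (auto simp: closed comp_assoc)
  qed
  have "real (card g) * (\<Sum>t\<in>\<Omega>. of_bool (t i)) = (\<Sum>j\<in>g. \<Sum>t\<in>\<Omega>. of_bool (t j))"
    using swap by simp
  also have "\<dots> = (\<Sum>t\<in>\<Omega>. \<Sum>j\<in>g. of_bool (t j))" by (rule sum.swap)
  also have "\<dots> = (\<Sum>t\<in>\<Omega>. real a)"
    by (rule sum.cong[OF refl]) (use assms(1) in \<open>auto simp: \<Omega>_def sum.If_cases Int_def of_bool_def\<close>)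
  finally have "real (card g) * (\<Sum>t\<in>\<Omega>. of_bool (t i)) = real a * real (card \<Omega>)" by simp
  moreover have "card g > 0" using assms(1,2) by (auto simp: card_gt_0_iff)
  ultimately show ?thesis by (simp add: field_simps)
qed

lemma uniform_ones_nonempty:
  assumes "finite (g :: nat set)" "a \<le> card g"
  shows "{t \<in> g \<rightarrow>\<^sub>E (UNIV :: bool set). card {i \<in> g. t i} = a} \<noteq> {}"
proof -
  obtain B where B: "B \<subseteq> g" "card B = a" using obtain_subset_with_card_n[OF assms(2)] by auto
  have "{i \<in> g. (\<lambda>i\<in>g. i \<in> B) i} = B" using B by auto
  then have "(\<lambda>i\<in>g. i \<in> B) \<in> {t \<in> g \<rightarrow>\<^sub>E (UNIV :: bool set). card {i \<in> g. t i} = a}"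
    using B by auto
  then show ?thesis by blast
qed

lemma finite_uniform_ones:
  assumes "finite (g :: nat set)"
  shows "finite {t \<in> g \<rightarrow>\<^sub>E (UNIV :: bool set). card {i \<in> g. t i} = a}"
  by (rule finite_subset[of _ "g \<rightarrow>\<^sub>E UNIV"]) (auto intro: finite_PiE assms)

text \<open>Full and remainder groups have the same marginal mean for different reasons: symmetry
  among the vectors with a fixed number of ones, and the Bernoulli parameter itself.\<close>

lemma group_law_mean:
  assumes g: "finite g" "i \<in> g" and l: "fst l \<le> snd l" "0 < snd l"
  shows "measure_pmf.expectation (group_law l g) (\<lambda>t. of_bool (t i)) = real (fst l) / real (snd l)"
proof (cases "card g = snd l")
  case True
  let ?\<Omega> = "{t \<in> g \<rightarrow>\<^sub>E (UNIV :: bool set). card {i \<in> g. t i} = fst l}"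
  have ne: "?\<Omega> \<noteq> {}" and fin: "finite ?\<Omega>"
    using uniform_ones_nonempty[OF g(1), of "fst l"] finite_uniform_ones[OF g(1), of "fst l"] l True
    by auto
  have "card ?\<Omega> > 0" unfolding card_gt_0_iff using ne fin by (rule conjI)
  then show ?thesis
    using True sum_uniform_ones[OF g, of "fst l"] ne fin
    by (simp add: group_law_def integral_pmf_of_set)
next
  case False
  have "measure_pmf.expectation (Pi_pmf g undefined (\<lambda>_. bernoulli_pmf (real (fst l) / real (snd l)))) (\<lambda>t. of_bool (t i))
      = measure_pmf.expectation (map_pmf (\<lambda>t. t i) (Pi_pmf g undefined (\<lambda>_. bernoulli_pmf (real (fst l) / real (snd l))))) (of_bool :: bool \<Rightarrow> real)"
    by simp
  also have "\<dots> = measure_pmf.expectation (bernoulli_pmf (real (fst l) / real (snd l))) of_bool"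
    using g by (subst Pi_pmf_component) auto
  also have "\<dots> = real (fst l) / real (snd l)" using l by simp
  finally show ?thesis using False by (simp add: group_law_def)
qed

text \<open>This deterministic count is the source of the cancellation in full groups. A remainder
  group has no counterpart, its number of ones being random.\<close>

lemma group_law_full_count:
  assumes "finite g" "fst l \<le> snd l" "card g = snd l" "t \<in> set_pmf (group_law l g)"
  shows "card {i \<in> g. t i} = fst l"
proof -
  have "set_pmf (group_law l g) = {t \<in> g \<rightarrow>\<^sub>E (UNIV :: bool set). card {i \<in> g. t i} = fst l}"
    unfolding group_law_def using assms uniform_ones_nonempty[of g "fst l"] finite_uniform_ones[of g "fst l"]
    by (simp add: set_pmf_of_set)
  with assms(4) show ?thesis by auto
qed

text \<open>Prescribing \<open>x\<close> on the union of the groups amounts to prescribing each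
  restricted subvector, and independence across groups makes the probability a product. Coordinates
  outside the union stay free, as is needed when only the sampled units are grouped.\<close>

lemma pmf_agree_on_groups:
  fixes K :: "(nat \<Rightarrow> bool) pmf"
  assumes "finite G"
    and indep: "prob_space.indep_vars (measure_pmf K) (\<lambda>_. count_space UNIV) (\<lambda>g t. restrict t g) G"
  shows "measure_pmf.prob K {t. \<forall>i\<in>\<Union>G. t i = x i}
       = (\<Prod>g\<in>G. pmf (map_pmf (\<lambda>t. restrict t g) K) (restrict x g))"
\<comment> \<open>The product rule for independent variables asks for a nonempty index set. Without
  groups both sides equal 1.\<close>
proof (cases "G = {}")
  case False
  have "{t. \<forall>i\<in>\<Union>G. t i = x i} = (\<Inter>g\<in>G. (\<lambda>t. restrict t g) -` {restrict x g} \<inter> space (measure_pmf K))"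
    by (auto simp: fun_eq_iff restrict_apply) (metis (full_types))+
  also have "measure_pmf.prob K \<dots> = (\<Prod>g\<in>G. measure_pmf.prob K ((\<lambda>t. restrict t g) -` {restrict x g} \<inter> space (measure_pmf K)))"
    by (rule prob_space.indep_varsD_finite[OF measure_pmf.prob_space_axioms indep]) (use False assms in auto)
  finally show ?thesis by (simp only: pmf_map space_measure_pmf Int_UNIV_right)
qed auto

lemma (in prob_space) second_moment_sum_orthogonal:
  fixes X :: "'i \<Rightarrow> 'a \<Rightarrow> real"
  assumes "finite I"
    and int: "\<And>i j. i \<in> I \<Longrightarrow> j \<in> I \<Longrightarrow> integrable M (\<lambda>\<omega>. X i \<omega> * X j \<omega>)"
    and orth: "\<And>i j. i \<in> I \<Longrightarrow> j \<in> I \<Longrightarrow> i \<noteq> j \<Longrightarrow> expectation (\<lambda>\<omega>. X i \<omega> * X j \<omega>) = 0"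
  shows "integrable M (\<lambda>\<omega>. (\<Sum>i\<in>I. X i \<omega>)\<^sup>2)"
    and "expectation (\<lambda>\<omega>. (\<Sum>i\<in>I. X i \<omega>)\<^sup>2) = (\<Sum>i\<in>I. expectation (\<lambda>\<omega>. (X i \<omega>)\<^sup>2))"
proof -
  have eq: "(\<Sum>i\<in>I. X i \<omega>)\<^sup>2 = (\<Sum>i\<in>I. \<Sum>j\<in>I. X i \<omega> * X j \<omega>)" for \<omega>
    by (simp add: power2_eq_square sum_product)
  show "integrable M (\<lambda>\<omega>. (\<Sum>i\<in>I. X i \<omega>)\<^sup>2)"
    unfolding eq by (intro Bochner_Integration.integrable_sum int)
  have "expectation (\<lambda>\<omega>. (\<Sum>i\<in>I. X i \<omega>)\<^sup>2) = (\<Sum>i\<in>I. \<Sum>j\<in>I. expectation (\<lambda>\<omega>. X i \<omega> * X j \<omega>))"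
    unfolding eq
    by (simp add: int Bochner_Integration.integral_sum Bochner_Integration.integrable_sum)
  also have "\<dots> = (\<Sum>i\<in>I. expectation (\<lambda>\<omega>. (X i \<omega>)\<^sup>2))"
  proof (rule sum.cong[OF refl])
    fix i assume i: "i \<in> I"
    have "(\<Sum>j\<in>I. expectation (\<lambda>\<omega>. X i \<omega> * X j \<omega>))
        = (\<Sum>j\<in>I. if j = i then expectation (\<lambda>\<omega>. X i \<omega> * X i \<omega>) else 0)"
      by (rule sum.cong) (use orth i in auto)
    then show "(\<Sum>j\<in>I. expectation (\<lambda>\<omega>. X i \<omega> * X j \<omega>)) = expectation (\<lambda>\<omega>. (X i \<omega>)\<^sup>2)"
      using assms(1) i by (simp add: power2_eq_square)
  qed
  finally show "expectation (\<lambda>\<omega>. (\<Sum>i\<in>I. X i \<omega>)\<^sup>2) = (\<Sum>i\<in>I. expectation (\<lambda>\<omega>. (X i \<omega>)\<^sup>2))" .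
qed

text \<open>The group sums are centred and independent, so that the cross terms vanish. In a full
  group the deviations add up to zero, hence any constant \<open>\<mu> g\<close> may be subtracted
  from \<open>\<beta>\<close>; in a remainder group this fails and \<open>\<mu> g\<close> has to be
  0. Cauchy-Schwarz with deviations of modulus at most 1 leaves the factor
  \<open>card g\<close>.\<close>

lemma pmf_group_sum_second_moment:
  fixes K :: "(nat \<Rightarrow> bool) pmf" and q \<beta> :: "nat \<Rightarrow> real" and \<mu> :: "nat set \<Rightarrow> real"
  assumes finG: "finite G" and fing: "\<And>g. g \<in> G \<Longrightarrow> finite g"
    and indep: "prob_space.indep_vars (measure_pmf K) (\<lambda>_. count_space UNIV) (\<lambda>g t. restrict t g) G"
    and law: "\<And>g. g \<in> G \<Longrightarrow> \<exists>l. map_pmf (\<lambda>t. restrict t g) K = group_law l g \<and> fst l \<le> snd l \<and> 0 < snd l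
        \<and> (\<forall>i\<in>g. q i = real (fst l) / real (snd l)) \<and> (card g = snd l \<or> \<mu> g = 0)"
  shows "measure_pmf.expectation K (\<lambda>t. (\<Sum>g\<in>G. \<Sum>i\<in>g. (of_bool (t i) - q i) * \<beta> i)\<^sup>2)
       \<le> (\<Sum>g\<in>G. real (card g) * (\<Sum>i\<in>g. (\<beta> i - \<mu> g)\<^sup>2))"
proof -
  define A where "A g t = (\<Sum>i\<in>g. (of_bool (t i) - q i) * \<beta> i)" for g and t :: "nat \<Rightarrow> bool"
  \<comment> \<open>A crude bound independent of the random vector. It serves the integrability of
    the group sums and of their products.\<close>
  define c where "c g = (\<Sum>i\<in>g. (1 + \<bar>q i\<bar>) * \<bar>\<beta> i\<bar>)" for g
  have A_le: "\<bar>A g t\<bar> \<le> c g" for g t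
    unfolding A_def c_def
    by (rule order_trans[OF sum_abs]) (auto simp: abs_mult intro!: sum_mono mult_right_mono)
  have int_A: "integrable (measure_pmf K) (A g)" for g
    by (rule measure_pmf.integrable_const_bound[of _ "c g"]) (use A_le in auto)
  have int_AA: "integrable (measure_pmf K) (\<lambda>t. A g t * A h t)" for g h
  proof (rule measure_pmf.integrable_const_bound[of _ "c g * c h"])
    show "AE t in measure_pmf K. norm (A g t * A h t) \<le> c g * c h"
      using mult_mono[OF A_le A_le order_trans[OF abs_ge_zero A_le] abs_ge_zero] by (auto simp: abs_mult)
  qed auto
  \<comment> \<open>Independence is given for the restricted vectors, so each group sum is first
    exhibited as a function of its own restriction.\<close>
  have A_restrict: "A g t = A g (restrict t g)" for g t
    unfolding A_def by (rule sum.cong) auto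
  have EA: "measure_pmf.expectation K (A g) = 0" if g: "g \<in> G" for g
  proof -
    obtain l where l: "map_pmf (\<lambda>t. restrict t g) K = group_law l g" "fst l \<le> snd l" "0 < snd l"
      "\<forall>i\<in>g. q i = real (fst l) / real (snd l)" using law[OF g] by blast
    have mean: "measure_pmf.expectation K (\<lambda>t. of_bool (t i)) = q i" if i: "i \<in> g" for i
    proof -
      have "measure_pmf.expectation K (\<lambda>t. of_bool (t i) :: real)
          = measure_pmf.expectation (map_pmf (\<lambda>t. restrict t g) K) (\<lambda>t. of_bool (t i))"
        using i by simp
      also have "\<dots> = q i" using l group_law_mean[OF fing[OF g] i] i by simp
      finally show ?thesis .
    qed
    have "integrable (measure_pmf K) (\<lambda>t. of_bool (t i) :: real)" for i
      by (rule measure_pmf.integrable_const_bound[of _ 1]) auto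
    then show ?thesis unfolding A_def by (simp add: mean)
  qed
  have EAA: "measure_pmf.expectation K (\<lambda>t. A g t * A h t) = 0" if "g \<in> G" "h \<in> G" "g \<noteq> h" for g h
  proof -
    have "prob_space.indep_vars (measure_pmf K) (\<lambda>_. borel) (\<lambda>g t. A g (restrict t g)) G"
      by (rule prob_space.indep_vars_compose2[OF measure_pmf.prob_space_axioms indep]) simp
    then have "prob_space.indep_vars (measure_pmf K) (\<lambda>_. borel) (\<lambda>g t. A g t) G"
      unfolding A_restrict[symmetric] .
    from prob_space.indep_vars_subset[OF measure_pmf.prob_space_axioms this, of "{g, h}"] that
    have gh: "prob_space.indep_vars (measure_pmf K) (\<lambda>_. borel) (\<lambda>g t. A g t) {g, h}"
      by fast
    have "measure_pmf.expectation K (\<lambda>t. \<Prod>i\<in>{g, h}. A i t) = (\<Prod>i\<in>{g, h}. measure_pmf.expectation K (A i))"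
      by (rule prob_space.indep_vars_lebesgue_integral[OF measure_pmf.prob_space_axioms _ gh int_A]) simp
    then show ?thesis using that EA[OF that(1)] by simp
  qed
  have "measure_pmf.expectation K (\<lambda>t. (\<Sum>g\<in>G. A g t)\<^sup>2)
      = (\<Sum>g\<in>G. measure_pmf.expectation K (\<lambda>t. (A g t)\<^sup>2))"
    by (rule measure_pmf.second_moment_sum_orthogonal(2)[OF finG int_AA EAA])
  also have "\<dots> \<le> (\<Sum>g\<in>G. real (card g) * (\<Sum>i\<in>g. (\<beta> i - \<mu> g)\<^sup>2))"
  proof (rule sum_mono)
    fix g assume g: "g \<in> G"
    obtain l where l: "map_pmf (\<lambda>t. restrict t g) K = group_law l g" "fst l \<le> snd l" "0 < snd l"
      "\<forall>i\<in>g. q i = real (fst l) / real (snd l)" "card g = snd l \<or> \<mu> g = 0" using law[OF g] by blast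
    have *: "(A g t)\<^sup>2 \<le> real (card g) * (\<Sum>i\<in>g. (\<beta> i - \<mu> g)\<^sup>2)" if t: "t \<in> set_pmf K" for t
    proof -
      have "A g t = (\<Sum>i\<in>g. (of_bool (t i) - q i) * (\<beta> i - \<mu> g))"
      proof (cases "card g = snd l")
        case True
        have "restrict t g \<in> set_pmf (group_law l g)" unfolding l(1)[symmetric] using t by auto
        from group_law_full_count[OF fing[OF g] l(2) True this]
        have "card {i \<in> g. restrict t g i} = fst l" .
        moreover have "{i \<in> g. restrict t g i} = {i \<in> g. t i}" by auto
        ultimately have "(\<Sum>i\<in>g. of_bool (t i) :: real) = fst l"
          using fing[OF g] by (simp add: of_bool_def sum.If_cases Int_def)
        moreover have "(\<Sum>i\<in>g. q i) = fst l" using l(3,4) True by simp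
        ultimately have "(\<Sum>i\<in>g. (of_bool (t i) - q i)) = 0" by (simp add: sum_subtractf)
        then have "(\<Sum>i\<in>g. (of_bool (t i) - q i) * \<mu> g) = 0"
          by (simp add: sum_distrib_right[symmetric])
        then show ?thesis unfolding A_def by (simp add: right_diff_distrib sum_subtractf)
      qed (use l(5) in \<open>simp add: A_def\<close>)
      then have "(A g t)\<^sup>2 \<le> (\<Sum>i\<in>g. (of_bool (t i) - q i)\<^sup>2) * (\<Sum>i\<in>g. (\<beta> i - \<mu> g)\<^sup>2)"
        by (simp add: Cauchy_Schwarz_ineq_sum)
      also have "\<dots> \<le> real (card g) * (\<Sum>i\<in>g. (\<beta> i - \<mu> g)\<^sup>2)"
      proof (rule mult_right_mono)
        have "(of_bool (t i) - q i)\<^sup>2 \<le> 1" if i: "i \<in> g" for i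
        proof -
          have "0 \<le> q i" "q i \<le> 1" using i l(2,3,4) by auto
          then have "\<bar>of_bool (t i) - q i\<bar> \<le> 1" by (cases "t i") auto
          then show ?thesis by (simp add: abs_square_le_1)
        qed
        then have "(\<Sum>i\<in>g. (of_bool (t i) - q i)\<^sup>2) \<le> (\<Sum>i\<in>g. 1)" by (rule sum_mono)
        then show "(\<Sum>i\<in>g. (of_bool (t i) - q i)\<^sup>2) \<le> real (card g)" by simp
      qed (auto intro: sum_nonneg)
      finally show ?thesis .
    qed
    have "measure_pmf.expectation K (\<lambda>t. (A g t)\<^sup>2)
       \<le> measure_pmf.expectation K (\<lambda>t. real (card g) * (\<Sum>i\<in>g. (\<beta> i - \<mu> g)\<^sup>2))"
      by (rule integral_mono_AE) (use * int_AA[of g g] in \<open>auto simp: AE_measure_pmf_iff power2_eq_square\<close>)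
    then show "measure_pmf.expectation K (\<lambda>t. (A g t)\<^sup>2) \<le> real (card g) * (\<Sum>i\<in>g. (\<beta> i - \<mu> g)\<^sup>2)"
      by simp
  qed
  finally show ?thesis unfolding A_def .
qed

subsection \<open>Approximation by bounded Lipschitz functions\<close>

text \<open>The Doob-Dynkin factorization. Nonnegative functions are treated by induction over
  indicators, multiples, sums and increasing limits, then the positive and negative parts are
  recombined.\<close>

lemma vimage_algebra_real_factor:
  fixes f :: "'w \<Rightarrow> real"
  assumes f: "f \<in> borel_measurable (vimage_algebra \<Omega> X N)" and X: "X \<in> \<Omega> \<rightarrow> space N"
  shows "\<exists>g\<in>borel_measurable N. \<forall>\<omega>\<in>\<Omega>. f \<omega> = g (X \<omega>)"
proof -
  have nonneg: "\<exists>g\<in>borel_measurable N. \<forall>\<omega>\<in>\<Omega>. u \<omega> = g (X \<omega>)"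
    if u: "u \<in> borel_measurable (vimage_algebra \<Omega> X N)" and "\<And>\<omega>. 0 \<le> u \<omega>" for u :: "'w \<Rightarrow> real"
    using that
  proof (induction rule: borel_measurable_induct_real)
    case (set A)
    then obtain B where "B \<in> sets N" "A = X -` B \<inter> \<Omega>" by (auto simp: sets_vimage_algebra2[OF X])
    then show ?case by (intro bexI[of _ "indicator B"]) (auto simp: indicator_def)
  next
    case (mult u c)
    then obtain g where "g \<in> borel_measurable N" "\<forall>\<omega>\<in>\<Omega>. u \<omega> = g (X \<omega>)" by blast
    then show ?case by (intro bexI[of _ "\<lambda>x. c * g x"]) auto
  next
    case (add u v)
    then obtain g h where "g \<in> borel_measurable N" "\<forall>\<omega>\<in>\<Omega>. u \<omega> = g (X \<omega>)"
      "h \<in> borel_measurable N" "\<forall>\<omega>\<in>\<Omega>. v \<omega> = h (X \<omega>)" by blast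
    then show ?case by (intro bexI[of _ "\<lambda>x. h x + g x"]) auto
  next
    case (seq U)
    then obtain g where g: "\<And>i. g i \<in> borel_measurable N" "\<And>i \<omega>. \<omega> \<in> \<Omega> \<Longrightarrow> U i \<omega> = g i (X \<omega>)"
      by metis
    \<comment> \<open>Off the range of \<open>X\<close> the factors need not converge. There
      \<open>lim\<close> takes an arbitrary value, but it is measurable everywhere and correct at
      all points \<open>X \<omega>\<close>.\<close>
    have "u \<omega> = lim (\<lambda>i. g i (X \<omega>))" if "\<omega> \<in> \<Omega>" for \<omega>
    proof -
      have "(\<lambda>i. g i (X \<omega>)) \<longlonglongrightarrow> u \<omega>" using seq(4)[of \<omega>] that by (simp add: g(2)[symmetric])
      then show ?thesis by (simp add: limI)
    qed
    then show ?case using g(1) by (intro bexI[of _ "\<lambda>x. lim (\<lambda>i. g i x)"]) auto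
  qed
  obtain g where g: "g \<in> borel_measurable N" "\<forall>\<omega>\<in>\<Omega>. max 0 (f \<omega>) = g (X \<omega>)"
    using nonneg[OF borel_measurable_max[OF f borel_measurable_const[of 0]] max.cobounded1] by blast
  obtain h where h: "h \<in> borel_measurable N" "\<forall>\<omega>\<in>\<Omega>. max 0 (- f \<omega>) = h (X \<omega>)"
    using nonneg[OF borel_measurable_max[OF borel_measurable_uminus[OF f] borel_measurable_const[of 0]] max.cobounded1] by blast
  have "f \<omega> = g (X \<omega>) - h (X \<omega>)" if "\<omega> \<in> \<Omega>" for \<omega>
    unfolding g(2)[rule_format, OF that, symmetric] h(2)[rule_format, OF that, symmetric] by (simp add: max_def)
  with g(1) h(1) show ?thesis by (intro bexI[of _ "\<lambda>x. g x - h x"]) auto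
qed

section \<open>Sums and products of square-integrable functions\<close>

lemma integrable_square_add:
  fixes f g :: "'a \<Rightarrow> real"
  assumes [measurable]: "f \<in> borel_measurable M" "g \<in> borel_measurable M"
    and "integrable M (\<lambda>x. (f x)\<^sup>2)" "integrable M (\<lambda>x. (g x)\<^sup>2)"
  shows "integrable M (\<lambda>x. (f x + g x)\<^sup>2)"
proof (rule Bochner_Integration.integrable_bound)
  show "integrable M (\<lambda>x. 2 * (f x)\<^sup>2 + 2 * (g x)\<^sup>2)" using assms by auto
  have "(f x + g x)\<^sup>2 \<le> 2 * (f x)\<^sup>2 + 2 * (g x)\<^sup>2" for x
    using sum_squares_bound[of "f x" "g x"] by (simp add: power2_sum)
  then show "AE x in M. norm ((f x + g x)\<^sup>2) \<le> norm (2 * (f x)\<^sup>2 + 2 * (g x)\<^sup>2)"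
    by (auto intro!: AE_I2 order_trans[OF _ abs_ge_self])
qed simp

lemma integrable_mult_of_squares:
  fixes f g :: "'a \<Rightarrow> real"
  assumes [measurable]: "f \<in> borel_measurable M" "g \<in> borel_measurable M"
    and "integrable M (\<lambda>x. (f x)\<^sup>2)" "integrable M (\<lambda>x. (g x)\<^sup>2)"
  shows "integrable M (\<lambda>x. f x * g x)"
proof (rule Bochner_Integration.integrable_bound)
  show "integrable M (\<lambda>x. (f x)\<^sup>2 + (g x)\<^sup>2)" using assms by auto
  have "\<bar>f x * g x\<bar> \<le> (f x)\<^sup>2 + (g x)\<^sup>2" for x
  proof -
    have "2 * (\<bar>f x\<bar> * \<bar>g x\<bar>) \<le> (f x)\<^sup>2 + (g x)\<^sup>2"
      using sum_squares_bound[of "\<bar>f x\<bar>" "\<bar>g x\<bar>"] by simp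
    moreover have "0 \<le> \<bar>f x\<bar> * \<bar>g x\<bar>" by simp
    ultimately show ?thesis by (simp only: abs_mult)
  qed
  then show "AE x in M. norm (f x * g x) \<le> norm ((f x)\<^sup>2 + (g x)\<^sup>2)"
    by (auto intro!: AE_I2 order_trans[OF _ abs_ge_self])
qed simp

lemma integral_square_add_le:
  fixes f g :: "'a \<Rightarrow> real"
  assumes [measurable]: "f \<in> borel_measurable M" "g \<in> borel_measurable M"
    and "integrable M (\<lambda>x. (f x)\<^sup>2)" "integrable M (\<lambda>x. (g x)\<^sup>2)"
  shows "(\<integral>x. (f x + g x)\<^sup>2 \<partial>M) \<le> 2 * (\<integral>x. (f x)\<^sup>2 \<partial>M) + 2 * (\<integral>x. (g x)\<^sup>2 \<partial>M)"
proof -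
  have "(\<integral>x. (f x + g x)\<^sup>2 \<partial>M) \<le> (\<integral>x. 2 * (f x)\<^sup>2 + 2 * (g x)\<^sup>2 \<partial>M)"
  proof (rule integral_mono[OF integrable_square_add[OF assms]])
    show "(f x + g x)\<^sup>2 \<le> 2 * (f x)\<^sup>2 + 2 * (g x)\<^sup>2" for x
      using sum_squares_bound[of "f x" "g x"] by (simp add: power2_sum)
  qed (use assms in auto)
  then show ?thesis using assms by simp
qed

text \<open>Membership in the closure of the bounded Lipschitz functions with respect to the
  mean-square distance. The Lipschitz constant will be paired with the matching loss in full groups,
  and the bound controls the remainder groups, where nothing cancels. Integrability is demanded
  explicitly because the integral of a non-integrable function is 0 by convention.\<close>

definition lipschitz_approx :: "'a::metric_space measure \<Rightarrow> ('a \<Rightarrow> real) \<Rightarrow> bool" where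
  "lipschitz_approx M b \<longleftrightarrow> (\<forall>\<epsilon>>0. \<exists>f L B. L-lipschitz_on UNIV f \<and> (\<forall>x. \<bar>f x\<bar> \<le> B) \<and>
      integrable M (\<lambda>x. (b x - f x)\<^sup>2) \<and> (\<integral>x. (b x - f x)\<^sup>2 \<partial>M) < \<epsilon>)"

lemma lipschitz_on_borel:
  fixes f :: "'a::metric_space \<Rightarrow> real"
  assumes "L-lipschitz_on UNIV f" "sets M = sets borel"
  shows "f \<in> borel_measurable M"
proof -
  have "continuous_on UNIV f" using assms(1) by (rule lipschitz_on_continuous_on)
  then show ?thesis using assms(2) borel_measurable_continuous_onI measurable_cong_sets by blast
qed

lemma lipschitz_approx_add:
  fixes M :: "'a::metric_space measure"
  assumes M: "sets M = sets borel" and [measurable]: "b \<in> borel_measurable M" "c \<in> borel_measurable M"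
    and b: "lipschitz_approx M b" and c: "lipschitz_approx M c"
  shows "lipschitz_approx M (\<lambda>x. b x + c x)"
  unfolding lipschitz_approx_def
proof (intro allI impI)
  fix \<epsilon> :: real assume "\<epsilon> > 0"
  \<comment> \<open>Since the square of a sum is at most twice the sum of the squares, each of the
    two errors may use a quarter.\<close>
  then have e4: "\<epsilon> / 4 > 0" by simp
  from b[unfolded lipschitz_approx_def, rule_format, OF e4] obtain f L B where
    f: "L-lipschitz_on UNIV f" "\<And>x. \<bar>f x\<bar> \<le> B" "integrable M (\<lambda>x. (b x - f x)\<^sup>2)" "(\<integral>x. (b x - f x)\<^sup>2 \<partial>M) < \<epsilon> / 4"
    by blast
  from c[unfolded lipschitz_approx_def, rule_format, OF e4] obtain g L' B' where
    g: "L'-lipschitz_on UNIV g" "\<And>x. \<bar>g x\<bar> \<le> B'" "integrable M (\<lambda>x. (c x - g x)\<^sup>2)" "(\<integral>x. (c x - g x)\<^sup>2 \<partial>M) < \<epsilon> / 4"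
    by blast
  note [measurable] = lipschitz_on_borel[OF f(1) M] lipschitz_on_borel[OF g(1) M]
  have eq: "(b x + c x - (f x + g x)) = (b x - f x) + (c x - g x)" for x by simp
  have "(L + L')-lipschitz_on UNIV (\<lambda>x. f x + g x)" using f(1) g(1) by (rule lipschitz_on_add)
  moreover have "\<bar>f x + g x\<bar> \<le> B + B'" for x using f(2)[of x] g(2)[of x] by linarith
  moreover have "integrable M (\<lambda>x. (b x + c x - (f x + g x))\<^sup>2)"
    unfolding eq by (rule integrable_square_add) (use f g in measurable)
  moreover have "(\<integral>x. (b x + c x - (f x + g x))\<^sup>2 \<partial>M) < \<epsilon>"
    using integral_square_add_le[of "\<lambda>x. b x - f x" M "\<lambda>x. c x - g x"] f(3,4) g(3,4) unfolding eq by simp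
  ultimately show "\<exists>f L B. L-lipschitz_on UNIV f \<and> (\<forall>x. \<bar>f x\<bar> \<le> B) \<and>
      integrable M (\<lambda>x. (b x + c x - f x)\<^sup>2) \<and> (\<integral>x. (b x + c x - f x)\<^sup>2 \<partial>M) < \<epsilon>"
    by (intro exI[of _ "\<lambda>x. f x + g x"] exI[of _ "L + L'"] exI[of _ "B + B'"]) auto
qed

text \<open>A diagonal choice: a member of the sequence close to \<open>b\<close>, then a Lipschitz
  function close to that member. All limit arguments for the class are reduced to this
  closedness.\<close>

lemma lipschitz_approx_limit:
  fixes M :: "'a::metric_space measure"
  assumes M: "sets M = sets borel" and [measurable]: "b \<in> borel_measurable M" "\<And>n. bs n \<in> borel_measurable M"
    and b: "\<And>n. lipschitz_approx M (bs n)"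
    and lim: "\<And>n. integrable M (\<lambda>x. (b x - bs n x)\<^sup>2)" "(\<lambda>n. \<integral>x. (b x - bs n x)\<^sup>2 \<partial>M) \<longlonglongrightarrow> 0"
  shows "lipschitz_approx M b"
  unfolding lipschitz_approx_def
proof (intro allI impI)
  fix \<epsilon> :: real assume "\<epsilon> > 0"
  then have e4: "\<epsilon> / 4 > 0" by simp
  from order_tendstoD(2)[OF lim(2) e4] obtain n where n: "(\<integral>x. (b x - bs n x)\<^sup>2 \<partial>M) < \<epsilon> / 4"
    by (auto dest: eventually_happens)
  from b[of n, unfolded lipschitz_approx_def, rule_format, OF e4] obtain f L B where
    f: "L-lipschitz_on UNIV f" "\<And>x. \<bar>f x\<bar> \<le> B" "integrable M (\<lambda>x. (bs n x - f x)\<^sup>2)" "(\<integral>x. (bs n x - f x)\<^sup>2 \<partial>M) < \<epsilon> / 4"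
    by blast
  note [measurable] = lipschitz_on_borel[OF f(1) M]
  have eq: "(b x - f x) = (b x - bs n x) + (bs n x - f x)" for x by simp
  have "integrable M (\<lambda>x. (b x - f x)\<^sup>2)"
    unfolding eq by (rule integrable_square_add) (use f lim(1)[of n] in measurable)
  moreover have "(\<integral>x. (b x - f x)\<^sup>2 \<partial>M) < \<epsilon>"
    using integral_square_add_le[of "\<lambda>x. b x - bs n x" M "\<lambda>x. bs n x - f x"] f(3,4) n lim(1)[of n] unfolding eq by simp
  ultimately show "\<exists>f L B. L-lipschitz_on UNIV f \<and> (\<forall>x. \<bar>f x\<bar> \<le> B) \<and>
      integrable M (\<lambda>x. (b x - f x)\<^sup>2) \<and> (\<integral>x. (b x - f x)\<^sup>2 \<partial>M) < \<epsilon>"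
    using f by (intro exI[of _ f] exI[of _ L] exI[of _ B]) auto
qed

lemma lipschitz_approx_cmult:
  fixes M :: "'a::metric_space measure"
  assumes M: "sets M = sets borel" and [measurable]: "b \<in> borel_measurable M"
    and b: "lipschitz_approx M b"
  shows "lipschitz_approx M (\<lambda>x. c * b x)"
  unfolding lipschitz_approx_def
proof (intro allI impI)
  fix \<epsilon> :: real assume e: "\<epsilon> > 0"
  \<comment> \<open>The summand 1 covers \<open>c = 0\<close> and turns the final estimate into a
    strict one.\<close>
  then have e4: "\<epsilon> / (c\<^sup>2 + 1) > 0" by (simp add: add_nonneg_pos)
  from b[unfolded lipschitz_approx_def, rule_format, OF e4] obtain f L B where
    f: "L-lipschitz_on UNIV f" "\<And>x. \<bar>f x\<bar> \<le> B" "integrable M (\<lambda>x. (b x - f x)\<^sup>2)"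
      "(\<integral>x. (b x - f x)\<^sup>2 \<partial>M) < \<epsilon> / (c\<^sup>2 + 1)"
    by blast
  have eq: "(c * b x - c * f x)\<^sup>2 = c\<^sup>2 * (b x - f x)\<^sup>2" for x
    by (simp add: power_mult_distrib[symmetric] algebra_simps)
  have "c\<^sup>2 * (\<integral>x. (b x - f x)\<^sup>2 \<partial>M) \<le> c\<^sup>2 * (\<epsilon> / (c\<^sup>2 + 1))"
    using f(4) by (intro mult_left_mono) auto
  also have "\<dots> < \<epsilon>" using e by (simp add: divide_less_eq add_nonneg_pos distrib_left mult.commute)
  finally have "(\<integral>x. (c * b x - c * f x)\<^sup>2 \<partial>M) < \<epsilon>" unfolding eq by simp
  moreover have "integrable M (\<lambda>x. (c * b x - c * f x)\<^sup>2)" unfolding eq using f(3) by simp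
  moreover have "(\<bar>c\<bar> * L)-lipschitz_on UNIV (\<lambda>x. c * f x)" using f(1) by (rule lipschitz_on_cmult_real)
  moreover have "\<bar>c * f x\<bar> \<le> \<bar>c\<bar> * B" for x using f(2)[of x] by (simp add: abs_mult mult_left_mono)
  ultimately show "\<exists>f L B. L-lipschitz_on UNIV f \<and> (\<forall>x. \<bar>f x\<bar> \<le> B) \<and>
      integrable M (\<lambda>x. (c * b x - f x)\<^sup>2) \<and> (\<integral>x. (c * b x - f x)\<^sup>2 \<partial>M) < \<epsilon>"
    by (intro exI[of _ "\<lambda>x. c * f x"] exI[of _ "\<bar>c\<bar> * L"] exI[of _ "\<bar>c\<bar> * B"]) auto
qed

lemma lipschitz_approx_lipschitz:
  assumes "L-lipschitz_on UNIV f" "\<And>x. \<bar>f x\<bar> \<le> B"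
  shows "lipschitz_approx M f"
  unfolding lipschitz_approx_def using assms by (intro allI impI exI[of _ f] exI[of _ L] exI[of _ B]) auto

text \<open>The functions \<open>max 0 (1 - n * infdist x F)\<close> are n-Lipschitz with values
  between 0 and 1, equal 1 on \<open>F\<close>, and vanish at any point off \<open>F\<close> once n
  is large, because closedness makes its distance to \<open>F\<close> positive. Dominated
  convergence under a finite measure does the rest.\<close>

lemma lipschitz_approx_closed:
  fixes M :: "'a::metric_space measure"
  assumes M: "sets M = sets borel" and "finite_measure M" and F: "closed F"
  shows "lipschitz_approx M (indicator F)"
\<comment> \<open>By convention the distance to the empty set is 0, so the approximating functions
  would be constantly 1 there.\<close>
proof (cases "F = {}")
  case True
  then show ?thesis by (intro lipschitz_approx_lipschitz[of 0 _ 0]) (auto intro: lipschitz_on_constant)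
next
  case False
  interpret finite_measure M by fact
  define f where "f n x = max 0 (1 - real n * infdist x F)" for n x
  have lip: "(real n)-lipschitz_on UNIV (f n)" for n
  proof (rule lipschitz_onI)
    fix x y
    have "\<bar>infdist x F - infdist y F\<bar> \<le> dist x y" by (rule infdist_triangle_abs)
    then have "real n * \<bar>infdist x F - infdist y F\<bar> \<le> real n * dist x y" by (rule mult_left_mono) simp
    then have "\<bar>real n * infdist x F - real n * infdist y F\<bar> \<le> real n * dist x y"
      by (simp add: abs_mult right_diff_distrib[symmetric])
    then show "dist (f n x) (f n y) \<le> real n * dist x y"
      by (auto simp: f_def dist_real_def)
  qed simp
  have bnd: "\<bar>f n x\<bar> \<le> 1" for n x unfolding f_def using infdist_nonneg[of x F] by (auto simp: max_def)
  note [measurable] = lipschitz_on_borel[OF lip M]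
  have Fm[measurable]: "F \<in> sets M" using M F by (simp add: borel_closed)
  have b1: "norm ((indicator F x - f n x)\<^sup>2) \<le> 1" for n x
  proof -
    have "0 \<le> f n x" "f n x \<le> 1" using bnd[of n x] by (auto simp: f_def)
    then have "\<bar>indicator F x - f n x\<bar> \<le> 1" by (auto simp: indicator_def)
    then show ?thesis by (simp add: abs_square_le_1)
  qed
  have lim: "(\<lambda>n. (indicator F x - f n x)\<^sup>2) \<longlonglongrightarrow> 0" for x
  proof (cases "x \<in> F")
    case True then show ?thesis by (simp add: f_def)
  next
    case False
    then have pos: "infdist x F > 0" using F \<open>F \<noteq> {}\<close> in_closed_iff_infdist_zero[of F x] infdist_nonneg[of x F] by force
    obtain N :: nat where N: "1 / infdist x F < N" using reals_Archimedean2 by blast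
    have "f n x = 0" if "n \<ge> N" for n
    proof -
      have "1 / infdist x F \<le> real n" using N that by linarith
      then have "1 \<le> real n * infdist x F" using pos by (simp add: field_simps)
      then show ?thesis by (simp add: f_def)
    qed
    then have "eventually (\<lambda>n. (indicator F x - f n x)\<^sup>2 = 0) sequentially"
      using False by (auto simp: eventually_sequentially)
    then show ?thesis by (rule tendsto_eventually)
  qed
  show ?thesis
  proof (rule lipschitz_approx_limit[OF M, of _ f])
    show "lipschitz_approx M (f n)" for n using lip bnd by (rule lipschitz_approx_lipschitz)
    show "integrable M (\<lambda>x. (indicator F x - f n x)\<^sup>2)" for n
      by (rule integrable_const_bound[of _ 1]) (use b1 in auto)
    have "(\<lambda>n. \<integral>x. (indicator F x - f n x)\<^sup>2 \<partial>M) \<longlonglongrightarrow> (\<integral>x. 0 \<partial>M)"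
      by (rule integral_dominated_convergence[where w="\<lambda>_. 1"]) (use b1 lim in auto)
    then show "(\<lambda>n. \<integral>x. (indicator F x - f n x)\<^sup>2 \<partial>M) \<longlonglongrightarrow> 0" by simp
  qed auto
qed

text \<open>Closed sets form an intersection-stable generator of the Borel sets. Complements follow
  by linearity and countable disjoint unions as mean-square limits of partial sums, so Dynkin's
  theorem applies.\<close>

lemma lipschitz_approx_indicator:
  fixes M :: "'a::metric_space measure"
  assumes M: "sets M = sets borel" and "finite_measure M" and A: "A \<in> sets M"
  shows "lipschitz_approx M (indicator A)"
proof -
  interpret finite_measure M by fact
  have sM: "sets M = sigma_sets UNIV {F. closed F}"
    unfolding M borel_eq_closed by (simp add: sets_measure_of)
  have "Int_stable {F :: 'a set. closed F}" by (auto simp: Int_stable_def)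
  moreover have "{F :: 'a set. closed F} \<subseteq> Pow UNIV" by simp
  moreover from A have "A \<in> sigma_sets UNIV {F :: 'a set. closed F}" unfolding sM .
  ultimately show ?thesis
  proof (induction rule: sigma_sets_induct_disjoint)
    case (basic A) then show ?case using lipschitz_approx_closed[OF assms(1,2)] by simp
  next
    case empty show ?case using assms(1,2) by (intro lipschitz_approx_closed) auto
  next
    case (compl A)
    then have [measurable]: "A \<in> sets M" unfolding sM by simp
    have eq: "(indicator (UNIV - A) :: 'a \<Rightarrow> real) = (\<lambda>x. indicator UNIV x + (-1) * indicator A x)"
      by (auto simp: indicator_def fun_eq_iff)
    show ?case unfolding eq
      by (intro lipschitz_approx_add lipschitz_approx_cmult lipschitz_approx_closed assms compl) auto
  next
    case (union A)
    then have [measurable]: "\<And>i. A i \<in> sets M" unfolding sM by auto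
    define bs where "bs n x = (\<Sum>i<n. indicator (A i) x :: real)" for n :: nat and x
    have bs: "bs n x = indicator (\<Union>i<n. A i) x" for n x
      unfolding bs_def using union(1)
      by (subst indicator_UN_disjoint) (auto simp: disjoint_family_on_def)
    have approx: "lipschitz_approx M (bs n)" for n
    proof (induction n)
      case 0 then show ?case using lipschitz_approx_lipschitz[of 0 "\<lambda>_. 0" 0 M] by (simp add: bs_def[abs_def] lipschitz_on_constant)
    next
      case (Suc n)
      have "bs (Suc n) = (\<lambda>x. bs n x + indicator (A n) x)" by (auto simp: bs_def)
      then show ?case using lipschitz_approx_add[OF M _ _ Suc union(3)[of n]] by (simp add: bs_def[abs_def])
    qed
    have b1: "norm ((indicator (\<Union>i. A i) x - bs n x)\<^sup>2) \<le> 1" for n x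
      unfolding bs by (auto simp: indicator_def)
    have bsm[measurable]: "bs n \<in> borel_measurable M" for n unfolding bs_def by measurable
    have lim: "(\<lambda>n. (indicator (\<Union>i. A i) x - bs n x)\<^sup>2) \<longlonglongrightarrow> 0" for x
    proof (cases "x \<in> (\<Union>i. A i)")
      case True
      then obtain k where "x \<in> A k" by auto
      then have "eventually (\<lambda>n. (indicator (\<Union>i. A i) x - bs n x)\<^sup>2 = 0) sequentially"
        unfolding bs by (intro eventually_sequentiallyI[of "Suc k"]) (auto simp: indicator_def)
      then show ?thesis by (rule tendsto_eventually)
    qed (auto simp: bs)
    show ?case
    proof (rule lipschitz_approx_limit[OF M, of _ bs, OF _ _ approx])
      show "integrable M (\<lambda>x. (indicator (\<Union>i. A i) x - bs n x)\<^sup>2)" for n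
        by (rule integrable_const_bound[of _ 1]) (use b1 in auto)
      have "(\<lambda>n. \<integral>x. (indicator (\<Union>i. A i) x - bs n x)\<^sup>2 \<partial>M) \<longlonglongrightarrow> (\<integral>x. 0 \<partial>M)"
        by (rule integral_dominated_convergence[where w="\<lambda>_. 1"]) (use b1 lim in auto)
      then show "(\<lambda>n. \<integral>x. (indicator (\<Union>i. A i) x - bs n x)\<^sup>2 \<partial>M) \<longlonglongrightarrow> 0" by simp
    qed auto
  qed
qed

text \<open>Square integrability is carried as a premise through the induction: each summand and
  each member of an increasing sequence lies below the function it builds and inherits the
  property.\<close>

lemma lipschitz_approx_nonneg:
  fixes M :: "'a::metric_space measure"
  assumes M: "sets M = sets borel" and "finite_measure M"
    and b: "b \<in> borel_measurable M" and "\<And>x. 0 \<le> b x" and "integrable M (\<lambda>x. (b x)\<^sup>2)"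
  shows "lipschitz_approx M b"
  using b assms(4,5)
proof (induction rule: borel_measurable_induct_real)
  case (set A) show ?case using M assms(2) set(1) by (rule lipschitz_approx_indicator)
next
  case (mult u c)
  show ?case
  \<comment> \<open>For \<open>c = 0\<close> the premise on the product says nothing about
    \<open>u\<close>; the zero function is approximated by itself.\<close>
  proof (cases "c = 0")
    case False
    then have "integrable M (\<lambda>x. (u x)\<^sup>2)" using mult.prems by (simp add: power_mult_distrib)
    then show ?thesis using mult by (intro lipschitz_approx_cmult[OF M]) auto
  qed (use lipschitz_approx_lipschitz[of 0 _ 0] in \<open>auto intro: lipschitz_on_constant\<close>)
next
  case (add u v)
  note [measurable] = add(1,3)
  have "integrable M (\<lambda>x. (u x)\<^sup>2)" "integrable M (\<lambda>x. (v x)\<^sup>2)"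
    using add(2,4) by (auto intro!: Bochner_Integration.integrable_bound[OF add.prems] AE_I2 power_mono)
  then show ?case using add by (intro lipschitz_approx_add[OF M]) auto
next
  case (seq U)
  note [measurable] = seq(1)
  have [measurable]: "b \<in> borel_measurable M" by (rule borel_measurable_LIMSEQ_real[OF seq(4) seq(1)])
  have le: "U i x \<le> b x" if "x \<in> space M" for i x
    using seq(3,4) that by (intro incseq_le) (auto simp: incseq_def le_fun_def)
  have dom: "AE x in M. norm ((b x - U i x)\<^sup>2) \<le> (b x)\<^sup>2" for i
    using le seq(2) by (auto intro!: AE_I2 power_mono)
  show ?case
  proof (rule lipschitz_approx_limit[OF M, of _ U])
    show "lipschitz_approx M (U i)" for i
    proof (rule seq(5))
      show "integrable M (\<lambda>x. (U i x)\<^sup>2)"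
        by (rule Bochner_Integration.integrable_bound[OF seq.prems]) (use le seq(2) in \<open>auto intro!: AE_I2 power_mono\<close>)
    qed
    show "integrable M (\<lambda>x. (b x - U i x)\<^sup>2)" for i
      by (rule Bochner_Integration.integrable_bound[OF seq.prems]) (use dom in auto)
    have "(\<lambda>n. \<integral>x. (b x - U n x)\<^sup>2 \<partial>M) \<longlonglongrightarrow> (\<integral>x. 0 \<partial>M)"
    proof (rule integral_dominated_convergence[where w="\<lambda>x. (b x)\<^sup>2"])
      show "AE x in M. (\<lambda>n. (b x - U n x)\<^sup>2) \<longlonglongrightarrow> 0"
        by (rule AE_I2, rule tendsto_eq_intros, rule tendsto_diff[OF tendsto_const seq(4)]) auto
    qed (use dom seq.prems in auto)
    then show "(\<lambda>n. \<integral>x. (b x - U n x)\<^sup>2 \<partial>M) \<longlonglongrightarrow> 0" by simp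
  qed auto
qed

lemma lipschitz_approx_square_integrable:
  fixes M :: "'a::metric_space measure"
  assumes M: "sets M = sets borel" "finite_measure M"
    and [measurable]: "b \<in> borel_measurable M" and b2: "integrable M (\<lambda>x. (b x)\<^sup>2)"
  shows "lipschitz_approx M b"
proof -
  have "lipschitz_approx M (\<lambda>x. max (b x) 0)" "lipschitz_approx M (\<lambda>x. max (- b x) 0)"
    by (rule lipschitz_approx_nonneg[OF M];
        auto intro!: Bochner_Integration.integrable_bound[OF b2] AE_I2 simp: max_def)+
  then have "lipschitz_approx M (\<lambda>x. max (b x) 0 + (-1) * max (- b x) 0)"
    by (intro lipschitz_approx_add lipschitz_approx_cmult M) auto
  moreover have "(\<lambda>x. max (b x) 0 + (-1) * max (- b x) 0) = b" by (auto simp: max_def)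
  ultimately show ?thesis by simp
qed

subsection \<open>Laws of large numbers and convergence in probability\<close>

lemma distr_eq_integral:
  fixes h :: "'b \<Rightarrow> real"
  assumes [measurable]: "X \<in> M \<rightarrow>\<^sub>M N" "Y \<in> M \<rightarrow>\<^sub>M N" "h \<in> borel_measurable N"
    and eq: "distr M N X = distr M N Y"
  shows "integrable M (\<lambda>\<omega>. h (X \<omega>)) \<longleftrightarrow> integrable M (\<lambda>\<omega>. h (Y \<omega>))"
    and "(\<integral>\<omega>. h (X \<omega>) \<partial>M) = (\<integral>\<omega>. h (Y \<omega>) \<partial>M)"
proof -
  show "integrable M (\<lambda>\<omega>. h (X \<omega>)) \<longleftrightarrow> integrable M (\<lambda>\<omega>. h (Y \<omega>))"
    using integrable_distr_eq[of X M N h] integrable_distr_eq[of Y M N h] eq by simp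
  show "(\<integral>\<omega>. h (X \<omega>) \<partial>M) = (\<integral>\<omega>. h (Y \<omega>) \<partial>M)"
    using integral_distr[of X M N h] integral_distr[of Y M N h] eq by simp
qed

section \<open>Laws of large numbers in mean\<close>

context prob_space
begin

text \<open>The variance of the absolute value is nonnegative.\<close>

lemma expectation_abs_le_sqrt:
  fixes X :: "'a \<Rightarrow> real"
  assumes [measurable]: "X \<in> borel_measurable M" and X2: "integrable M (\<lambda>\<omega>. (X \<omega>)\<^sup>2)"
  shows "expectation (\<lambda>\<omega>. \<bar>X \<omega>\<bar>) \<le> sqrt (expectation (\<lambda>\<omega>. (X \<omega>)\<^sup>2))"
proof -
  have "integrable M X" using square_integrable_imp_integrable[OF assms] .
  then have "variance (\<lambda>\<omega>. \<bar>X \<omega>\<bar>) = expectation (\<lambda>\<omega>. (X \<omega>)\<^sup>2) - (expectation (\<lambda>\<omega>. \<bar>X \<omega>\<bar>))\<^sup>2"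
    using X2 by (subst variance_eq) auto
  moreover have "0 \<le> variance (\<lambda>\<omega>. \<bar>X \<omega>\<bar>)" by (rule variance_positive)
  ultimately show ?thesis by (intro real_le_rsqrt) simp
qed

lemma iid_sum_second_moment:
  fixes X :: "nat \<Rightarrow> 'a \<Rightarrow> real"
  assumes indep: "indep_vars (\<lambda>_. borel) X {1..}"
    and ident: "\<And>i. i \<ge> 1 \<Longrightarrow> distr M borel (X i) = distr M borel (X 1)"
    and X2: "integrable M (\<lambda>\<omega>. (X 1 \<omega>)\<^sup>2)" and mean: "expectation (X 1) = 0"
  shows "integrable M (\<lambda>\<omega>. (\<Sum>i=1..n. X i \<omega>)\<^sup>2)"
    and "expectation (\<lambda>\<omega>. (\<Sum>i=1..n. X i \<omega>)\<^sup>2) = real n * expectation (\<lambda>\<omega>. (X 1 \<omega>)\<^sup>2)"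
proof -
  have m[measurable]: "i \<ge> 1 \<Longrightarrow> X i \<in> borel_measurable M" for i
    using indep by (auto simp: indep_vars_def)
  have sq: "integrable M (\<lambda>\<omega>. (X i \<omega>)\<^sup>2)" "expectation (\<lambda>\<omega>. (X i \<omega>)\<^sup>2) = expectation (\<lambda>\<omega>. (X 1 \<omega>)\<^sup>2)"
    if "i \<ge> 1" for i
    using distr_eq_integral[OF m[OF that] m[OF order_refl] _ ident[OF that], of "\<lambda>x. x\<^sup>2"] X2 by auto
  have int: "integrable M (X i)" if "i \<ge> 1" for i
    using square_integrable_imp_integrable[OF m[OF that] sq(1)[OF that]] .
  have mean_i: "expectation (X i) = 0" if "i \<ge> 1" for i
    using distr_eq_integral(2)[OF m[OF that] m[OF order_refl] _ ident[OF that], of "\<lambda>x. x"] mean by simp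
  have prod: "integrable M (\<lambda>\<omega>. X i \<omega> * X j \<omega>)" if "i \<in> {1..n}" "j \<in> {1..n}" for i j
    by (rule integrable_mult_of_squares) (use that sq in auto)
  have orth: "expectation (\<lambda>\<omega>. X i \<omega> * X j \<omega>) = 0" if ij: "i \<in> {1..n}" "j \<in> {1..n}" "i \<noteq> j" for i j
  proof -
    from indep_vars_subset[OF indep, of "{i, j}"] ij have "indep_vars (\<lambda>_. borel) X {i, j}" by fastforce
    then have "expectation (\<lambda>\<omega>. \<Prod>k\<in>{i, j}. X k \<omega>) = (\<Prod>k\<in>{i, j}. expectation (X k))"
      by (intro indep_vars_lebesgue_integral) (use ij int in auto)
    then show ?thesis using ij mean_i by simp
  qed
  show "integrable M (\<lambda>\<omega>. (\<Sum>i=1..n. X i \<omega>)\<^sup>2)"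
    by (rule second_moment_sum_orthogonal(1)) (use prod orth in auto)
  have "expectation (\<lambda>\<omega>. (\<Sum>i=1..n. X i \<omega>)\<^sup>2) = (\<Sum>i=1..n. expectation (\<lambda>\<omega>. (X i \<omega>)\<^sup>2))"
    by (rule second_moment_sum_orthogonal(2)) (use prod orth in auto)
  then show "expectation (\<lambda>\<omega>. (\<Sum>i=1..n. X i \<omega>)\<^sup>2) = real n * expectation (\<lambda>\<omega>. (X 1 \<omega>)\<^sup>2)"
    using sum.cong[OF refl sq(2), of "{1..n}" "\<lambda>i. i"] by simp
qed

text \<open>The centred average has second moment of order 1/n by orthogonality, and the first
  absolute moment is at most its square root.\<close>

lemma L1_law_of_large_numbers_bounded:
  fixes X :: "nat \<Rightarrow> 'a \<Rightarrow> real"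
  assumes indep: "indep_vars (\<lambda>_. borel) X {1..}"
    and ident: "\<And>i. i \<ge> 1 \<Longrightarrow> distr M borel (X i) = distr M borel (X 1)"
    and bounded: "\<And>i \<omega>. \<bar>X i \<omega>\<bar> \<le> K"
  shows "(\<lambda>n. expectation (\<lambda>\<omega>. \<bar>1 / real n * (\<Sum>i=1..n. X i \<omega>) - expectation (X 1)\<bar>)) \<longlonglongrightarrow> 0"
proof -
  define m where "m = expectation (X 1)"
  define Z where "Z i \<omega> = X i \<omega> - m" for i \<omega>
  have [measurable]: "i \<ge> 1 \<Longrightarrow> X i \<in> borel_measurable M" for i
    using indep by (auto simp: indep_vars_def)
  have int1: "integrable M (X 1)"
    by (rule integrable_const_bound[of _ K]) (use bounded in auto)
  have indepZ: "indep_vars (\<lambda>_. borel) Z {1..}"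
    unfolding Z_def by (rule indep_vars_compose2[OF indep, of "\<lambda>_ x. x - m"]) simp
  have identZ: "distr M borel (Z i) = distr M borel (Z 1)" if "i \<ge> 1" for i
  proof -
    have "distr M borel (Z i) = distr (distr M borel (X i)) borel (\<lambda>x. x - m)" if "i \<ge> 1" for i
      using that by (subst distr_distr) (auto simp: comp_def Z_def[abs_def])
    then show ?thesis using ident[OF that] that by simp
  qed
  have Zb: "\<bar>Z 1 \<omega>\<bar> \<le> K + \<bar>m\<bar>" for \<omega> using bounded[of 1 \<omega>] by (auto simp: Z_def)
  have "(Z 1 \<omega>)\<^sup>2 \<le> (K + \<bar>m\<bar>)\<^sup>2" for \<omega>
    using power_mono[OF Zb[of \<omega>], of 2] by simp
  then have Z2: "integrable M (\<lambda>\<omega>. (Z 1 \<omega>)\<^sup>2)"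
    by (intro integrable_const_bound[of _ "(K + \<bar>m\<bar>)\<^sup>2"]) (auto simp: Z_def[abs_def])
  have mZ: "expectation (Z 1) = 0" using int1 unfolding Z_def[abs_def] by (simp add: m_def prob_space)
  note sm = iid_sum_second_moment[OF indepZ identZ Z2 mZ]
  have le: "expectation (\<lambda>\<omega>. \<bar>1 / real n * (\<Sum>i=1..n. X i \<omega>) - m\<bar>) \<le> sqrt (expectation (\<lambda>\<omega>. (Z 1 \<omega>)\<^sup>2) / real n)"
    if n: "n \<ge> 1" for n
  proof -
    have eq: "1 / real n * (\<Sum>i=1..n. X i \<omega>) - m = 1 / real n * (\<Sum>i=1..n. Z i \<omega>)" for \<omega>
      using n by (simp add: Z_def sum_subtractf field_simps)
    have "expectation (\<lambda>\<omega>. \<bar>1 / real n * (\<Sum>i=1..n. Z i \<omega>)\<bar>)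
        \<le> sqrt (expectation (\<lambda>\<omega>. (1 / real n * (\<Sum>i=1..n. Z i \<omega>))\<^sup>2))"
      by (rule expectation_abs_le_sqrt) (use sm(1)[of n] in \<open>auto simp: power_mult_distrib power_divide Z_def\<close>)
    also have "expectation (\<lambda>\<omega>. (1 / real n * (\<Sum>i=1..n. Z i \<omega>))\<^sup>2) = expectation (\<lambda>\<omega>. (Z 1 \<omega>)\<^sup>2) / real n"
      unfolding power_mult_distrib using sm(2)[of n] n by (simp add: field_simps power2_eq_square)
    finally show ?thesis unfolding eq .
  qed
  have lim0: "(\<lambda>n. sqrt (expectation (\<lambda>\<omega>. (Z 1 \<omega>)\<^sup>2) / real n)) \<longlonglongrightarrow> 0"
    using tendsto_real_sqrt[OF lim_const_over_n] by simp
  show ?thesis unfolding m_def[symmetric]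
  proof (rule tendsto_sandwich[OF _ _ tendsto_const lim0])
    show "\<forall>\<^sub>F n in sequentially. expectation (\<lambda>\<omega>. \<bar>1 / real n * (\<Sum>i=1..n. X i \<omega>) - m\<bar>)
        \<le> sqrt (expectation (\<lambda>\<omega>. (Z 1 \<omega>)\<^sup>2) / real n)"
      by (rule eventually_sequentiallyI) (rule le)
  qed (simp add: integral_nonneg)
qed

text \<open>Truncation reduces the claim to bounded variables. The truncation error of the average
  has mean at most \<open>r K\<close> for every n, because the variables are identically
  distributed, and \<open>r K\<close> vanishes by dominated convergence. Thus the level is fixed
  first and n grows afterwards.\<close>

lemma L1_law_of_large_numbers:
  fixes X :: "nat \<Rightarrow> 'a \<Rightarrow> real"
  assumes indep: "indep_vars (\<lambda>_. borel) X {1..}"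
    and ident: "\<And>i. i \<ge> 1 \<Longrightarrow> distr M borel (X i) = distr M borel (X 1)"
    and int1: "integrable M (X 1)"
  shows "(\<lambda>n. expectation (\<lambda>\<omega>. \<bar>1 / real n * (\<Sum>i=1..n. X i \<omega>) - expectation (X 1)\<bar>)) \<longlonglongrightarrow> 0"
proof -
  define tr where "tr K x = (if \<bar>x\<bar> \<le> K then x else 0)" for K x :: real
  have [measurable]: "tr K \<in> borel_measurable borel" for K unfolding tr_def by measurable
  have m[measurable]: "i \<ge> 1 \<Longrightarrow> X i \<in> borel_measurable M" for i
    using indep by (auto simp: indep_vars_def)
  have int: "integrable M (X i)" if "i \<ge> 1" for i
    using distr_eq_integral(1)[OF m[OF that] m[OF order_refl] _ ident[OF that], of "\<lambda>x. x"] int1 by simp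
  have tr_le: "\<bar>tr K x\<bar> \<le> \<bar>x\<bar>" for K x by (simp add: tr_def)
  have int_tr: "integrable M (\<lambda>\<omega>. tr K (X i \<omega>))" if "i \<ge> 1" for i K
    using that by (intro Bochner_Integration.integrable_bound[OF int[OF that]]) (auto simp: tr_le)
  define r where "r K = expectation (\<lambda>\<omega>. \<bar>X 1 \<omega> - tr K (X 1 \<omega>)\<bar>)" for K
  have r_lim: "(\<lambda>k. r (real k)) \<longlonglongrightarrow> 0"
  proof -
    have "(\<lambda>k. r (real k)) \<longlonglongrightarrow> expectation (\<lambda>_. 0)"
      unfolding r_def
    proof (rule integral_dominated_convergence[where w="\<lambda>\<omega>. \<bar>X 1 \<omega>\<bar>"])
      show "AE \<omega> in M. (\<lambda>k. \<bar>X 1 \<omega> - tr (real k) (X 1 \<omega>)\<bar>) \<longlonglongrightarrow> 0"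
      proof (rule AE_I2)
        fix \<omega>
        obtain k :: nat where "\<bar>X 1 \<omega>\<bar> \<le> real k" using real_arch_simple by blast
        then show "(\<lambda>k. \<bar>X 1 \<omega> - tr (real k) (X 1 \<omega>)\<bar>) \<longlonglongrightarrow> 0"
          by (intro tendsto_eventually eventually_sequentiallyI[of k]) (auto simp: tr_def)
      qed
    qed (use int1 in \<open>auto simp: tr_def\<close>)
    then show ?thesis by simp
  qed
  show ?thesis
  proof (rule LIMSEQ_I)
    fix e :: real assume e: "e > 0"
    \<comment> \<open>Truncation alters both the average and the expectation, so its error is
      counted twice; the bounded part receives the other half of \<open>e\<close>.\<close>
    then have "eventually (\<lambda>k. r (real k) < e / 4) sequentially" using order_tendstoD(2)[OF r_lim, of "e / 4"] by simp
    then obtain k where k: "r (real k) < e / 4" by (auto dest: eventually_happens)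
    define Xt where "Xt i \<omega> = tr (real k) (X i \<omega>)" for i \<omega>
    have indep_t: "indep_vars (\<lambda>_. borel) Xt {1..}"
      unfolding Xt_def by (rule indep_vars_compose2[OF indep, of "\<lambda>_. tr (real k)"]) simp
    have ident_t: "distr M borel (Xt i) = distr M borel (Xt 1)" if "i \<ge> 1" for i
    proof -
      have "distr M borel (Xt i) = distr (distr M borel (X i)) borel (tr (real k))" if "i \<ge> 1" for i
        using that by (subst distr_distr) (auto simp: comp_def Xt_def[abs_def])
      then show ?thesis using ident[OF that] that by simp
    qed
    have "\<bar>Xt i \<omega>\<bar> \<le> real k" for i \<omega> by (simp add: Xt_def tr_def)
    from L1_law_of_large_numbers_bounded[OF indep_t ident_t this]
    have "eventually (\<lambda>n. expectation (\<lambda>\<omega>. \<bar>1 / real n * (\<Sum>i=1..n. Xt i \<omega>) - expectation (Xt 1)\<bar>) < e / 2) sequentially"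
      using half_gt_zero[OF e] by (rule order_tendstoD(2))
    then obtain N where N: "\<And>n. n \<ge> N \<Longrightarrow>
        expectation (\<lambda>\<omega>. \<bar>1 / real n * (\<Sum>i=1..n. Xt i \<omega>) - expectation (Xt 1)\<bar>) < e / 2"
      by (auto simp: eventually_sequentially)
    have "expectation (\<lambda>\<omega>. \<bar>1 / real n * (\<Sum>i=1..n. X i \<omega>) - expectation (X 1)\<bar>) < e" if n: "n \<ge> max N 1" for n
    proof -
      have [measurable]: "i \<ge> 1 \<Longrightarrow> Xt i \<in> borel_measurable M" for i unfolding Xt_def by measurable
      have it: "integrable M (Xt i)" if "i \<ge> 1" for i unfolding Xt_def using int_tr that by simp
      have ri: "expectation (\<lambda>\<omega>. \<bar>X i \<omega> - Xt i \<omega>\<bar>) = r (real k)" if "i \<ge> 1" for i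
        using distr_eq_integral(2)[OF m[OF that] m[OF order_refl] _ ident[OF that], of "\<lambda>x. \<bar>x - tr (real k) x\<bar>"]
        by (simp add: r_def Xt_def)
      have "\<bar>1 / real n * (\<Sum>i=1..n. X i \<omega>) - expectation (X 1)\<bar>
          \<le> \<bar>1 / real n * (\<Sum>i=1..n. Xt i \<omega>) - expectation (Xt 1)\<bar>
            + (1 / real n * (\<Sum>i=1..n. \<bar>X i \<omega> - Xt i \<omega>\<bar>) + r (real k))" for \<omega>
      proof -
        have "\<bar>expectation (X 1) - expectation (Xt 1)\<bar> = \<bar>expectation (\<lambda>\<omega>. X 1 \<omega> - Xt 1 \<omega>)\<bar>"
          using int1 it by simp
        also have "\<dots> \<le> r (real k)" unfolding r_def Xt_def by (rule integral_abs_bound)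
        finally have 1: "\<bar>expectation (X 1) - expectation (Xt 1)\<bar> \<le> r (real k)" .
        have "\<bar>1 / real n * (\<Sum>i=1..n. X i \<omega>) - 1 / real n * (\<Sum>i=1..n. Xt i \<omega>)\<bar>
            = 1 / real n * \<bar>\<Sum>i=1..n. X i \<omega> - Xt i \<omega>\<bar>"
          by (simp add: sum_subtractf right_diff_distrib[symmetric] abs_mult diff_divide_distrib[symmetric])
        also have "\<dots> \<le> 1 / real n * (\<Sum>i=1..n. \<bar>X i \<omega> - Xt i \<omega>\<bar>)"
          by (intro mult_left_mono sum_abs) simp
        finally show ?thesis using 1 by linarith
      qed
      then have "expectation (\<lambda>\<omega>. \<bar>1 / real n * (\<Sum>i=1..n. X i \<omega>) - expectation (X 1)\<bar>)
         \<le> expectation (\<lambda>\<omega>. \<bar>1 / real n * (\<Sum>i=1..n. Xt i \<omega>) - expectation (Xt 1)\<bar>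
            + (1 / real n * (\<Sum>i=1..n. \<bar>X i \<omega> - Xt i \<omega>\<bar>) + r (real k)))"
        using int it by (intro integral_mono) (auto intro!: Bochner_Integration.integrable_add
          integrable_abs Bochner_Integration.integrable_diff integrable_mult_right Bochner_Integration.integrable_sum)
      also have "\<dots> = expectation (\<lambda>\<omega>. \<bar>1 / real n * (\<Sum>i=1..n. Xt i \<omega>) - expectation (Xt 1)\<bar>) + (r (real k) + r (real k))"
      proof -
        have "expectation (\<lambda>\<omega>. 1 / real n * (\<Sum>i=1..n. \<bar>X i \<omega> - Xt i \<omega>\<bar>))
            = 1 / real n * (\<Sum>i=1..n. expectation (\<lambda>\<omega>. \<bar>X i \<omega> - Xt i \<omega>\<bar>))"
          using int it by (subst integral_mult_right_zero, subst Bochner_Integration.integral_sum) auto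
        also have "\<dots> = r (real k)" using n by (simp add: ri)
        finally have avg: "expectation (\<lambda>\<omega>. 1 / real n * (\<Sum>i=1..n. \<bar>X i \<omega> - Xt i \<omega>\<bar>)) = r (real k)" .
        have "integrable M (\<lambda>\<omega>. \<bar>1 / real n * (\<Sum>i=1..n. Xt i \<omega>) - expectation (Xt 1)\<bar>)"
          "integrable M (\<lambda>\<omega>. 1 / real n * (\<Sum>i=1..n. \<bar>X i \<omega> - Xt i \<omega>\<bar>))"
          using int it by (auto intro!: Bochner_Integration.integrable_add
          integrable_abs Bochner_Integration.integrable_diff integrable_mult_right Bochner_Integration.integrable_sum)
        then show ?thesis using avg by (simp add: prob_space del: One_nat_def)
      qed
      also have "\<dots> < e" using N[of n] k n by simp
      finally show ?thesis .
    qed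
    then show "\<exists>no. \<forall>n\<ge>no. norm (expectation (\<lambda>\<omega>. \<bar>1 / real n * (\<Sum>i=1..n. X i \<omega>) - expectation (X 1)\<bar>) - 0) < e"
      by (intro exI[of _ "max N 1"]) (auto simp: integral_nonneg)
  qed
qed

section \<open>Convergence in probability: criteria and consequences\<close>

text \<open>Chebyshev's inequality on events whose probability tends to one. The events may depend
  on \<open>\<eta>\<close>. This suits quantities whose second moment is controlled only where
  another random quantity is small.\<close>

lemma tends_to_zero_in_probI:
  fixes X :: "nat \<Rightarrow> 'a \<Rightarrow> real"
  assumes [measurable]: "\<And>n. n \<ge> 1 \<Longrightarrow> X n \<in> borel_measurable M"
    and small: "\<And>\<eta>. \<eta> > 0 \<Longrightarrow> \<exists>A. (\<forall>n\<ge>1. A n \<in> events) \<and> (\<lambda>n. prob (space M - A n)) \<longlonglongrightarrow> 0 \<and>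
       (eventually (\<lambda>n. integrable M (\<lambda>\<omega>. indicator (A n) \<omega> * (X n \<omega>)\<^sup>2) \<and>
           expectation (\<lambda>\<omega>. indicator (A n) \<omega> * (X n \<omega>)\<^sup>2) \<le> \<eta>) sequentially)"
  shows "tends_to_zero_in_prob M X"
  unfolding tends_to_zero_in_prob_def
proof (intro allI impI LIMSEQ_I)
  fix \<epsilon> e :: real assume \<epsilon>: "\<epsilon> > 0" and e: "e > 0"
  \<comment> \<open>Markov's inequality divides by \<open>\<epsilon>\<^sup>2\<close> and leaves
    \<open>e / 4\<close>; the complement of \<open>A n\<close> is allowed
    \<open>e / 2\<close>.\<close>
  then have "e / 4 * \<epsilon>\<^sup>2 > 0" by simp
  from small[OF this] obtain A where A: "\<And>n. n \<ge> 1 \<Longrightarrow> A n \<in> events" "(\<lambda>n. prob (space M - A n)) \<longlonglongrightarrow> 0"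
    and ev: "eventually (\<lambda>n. integrable M (\<lambda>\<omega>. indicator (A n) \<omega> * (X n \<omega>)\<^sup>2) \<and>
           expectation (\<lambda>\<omega>. indicator (A n) \<omega> * (X n \<omega>)\<^sup>2) \<le> e / 4 * \<epsilon>\<^sup>2) sequentially" by auto
  have "eventually (\<lambda>n. prob (space M - A n) < e / 2) sequentially"
    using order_tendstoD(2)[OF A(2), of "e / 2"] e by simp
  with ev eventually_ge_at_top[of 1]
  have "eventually (\<lambda>n. prob {\<omega> \<in> space M. \<epsilon> < \<bar>X n \<omega>\<bar>} < e) sequentially"
  proof eventually_elim
    case (elim n)
    then have n: "n \<ge> 1" by simp
    note [measurable] = A(1)[OF n]
    have [measurable]: "X n \<in> borel_measurable M" using n by measurable
    have "prob {\<omega> \<in> space M. \<epsilon> < \<bar>X n \<omega>\<bar>} \<le> prob ((space M - A n) \<union> {\<omega> \<in> space M. \<epsilon>\<^sup>2 \<le> indicator (A n) \<omega> * (X n \<omega>)\<^sup>2})"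
    proof (rule finite_measure_mono)
      show "{\<omega> \<in> space M. \<epsilon> < \<bar>X n \<omega>\<bar>} \<subseteq> (space M - A n) \<union> {\<omega> \<in> space M. \<epsilon>\<^sup>2 \<le> indicator (A n) \<omega> * (X n \<omega>)\<^sup>2}"
        using \<epsilon> by (auto simp: indicator_def abs_le_square_iff[symmetric])
    qed measurable
    also have "\<dots> \<le> prob (space M - A n) + prob {\<omega> \<in> space M. \<epsilon>\<^sup>2 \<le> indicator (A n) \<omega> * (X n \<omega>)\<^sup>2}"
      by (rule measure_Un_le) measurable
    also have "prob {\<omega> \<in> space M. \<epsilon>\<^sup>2 \<le> indicator (A n) \<omega> * (X n \<omega>)\<^sup>2}
        \<le> expectation (\<lambda>\<omega>. indicator (A n) \<omega> * (X n \<omega>)\<^sup>2) / \<epsilon>\<^sup>2"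
      using elim \<epsilon> by (intro integral_Markov_inequality_measure[where A="{}"]) auto
    also have "\<dots> \<le> (e / 4 * \<epsilon>\<^sup>2) / \<epsilon>\<^sup>2" using elim by (intro divide_right_mono) auto
    also have "\<dots> = e / 4" using \<epsilon> by simp
    finally show ?case using elim e by simp
  qed
  then show "\<exists>no. \<forall>n\<ge>no. norm (prob {\<omega> \<in> space M. \<epsilon> < \<bar>X n \<omega>\<bar>} - 0) < e"
    by (auto simp: eventually_sequentially)
qed

lemma tends_to_zero_in_prob_L1:
  fixes X :: "nat \<Rightarrow> 'a \<Rightarrow> real"
  assumes int: "\<And>n. n \<ge> 1 \<Longrightarrow> integrable M (X n)"
    and lim: "(\<lambda>n. expectation (\<lambda>\<omega>. \<bar>X n \<omega>\<bar>)) \<longlonglongrightarrow> 0"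
  shows "tends_to_zero_in_prob M X"
  unfolding tends_to_zero_in_prob_def
proof (intro allI impI)
  fix \<epsilon> :: real assume \<epsilon>: "\<epsilon> > 0"
  have le: "prob {\<omega> \<in> space M. \<epsilon> < \<bar>X n \<omega>\<bar>} \<le> expectation (\<lambda>\<omega>. \<bar>X n \<omega>\<bar>) / \<epsilon>" if n: "n \<ge> 1" for n
  proof -
    note [measurable] = borel_measurable_integrable[OF int[OF n]]
    have "prob {\<omega> \<in> space M. \<epsilon> < \<bar>X n \<omega>\<bar>} \<le> prob {\<omega> \<in> space M. \<epsilon> \<le> \<bar>X n \<omega>\<bar>}"
      by (rule finite_measure_mono) auto
    also have "\<dots> \<le> expectation (\<lambda>\<omega>. \<bar>X n \<omega>\<bar>) / \<epsilon>"
      using int[OF n] \<epsilon> by (intro integral_Markov_inequality_measure[where A="{}"]) auto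
    finally show ?thesis .
  qed
  have "(\<lambda>n. expectation (\<lambda>\<omega>. \<bar>X n \<omega>\<bar>) / \<epsilon>) \<longlonglongrightarrow> 0 / \<epsilon>"
    using \<epsilon> by (intro tendsto_divide lim) auto
  then have lim0: "(\<lambda>n. expectation (\<lambda>\<omega>. \<bar>X n \<omega>\<bar>) / \<epsilon>) \<longlonglongrightarrow> 0" by simp
  show "(\<lambda>n. prob {\<omega> \<in> space M. \<epsilon> < \<bar>X n \<omega>\<bar>}) \<longlonglongrightarrow> 0"
    by (rule tendsto_sandwich[OF _ _ tendsto_const lim0])
       (auto intro!: eventually_sequentiallyI[of 1] le)
qed

text \<open>If \<open>Z n\<close> exceeds \<open>\<epsilon>\<close>, one of the two dominating terms
  exceeds \<open>\<epsilon> / 2\<close>. This one rule replaces separate statements on sums,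
  products and pointwise domination.\<close>

lemma tends_to_zero_in_prob_le_add:
  fixes X Y Z :: "nat \<Rightarrow> 'a \<Rightarrow> real"
  assumes [measurable]: "\<And>n. n \<ge> 1 \<Longrightarrow> X n \<in> borel_measurable M" "\<And>n. n \<ge> 1 \<Longrightarrow> Y n \<in> borel_measurable M"
    and X: "tends_to_zero_in_prob M X" and Y: "tends_to_zero_in_prob M Y"
    and le: "\<And>n \<omega>. n \<ge> 1 \<Longrightarrow> \<omega> \<in> space M \<Longrightarrow> \<bar>Z n \<omega>\<bar> \<le> \<bar>X n \<omega>\<bar> + \<bar>Y n \<omega>\<bar>"
  shows "tends_to_zero_in_prob M Z"
  unfolding tends_to_zero_in_prob_def
proof (intro allI impI)
  fix \<epsilon> :: real assume \<epsilon>: "\<epsilon> > 0"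
  have "prob {\<omega> \<in> space M. \<epsilon> < \<bar>Z n \<omega>\<bar>} \<le> prob {\<omega> \<in> space M. \<epsilon> / 2 < \<bar>X n \<omega>\<bar>} + prob {\<omega> \<in> space M. \<epsilon> / 2 < \<bar>Y n \<omega>\<bar>}"
    if n: "n \<ge> 1" for n
  proof -
    have [measurable]: "X n \<in> borel_measurable M" "Y n \<in> borel_measurable M" using n by auto
    have "prob {\<omega> \<in> space M. \<epsilon> < \<bar>Z n \<omega>\<bar>} \<le> prob ({\<omega> \<in> space M. \<epsilon> / 2 < \<bar>X n \<omega>\<bar>} \<union> {\<omega> \<in> space M. \<epsilon> / 2 < \<bar>Y n \<omega>\<bar>})"
    proof (rule finite_measure_mono)
      show "{\<omega> \<in> space M. \<epsilon> < \<bar>Z n \<omega>\<bar>} \<subseteq> {\<omega> \<in> space M. \<epsilon> / 2 < \<bar>X n \<omega>\<bar>} \<union> {\<omega> \<in> space M. \<epsilon> / 2 < \<bar>Y n \<omega>\<bar>}"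
      proof
        fix \<omega> assume "\<omega> \<in> {\<omega> \<in> space M. \<epsilon> < \<bar>Z n \<omega>\<bar>}"
        with le[OF n, of \<omega>] show "\<omega> \<in> {\<omega> \<in> space M. \<epsilon> / 2 < \<bar>X n \<omega>\<bar>} \<union> {\<omega> \<in> space M. \<epsilon> / 2 < \<bar>Y n \<omega>\<bar>}"
          by auto
      qed
    qed measurable
    also have "\<dots> \<le> prob {\<omega> \<in> space M. \<epsilon> / 2 < \<bar>X n \<omega>\<bar>} + prob {\<omega> \<in> space M. \<epsilon> / 2 < \<bar>Y n \<omega>\<bar>}"
      by (rule measure_Un_le) measurable
    finally show ?thesis .
  qed
  note le2 = this
  have lim0: "(\<lambda>n. prob {\<omega> \<in> space M. \<epsilon> / 2 < \<bar>X n \<omega>\<bar>} + prob {\<omega> \<in> space M. \<epsilon> / 2 < \<bar>Y n \<omega>\<bar>}) \<longlonglongrightarrow> 0"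
    using X Y half_gt_zero[OF \<epsilon>] unfolding tends_to_zero_in_prob_def by (intro tendsto_add_zero) blast+
  show "(\<lambda>n. prob {\<omega> \<in> space M. \<epsilon> < \<bar>Z n \<omega>\<bar>}) \<longlonglongrightarrow> 0"
    by (rule tendsto_sandwich[OF _ _ tendsto_const lim0])
       (simp, rule eventually_sequentiallyI, rule le2)
qed

text \<open>Bounded convergence in quantitative form: where \<open>X n\<close> is small,
  \<open>Z n\<close> is at most a multiple of it, and the exceptional event has small probability
  while \<open>Z n\<close> stays bounded on it. Vector values admit differences of complex
  exponentials.\<close>

lemma tends_to_zero_in_prob_expectation:
  fixes X :: "nat \<Rightarrow> 'a \<Rightarrow> real" and Z :: "nat \<Rightarrow> 'a \<Rightarrow> 'b::{banach, second_countable_topology}"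
  assumes [measurable]: "\<And>n. n \<ge> 1 \<Longrightarrow> X n \<in> borel_measurable M" "\<And>n. n \<ge> 1 \<Longrightarrow> Z n \<in> borel_measurable M"
    and X: "tends_to_zero_in_prob M X"
    and B: "\<And>n \<omega>. n \<ge> 1 \<Longrightarrow> \<omega> \<in> space M \<Longrightarrow> norm (Z n \<omega>) \<le> B"
    and C: "\<And>n \<omega>. n \<ge> 1 \<Longrightarrow> \<omega> \<in> space M \<Longrightarrow> norm (Z n \<omega>) \<le> C * \<bar>X n \<omega>\<bar>" "C \<ge> 0"
  shows "(\<lambda>n. expectation (\<lambda>\<omega>. norm (Z n \<omega>))) \<longlonglongrightarrow> 0"
proof (rule LIMSEQ_I)
  fix e :: real assume e: "e > 0"
  \<comment> \<open>With \<open>C + 1\<close> in the denominator,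
    \<open>C * \<epsilon> < e / 2\<close> also for \<open>C = 0\<close>.\<close>
  define \<epsilon> where "\<epsilon> = e / (2 * (C + 1))"
  have \<epsilon>: "\<epsilon> > 0" "C * \<epsilon> < e / 2 + 0" using e C(2) by (auto simp: \<epsilon>_def field_simps)
  define B' where "B' = max B 1"
  have "eventually (\<lambda>n. prob {\<omega> \<in> space M. \<epsilon> < \<bar>X n \<omega>\<bar>} < e / (2 * B')) sequentially"
    using X \<epsilon>(1) e unfolding tends_to_zero_in_prob_def
    by (intro order_tendstoD(2)[of _ 0]) (auto simp: B'_def)
  with eventually_ge_at_top[of 1]
  have "eventually (\<lambda>n. expectation (\<lambda>\<omega>. norm (Z n \<omega>)) < e) sequentially"
  proof eventually_elim
    case (elim n)
    then have n: "n \<ge> 1" by simp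
    have [measurable]: "X n \<in> borel_measurable M" "Z n \<in> borel_measurable M" using n by auto
    have int: "integrable M (\<lambda>\<omega>. norm (Z n \<omega>))"
      by (rule integrable_const_bound[of _ B]) (use B[OF n] in auto)
    have "expectation (\<lambda>\<omega>. norm (Z n \<omega>)) \<le> expectation (\<lambda>\<omega>. C * \<epsilon> + B' * indicator {\<omega> \<in> space M. \<epsilon> < \<bar>X n \<omega>\<bar>} \<omega>)"
    proof (rule integral_mono[OF int])
      fix \<omega> assume \<omega>: "\<omega> \<in> space M"
      show "norm (Z n \<omega>) \<le> C * \<epsilon> + B' * indicator {\<omega> \<in> space M. \<epsilon> < \<bar>X n \<omega>\<bar>} \<omega>"
      proof (cases "\<epsilon> < \<bar>X n \<omega>\<bar>")
        case True
        then show ?thesis using B[OF n \<omega>] \<omega> C(2) \<epsilon>(1) by (auto simp: B'_def intro: add_increasing)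
      next
        case False
        then have "C * \<bar>X n \<omega>\<bar> \<le> C * \<epsilon>" using C(2) by (intro mult_left_mono) auto
        then show ?thesis using C(1)[OF n \<omega>] False by auto
      qed
    qed (auto intro!: Bochner_Integration.integrable_add integrable_mult_right simp: less_top[symmetric])
    also have "\<dots> = C * \<epsilon> + B' * prob {\<omega> \<in> space M. \<epsilon> < \<bar>X n \<omega>\<bar>}"
      by (subst Bochner_Integration.integral_add)
         (auto intro!: integrable_mult_right simp: less_top[symmetric] prob_space)
    also have "B' * prob {\<omega> \<in> space M. \<epsilon> < \<bar>X n \<omega>\<bar>} < B' * (e / (2 * B'))"
      using elim by (intro mult_strict_left_mono) (auto simp: B'_def)
    also have "B' * (e / (2 * B')) = e / 2" by (simp add: B'_def)
    finally show ?case using \<epsilon>(2) by linarith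
  qed
  then show "\<exists>no. \<forall>n\<ge>no. norm (expectation (\<lambda>\<omega>. norm (Z n \<omega>)) - 0) < e"
    by (auto simp: eventually_sequentially integral_nonneg)
qed

end

subsection \<open>Groups and conditional laws\<close>

text \<open>Pairs such as (1, 2) and (2, 4) have the same quotient, so a group may match several
  levels and one is selected for each group. Every level admits at most one group below its size,
  which bounds the number of groups that are remainders for their selected level by the number of
  levels.\<close>

lemma valid_grouping_level_choice:
  assumes G: "valid_grouping q lev x S G" and S: "S \<subseteq> {1..n}" and lev: "propensity_levels q lev"
  shows "\<exists>lv. (\<forall>g\<in>G. lv g \<in> lev \<and> g \<in> level_groups q x G (lv g) \<and> finite g \<and> card g \<le> snd (lv g)
      \<and> 1 \<le> fst (lv g) \<and> fst (lv g) \<le> snd (lv g) \<and> (\<forall>i\<in>g. q (x i) = real (fst (lv g)) / real (snd (lv g))))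
    \<and> card {g \<in> G. card g < snd (lv g)} \<le> card lev \<and> finite G"
proof -
  have "\<forall>g\<in>G. \<exists>l. l \<in> lev \<and> g \<in> level_groups q x G l"
    using G unfolding valid_grouping_def by blast
  from bchoice[OF this] obtain lv where lv: "\<And>g. g \<in> G \<Longrightarrow> lv g \<in> lev \<and> g \<in> level_groups q x G (lv g)"
    by auto
  have part: "partition_on S G" using G by (simp add: valid_grouping_def)
  have finS: "finite S" using S finite_subset by blast
  have finG: "finite G" by (rule finite_elements[OF finS part])
  have fing: "finite g" if "g \<in> G" for g
    using partition_onD1[OF part] finS that by (metis Union_upper finite_subset)
  have 1: "lv g \<in> lev \<and> g \<in> level_groups q x G (lv g) \<and> finite g \<and> card g \<le> snd (lv g)
      \<and> 1 \<le> fst (lv g) \<and> fst (lv g) \<le> snd (lv g) \<and> (\<forall>i\<in>g. q (x i) = real (fst (lv g)) / real (snd (lv g)))"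
    if g: "g \<in> G" for g
  proof -
    note l = lv[OF g]
    have "\<forall>(a, k)\<in>lev. 1 \<le> a \<and> a \<le> k" using lev unfolding propensity_levels_def by blast
    with l have "1 \<le> fst (lv g) \<and> fst (lv g) \<le> snd (lv g)" by (cases "lv g") auto
    moreover have "card g \<le> snd (lv g)" using G l unfolding valid_grouping_def by blast
    ultimately show ?thesis using l fing[OF g] by (auto simp: level_groups_def)
  qed
  have finl: "finite lev" using lev by (simp add: propensity_levels_def)
  have "{g \<in> G. card g < snd (lv g)} \<subseteq> (\<Union>l\<in>lev. {g \<in> level_groups q x G l. card g < snd l})"
    using lv by auto
  then have "card {g \<in> G. card g < snd (lv g)} \<le> card (\<Union>l\<in>lev. {g \<in> level_groups q x G l. card g < snd l})"
    by (rule card_mono[rotated]) (use finl finG in \<open>auto simp: level_groups_def\<close>)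
  also have "\<dots> \<le> (\<Sum>l\<in>lev. card {g \<in> level_groups q x G l. card g < snd l})"
    by (rule card_UN_le[OF finl])
  also have "\<dots> \<le> (\<Sum>l\<in>lev. 1)"
    by (rule sum_mono) (use G in \<open>simp add: valid_grouping_def\<close>)
  finally have 2: "card {g \<in> G. card g < snd (lv g)} \<le> card lev" by simp
  show ?thesis by (intro exI[of _ lv] conjI ballI 1 2 finG)
qed

lemma partition_on_sum:
  fixes h :: "'i \<Rightarrow> real"
  assumes "finite S" "partition_on S G"
  shows "(\<Sum>g\<in>G. \<Sum>i\<in>g. h i) = (\<Sum>i\<in>S. h i)"
proof -
  have "sum h (\<Union>G) = (sum \<circ> sum) h G"
    by (rule sum.Union_disjoint)
       (use assms in \<open>auto simp: partition_on_def disjoint_def intro: finite_subset[OF Union_upper]\<close>)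
  then show ?thesis using partition_onD1[OF assms(2)] by simp
qed

text \<open>The integrand is split into a bounded Lipschitz part \<open>f\<close> and a residual
  \<open>r\<close>. In full groups \<open>f\<close> is compared with its value at the group mean,
  which produces the matching loss; each of the at most \<open>card lev\<close> remainder groups
  costs at most \<open>k * B\<^sup>2\<close>; the residual is summed over all units. The prefactor
  combines \<open>card g \<le> k\<close> with the 2 from squaring a sum.\<close>

lemma grouping_variance_bound:
  fixes f r :: "'a::euclidean_space \<Rightarrow> real" and x :: "nat \<Rightarrow> 'a"
  assumes G: "valid_grouping q lev x S G" and S: "S \<subseteq> {1..n}" and n: "n \<ge> 1"
    and lev: "propensity_levels q lev" and k: "\<And>l. l \<in> lev \<Longrightarrow> snd l \<le> k"
    and f: "L-lipschitz_on UNIV f" "\<And>x. \<bar>f x\<bar> \<le> B"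
  shows "\<exists>\<mu>. (\<forall>g\<in>G. \<exists>l\<in>lev. g \<in> level_groups q x G l \<and> 1 \<le> fst l \<and> fst l \<le> snd l
              \<and> (\<forall>i\<in>g. q (x i) = real (fst l) / real (snd l)) \<and> (card g = snd l \<or> \<mu> g = 0))
       \<and> (\<Sum>g\<in>G. real (card g) * (\<Sum>i\<in>g. (f (x i) + r (x i) - \<mu> g)\<^sup>2))
         \<le> 2 * real k * (L\<^sup>2 * (real n * match_loss n x G) + real (card lev) * (real k * B\<^sup>2) + (\<Sum>i=1..n. (r (x i))\<^sup>2))"
proof -
  obtain lv where
    "\<forall>g\<in>G. lv g \<in> lev \<and> g \<in> level_groups q x G (lv g) \<and> finite g \<and> card g \<le> snd (lv g)
      \<and> 1 \<le> fst (lv g) \<and> fst (lv g) \<le> snd (lv g) \<and> (\<forall>i\<in>g. q (x i) = real (fst (lv g)) / real (snd (lv g)))"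
    and rem: "card {g \<in> G. card g < snd (lv g)} \<le> card lev" and finG: "finite G"
    using valid_grouping_level_choice[OF G S lev] by (elim exE conjE)
  note lv = bspec[OF this(1)]
  have L: "L \<ge> 0" using f(1) by (rule lipschitz_on_nonneg)
  have finS: "finite S" using S finite_subset by blast
  have part: "partition_on S G" using G by (simp add: valid_grouping_def)
  \<comment> \<open>Recentring is legitimate in full groups only, so remainder groups receive
    0.\<close>
  define \<mu> where "\<mu> g = (if card g = snd (lv g) then f (group_mean x g) else 0)" for g
  define e where "e g = (\<Sum>i\<in>g. (norm (x i - group_mean x g))\<^sup>2)" for g
  have inner: "(\<Sum>i\<in>g. (f (x i) - \<mu> g)\<^sup>2) \<le> L\<^sup>2 * e g + (if card g < snd (lv g) then real k * B\<^sup>2 else 0)"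
    if g: "g \<in> G" for g
  proof (cases "card g = snd (lv g)")
    case True
    have "(f (x i) - \<mu> g)\<^sup>2 \<le> L\<^sup>2 * (norm (x i - group_mean x g))\<^sup>2" for i
    proof -
      have "\<bar>f (x i) - f (group_mean x g)\<bar> \<le> L * norm (x i - group_mean x g)"
        using lipschitz_onD[OF f(1), of "x i" "group_mean x g"] by (simp add: dist_norm)
      then have "\<bar>f (x i) - f (group_mean x g)\<bar>\<^sup>2 \<le> (L * norm (x i - group_mean x g))\<^sup>2"
        by (rule power_mono) simp
      then show ?thesis using True by (simp add: \<mu>_def power_mult_distrib)
    qed
    then have "(\<Sum>i\<in>g. (f (x i) - \<mu> g)\<^sup>2) \<le> L\<^sup>2 * e g"
      unfolding e_def sum_distrib_left by (rule sum_mono)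
    then show ?thesis using True by simp
  next
    case False
    have "(f (x i) - \<mu> g)\<^sup>2 \<le> B\<^sup>2" for i
      using False power_mono[OF f(2)[of "x i"], of 2] by (simp add: \<mu>_def)
    then have "(\<Sum>i\<in>g. (f (x i) - \<mu> g)\<^sup>2) \<le> (\<Sum>i\<in>g. B\<^sup>2)" by (rule sum_mono)
    also have "\<dots> \<le> real k * B\<^sup>2"
      using lv[OF g] k[of "lv g"] by (simp add: mult_right_mono)
    finally have "(\<Sum>i\<in>g. (f (x i) - \<mu> g)\<^sup>2) \<le> real k * B\<^sup>2" .
    moreover have "0 \<le> L\<^sup>2 * e g" by (simp add: e_def sum_nonneg)
    ultimately show ?thesis using False lv[OF g] by auto
  qed
  have group: "real (card g) * (\<Sum>i\<in>g. (f (x i) + r (x i) - \<mu> g)\<^sup>2)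
      \<le> 2 * real k * (L\<^sup>2 * e g + (if card g < snd (lv g) then real k * B\<^sup>2 else 0) + (\<Sum>i\<in>g. (r (x i))\<^sup>2))"
    if g: "g \<in> G" for g
  proof -
    have "(f (x i) + r (x i) - \<mu> g)\<^sup>2 \<le> 2 * (f (x i) - \<mu> g)\<^sup>2 + 2 * (r (x i))\<^sup>2" for i
      using sum_squares_bound[of "f (x i) - \<mu> g" "r (x i)"] power2_sum[of "f (x i) - \<mu> g" "r (x i)"]
      by (simp add: algebra_simps)
    then have "(\<Sum>i\<in>g. (f (x i) + r (x i) - \<mu> g)\<^sup>2) \<le> (\<Sum>i\<in>g. 2 * (f (x i) - \<mu> g)\<^sup>2 + 2 * (r (x i))\<^sup>2)"
      by (rule sum_mono)
    also have "\<dots> = 2 * (\<Sum>i\<in>g. (f (x i) - \<mu> g)\<^sup>2) + 2 * (\<Sum>i\<in>g. (r (x i))\<^sup>2)"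
      by (simp add: sum.distrib sum_distrib_left)
    also have "\<dots> \<le> 2 * (L\<^sup>2 * e g + (if card g < snd (lv g) then real k * B\<^sup>2 else 0) + (\<Sum>i\<in>g. (r (x i))\<^sup>2))"
      using inner[OF g] by simp
    finally have le: "(\<Sum>i\<in>g. (f (x i) + r (x i) - \<mu> g)\<^sup>2)
       \<le> 2 * (L\<^sup>2 * e g + (if card g < snd (lv g) then real k * B\<^sup>2 else 0) + (\<Sum>i\<in>g. (r (x i))\<^sup>2))" .
    have "real (card g) \<le> real k" using lv[OF g] k[of "lv g"] by simp
    from mult_mono[OF this le _ sum_nonneg] show ?thesis by (simp add: mult.assoc mult.left_commute)
  qed
  have "(\<Sum>g\<in>G. real (card g) * (\<Sum>i\<in>g. (f (x i) + r (x i) - \<mu> g)\<^sup>2))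
     \<le> (\<Sum>g\<in>G. 2 * real k * (L\<^sup>2 * e g + (if card g < snd (lv g) then real k * B\<^sup>2 else 0) + (\<Sum>i\<in>g. (r (x i))\<^sup>2)))"
    using group by (rule sum_mono)
  also have "\<dots> = 2 * real k * (L\<^sup>2 * (\<Sum>g\<in>G. e g) + real (card {g \<in> G. card g < snd (lv g)}) * (real k * B\<^sup>2)
      + (\<Sum>g\<in>G. \<Sum>i\<in>g. (r (x i))\<^sup>2))"
    using finG by (simp add: sum_distrib_left[symmetric] sum.distrib sum.If_cases Int_def)
  also have "\<dots> \<le> 2 * real k * (L\<^sup>2 * (real n * match_loss n x G) + real (card lev) * (real k * B\<^sup>2) + (\<Sum>i=1..n. (r (x i))\<^sup>2))"
  proof (intro mult_left_mono add_mono)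
    show "(\<Sum>g\<in>G. e g) \<le> real n * match_loss n x G"
      using n by (simp add: match_loss_def e_def)
    show "real (card {g \<in> G. card g < snd (lv g)}) * (real k * B\<^sup>2) \<le> real (card lev) * (real k * B\<^sup>2)"
      using rem by (intro mult_right_mono) auto
    show "(\<Sum>g\<in>G. \<Sum>i\<in>g. (r (x i))\<^sup>2) \<le> (\<Sum>i=1..n. (r (x i))\<^sup>2)"
      unfolding partition_on_sum[OF finS part] using S by (intro sum_mono2) auto
  qed auto
  finally have "(\<Sum>g\<in>G. real (card g) * (\<Sum>i\<in>g. (f (x i) + r (x i) - \<mu> g)\<^sup>2)) \<le> \<dots>" .
  moreover have "\<forall>g\<in>G. \<exists>l\<in>lev. g \<in> level_groups q x G l \<and> 1 \<le> fst l \<and> fst l \<le> snd l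
              \<and> (\<forall>i\<in>g. q (x i) = real (fst l) / real (snd l)) \<and> (card g = snd l \<or> \<mu> g = 0)"
    using lv by (intro ballI) (auto simp: \<mu>_def intro!: bexI)
  ultimately show ?thesis by blast
qed

section \<open>Integration against conditional laws with finite support\<close>

lemma set_pmf_expectation_finite:
  fixes f :: "'b \<Rightarrow> real"
  assumes "finite E" "set_pmf K \<subseteq> E"
  shows "measure_pmf.expectation K f = (\<Sum>x\<in>E. pmf K x * f x)"
  using integral_measure_pmf[OF assms(1), of K f] assms(2) by auto

context prob_space
begin

lemma subalgebra_sigma_finite:
  "subalgebra M F \<Longrightarrow> sigma_finite_subalgebra M F"
  by (rule finite_measure_subalgebra_is_sigma_finite)
     (simp add: finite_measure_subalgebra_def finite_measure_subalgebra_axioms_def finite_measure_axioms)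

text \<open>The conditional probability of an event that always occurs is 1 almost surely, which
  confines the kernel to \<open>E\<close> off a null set.\<close>

lemma cond_law_support:
  assumes F: "subalgebra M F" and K: "cond_law M F X K" and E: "\<And>\<omega>. \<omega> \<in> space M \<Longrightarrow> X \<omega> \<in> E"
  shows "AE \<omega> in M. set_pmf (K \<omega>) \<subseteq> E"
proof -
  interpret sigma_finite_subalgebra M F using F by (rule subalgebra_sigma_finite)
  have "AE \<omega> in M. real_cond_exp M F (indicator {\<omega> \<in> space M. X \<omega> \<in> E}) \<omega> = measure_pmf.prob (K \<omega>) E"
    using K unfolding cond_law_def by blast
  moreover have "{\<omega> \<in> space M. X \<omega> \<in> E} = space M" using E by auto
  moreover have "AE \<omega> in M. real_cond_exp M F (indicator (space M)) \<omega> = indicator (space M) \<omega>"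
  proof (rule real_cond_exp_F_meas)
    have "space M = space F" using F by (simp add: subalgebra_def)
    then show "indicator (space M) \<in> borel_measurable F" by simp
  qed (simp add: less_top[symmetric])
  ultimately have "AE \<omega> in M. measure_pmf.prob (K \<omega>) E = 1" by auto
  then show ?thesis
  proof (rule AE_mp, intro AE_I2 impI)
    fix \<omega> assume "measure_pmf.prob (K \<omega>) E = 1"
    then have "AE t in measure_pmf (K \<omega>). t \<in> E"
      using measure_pmf.prob_eq_1[of "E" "K \<omega>"] by simp
    then show "set_pmf (K \<omega>) \<subseteq> E" by (auto simp: AE_measure_pmf_iff)
  qed
qed

text \<open>Disintegration along a finite-valued \<open>X\<close>: the integrand is the sum of
  \<open>\<phi> x\<close> times the indicator of \<open>X = x\<close>, and the
  \<open>F\<close>-measurable factor is pulled out of the conditional expectation of the indicator.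
  The random function \<open>\<phi>\<close> may be unbounded, so that outcomes can be part of
  it.\<close>

lemma cond_law_integral:
  fixes \<phi> :: "'b \<Rightarrow> 'a \<Rightarrow> real"
  assumes F: "subalgebra M F" and K: "cond_law M F X K" and finE: "finite E"
    and E: "\<And>\<omega>. \<omega> \<in> space M \<Longrightarrow> X \<omega> \<in> E" and X: "\<And>x. x \<in> E \<Longrightarrow> {\<omega> \<in> space M. X \<omega> = x} \<in> events"
    and \<phi>: "\<And>x. x \<in> E \<Longrightarrow> \<phi> x \<in> borel_measurable F" "\<And>x. x \<in> E \<Longrightarrow> integrable M (\<phi> x)"
  shows "integrable M (\<lambda>\<omega>. \<phi> (X \<omega>) \<omega>)"
    and "integrable M (\<lambda>\<omega>. \<Sum>x\<in>E. pmf (K \<omega>) x * \<phi> x \<omega>)"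
    and "expectation (\<lambda>\<omega>. \<phi> (X \<omega>) \<omega>) = expectation (\<lambda>\<omega>. \<Sum>x\<in>E. pmf (K \<omega>) x * \<phi> x \<omega>)"
proof -
  interpret sigma_finite_subalgebra M F using F by (rule subalgebra_sigma_finite)
  define I where "I x = (indicator {\<omega> \<in> space M. X \<omega> = x} :: 'a \<Rightarrow> real)" for x
  have Im[measurable]: "I x \<in> borel_measurable M" if "x \<in> E" for x
    using X[OF that] by (simp add: I_def)
  have \<phi>M: "\<phi> x \<in> borel_measurable M" if "x \<in> E" for x
    using \<phi>(2)[OF that] by (rule borel_measurable_integrable)
  have int: "integrable M (\<lambda>\<omega>. \<phi> x \<omega> * I x \<omega>)" if "x \<in> E" for x
    by (rule Bochner_Integration.integrable_bound[OF \<phi>(2)[OF that]])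
       (use borel_measurable_times[OF \<phi>M[OF that] Im[OF that]] in \<open>auto simp: I_def indicator_def\<close>)
  have Kx: "AE \<omega> in M. real_cond_exp M F (I x) \<omega> = pmf (K \<omega>) x" for x
  proof -
    have "AE \<omega> in M. real_cond_exp M F (indicator {\<omega> \<in> space M. X \<omega> \<in> {x}}) \<omega> = measure_pmf.prob (K \<omega>) {x}"
      using K unfolding cond_law_def by blast
    then show ?thesis by (simp add: I_def pmf.rep_eq)
  qed
  have pm[measurable]: "(\<lambda>\<omega>. pmf (K \<omega>) x) \<in> borel_measurable M" for x
  proof -
    have "(\<lambda>\<omega>. measure_pmf.prob (K \<omega>) {x}) \<in> borel_measurable F" using K unfolding cond_law_def by blast
    then show ?thesis using measurable_from_subalg[OF F] by (simp add: pmf.rep_eq)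
  qed
  have step: "integrable M (\<lambda>\<omega>. pmf (K \<omega>) x * \<phi> x \<omega>)"
    "expectation (\<lambda>\<omega>. \<phi> x \<omega> * I x \<omega>) = expectation (\<lambda>\<omega>. pmf (K \<omega>) x * \<phi> x \<omega>)" if x: "x \<in> E" for x
  proof -
    note ce = real_cond_exp_intg[OF int[OF x] \<phi>(1)[OF x] Im[OF x]]
    have ae: "AE \<omega> in M. \<phi> x \<omega> * real_cond_exp M F (I x) \<omega> = pmf (K \<omega>) x * \<phi> x \<omega>"
      using Kx[of x] by auto
    note [measurable] = \<phi>M[OF x]
    show "integrable M (\<lambda>\<omega>. pmf (K \<omega>) x * \<phi> x \<omega>)"
      by (rule integrable_cong_AE_imp[OF ce(1) _ AE_mp[OF ae]]) auto
    have "expectation (\<lambda>\<omega>. \<phi> x \<omega> * real_cond_exp M F (I x) \<omega>) = expectation (\<lambda>\<omega>. pmf (K \<omega>) x * \<phi> x \<omega>)"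
      by (rule integral_cong_AE) (use ae in auto)
    with ce(2) show "expectation (\<lambda>\<omega>. \<phi> x \<omega> * I x \<omega>) = expectation (\<lambda>\<omega>. pmf (K \<omega>) x * \<phi> x \<omega>)" by simp
  qed
  have eq: "\<phi> (X \<omega>) \<omega> = (\<Sum>x\<in>E. \<phi> x \<omega> * I x \<omega>)" if "\<omega> \<in> space M" for \<omega>
  proof -
    have "(\<Sum>x\<in>E. \<phi> x \<omega> * I x \<omega>) = (\<Sum>x\<in>E. if x = X \<omega> then \<phi> x \<omega> else 0)"
      by (rule sum.cong) (use that in \<open>auto simp: I_def\<close>)
    then show ?thesis using finE E[OF that] by simp
  qed
  show "integrable M (\<lambda>\<omega>. \<phi> (X \<omega>) \<omega>)"
    by (subst Bochner_Integration.integrable_cong[OF refl eq]) (auto intro: int)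
  show "integrable M (\<lambda>\<omega>. \<Sum>x\<in>E. pmf (K \<omega>) x * \<phi> x \<omega>)" by (auto intro: step)
  have "expectation (\<lambda>\<omega>. \<phi> (X \<omega>) \<omega>) = expectation (\<lambda>\<omega>. \<Sum>x\<in>E. \<phi> x \<omega> * I x \<omega>)"
    by (rule Bochner_Integration.integral_cong[OF refl eq])
  also have "\<dots> = (\<Sum>x\<in>E. expectation (\<lambda>\<omega>. pmf (K \<omega>) x * \<phi> x \<omega>))"
    by (subst Bochner_Integration.integral_sum) (auto intro: int sum.cong step)
  also have "\<dots> = expectation (\<lambda>\<omega>. \<Sum>x\<in>E. pmf (K \<omega>) x * \<phi> x \<omega>)"
    by (subst Bochner_Integration.integral_sum) (auto intro: step)
  finally show "expectation (\<lambda>\<omega>. \<phi> (X \<omega>) \<omega>) = expectation (\<lambda>\<omega>. \<Sum>x\<in>E. pmf (K \<omega>) x * \<phi> x \<omega>)" .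
qed

end

section \<open>Measurability of expressions in a random partition\<close>

lemma propensity_bounds:
  assumes "propensity_levels q lev"
  shows "0 < q x" "q x \<le> 1" "finite (range q)" "q \<in> borel_measurable borel"
proof -
  have ex: "\<exists>l\<in>lev. 1 \<le> fst l \<and> fst l \<le> snd l \<and> q x = real (fst l) / real (snd l)" for x
  proof -
    from assms obtain l where l: "l \<in> lev" "case l of (a, k) \<Rightarrow> q x = real a / real k"
      unfolding propensity_levels_def by blast
    from assms l(1) have "case l of (a, k) \<Rightarrow> 1 \<le> a \<and> a \<le> k"
      unfolding propensity_levels_def by blast
    with l show ?thesis by (auto simp: case_prod_beta)
  qed
  from ex[of x] obtain l where l: "1 \<le> fst l" "fst l \<le> snd l" "q x = real (fst l) / real (snd l)" by blast
  show "0 < q x" using l by simp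
  show "q x \<le> 1" using l by (simp add: divide_le_eq_1)
  have "range q \<subseteq> (\<lambda>l. real (fst l) / real (snd l)) ` lev" using ex by auto
  moreover have "finite lev" using assms by (simp add: propensity_levels_def)
  ultimately show "finite (range q)" by (auto intro: finite_subset)
  show "q \<in> borel_measurable borel" using assms by (simp add: propensity_levels_def)
qed

text \<open>Only finitely many values of \<open>q\<close> matter and finite sets of reals are
  closed, so \<open>f\<close> may be arbitrary. In particular it may contain a choice of a level by
  the Hilbert operator.\<close>

lemma measurable_finite_range_comp:
  fixes q :: "'a::topological_space \<Rightarrow> real"
  assumes "q \<in> borel_measurable borel" "finite (range q)"
  shows "(\<lambda>x. f (q x)) \<in> borel \<rightarrow>\<^sub>M N \<longleftrightarrow> (\<forall>x. f (q x) \<in> space N)"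
proof
  assume R: "\<forall>x. f (q x) \<in> space N"
  show "(\<lambda>x. f (q x)) \<in> borel \<rightarrow>\<^sub>M N"
  proof (rule measurableI)
    fix A assume "A \<in> sets N"
    have "(\<lambda>x. f (q x)) -` A \<inter> space borel = q -` {v \<in> range q. f v \<in> A} \<inter> space borel" by auto
    moreover have "{v \<in> range q. f v \<in> A} \<in> sets borel"
      by (rule borel_closed) (rule finite_imp_closed, use assms(2) in simp)
    then have "q -` {v \<in> range q. f v \<in> A} \<inter> space borel \<in> sets borel"
      by (rule measurable_sets[OF assms(1)])
    ultimately show "(\<lambda>x. f (q x)) -` A \<inter> space borel \<in> sets borel" by (simp only:)
  qed (use R in auto)
qed (auto dest: measurable_space)

text \<open>A partition of finitely many units has finitely many possible values. Measurability is
  therefore checked with the partition held fixed.\<close>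

lemma measurable_finite_choice:
  assumes G: "G \<in> F \<rightarrow>\<^sub>M count_space UNIV" and fin: "finite \<G>" and sp: "\<And>\<omega>. \<omega> \<in> space F \<Longrightarrow> G \<omega> \<in> \<G>"
    and h: "\<And>H. H \<in> \<G> \<Longrightarrow> h H \<in> F \<rightarrow>\<^sub>M N"
  shows "(\<lambda>\<omega>. h (G \<omega>) \<omega>) \<in> F \<rightarrow>\<^sub>M N"
proof (rule measurable_compose_countable'[OF h])
  show "G \<in> F \<rightarrow>\<^sub>M count_space \<G>" using G sp by (auto simp: measurable_def)
qed (use fin in \<open>auto intro: countable_finite\<close>)

lemma match_loss_measurable:
  fixes \<psi> :: "nat \<Rightarrow> 'w \<Rightarrow> 'a::euclidean_space"
  assumes G: "G \<in> F \<rightarrow>\<^sub>M count_space UNIV" and sp: "\<And>\<omega>. \<omega> \<in> space F \<Longrightarrow> G \<omega> \<subseteq> Pow {1..n}"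
    and \<psi>: "\<And>i. i \<in> {1..n} \<Longrightarrow> \<psi> i \<in> borel_measurable F"
  shows "(\<lambda>\<omega>. match_loss n (\<lambda>i. \<psi> i \<omega>) (G \<omega>)) \<in> borel_measurable F"
proof (rule measurable_finite_choice[OF G])
  show "finite (Pow (Pow {1..n}))" by simp
  show "(\<lambda>\<omega>. match_loss n (\<lambda>i. \<psi> i \<omega>) H) \<in> borel_measurable F" if "H \<in> Pow (Pow {1..n})" for H
  proof -
    have "\<psi> i \<in> borel_measurable F" if "g \<in> H" "i \<in> g" for g i
      using that \<open>H \<in> Pow (Pow {1..n})\<close> by (intro \<psi>) blast
    then show ?thesis unfolding match_loss_def group_mean_def
      by (intro borel_measurable_times borel_measurable_const borel_measurable_sum borel_measurable_power
        borel_measurable_norm borel_measurable_diff borel_measurable_scaleR) auto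
  qed
qed (use sp in auto)

text \<open>If several levels match a group, then complete randomization imposes the laws of all of them on
  it, so that these agree and any matching level may be selected.\<close>

definition assign_prob ::
  "('a \<Rightarrow> real) \<Rightarrow> (nat \<times> nat) set \<Rightarrow> nat set set \<Rightarrow> (nat \<Rightarrow> 'a) \<Rightarrow> (nat \<Rightarrow> bool) \<Rightarrow> real" where
  "assign_prob q lev G x t = (\<Prod>g\<in>G. pmf (group_law
     (SOME l. l \<in> lev \<and> q (x (Min g)) = real (fst l) / real (snd l)) g) (restrict t g))"

lemma assign_prob_bounds: "0 \<le> assign_prob q lev G x t" "assign_prob q lev G x t \<le> 1"
  unfolding assign_prob_def by (auto intro: prod_nonneg prod_le_1 pmf_le_1)

text \<open>The map that yields the partition is evaluated later at arguments for which its value is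
  no partition. The guard restricts attention to finite collections of nonempty groups, for which
  \<open>Min g\<close> is a unit and only its covariate enters.\<close>

lemma assign_prob_measurable:
  assumes lev: "propensity_levels q lev" and G: "G \<in> F \<rightarrow>\<^sub>M count_space UNIV"
    and \<psi>: "\<And>i. i \<in> {1..n} \<Longrightarrow> \<psi> i \<in> borel_measurable F"
  shows "(\<lambda>\<omega>. if G \<omega> \<subseteq> Pow {1..n} - {{}} then assign_prob q lev (G \<omega>) (\<lambda>i. \<psi> i \<omega>) t else 0) \<in> borel_measurable F"
proof -
  \<comment> \<open>All values rejected by the guard are merged into \<open>None\<close>, so that
    \<open>H\<close> has finite range even though \<open>G\<close> may not.\<close>
  define H where "H \<omega> = (if G \<omega> \<subseteq> Pow {1..n} - {{}} then Some (G \<omega>) else None)" for \<omega>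
  have Hm: "H \<in> F \<rightarrow>\<^sub>M count_space UNIV"
    unfolding H_def by (rule measurable_compose[OF G]) simp
  have "(\<lambda>\<omega>. case H \<omega> of None \<Rightarrow> 0 | Some G \<Rightarrow> assign_prob q lev G (\<lambda>i. \<psi> i \<omega>) t) \<in> borel_measurable F"
  proof (rule measurable_finite_choice[OF Hm, where \<G>="insert None (Some ` Pow (Pow {1..n} - {{}}))"])
    show "finite (insert None (Some ` Pow (Pow {1..n} - {{}})))" by simp
    fix h assume h: "h \<in> insert None (Some ` Pow (Pow {1..n} - {{}}))"
    show "(\<lambda>\<omega>. case h of None \<Rightarrow> 0 | Some G \<Rightarrow> assign_prob q lev G (\<lambda>i. \<psi> i \<omega>) t) \<in> borel_measurable F"
    proof (cases h)
      case (Some G')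
      have "(\<lambda>\<omega>. pmf (group_law (SOME l. l \<in> lev \<and> q (\<psi> (Min g) \<omega>) = real (fst l) / real (snd l)) g) (restrict t g))
          \<in> borel_measurable F" if g: "g \<in> G'" for g
      proof -
        have g': "finite g" "g \<noteq> {}" "g \<subseteq> {1..n}" using h Some g by (auto intro: finite_subset)
        then have "Min g \<in> {1..n}" using Min_in by blast
        from measurable_compose[OF \<psi>[OF this]
          measurable_finite_range_comp[OF propensity_bounds(4,3)[OF lev], THEN iffD2, of
            "\<lambda>v. pmf (group_law (SOME l. l \<in> lev \<and> v = real (fst l) / real (snd l)) g) (restrict t g)" borel]]
        show ?thesis by simp
      qed
      then show ?thesis unfolding Some by (auto simp: assign_prob_def intro: borel_measurable_prod)
    qed simp
  qed (auto simp: H_def)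
  also have "(\<lambda>\<omega>. case H \<omega> of None \<Rightarrow> 0 | Some G \<Rightarrow> assign_prob q lev G (\<lambda>i. \<psi> i \<omega>) t)
    = (\<lambda>\<omega>. if G \<omega> \<subseteq> Pow {1..n} - {{}} then assign_prob q lev (G \<omega>) (\<lambda>i. \<psi> i \<omega>) t else 0)"
    by (auto simp: H_def)
  finally show ?thesis .
qed

section \<open>One randomization step at a fixed sample size\<close>

text \<open>Here \<open>F\<close> is the information conditioned on and \<open>S\<close> the set of
  units to be grouped. Sampling, with all units, and assignment, with the sampled ones, are the two
  intended instances.\<close>

locale randomized_groups = prob_space M for M :: "'w measure" +
  fixes F :: "'w measure" and n :: nat and q :: "'a::euclidean_space \<Rightarrow> real" and lev :: "(nat \<times> nat) set"
    and \<psi> :: "nat \<Rightarrow> 'w \<Rightarrow> 'a" and S :: "'w \<Rightarrow> nat set" and G :: "'w \<Rightarrow> nat set set"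
    and X :: "nat \<Rightarrow> 'w \<Rightarrow> bool"
  assumes F: "subalgebra M F" and n: "n \<ge> 1" and lev: "propensity_levels q lev"
    and valid: "\<And>\<omega>. \<omega> \<in> space M \<Longrightarrow> valid_grouping q lev (\<lambda>i. \<psi> i \<omega>) (S \<omega>) (G \<omega>)"
    and S: "\<And>\<omega>. \<omega> \<in> space M \<Longrightarrow> S \<omega> \<subseteq> {1..n}"
    and G_meas: "G \<in> F \<rightarrow>\<^sub>M count_space UNIV"
    and \<psi>_meas: "\<And>i. i \<in> {1..n} \<Longrightarrow> \<psi> i \<in> borel_measurable F"
    and X_meas: "\<And>i. i \<in> {1..n} \<Longrightarrow> X i \<in> M \<rightarrow>\<^sub>M count_space UNIV"
    and randomized: "completely_randomized M F n q lev \<psi> G X"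
begin

lemma space_F: "space F = space M"
  using F by (simp add: subalgebra_def)

lemma partition: "\<omega> \<in> space M \<Longrightarrow> partition_on (S \<omega>) (G \<omega>)"
  using valid by (simp add: valid_grouping_def)

lemma S_eq: "\<omega> \<in> space M \<Longrightarrow> S \<omega> = \<Union>(G \<omega>)"
  using partition_onD1[OF partition] .

lemma finite_S: "\<omega> \<in> space M \<Longrightarrow> finite (S \<omega>)"
  using S finite_subset by blast

lemma G_subset: "\<omega> \<in> space M \<Longrightarrow> G \<omega> \<subseteq> Pow {1..n} - {{}}"
  using S S_eq partition_onD3[OF partition] by blast

lemma S_meas: "(\<lambda>\<omega>. of_bool (i \<in> S \<omega>) :: real) \<in> borel_measurable F"
proof -
  have "(\<lambda>\<omega>. of_bool (i \<in> \<Union>(G \<omega>)) :: real) \<in> borel_measurable F"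
    by (rule measurable_compose[OF G_meas]) simp
  then show ?thesis
    by (rule measurable_cong[THEN iffD1, rotated]) (simp add: S_eq space_F)
qed

lemma sum_S: "\<omega> \<in> space M \<Longrightarrow> (\<Sum>i\<in>S \<omega>. h i) = (\<Sum>i=1..n. of_bool (i \<in> S \<omega>) * h i)" for h :: "nat \<Rightarrow> real"
  using S[of \<omega>] by (intro sum.mono_neutral_cong_left) auto

definition X_vec :: "'w \<Rightarrow> nat \<Rightarrow> bool" where
  "X_vec \<omega> = (\<lambda>i\<in>{1..n}. X i \<omega>)"

definition vecs :: "(nat \<Rightarrow> bool) set" where
  "vecs = {1..n} \<rightarrow>\<^sub>E UNIV"

lemma finite_vecs: "finite vecs"
  by (auto simp: vecs_def intro!: finite_PiE)

lemma X_vec_in: "X_vec \<omega> \<in> vecs"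
  by (auto simp: X_vec_def vecs_def)

lemma X_vec_event: "x \<in> vecs \<Longrightarrow> {\<omega> \<in> space M. X_vec \<omega> = x} \<in> events"
proof -
  assume x: "x \<in> vecs"
  have "X_vec \<omega> = x \<longleftrightarrow> (\<forall>i\<in>{1..n}. X i \<omega> = x i)" for \<omega>
  proof
    assume "\<forall>i\<in>{1..n}. X i \<omega> = x i"
    then show "X_vec \<omega> = x"
      using x X_vec_in[of \<omega>] unfolding vecs_def by (intro PiE_ext) (auto simp: X_vec_def)
  qed (auto simp: X_vec_def)
  then have "{\<omega> \<in> space M. X_vec \<omega> = x} = {\<omega> \<in> space M. \<forall>i\<in>{1..n}. X i \<omega> = x i}" by simp
  also have "\<dots> \<in> events"
  proof (rule sets.sets_Collect_finite_All')
    fix i assume "i \<in> {1..n}"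
    from measurable_sets[OF X_meas[OF this], of "{x i}"]
    show "{\<omega> \<in> space M. X i \<omega> = x i} \<in> events" by (simp add: vimage_def Int_def conj_commute)
  qed (use n in auto)
  finally show ?thesis .
qed

text \<open>The almost sure properties of the kernel, gathered at a single \<open>\<omega>\<close>.
  Off a null set the arguments then concern one fixed probability mass function.\<close>

definition is_group_design :: "'w \<Rightarrow> (nat \<Rightarrow> bool) pmf \<Rightarrow> bool" where
  "is_group_design \<omega> K \<longleftrightarrow> set_pmf K \<subseteq> vecs \<and>
     prob_space.indep_vars (measure_pmf K) (\<lambda>_. count_space UNIV) (\<lambda>g t. restrict t g) (G \<omega>) \<and>
     (\<forall>l\<in>lev. \<forall>g\<in>level_groups q (\<lambda>i. \<psi> i \<omega>) (G \<omega>) l. map_pmf (\<lambda>t. restrict t g) K = group_law l g)"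

lemma group_design_obtain:
  obtains K where "cond_law M F X_vec K" "AE \<omega> in M. is_group_design \<omega> (K \<omega>)"
proof -
  from randomized obtain K where K: "cond_law M F X_vec K" and
    ae: "AE \<omega> in M. prob_space.indep_vars (measure_pmf (K \<omega>)) (\<lambda>_. count_space UNIV) (\<lambda>g t. restrict t g) (G \<omega>)
      \<and> (\<forall>l\<in>lev. \<forall>g\<in>level_groups q (\<lambda>i. \<psi> i \<omega>) (G \<omega>) l. map_pmf (\<lambda>t. restrict t g) (K \<omega>) = group_law l g)"
    unfolding completely_randomized_def X_vec_def[abs_def] by blast
  from AE_conjI[OF cond_law_support[OF F K X_vec_in] ae] have "AE \<omega> in M. is_group_design \<omega> (K \<omega>)"
    unfolding is_group_design_def .
  with K show thesis by (rule that)
qed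

text \<open>Independence across groups gives a product, and each factor is a group law evaluated at
  the prescribed subvector. The result depends on the partition and the covariates only, not on
  outcomes.\<close>

lemma group_design_agree:
  assumes \<omega>: "\<omega> \<in> space M" and K: "is_group_design \<omega> K"
  shows "measure_pmf.prob K {x. \<forall>i\<in>\<Union>(G \<omega>). x i = t i} = assign_prob q lev (G \<omega>) (\<lambda>i. \<psi> i \<omega>) t"
proof -
  obtain lv where
    "\<forall>g\<in>G \<omega>. lv g \<in> lev \<and> g \<in> level_groups q (\<lambda>i. \<psi> i \<omega>) (G \<omega>) (lv g) \<and> finite g \<and> card g \<le> snd (lv g)
      \<and> 1 \<le> fst (lv g) \<and> fst (lv g) \<le> snd (lv g) \<and> (\<forall>i\<in>g. q (\<psi> i \<omega>) = real (fst (lv g)) / real (snd (lv g)))"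
    and fin: "finite (G \<omega>)"
    using valid_grouping_level_choice[OF valid[OF \<omega>] S[OF \<omega>] lev] by (elim exE conjE)
  note lv = bspec[OF this(1)]
  have law: "map_pmf (\<lambda>t. restrict t g) K
      = group_law (SOME l. l \<in> lev \<and> q (\<psi> (Min g) \<omega>) = real (fst l) / real (snd l)) g" if g: "g \<in> G \<omega>" for g
  proof -
    have "g \<noteq> {}" "finite g" using G_subset[OF \<omega>] lv[OF g] g by auto
    then have "Min g \<in> g" by simp
    \<comment> \<open>The level chosen at the smallest unit may differ from \<open>lv g\<close>, but
      it has the same quotient. The whole group therefore matches it, and the randomization imposes
      its law as well.\<close>
    define l where "l = (SOME l. l \<in> lev \<and> q (\<psi> (Min g) \<omega>) = real (fst l) / real (snd l))"
    have "lv g \<in> lev \<and> q (\<psi> (Min g) \<omega>) = real (fst (lv g)) / real (snd (lv g))"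
      using lv[OF g] \<open>Min g \<in> g\<close> by blast
    then have l: "l \<in> lev \<and> q (\<psi> (Min g) \<omega>) = real (fst l) / real (snd l)"
      unfolding l_def by (rule someI)
    then have "g \<in> level_groups q (\<lambda>i. \<psi> i \<omega>) (G \<omega>) l"
      using lv[OF g] \<open>Min g \<in> g\<close> g by (auto simp: level_groups_def)
    then show ?thesis using K l unfolding is_group_design_def l_def[symmetric] by blast
  qed
  have "measure_pmf.prob K {x. \<forall>i\<in>\<Union>(G \<omega>). x i = t i}
      = (\<Prod>g\<in>G \<omega>. pmf (map_pmf (\<lambda>t. restrict t g) K) (restrict t g))"
    by (rule pmf_agree_on_groups[OF fin]) (use K in \<open>simp add: is_group_design_def\<close>)
  then show ?thesis by (simp add: assign_prob_def law)
qed

text \<open>The design is integrated out against an \<open>F\<close>-measurable weight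
  \<open>h\<close>, which may contain outcomes. The guard holds at every point of
  \<open>space M\<close>; it is written out so that the right-hand side has the form whose
  measurability is known.\<close>

lemma assignment_probability:
  fixes h :: "'w \<Rightarrow> real"
  assumes h: "h \<in> borel_measurable F" "integrable M h"
  shows "expectation (\<lambda>\<omega>. of_bool (\<forall>i\<in>S \<omega>. X i \<omega> = t i) * h \<omega>)
       = expectation (\<lambda>\<omega>. (if G \<omega> \<subseteq> Pow {1..n} - {{}} then assign_prob q lev (G \<omega>) (\<lambda>i. \<psi> i \<omega>) t else 0) * h \<omega>)"
proof -
  obtain K where K: "cond_law M F X_vec K" "AE \<omega> in M. is_group_design \<omega> (K \<omega>)"
    by (rule group_design_obtain)
  \<comment> \<open>The set of grouped units is expressed through the partition, because the latter
    is known to be \<open>F\<close>-measurable.\<close>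
  define \<phi> where "\<phi> x \<omega> = of_bool (\<forall>i\<in>\<Union>(G \<omega>). x i = t i) * h \<omega>" for x \<omega>
  have \<phi>m: "\<phi> x \<in> borel_measurable F" for x
    unfolding \<phi>_def by (intro borel_measurable_times h(1) measurable_compose[OF G_meas]) simp
  have \<phi>i: "integrable M (\<phi> x)" for x
    by (rule Bochner_Integration.integrable_bound[OF h(2)])
       (use measurable_from_subalg[OF F \<phi>m] in \<open>auto simp: \<phi>_def\<close>)
  note ci = cond_law_integral[OF F K(1) finite_vecs X_vec_in X_vec_event \<phi>m \<phi>i]
  have "expectation (\<lambda>\<omega>. of_bool (\<forall>i\<in>S \<omega>. X i \<omega> = t i) * h \<omega>) = expectation (\<lambda>\<omega>. \<phi> (X_vec \<omega>) \<omega>)"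
  proof (rule Bochner_Integration.integral_cong[OF refl])
    fix \<omega> assume \<omega>: "\<omega> \<in> space M"
    have "(\<forall>i\<in>S \<omega>. X i \<omega> = t i) \<longleftrightarrow> (\<forall>i\<in>\<Union>(G \<omega>). X_vec \<omega> i = t i)"
      using S[OF \<omega>] unfolding S_eq[OF \<omega>, symmetric] X_vec_def by (auto simp: subset_iff)
    then show "of_bool (\<forall>i\<in>S \<omega>. X i \<omega> = t i) * h \<omega> = \<phi> (X_vec \<omega>) \<omega>" by (simp add: \<phi>_def)
  qed
  also have "\<dots> = expectation (\<lambda>\<omega>. \<Sum>x\<in>vecs. pmf (K \<omega>) x * \<phi> x \<omega>)" by (rule ci(3))
  also have "\<dots> = expectation (\<lambda>\<omega>. (if G \<omega> \<subseteq> Pow {1..n} - {{}} then assign_prob q lev (G \<omega>) (\<lambda>i. \<psi> i \<omega>) t else 0) * h \<omega>)"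
  proof (rule integral_cong_AE)
    show "AE \<omega> in M. (\<Sum>x\<in>vecs. pmf (K \<omega>) x * \<phi> x \<omega>)
        = (if G \<omega> \<subseteq> Pow {1..n} - {{}} then assign_prob q lev (G \<omega>) (\<lambda>i. \<psi> i \<omega>) t else 0) * h \<omega>"
      using K(2)
    proof (rule AE_mp, intro AE_I2 impI)
      fix \<omega> assume \<omega>: "\<omega> \<in> space M" and good: "is_group_design \<omega> (K \<omega>)"
      have "(\<Sum>x\<in>vecs. pmf (K \<omega>) x * \<phi> x \<omega>) = measure_pmf.expectation (K \<omega>) (\<lambda>x. \<phi> x \<omega>)"
        using good by (intro set_pmf_expectation_finite[symmetric] finite_vecs) (simp add: is_group_design_def)
      also have "\<dots> = measure_pmf.expectation (K \<omega>) (\<lambda>x. indicator {x. \<forall>i\<in>\<Union>(G \<omega>). x i = t i} x * h \<omega>)"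
        by (simp add: \<phi>_def indicator_def of_bool_def)
      also have "\<dots> = measure_pmf.prob (K \<omega>) {x. \<forall>i\<in>\<Union>(G \<omega>). x i = t i} * h \<omega>" by simp
      finally show "(\<Sum>x\<in>vecs. pmf (K \<omega>) x * \<phi> x \<omega>)
        = (if G \<omega> \<subseteq> Pow {1..n} - {{}} then assign_prob q lev (G \<omega>) (\<lambda>i. \<psi> i \<omega>) t else 0) * h \<omega>"
        using group_design_agree[OF \<omega> good] G_subset[OF \<omega>] by simp
    qed
    show "(\<lambda>\<omega>. \<Sum>x\<in>vecs. pmf (K \<omega>) x * \<phi> x \<omega>) \<in> borel_measurable M"
      using ci(2) by (rule borel_measurable_integrable)
    show "(\<lambda>\<omega>. (if G \<omega> \<subseteq> Pow {1..n} - {{}} then assign_prob q lev (G \<omega>) (\<lambda>i. \<psi> i \<omega>) t else 0) * h \<omega>) \<in> borel_measurable M"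
      by (intro borel_measurable_times measurable_from_subalg[OF F] assign_prob_measurable lev G_meas \<psi>_meas h(1)) auto
  qed
  finally show ?thesis .
qed

text \<open>Conditionally on \<open>F\<close> the second moment is bounded by the grouping estimate
  at each point, and on \<open>A\<close> the matching loss there is at most \<open>\<delta>\<close>.
  Taking expectations leaves only the mean squares of the residual \<open>r\<close>.\<close>

lemma randomization_variance:
  fixes f r :: "'a \<Rightarrow> real"
  assumes k: "\<And>l. l \<in> lev \<Longrightarrow> snd l \<le> k"
    and f: "L-lipschitz_on UNIV f" "\<And>x. \<bar>f x\<bar> \<le> B"
    and r: "r \<in> borel_measurable borel" "\<And>i. i \<in> {1..n} \<Longrightarrow> integrable M (\<lambda>\<omega>. (r (\<psi> i \<omega>))\<^sup>2)"
    and \<delta>: "\<delta> \<ge> 0"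
  defines "A \<equiv> {\<omega> \<in> space M. match_loss n (\<lambda>i. \<psi> i \<omega>) (G \<omega>) \<le> \<delta>}"
    and "R \<equiv> (\<lambda>\<omega>. \<Sum>i\<in>S \<omega>. (of_bool (X i \<omega>) - q (\<psi> i \<omega>)) * (f (\<psi> i \<omega>) + r (\<psi> i \<omega>)))"
  shows "A \<in> events" "integrable M (\<lambda>\<omega>. indicator A \<omega> * (R \<omega>)\<^sup>2)"
    and "expectation (\<lambda>\<omega>. indicator A \<omega> * (R \<omega>)\<^sup>2)
       \<le> 2 * real k * (L\<^sup>2 * (real n * \<delta>) + real (card lev) * (real k * B\<^sup>2) + (\<Sum>i=1..n. expectation (\<lambda>\<omega>. (r (\<psi> i \<omega>))\<^sup>2)))"
proof -
  define b where "b x = f x + r x" for x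
  have fm[measurable]: "f \<in> borel_measurable borel" by (rule lipschitz_on_borel[OF f(1) refl])
  note [measurable] = r(1) propensity_bounds(4)[OF lev]
  have bm[measurable]: "b \<in> borel_measurable borel" unfolding b_def by measurable
  \<comment> \<open>The indicator of \<open>A\<close> has to be \<open>F\<close>-measurable to pass
    under the conditional law. It is, since the matching loss is a function of covariates and
    partition.\<close>
  have AF: "A \<in> sets F"
  proof -
    have "(\<lambda>\<omega>. match_loss n (\<lambda>i. \<psi> i \<omega>) (G \<omega>)) \<in> borel_measurable F"
      by (rule match_loss_measurable[OF G_meas _ \<psi>_meas]) (use G_subset in \<open>auto simp: space_F\<close>)
    then have "{\<omega> \<in> space F. match_loss n (\<lambda>i. \<psi> i \<omega>) (G \<omega>) \<le> \<delta>} \<in> sets F" by measurable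
    then show ?thesis by (simp add: A_def space_F)
  qed
  then show A: "A \<in> events" using F by (auto simp: subalgebra_def)
  obtain K where K: "cond_law M F X_vec K" "AE \<omega> in M. is_group_design \<omega> (K \<omega>)"
    by (rule group_design_obtain)
  define Q where "Q x \<omega> = (\<Sum>i=1..n. of_bool (i \<in> S \<omega>) * ((of_bool (x i) - q (\<psi> i \<omega>)) * b (\<psi> i \<omega>)))" for x and \<omega>
  define \<phi> where "\<phi> x \<omega> = indicator A \<omega> * (Q x \<omega>)\<^sup>2" for x \<omega>
  have \<psi>q: "(\<lambda>\<omega>. q (\<psi> i \<omega>)) \<in> borel_measurable F" "(\<lambda>\<omega>. b (\<psi> i \<omega>)) \<in> borel_measurable F" if "i \<in> {1..n}" for i
    using measurable_compose[OF \<psi>_meas[OF that] propensity_bounds(4)[OF lev]]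
      measurable_compose[OF \<psi>_meas[OF that] bm] by auto
  have Qm: "Q x \<in> borel_measurable F" for x
    unfolding Q_def by (intro borel_measurable_sum borel_measurable_times S_meas borel_measurable_diff
      borel_measurable_const \<psi>q) auto
  have \<phi>m: "\<phi> x \<in> borel_measurable F" for x
    unfolding \<phi>_def by (intro borel_measurable_times borel_measurable_indicator AF borel_measurable_power Qm)
  have r2: "integrable M (\<lambda>\<omega>. \<Sum>i=1..n. (r (\<psi> i \<omega>))\<^sup>2)"
    using r(2) by (intro Bochner_Integration.integrable_sum) auto
  \<comment> \<open>A bound of order n with no use of randomization. It provides integrability for
    every fixed vector \<open>x\<close>; the sharp estimate comes from the kernel.\<close>
  have QB: "(Q x \<omega>)\<^sup>2 \<le> real n * (\<Sum>i=1..n. 2 * B\<^sup>2 + 2 * (r (\<psi> i \<omega>))\<^sup>2)" for x \<omega>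
  proof -
    have "(Q x \<omega>)\<^sup>2 \<le> (\<Sum>i=1..n. (of_bool (i \<in> S \<omega>))\<^sup>2) * (\<Sum>i=1..n. ((of_bool (x i) - q (\<psi> i \<omega>)) * b (\<psi> i \<omega>))\<^sup>2)"
      unfolding Q_def by (rule Cauchy_Schwarz_ineq_sum)
    also have "\<dots> \<le> real n * (\<Sum>i=1..n. 2 * B\<^sup>2 + 2 * (r (\<psi> i \<omega>))\<^sup>2)"
    proof (intro mult_mono sum_mono)
      have "(\<Sum>i=1..n. (of_bool (i \<in> S \<omega>))\<^sup>2 :: real) \<le> (\<Sum>i=1..n. 1)" by (rule sum_mono) auto
      then show "(\<Sum>i=1..n. (of_bool (i \<in> S \<omega>))\<^sup>2 :: real) \<le> real n" by simp
      fix i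
      have "\<bar>of_bool (x i) - q (\<psi> i \<omega>)\<bar> \<le> 1"
        using propensity_bounds(1,2)[OF lev, of "\<psi> i \<omega>"] by (cases "x i") auto
      then have "(of_bool (x i) - q (\<psi> i \<omega>))\<^sup>2 \<le> 1" by (simp add: abs_square_le_1)
      then have "((of_bool (x i) - q (\<psi> i \<omega>)) * b (\<psi> i \<omega>))\<^sup>2 \<le> 1 * (b (\<psi> i \<omega>))\<^sup>2"
        unfolding power_mult_distrib by (rule mult_right_mono) simp
      also have "\<dots> \<le> 2 * (f (\<psi> i \<omega>))\<^sup>2 + 2 * (r (\<psi> i \<omega>))\<^sup>2"
        using sum_squares_bound[of "f (\<psi> i \<omega>)" "r (\<psi> i \<omega>)"] by (simp add: b_def power2_sum)
      also have "(f (\<psi> i \<omega>))\<^sup>2 \<le> B\<^sup>2" using power_mono[OF f(2), of _ 2] by simp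
      finally show "((of_bool (x i) - q (\<psi> i \<omega>)) * b (\<psi> i \<omega>))\<^sup>2 \<le> 2 * B\<^sup>2 + 2 * (r (\<psi> i \<omega>))\<^sup>2" by simp
    qed (auto intro!: sum_nonneg)
    finally show ?thesis .
  qed
  have \<phi>i: "integrable M (\<phi> x)" for x
  proof (rule Bochner_Integration.integrable_bound)
    show "integrable M (\<lambda>\<omega>. real n * (\<Sum>i=1..n. 2 * B\<^sup>2 + 2 * (r (\<psi> i \<omega>))\<^sup>2))"
      using r(2) by (intro integrable_mult_right Bochner_Integration.integrable_sum Bochner_Integration.integrable_add) auto
    show "AE \<omega> in M. norm (\<phi> x \<omega>) \<le> norm (real n * (\<Sum>i=1..n. 2 * B\<^sup>2 + 2 * (r (\<psi> i \<omega>))\<^sup>2))"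
      by (intro AE_I2) (auto simp: \<phi>_def indicator_def simp del: One_nat_def intro: order_trans[OF QB abs_ge_self])
  qed (use measurable_from_subalg[OF F \<phi>m] in simp)
  note ci = cond_law_integral[OF F K(1) finite_vecs X_vec_in X_vec_event \<phi>m \<phi>i]
  have eqR: "indicator A \<omega> * (R \<omega>)\<^sup>2 = \<phi> (X_vec \<omega>) \<omega>" if \<omega>: "\<omega> \<in> space M" for \<omega>
    unfolding R_def \<phi>_def Q_def b_def sum_S[OF \<omega>] by (auto simp: X_vec_def intro!: sum.cong)
  show "integrable M (\<lambda>\<omega>. indicator A \<omega> * (R \<omega>)\<^sup>2)"
    by (subst Bochner_Integration.integrable_cong[OF refl eqR]) (auto intro: ci(1))
  define bd where "bd \<omega> = 2 * real k * (L\<^sup>2 * (real n * \<delta>) + real (card lev) * (real k * B\<^sup>2) + (\<Sum>i=1..n. (r (\<psi> i \<omega>))\<^sup>2))" for \<omega>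
  have bd_int: "integrable M bd" unfolding bd_def using r2 by simp
  have "expectation (\<lambda>\<omega>. indicator A \<omega> * (R \<omega>)\<^sup>2) = expectation (\<lambda>\<omega>. \<phi> (X_vec \<omega>) \<omega>)"
    by (rule Bochner_Integration.integral_cong[OF refl eqR])
  also have "\<dots> = expectation (\<lambda>\<omega>. \<Sum>x\<in>vecs. pmf (K \<omega>) x * \<phi> x \<omega>)" by (rule ci(3))
  also have "\<dots> \<le> expectation bd"
  proof (rule integral_mono_AE[OF ci(2) bd_int])
    show "AE \<omega> in M. (\<Sum>x\<in>vecs. pmf (K \<omega>) x * \<phi> x \<omega>) \<le> bd \<omega>"
      using K(2)
    proof (rule AE_mp, intro AE_I2 impI)
      fix \<omega> assume \<omega>: "\<omega> \<in> space M" and good: "is_group_design \<omega> (K \<omega>)"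
      from grouping_variance_bound[OF valid[OF \<omega>] S[OF \<omega>] n lev k f, of r] obtain \<mu> where
        \<mu>: "\<And>g. g \<in> G \<omega> \<Longrightarrow> \<exists>l\<in>lev. g \<in> level_groups q (\<lambda>i. \<psi> i \<omega>) (G \<omega>) l \<and> 1 \<le> fst l \<and> fst l \<le> snd l
              \<and> (\<forall>i\<in>g. q (\<psi> i \<omega>) = real (fst l) / real (snd l)) \<and> (card g = snd l \<or> \<mu> g = 0)"
        and bound: "(\<Sum>g\<in>G \<omega>. real (card g) * (\<Sum>i\<in>g. (b (\<psi> i \<omega>) - \<mu> g)\<^sup>2))
          \<le> 2 * real k * (L\<^sup>2 * (real n * match_loss n (\<lambda>i. \<psi> i \<omega>) (G \<omega>)) + real (card lev) * (real k * B\<^sup>2)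
             + (\<Sum>i=1..n. (r (\<psi> i \<omega>))\<^sup>2))"
        unfolding b_def by blast
      have finG: "finite (G \<omega>)" using G_subset[OF \<omega>] by (rule finite_subset) simp
      have fing: "finite g" if "g \<in> G \<omega>" for g
        using G_subset[OF \<omega>] that by (intro finite_subset[of g "{1..n}"]) auto
      have bd0: "0 \<le> bd \<omega>" using \<delta> by (auto simp: bd_def intro!: mult_nonneg_nonneg add_nonneg_nonneg sum_nonneg)
      have "(\<Sum>x\<in>vecs. pmf (K \<omega>) x * \<phi> x \<omega>) = measure_pmf.expectation (K \<omega>) (\<lambda>x. \<phi> x \<omega>)"
        using good by (intro set_pmf_expectation_finite[symmetric] finite_vecs) (simp add: is_group_design_def)
      also have "\<dots> = indicator A \<omega> * measure_pmf.expectation (K \<omega>) (\<lambda>x. (Q x \<omega>)\<^sup>2)"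
        by (simp add: \<phi>_def)
      also have "\<dots> \<le> bd \<omega>"
      proof (cases "\<omega> \<in> A")
        case True
        have "Q x \<omega> = (\<Sum>g\<in>G \<omega>. \<Sum>i\<in>g. (of_bool (x i) - q (\<psi> i \<omega>)) * b (\<psi> i \<omega>))" for x
          unfolding partition_on_sum[OF finite_S[OF \<omega>] partition[OF \<omega>]] sum_S[OF \<omega>] Q_def ..
        then have "measure_pmf.expectation (K \<omega>) (\<lambda>x. (Q x \<omega>)\<^sup>2)
            = measure_pmf.expectation (K \<omega>) (\<lambda>x. (\<Sum>g\<in>G \<omega>. \<Sum>i\<in>g. (of_bool (x i) - q (\<psi> i \<omega>)) * b (\<psi> i \<omega>))\<^sup>2)"
          by simp
        also have "\<dots> \<le> (\<Sum>g\<in>G \<omega>. real (card g) * (\<Sum>i\<in>g. (b (\<psi> i \<omega>) - \<mu> g)\<^sup>2))"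
        proof (rule pmf_group_sum_second_moment[OF finG fing])
          fix g assume g: "g \<in> G \<omega>"
          from \<mu>[OF g] good show "\<exists>l. map_pmf (\<lambda>t. restrict t g) (K \<omega>) = group_law l g \<and> fst l \<le> snd l \<and> 0 < snd l
            \<and> (\<forall>i\<in>g. q (\<psi> i \<omega>) = real (fst l) / real (snd l)) \<and> (card g = snd l \<or> \<mu> g = 0)"
            unfolding is_group_design_def by (metis One_nat_def Suc_le_lessD less_le_trans)
        qed (use good in \<open>simp_all add: is_group_design_def\<close>)
        also note bound
        also have "2 * real k * (L\<^sup>2 * (real n * match_loss n (\<lambda>i. \<psi> i \<omega>) (G \<omega>)) + real (card lev) * (real k * B\<^sup>2)
             + (\<Sum>i=1..n. (r (\<psi> i \<omega>))\<^sup>2)) \<le> bd \<omega>"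
          unfolding bd_def using True by (intro mult_left_mono add_mono order_refl) (auto simp: A_def)
        finally show ?thesis using True by simp
      qed (use bd0 in simp)
      finally show "(\<Sum>x\<in>vecs. pmf (K \<omega>) x * \<phi> x \<omega>) \<le> bd \<omega>" .
    qed
  qed
  also have "expectation bd = 2 * real k * (L\<^sup>2 * (real n * \<delta>) + real (card lev) * (real k * B\<^sup>2) + (\<Sum>i=1..n. expectation (\<lambda>\<omega>. (r (\<psi> i \<omega>))\<^sup>2)))"
    unfolding bd_def using r2 r(2) by (simp add: prob_space)
  finally show "expectation (\<lambda>\<omega>. indicator A \<omega> * (R \<omega>)\<^sup>2)
       \<le> 2 * real k * (L\<^sup>2 * (real n * \<delta>) + real (card lev) * (real k * B\<^sup>2) + (\<Sum>i=1..n. expectation (\<lambda>\<omega>. (r (\<psi> i \<omega>))\<^sup>2)))" .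
qed

end

subsection \<open>Negligibility of the randomization error\<close>

lemma match_loss_nonneg: "0 \<le> match_loss n x G"
  unfolding match_loss_def by (intro mult_nonneg_nonneg sum_nonneg) auto

text \<open>The whole sequence of randomizations. Residuals are controlled through their
  expectations, so the covariates enter by their common marginal law.\<close>

locale randomized_scheme = prob_space M for M :: "'w measure" +
  fixes S :: "nat \<Rightarrow> 'w \<Rightarrow> nat set" and Z :: "nat \<Rightarrow> 'w \<Rightarrow> 'z" and Q :: "nat \<Rightarrow> 'z measure"
    and C :: "nat \<Rightarrow> 'w \<Rightarrow> 'c" and R :: "nat \<Rightarrow> 'c measure"
    and \<psi> :: "nat \<Rightarrow> 'w \<Rightarrow> 'a::euclidean_space" and q :: "'a \<Rightarrow> real" and lev :: "(nat \<times> nat) set"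
    and X :: "nat \<Rightarrow> nat \<Rightarrow> 'w \<Rightarrow> bool"
  assumes scheme: "locally_randomized M S Z Q C R \<psi> q lev X" and lev: "propensity_levels q lev"
    and C_meas: "\<And>n. n \<ge> 1 \<Longrightarrow> C n \<in> M \<rightarrow>\<^sub>M R n"
    and Z_meas: "\<And>n. n \<ge> 1 \<Longrightarrow> Z n \<in> gen_by M (C n) (R n) \<rightarrow>\<^sub>M Q n"
    and \<psi>_meas_C: "\<And>n i. i \<in> {1..n} \<Longrightarrow> \<psi> i \<in> borel_measurable (gen_by M (C n) (R n))"
    and S_subset: "\<And>n \<omega>. n \<ge> 1 \<Longrightarrow> \<omega> \<in> space M \<Longrightarrow> S n \<omega> \<subseteq> {1..n}"
    and X_meas_M: "\<And>n i. i \<in> {1..n} \<Longrightarrow> X n i \<in> M \<rightarrow>\<^sub>M count_space UNIV"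
    and \<psi>_ident: "\<And>i. i \<ge> 1 \<Longrightarrow> distr M borel (\<psi> i) = distr M borel (\<psi> 1)"
begin

lemma subalgebra_C: "n \<ge> 1 \<Longrightarrow> subalgebra M (gen_by M (C n) (R n))"
  using measurable_sets[OF C_meas] measurable_space[OF C_meas]
  by (auto simp: subalgebra_def gen_by_def sets_vimage_algebra2)

lemma \<psi>_meas_M: "i \<ge> 1 \<Longrightarrow> \<psi> i \<in> borel_measurable M"
  using measurable_from_subalg[OF subalgebra_C \<psi>_meas_C] by (metis atLeastAtMost_iff order_refl)

lemma groups_obtain:
  obtains h G where "\<And>n. n \<ge> 1 \<Longrightarrow> h n \<in> Q n \<rightarrow>\<^sub>M count_space UNIV"
    and "\<And>n \<omega>. n \<ge> 1 \<Longrightarrow> \<omega> \<in> space M \<Longrightarrow> G n \<omega> = h n (Z n \<omega>)"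
    and "\<And>n. n \<ge> 1 \<Longrightarrow> randomized_groups M (gen_by M (C n) (R n)) n q lev \<psi> (S n) (G n) (X n)"
    and "tends_to_zero_in_prob M (\<lambda>n \<omega>. match_loss n (\<lambda>i. \<psi> i \<omega>) (G n \<omega>))"
proof -
  from scheme obtain G where
    h: "\<forall>n\<ge>1. \<exists>h \<in> Q n \<rightarrow>\<^sub>M count_space UNIV. \<forall>\<omega>\<in>space M. G n \<omega> = h (Z n \<omega>)"
    and valid: "\<And>n \<omega>. n \<ge> 1 \<Longrightarrow> \<omega> \<in> space M \<Longrightarrow> valid_grouping q lev (\<lambda>i. \<psi> i \<omega>) (S n \<omega>) (G n \<omega>)"
    and rand: "\<And>n. n \<ge> 1 \<Longrightarrow> completely_randomized M (gen_by M (C n) (R n)) n q lev \<psi> (G n) (X n)"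
    and loss: "tends_to_zero_in_prob M (\<lambda>n \<omega>. match_loss n (\<lambda>i. \<psi> i \<omega>) (G n \<omega>))"
    unfolding locally_randomized_def by blast
  from h have "\<forall>n. \<exists>h. n \<ge> 1 \<longrightarrow> h \<in> Q n \<rightarrow>\<^sub>M count_space UNIV \<and> (\<forall>\<omega>\<in>space M. G n \<omega> = h (Z n \<omega>))" by blast
  from choice[OF this] obtain h where
    h: "\<And>n. n \<ge> 1 \<Longrightarrow> h n \<in> Q n \<rightarrow>\<^sub>M count_space UNIV" "\<And>n \<omega>. n \<ge> 1 \<Longrightarrow> \<omega> \<in> space M \<Longrightarrow> G n \<omega> = h n (Z n \<omega>)"
    by blast
  have groups: "randomized_groups M (gen_by M (C n) (R n)) n q lev \<psi> (S n) (G n) (X n)" if n: "n \<ge> 1" for n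
  proof
    show "subalgebra M (gen_by M (C n) (R n))" by (rule subalgebra_C[OF n])
    have "(\<lambda>\<omega>. h n (Z n \<omega>)) \<in> gen_by M (C n) (R n) \<rightarrow>\<^sub>M count_space UNIV"
      by (rule measurable_compose[OF Z_meas[OF n] h(1)[OF n]])
    then show "G n \<in> gen_by M (C n) (R n) \<rightarrow>\<^sub>M count_space UNIV"
      by (rule measurable_cong[THEN iffD1, rotated]) (simp add: gen_by_def h(2)[OF n])
  qed (use n lev valid rand S_subset \<psi>_meas_C X_meas_M in auto)
  show thesis by (rule that[OF h groups loss])
qed

lemma sum_meas:
  assumes n: "n \<ge> 1" and [measurable]: "b \<in> borel_measurable borel"
  shows "(\<lambda>\<omega>. \<Sum>i\<in>S n \<omega>. (of_bool (X n i \<omega>) - q (\<psi> i \<omega>)) * b (\<psi> i \<omega>)) \<in> borel_measurable M"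
proof -
  obtain h G where "randomized_groups M (gen_by M (C n) (R n)) n q lev \<psi> (S n) (G n) (X n)"
    using groups_obtain n by metis
  then interpret randomized_groups M "gen_by M (C n) (R n)" n q lev \<psi> "S n" "G n" "X n" .
  note [measurable] = propensity_bounds(4)[OF lev]
  have [measurable]: "\<psi> i \<in> borel_measurable M" "X n i \<in> M \<rightarrow>\<^sub>M count_space UNIV" if "i \<in> {1..n}" for i
    using \<psi>_meas_M X_meas_M that by auto
  have [measurable]: "(\<lambda>\<omega>. of_bool (i \<in> S n \<omega>) :: real) \<in> borel_measurable M" for i
    using measurable_from_subalg[OF F S_meas] .
  have "(\<lambda>\<omega>. \<Sum>i=1..n. of_bool (i \<in> S n \<omega>) * ((of_bool (X n i \<omega>) - q (\<psi> i \<omega>)) * b (\<psi> i \<omega>))) \<in> borel_measurable M"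
    by measurable
  then show ?thesis by (rule measurable_cong[THEN iffD1, rotated]) (simp add: sum_S)
qed

text \<open>The matching loss is small only in probability, not in mean; the second moment is therefore
  taken on the event that it is at most \<open>\<delta>\<close>.\<close>

theorem randomization_error_tends_to_zero:
  assumes [measurable]: "b \<in> borel_measurable borel" and b2: "integrable M (\<lambda>\<omega>. (b (\<psi> 1 \<omega>))\<^sup>2)"
  shows "tends_to_zero_in_prob M
    (\<lambda>n \<omega>. 1 / sqrt (real n) * (\<Sum>i\<in>S n \<omega>. (of_bool (X n i \<omega>) - q (\<psi> i \<omega>)) * b (\<psi> i \<omega>)))"
proof (rule tends_to_zero_in_probI)
  show "(\<lambda>\<omega>. 1 / sqrt (real n) * (\<Sum>i\<in>S n \<omega>. (of_bool (X n i \<omega>) - q (\<psi> i \<omega>)) * b (\<psi> i \<omega>))) \<in> borel_measurable M"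
    if "n \<ge> 1" for n using sum_meas[OF that assms(1)] by simp
next
  fix \<eta> :: real assume \<eta>: "\<eta> > 0"
  obtain h G where groups: "\<And>n. n \<ge> 1 \<Longrightarrow> randomized_groups M (gen_by M (C n) (R n)) n q lev \<psi> (S n) (G n) (X n)"
    and loss: "tends_to_zero_in_prob M (\<lambda>n \<omega>. match_loss n (\<lambda>i. \<psi> i \<omega>) (G n \<omega>))"
    by (rule groups_obtain) blast
  have finl: "finite lev" using lev by (simp add: propensity_levels_def)
  \<comment> \<open>A common bound for all group sizes; the successor makes its positivity
    immediate.\<close>
  define k where "k = Suc (\<Sum>l\<in>lev. snd l)"
  have k: "snd l \<le> k" if "l \<in> lev" for l
    using member_le_sum[OF that, of snd] finl unfolding k_def by fastforce
  have k0: "real k > 0" by (simp only: k_def of_nat_0_less_iff zero_less_Suc)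
  define \<mu> where "\<mu> = distr M borel (\<psi> 1)"
  note \<psi>1 = \<psi>_meas_M[OF order_refl]
  have b2': "integrable \<mu> (\<lambda>x. (b x)\<^sup>2)" unfolding \<mu>_def by (subst integrable_distr_eq[OF \<psi>1]) (use b2 in auto)
  have "lipschitz_approx \<mu> b"
    by (rule lipschitz_approx_square_integrable) (use b2' \<psi>1 in \<open>auto simp: \<mu>_def intro: finite_measure_distr\<close>)
  moreover have "\<eta> / (8 * real k) > 0" using \<eta> k0 by simp
  ultimately obtain f L B where f: "L-lipschitz_on UNIV f" "\<And>x. \<bar>f x\<bar> \<le> B"
    and r: "integrable \<mu> (\<lambda>x. (b x - f x)\<^sup>2)" "(\<integral>x. (b x - f x)\<^sup>2 \<partial>\<mu>) < \<eta> / (8 * real k)"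
    unfolding lipschitz_approx_def by blast
  have [measurable]: "f \<in> borel_measurable borel" by (rule lipschitz_on_borel[OF f(1) refl])
  have r1: "integrable M (\<lambda>\<omega>. (b (\<psi> 1 \<omega>) - f (\<psi> 1 \<omega>))\<^sup>2)"
    using r(1) unfolding \<mu>_def by (subst (asm) integrable_distr_eq[OF \<psi>1]) auto
  have ri: "integrable M (\<lambda>\<omega>. (b (\<psi> i \<omega>) - f (\<psi> i \<omega>))\<^sup>2)"
    "expectation (\<lambda>\<omega>. (b (\<psi> i \<omega>) - f (\<psi> i \<omega>))\<^sup>2) < \<eta> / (8 * real k)" if "i \<ge> 1" for i
  proof -
    note d = distr_eq_integral[OF \<psi>_meas_M[OF that] \<psi>1 _ \<psi>_ident[OF that], of "\<lambda>x. (b x - f x)\<^sup>2"]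
    show "integrable M (\<lambda>\<omega>. (b (\<psi> i \<omega>) - f (\<psi> i \<omega>))\<^sup>2)" using d(1) r1 by simp
    have "expectation (\<lambda>\<omega>. (b (\<psi> 1 \<omega>) - f (\<psi> 1 \<omega>))\<^sup>2) = (\<integral>x. (b x - f x)\<^sup>2 \<partial>\<mu>)"
      unfolding \<mu>_def by (subst integral_distr[OF \<psi>1]) auto
    then show "expectation (\<lambda>\<omega>. (b (\<psi> i \<omega>) - f (\<psi> i \<omega>))\<^sup>2) < \<eta> / (8 * real k)" using d(2) r(2) by simp
  qed
  \<comment> \<open>The matching loss contributes at most
    \<open>2 * k * (L\<^sup>2 + 1) * \<delta> = \<eta> / 4\<close>, the residual at most
    \<open>2 * k * (\<eta> / (8 * k)) = \<eta> / 4\<close>. The remainder groups contribute a term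
    of order 1/n, eventually below \<open>\<eta> / 2\<close>.\<close>
  define \<delta> where "\<delta> = \<eta> / (8 * real k * (L\<^sup>2 + 1))"
  have L1: "L\<^sup>2 + 1 > 0" by (simp add: add_nonneg_pos)
  have \<delta>: "\<delta> > 0" using \<eta> k0 L1 by (simp add: \<delta>_def)
  define A where "A n = {\<omega> \<in> space M. match_loss n (\<lambda>i. \<psi> i \<omega>) (G n \<omega>) \<le> \<delta>}" for n
  define E where "E n \<omega> = 1 / sqrt (real n) * (\<Sum>i\<in>S n \<omega>. (of_bool (X n i \<omega>) - q (\<psi> i \<omega>)) * b (\<psi> i \<omega>))" for n \<omega>
  have main: "A n \<in> events" "integrable M (\<lambda>\<omega>. indicator (A n) \<omega> * (E n \<omega>)\<^sup>2)"
    "expectation (\<lambda>\<omega>. indicator (A n) \<omega> * (E n \<omega>)\<^sup>2) \<le> \<eta> / 2 + 2 * (real k)\<^sup>2 * real (card lev) * B\<^sup>2 / real n"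
    if n: "n \<ge> 1" for n
  proof -
    interpret g: randomized_groups M "gen_by M (C n) (R n)" n q lev \<psi> "S n" "G n" "X n" by (rule groups[OF n])
    define U where "U \<omega> = (\<Sum>i\<in>S n \<omega>. (of_bool (X n i \<omega>) - q (\<psi> i \<omega>)) * (f (\<psi> i \<omega>) + (b (\<psi> i \<omega>) - f (\<psi> i \<omega>))))" for \<omega>
    have mm: "A n \<in> events" "integrable M (\<lambda>\<omega>. indicator (A n) \<omega> * (U \<omega>)\<^sup>2)"
      "expectation (\<lambda>\<omega>. indicator (A n) \<omega> * (U \<omega>)\<^sup>2)
       \<le> 2 * real k * (L\<^sup>2 * (real n * \<delta>) + real (card lev) * (real k * B\<^sup>2) + (\<Sum>i=1..n. expectation (\<lambda>\<omega>. (b (\<psi> i \<omega>) - f (\<psi> i \<omega>))\<^sup>2)))"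
      unfolding A_def U_def
      by (rule g.randomization_variance[OF k f, of "\<lambda>x. b x - f x"]; use ri(1) \<delta> in simp)+
    have EU: "indicator (A n) \<omega> * (E n \<omega>)\<^sup>2 = 1 / real n * (indicator (A n) \<omega> * (U \<omega>)\<^sup>2)" for \<omega>
      unfolding E_def U_def by (simp add: power_mult_distrib power_divide)
    show "A n \<in> events" by (rule mm(1))
    show "integrable M (\<lambda>\<omega>. indicator (A n) \<omega> * (E n \<omega>)\<^sup>2)" unfolding EU using mm(2) by simp
    have "expectation (\<lambda>\<omega>. indicator (A n) \<omega> * (E n \<omega>)\<^sup>2) = 1 / real n * expectation (\<lambda>\<omega>. indicator (A n) \<omega> * (U \<omega>)\<^sup>2)"
      unfolding EU by (rule integral_mult_right_zero)
    also have "\<dots> \<le> 1 / real n * (2 * real k * (L\<^sup>2 * (real n * \<delta>) + real (card lev) * (real k * B\<^sup>2) + (\<Sum>i=1..n. \<eta> / (8 * real k))))"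
      by (intro mult_left_mono order_trans[OF mm(3)] add_left_mono sum_mono) (use ri(2) in \<open>auto intro: less_imp_le\<close>)
    also have "\<dots> = 2 * real k * L\<^sup>2 * \<delta> + 2 * (real k)\<^sup>2 * real (card lev) * B\<^sup>2 / real n + \<eta> / 4"
      using n k0 by (simp add: field_simps power2_eq_square)
    also have "2 * real k * L\<^sup>2 * \<delta> \<le> 2 * real k * (L\<^sup>2 + 1) * \<delta>"
      using k0 \<delta> by (intro mult_right_mono mult_left_mono) auto
    also have "\<dots> = \<eta> / 4"
    proof -
      have "2 * a * (\<eta> / (8 * a)) = \<eta> / 4" if "a \<noteq> 0" for a :: real using that by simp
      from this[of "real k * (L\<^sup>2 + 1)"] k0 L1 show ?thesis unfolding \<delta>_def mult.assoc by simp
    qed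
    finally show "expectation (\<lambda>\<omega>. indicator (A n) \<omega> * (E n \<omega>)\<^sup>2) \<le> \<eta> / 2 + 2 * (real k)\<^sup>2 * real (card lev) * B\<^sup>2 / real n"
      by simp
  qed
  have "(\<lambda>n. 2 * (real k)\<^sup>2 * real (card lev) * B\<^sup>2 / real n) \<longlonglongrightarrow> 0" by (rule lim_const_over_n)
  then have "eventually (\<lambda>n. 2 * (real k)\<^sup>2 * real (card lev) * B\<^sup>2 / real n < \<eta> / 2) sequentially"
    by (rule order_tendstoD(2)) (use \<eta> in simp)
  with eventually_ge_at_top[of 1]
  have ev: "eventually (\<lambda>n. integrable M (\<lambda>\<omega>. indicator (A n) \<omega> * (E n \<omega>)\<^sup>2) \<and>
      expectation (\<lambda>\<omega>. indicator (A n) \<omega> * (E n \<omega>)\<^sup>2) \<le> \<eta>) sequentially"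
  proof eventually_elim
    case (elim n)
    then show ?case using main(2,3)[of n] by linarith
  qed
  have "(\<lambda>n. prob (space M - A n)) \<longlonglongrightarrow> 0"
  proof -
    have "space M - A n = {\<omega> \<in> space M. \<delta> < \<bar>match_loss n (\<lambda>i. \<psi> i \<omega>) (G n \<omega>)\<bar>}" for n
      by (auto simp: A_def abs_of_nonneg[OF match_loss_nonneg])
    then show ?thesis using loss \<delta> unfolding tends_to_zero_in_prob_def by simp
  qed
  then show "\<exists>A. (\<forall>n\<ge>1. A n \<in> events) \<and> (\<lambda>n. prob (space M - A n)) \<longlonglongrightarrow> 0 \<and>
       (eventually (\<lambda>n. integrable M (\<lambda>\<omega>. indicator (A n) \<omega> * (1 / sqrt (real n) * (\<Sum>i\<in>S n \<omega>. (of_bool (X n i \<omega>) - q (\<psi> i \<omega>)) * b (\<psi> i \<omega>)))\<^sup>2) \<and>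
           expectation (\<lambda>\<omega>. indicator (A n) \<omega> * (1 / sqrt (real n) * (\<Sum>i\<in>S n \<omega>. (of_bool (X n i \<omega>) - q (\<psi> i \<omega>)) * b (\<psi> i \<omega>)))\<^sup>2) \<le> \<eta>) sequentially)"
    unfolding E_def[symmetric] using main(1) ev by blast
qed

text \<open>A weaker normalization, 1/n, in exchange for a merely integrable \<open>b\<close>, such
  as a weighted conditional variance. The truncated integrand is covered by the square-integrable
  case, and the rest is at most \<open>E \<bar>b - tr K b\<bar>\<close> in mean for every n.\<close>

theorem randomization_error_L1:
  assumes [measurable]: "b \<in> borel_measurable borel" and b1: "integrable M (\<lambda>\<omega>. b (\<psi> 1 \<omega>))"
  defines "E \<equiv> \<lambda>n \<omega>. 1 / real n * (\<Sum>i\<in>S n \<omega>. (of_bool (X n i \<omega>) - q (\<psi> i \<omega>)) * b (\<psi> i \<omega>))"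
  shows "tends_to_zero_in_prob M E"
proof -
  define tr where "tr K x = (if \<bar>b x\<bar> \<le> K then b x else 0)" for K x
  have tr_m[measurable]: "tr K \<in> borel_measurable borel" for K unfolding tr_def by measurable
  note \<psi>1[measurable] = \<psi>_meas_M[OF order_refl]
  define rest where "rest K x = \<bar>b x - tr K x\<bar>" for K x
  have rest_m[measurable]: "rest K \<in> borel_measurable borel" for K unfolding rest_def by measurable
  have rest_int: "integrable M (\<lambda>\<omega>. rest K (\<psi> i \<omega>))"
    "expectation (\<lambda>\<omega>. rest K (\<psi> i \<omega>)) = expectation (\<lambda>\<omega>. rest K (\<psi> 1 \<omega>))" if "i \<ge> 1" for K i
  proof -
    note d = distr_eq_integral[OF \<psi>_meas_M[OF that] \<psi>1 rest_m \<psi>_ident[OF that]]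
    have "integrable M (\<lambda>\<omega>. rest K (\<psi> 1 \<omega>))"
      by (rule Bochner_Integration.integrable_bound[OF b1 measurable_compose[OF \<psi>1 rest_m]])
         (auto simp: rest_def tr_def)
    then show "integrable M (\<lambda>\<omega>. rest K (\<psi> i \<omega>))" using d(1) by simp
    show "expectation (\<lambda>\<omega>. rest K (\<psi> i \<omega>)) = expectation (\<lambda>\<omega>. rest K (\<psi> 1 \<omega>))" by (rule d(2))
  qed
  have rest_lim: "(\<lambda>k. expectation (\<lambda>\<omega>. rest (real k) (\<psi> 1 \<omega>))) \<longlonglongrightarrow> 0"
  proof -
    have "(\<lambda>k. expectation (\<lambda>\<omega>. rest (real k) (\<psi> 1 \<omega>))) \<longlonglongrightarrow> expectation (\<lambda>_. 0)"
    proof (rule integral_dominated_convergence[where w="\<lambda>\<omega>. \<bar>b (\<psi> 1 \<omega>)\<bar>"])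
      show "AE \<omega> in M. (\<lambda>k. rest (real k) (\<psi> 1 \<omega>)) \<longlonglongrightarrow> 0"
      proof (rule AE_I2)
        fix \<omega>
        obtain k :: nat where "\<bar>b (\<psi> 1 \<omega>)\<bar> \<le> real k" using real_arch_simple by blast
        then show "(\<lambda>k. rest (real k) (\<psi> 1 \<omega>)) \<longlonglongrightarrow> 0"
          by (intro tendsto_eventually eventually_sequentiallyI[of k]) (auto simp: tr_def rest_def)
      qed
    qed (use b1 in \<open>auto simp: tr_def rest_def\<close>)
    then show ?thesis by simp
  qed
  define Et where "Et K n \<omega> = 1 / real n * (\<Sum>i\<in>S n \<omega>. (of_bool (X n i \<omega>) - q (\<psi> i \<omega>)) * tr K (\<psi> i \<omega>))" for K n \<omega>
  have Et_m: "Et K n \<in> borel_measurable M" if "n \<ge> 1" for K n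
    unfolding Et_def using sum_meas[OF that tr_m[of K]] by simp
  have E_m: "E n \<in> borel_measurable M" if "n \<ge> 1" for n
    unfolding E_def using sum_meas[OF that assms(1)] by simp
  have abs1: "\<bar>of_bool t - q x\<bar> \<le> 1" for t x using propensity_bounds(1,2)[OF lev, of x] by (cases t) auto
  have avg_bound: "\<bar>1 / real n * (\<Sum>i\<in>S n \<omega>. (of_bool (X n i \<omega>) - q (\<psi> i \<omega>)) * u i)\<bar> \<le> 1 / real n * (\<Sum>i=1..n. \<bar>u i\<bar>)"
    if "n \<ge> 1" "\<omega> \<in> space M" for n \<omega> and u :: "nat \<Rightarrow> real"
  proof -
    have "\<bar>\<Sum>i\<in>S n \<omega>. (of_bool (X n i \<omega>) - q (\<psi> i \<omega>)) * u i\<bar> \<le> (\<Sum>i\<in>S n \<omega>. \<bar>u i\<bar>)"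
      by (rule order_trans[OF sum_abs], rule sum_mono) (simp add: abs_mult mult_left_le_one_le abs1)
    also have "\<dots> \<le> (\<Sum>i=1..n. \<bar>u i\<bar>)" using S_subset[OF that] by (intro sum_mono2) auto
    finally show ?thesis using that(1) by (simp add: abs_mult divide_right_mono)
  qed
  \<comment> \<open>Truncation bounds these averages uniformly, which upgrades convergence in
    probability to convergence in mean, so that it can be added to the truncation error.\<close>
  have Et_lim: "(\<lambda>n. expectation (\<lambda>\<omega>. norm (Et (real K) n \<omega>))) \<longlonglongrightarrow> 0" for K :: nat
  proof (rule tends_to_zero_in_prob_expectation[OF _ Et_m randomization_error_tends_to_zero])
    have trK: "\<bar>tr (real K) x\<bar> \<le> real K" for x by (simp add: tr_def)
    show "integrable M (\<lambda>\<omega>. (tr (real K) (\<psi> 1 \<omega>))\<^sup>2)"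
    proof (rule integrable_const_bound[of _ "(real K)\<^sup>2"])
      show "AE \<omega> in M. norm ((tr (real K) (\<psi> 1 \<omega>))\<^sup>2) \<le> (real K)\<^sup>2"
        using power_mono[OF trK, of _ 2] by simp
    qed measurable
    show "(\<lambda>\<omega>. 1 / sqrt (real n) * (\<Sum>i\<in>S n \<omega>. (of_bool (X n i \<omega>) - q (\<psi> i \<omega>)) * tr (real K) (\<psi> i \<omega>))) \<in> borel_measurable M"
      if "n \<ge> 1" for n using sum_meas[OF that tr_m[of "real K"]] by simp
    show "norm (Et (real K) n \<omega>) \<le> real K" if n: "n \<ge> 1" and "\<omega> \<in> space M" for n \<omega>
    proof -
      have "\<bar>Et (real K) n \<omega>\<bar> \<le> 1 / real n * (\<Sum>i=1..n. \<bar>tr (real K) (\<psi> i \<omega>)\<bar>)"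
        unfolding Et_def by (rule avg_bound[OF that])
      also have "\<dots> \<le> 1 / real n * (\<Sum>i=1..n. real K)" by (intro mult_left_mono sum_mono trK) simp
      finally show ?thesis using n by simp
    qed
    show "norm (Et (real K) n \<omega>) \<le> 1 * \<bar>1 / sqrt (real n) * (\<Sum>i\<in>S n \<omega>. (of_bool (X n i \<omega>) - q (\<psi> i \<omega>)) * tr (real K) (\<psi> i \<omega>))\<bar>"
      if n: "n \<ge> 1" for n \<omega>
    proof -
      have "sqrt (real n) \<le> real n" using n by (simp add: real_le_lsqrt power2_eq_square)
      then have "1 / real n \<le> 1 / sqrt (real n)" using n by (simp add: frac_le)
      then show ?thesis unfolding Et_def by (simp only: real_norm_def abs_mult mult_1) (intro mult_right_mono, auto)
    qed
  qed auto
  show ?thesis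
  proof (rule tends_to_zero_in_prob_L1)
    have dom: "\<bar>E n \<omega>\<bar> \<le> \<bar>Et K n \<omega>\<bar> + 1 / real n * (\<Sum>i=1..n. rest K (\<psi> i \<omega>))" if "n \<ge> 1" "\<omega> \<in> space M" for n K \<omega>
    proof -
      have "E n \<omega> = Et K n \<omega> + 1 / real n * (\<Sum>i\<in>S n \<omega>. (of_bool (X n i \<omega>) - q (\<psi> i \<omega>)) * (b (\<psi> i \<omega>) - tr K (\<psi> i \<omega>)))"
        unfolding E_def Et_def distrib_left[symmetric] sum.distrib[symmetric] by (simp add: algebra_simps)
      then show ?thesis using avg_bound[OF that, of "\<lambda>i. b (\<psi> i \<omega>) - tr K (\<psi> i \<omega>)"] unfolding rest_def by linarith
    qed
    have Et_int: "integrable M (\<lambda>\<omega>. \<bar>Et (real K) n \<omega>\<bar>)" if n: "n \<ge> 1" for n and K :: nat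
    proof (rule integrable_const_bound[of _ "real K"])
      have "\<bar>Et (real K) n \<omega>\<bar> \<le> real K" if "\<omega> \<in> space M" for \<omega>
      proof -
        have "\<bar>Et (real K) n \<omega>\<bar> \<le> 1 / real n * (\<Sum>i=1..n. \<bar>tr (real K) (\<psi> i \<omega>)\<bar>)"
          unfolding Et_def by (rule avg_bound[OF n that])
        also have "\<dots> \<le> 1 / real n * (\<Sum>i=1..n. real K)" by (intro mult_left_mono sum_mono) (auto simp: tr_def)
        finally show ?thesis using n by simp
      qed
      then show "AE \<omega> in M. norm \<bar>Et (real K) n \<omega>\<bar> \<le> real K" by simp
    qed (use Et_m[OF n] in auto)
    have rest_avg: "integrable M (\<lambda>\<omega>. 1 / real n * (\<Sum>i=1..n. rest K (\<psi> i \<omega>)))"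
      "expectation (\<lambda>\<omega>. 1 / real n * (\<Sum>i=1..n. rest K (\<psi> i \<omega>))) = expectation (\<lambda>\<omega>. rest K (\<psi> 1 \<omega>))" if n: "n \<ge> 1" for n K
    proof -
      show "integrable M (\<lambda>\<omega>. 1 / real n * (\<Sum>i=1..n. rest K (\<psi> i \<omega>)))"
        by (intro integrable_mult_right Bochner_Integration.integrable_sum rest_int) simp
      have "expectation (\<lambda>\<omega>. 1 / real n * (\<Sum>i=1..n. rest K (\<psi> i \<omega>))) = 1 / real n * (\<Sum>i=1..n. expectation (\<lambda>\<omega>. rest K (\<psi> i \<omega>)))"
        by (subst integral_mult_right_zero, subst Bochner_Integration.integral_sum) (auto intro: rest_int)
      also have "(\<Sum>i=1..n. expectation (\<lambda>\<omega>. rest K (\<psi> i \<omega>))) = (\<Sum>i=1..n. expectation (\<lambda>\<omega>. rest K (\<psi> 1 \<omega>)))"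
        by (intro sum.cong refl rest_int) simp
      finally show "expectation (\<lambda>\<omega>. 1 / real n * (\<Sum>i=1..n. rest K (\<psi> i \<omega>))) = expectation (\<lambda>\<omega>. rest K (\<psi> 1 \<omega>))"
        using n by simp
    qed
    have dom_int: "integrable M (\<lambda>\<omega>. \<bar>Et (real K) n \<omega>\<bar> + 1 / real n * (\<Sum>i=1..n. rest (real K) (\<psi> i \<omega>)))" if "n \<ge> 1" for n K
      by (intro Bochner_Integration.integrable_add Et_int rest_avg that)
    show E_int: "integrable M (E n)" if n: "n \<ge> 1" for n
      by (rule Bochner_Integration.integrable_bound[OF dom_int[OF n, of 0] E_m[OF n]])
         (use dom[OF n, of _ 0] in \<open>auto intro!: AE_I2 order_trans[OF _ abs_ge_self]\<close>)
    show "(\<lambda>n. expectation (\<lambda>\<omega>. \<bar>E n \<omega>\<bar>)) \<longlonglongrightarrow> 0"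
    proof (rule LIMSEQ_I)
      fix e :: real assume e: "e > 0"
      have "eventually (\<lambda>k. expectation (\<lambda>\<omega>. rest (real k) (\<psi> 1 \<omega>)) < e / 2) sequentially"
        by (rule order_tendstoD(2)[OF rest_lim]) (use e in simp)
      then obtain K where K: "expectation (\<lambda>\<omega>. rest (real K) (\<psi> 1 \<omega>)) < e / 2" by (auto dest: eventually_happens)
      have "eventually (\<lambda>n. expectation (\<lambda>\<omega>. norm (Et (real K) n \<omega>)) < e / 2) sequentially"
        by (rule order_tendstoD(2)[OF Et_lim]) (use e in simp)
      with eventually_ge_at_top[of 1] have "eventually (\<lambda>n. expectation (\<lambda>\<omega>. \<bar>E n \<omega>\<bar>) < e) sequentially"
      proof eventually_elim
        case (elim n)
        have "expectation (\<lambda>\<omega>. \<bar>E n \<omega>\<bar>) \<le> expectation (\<lambda>\<omega>. \<bar>Et (real K) n \<omega>\<bar> + 1 / real n * (\<Sum>i=1..n. rest (real K) (\<psi> i \<omega>)))"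
          by (rule integral_mono[OF _ dom_int dom]) (use elim E_int in auto)
        also have "\<dots> = expectation (\<lambda>\<omega>. \<bar>Et (real K) n \<omega>\<bar>) + expectation (\<lambda>\<omega>. rest (real K) (\<psi> 1 \<omega>))"
          by (subst Bochner_Integration.integral_add[OF Et_int rest_avg(1)]) (use elim rest_avg(2) in auto)
        finally show ?case using elim K by simp
      qed
      then show "\<exists>no. \<forall>n\<ge>no. norm (expectation (\<lambda>\<omega>. \<bar>E n \<omega>\<bar>) - 0) < e"
        by (auto simp: eventually_sequentially integral_nonneg)
    qed
  qed
qed

end

subsection \<open>Conditional independence of the outcomes and the design\<close>

lemma gen_by_measurable:
  assumes "f \<in> M \<rightarrow>\<^sub>M N"
  shows "f \<in> gen_by M f N \<rightarrow>\<^sub>M N"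
  unfolding gen_by_def by (rule measurable_vimage_algebra1) (use measurable_space[OF assms] in auto)

lemma subalgebra_gen_by:
  assumes "f \<in> M \<rightarrow>\<^sub>M N"
  shows "subalgebra M (gen_by M f N)"
  using measurable_sets[OF assms] measurable_space[OF assms]
  by (auto simp: subalgebra_def gen_by_def sets_vimage_algebra2)

lemma sets_gen_by:
  assumes "f \<in> M \<rightarrow>\<^sub>M N"
  shows "sets (gen_by M f N) = {f -` A \<inter> space M |A. A \<in> sets N}"
  unfolding gen_by_def by (rule sets_vimage_algebra2) (use measurable_space[OF assms] in auto)

text \<open>Conditional expectation zero, stated through integrals over events. This form involves
  no version chosen up to null sets and passes directly to variables with the same law.\<close>

definition cond_mean_zero :: "'w measure \<Rightarrow> 'w measure \<Rightarrow> ('w \<Rightarrow> real) \<Rightarrow> bool" where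
  "cond_mean_zero M F z \<longleftrightarrow> integrable M z \<and> (\<forall>E\<in>sets F. (\<integral>\<omega>. indicator E \<omega> * z \<omega> \<partial>M) = 0)"

context prob_space
begin

lemma cond_mean_zero_mult:
  fixes B :: "'a \<Rightarrow> real"
  assumes F: "subalgebra M F" and z: "cond_mean_zero M F z"
    and B: "B \<in> borel_measurable F" "\<And>\<omega>. \<omega> \<in> space M \<Longrightarrow> \<bar>B \<omega>\<bar> \<le> c"
  shows "integrable M (\<lambda>\<omega>. B \<omega> * z \<omega>)" "expectation (\<lambda>\<omega>. B \<omega> * z \<omega>) = 0"
proof -
  interpret sigma_finite_subalgebra M F using F by (rule subalgebra_sigma_finite)
  have zi: "integrable M z" using z by (simp add: cond_mean_zero_def)
  note Bm = measurable_from_subalg[OF F B(1)]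
  show int: "integrable M (\<lambda>\<omega>. B \<omega> * z \<omega>)"
  proof (rule Bochner_Integration.integrable_bound)
    show "integrable M (\<lambda>\<omega>. c * z \<omega>)" using zi by simp
    show "AE \<omega> in M. norm (B \<omega> * z \<omega>) \<le> norm (c * z \<omega>)"
      by (intro AE_I2) (simp add: abs_mult mult_right_mono order_trans[OF B(2) abs_ge_self])
  qed (use Bm zi in auto)
  have "AE \<omega> in M. real_cond_exp M F z \<omega> = 0"
  proof (rule real_cond_exp_charact)
    show "set_lebesgue_integral M A z = set_lebesgue_integral M A (\<lambda>_. 0)" if "A \<in> sets F" for A
      using z that unfolding cond_mean_zero_def set_lebesgue_integral_def by simp
  qed (use zi in auto)
  then have "expectation (\<lambda>\<omega>. B \<omega> * real_cond_exp M F z \<omega>) = expectation (\<lambda>_. 0)"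
    by (intro integral_cong_AE) (use Bm in auto)
  then show "expectation (\<lambda>\<omega>. B \<omega> * z \<omega>) = 0"
    using real_cond_exp_intg(2)[OF int B(1)] zi by simp
qed

text \<open>On product events P(X, Y, Z) = P(X, Y) P(Z) = P(X) P(Y) P(Z) = P(X) P(Y, Z). Rectangles
  in \<open>Y\<close> and \<open>Z\<close> are intersection-stable and generate the events of the
  pair.\<close>

lemma indep_set_gen_by_pair:
  assumes X: "X \<in> M \<rightarrow>\<^sub>M S" and Y: "Y \<in> M \<rightarrow>\<^sub>M T" and Z: "Z \<in> M \<rightarrow>\<^sub>M U"
    and XY: "indep_set (sets (gen_by M X S)) (sets (gen_by M Y T))"
    and XYZ: "indep_set (sets (gen_by M (\<lambda>\<omega>. (X \<omega>, Y \<omega>)) (S \<Otimes>\<^sub>M T))) (sets (gen_by M Z U))"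
  shows "indep_set (sets (gen_by M X S)) (sets (gen_by M (\<lambda>\<omega>. (Y \<omega>, Z \<omega>)) (T \<Otimes>\<^sub>M U)))"
proof -
  have XYm: "(\<lambda>\<omega>. (X \<omega>, Y \<omega>)) \<in> M \<rightarrow>\<^sub>M S \<Otimes>\<^sub>M T" and YZm: "(\<lambda>\<omega>. (Y \<omega>, Z \<omega>)) \<in> M \<rightarrow>\<^sub>M T \<Otimes>\<^sub>M U"
    using X Y Z by auto
  define \<A> where "\<A> = {X -` A \<inter> space M |A. A \<in> sets S}"
  define \<B> where "\<B> = {(Y -` B \<inter> space M) \<inter> (Z -` C \<inter> space M) |B C. B \<in> sets T \<and> C \<in> sets U}"
  have ev: "\<A> \<subseteq> events" "\<B> \<subseteq> events"
    using X Y Z by (auto simp: \<A>_def \<B>_def)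
  have p2: "prob ((X -` A \<inter> space M) \<inter> (Y -` B \<inter> space M)) = prob (X -` A \<inter> space M) * prob (Y -` B \<inter> space M)"
    if "A \<in> sets S" "B \<in> sets T" for A B
    by (rule indep_setD[OF XY]) (use that in \<open>auto simp: sets_gen_by[OF X] sets_gen_by[OF Y]\<close>)
  have p3: "prob ((X -` A \<inter> space M) \<inter> (Y -` B \<inter> space M) \<inter> (Z -` C \<inter> space M))
      = prob ((X -` A \<inter> space M) \<inter> (Y -` B \<inter> space M)) * prob (Z -` C \<inter> space M)"
    if "A \<in> sets S" "B \<in> sets T" "C \<in> sets U" for A B C
  proof -
    have AB: "A \<times> B \<in> sets (S \<Otimes>\<^sub>M T)" using that by simp
    have eq: "(X -` A \<inter> space M) \<inter> (Y -` B \<inter> space M) = (\<lambda>\<omega>. (X \<omega>, Y \<omega>)) -` (A \<times> B) \<inter> space M" by auto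
    show ?thesis
    proof (rule indep_setD[OF XYZ])
      show "(X -` A \<inter> space M) \<inter> (Y -` B \<inter> space M) \<in> sets (gen_by M (\<lambda>\<omega>. (X \<omega>, Y \<omega>)) (S \<Otimes>\<^sub>M T))"
        unfolding eq sets_gen_by[OF XYm] using AB by blast
      show "Z -` C \<inter> space M \<in> sets (gen_by M Z U)" unfolding sets_gen_by[OF Z] using that by blast
    qed
  qed
  have p1: "prob ((Y -` B \<inter> space M) \<inter> (Z -` C \<inter> space M)) = prob (Y -` B \<inter> space M) * prob (Z -` C \<inter> space M)"
    if "B \<in> sets T" "C \<in> sets U" for B C
  proof -
    \<comment> \<open>Independence of \<open>Y\<close> and \<open>Z\<close> is the case in which
      \<open>X\<close> is unrestricted.\<close>
    have "X -` space S \<inter> space M = space M" using measurable_space[OF X] by auto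
    moreover have "space M \<inter> (Y -` B \<inter> space M) = Y -` B \<inter> space M" by auto
    ultimately show ?thesis using p3[OF sets.top that] by simp
  qed
  have ind: "indep_set \<A> \<B>"
  proof (rule indep_setI[OF ev])
    fix a b assume "a \<in> \<A>" "b \<in> \<B>"
    then obtain A B C where A: "A \<in> sets S" "a = X -` A \<inter> space M" and BC: "B \<in> sets T" "C \<in> sets U"
      "b = (Y -` B \<inter> space M) \<inter> (Z -` C \<inter> space M)" by (auto simp: \<A>_def \<B>_def)
    have "a \<inter> b = (X -` A \<inter> space M) \<inter> (Y -` B \<inter> space M) \<inter> (Z -` C \<inter> space M)" using A BC by auto
    then show "prob (a \<inter> b) = prob a * prob b"
      using p3[OF A(1) BC(1,2)] p2[OF A(1) BC(1)] p1[OF BC(1,2)] A(2) BC(3) by simp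
  qed
  have stA: "Int_stable \<A>"
  proof (rule Int_stableI)
    fix a b assume "a \<in> \<A>" "b \<in> \<A>"
    then obtain A B where "A \<in> sets S" "B \<in> sets S" "a = X -` A \<inter> space M" "b = X -` B \<inter> space M" by (auto simp: \<A>_def)
    then have "a \<inter> b = X -` (A \<inter> B) \<inter> space M" "A \<inter> B \<in> sets S" by auto
    then show "a \<inter> b \<in> \<A>" unfolding \<A>_def by blast
  qed
  have stB: "Int_stable \<B>"
  proof (rule Int_stableI)
    fix a b assume "a \<in> \<B>" "b \<in> \<B>"
    then obtain A B C D where "A \<in> sets T" "B \<in> sets T" "C \<in> sets U" "D \<in> sets U"
      "a = (Y -` A \<inter> space M) \<inter> (Z -` C \<inter> space M)" "b = (Y -` B \<inter> space M) \<inter> (Z -` D \<inter> space M)" by (auto simp: \<B>_def)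
    then have "a \<inter> b = (Y -` (A \<inter> B) \<inter> space M) \<inter> (Z -` (C \<inter> D) \<inter> space M)" "A \<inter> B \<in> sets T" "C \<inter> D \<in> sets U" by auto
    then show "a \<inter> b \<in> \<B>" unfolding \<B>_def by blast
  qed
  have BP: "\<B> \<subseteq> Pow (space M)" by (auto simp: \<B>_def)
  have "(\<lambda>\<omega>. (Y \<omega>, Z \<omega>)) \<in> sigma (space M) \<B> \<rightarrow>\<^sub>M T \<Otimes>\<^sub>M U"
  proof (rule measurable_Pair)
    show "Y \<in> sigma (space M) \<B> \<rightarrow>\<^sub>M T"
    proof (rule measurableI)
      fix B assume "B \<in> sets T"
      moreover have "Z -` space U \<inter> space M = space M" using measurable_space[OF Z] by auto
      ultimately have "Y -` B \<inter> space M \<in> \<B>" unfolding \<B>_def by blast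
      then show "Y -` B \<inter> space (sigma (space M) \<B>) \<in> sets (sigma (space M) \<B>)" using BP by auto
    qed (use measurable_space[OF Y] BP in auto)
    show "Z \<in> sigma (space M) \<B> \<rightarrow>\<^sub>M U"
    proof (rule measurableI)
      fix C assume "C \<in> sets U"
      moreover have "Y -` space T \<inter> space M = space M" using measurable_space[OF Y] by auto
      ultimately have "Z -` C \<inter> space M \<in> \<B>" unfolding \<B>_def by blast
      then show "Z -` C \<inter> space (sigma (space M) \<B>) \<in> sets (sigma (space M) \<B>)" using BP by auto
    qed (use measurable_space[OF Z] BP in auto)
  qed
  from measurable_sets[OF this] BP
  have "{(\<lambda>\<omega>. (Y \<omega>, Z \<omega>)) -` E \<inter> space M |E. E \<in> sets (T \<Otimes>\<^sub>M U)} \<subseteq> sigma_sets (space M) \<B>" by auto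
  then have sub: "sigma_sets (space M) {(\<lambda>\<omega>. (Y \<omega>, Z \<omega>)) -` E \<inter> space M |E. E \<in> sets (T \<Otimes>\<^sub>M U)} \<subseteq> sigma_sets (space M) \<B>"
    by (rule sigma_sets_mono)
  have "indep_set (sigma_sets (space M) \<A>) (sigma_sets (space M) \<B>)"
    by (rule indep_set_sigma_sets[OF ind stA stB])
  moreover have "sets (gen_by M X S) \<subseteq> sigma_sets (space M) \<A>"
    unfolding sets_gen_by[OF X] \<A>_def by auto
  moreover have "sets (gen_by M (\<lambda>\<omega>. (Y \<omega>, Z \<omega>)) (T \<Otimes>\<^sub>M U)) \<subseteq> sigma_sets (space M) \<B>"
    unfolding sets_gen_by[OF YZm] using sub by auto
  ultimately show ?thesis
    unfolding indep_sets2_eq by blast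
qed

lemma joint_distr_indep_set:
  assumes X: "X \<in> M \<rightarrow>\<^sub>M S" and Y: "Y \<in> M \<rightarrow>\<^sub>M T"
    and XY: "indep_set (sets (gen_by M X S)) (sets (gen_by M Y T))"
  shows "distr M S X \<Otimes>\<^sub>M distr M T Y = distr M (S \<Otimes>\<^sub>M T) (\<lambda>\<omega>. (X \<omega>, Y \<omega>))"
proof (rule pair_measure_eqI)
  interpret DX: prob_space "distr M S X" using X by (rule prob_space_distr)
  interpret DY: prob_space "distr M T Y" using Y by (rule prob_space_distr)
  show "sigma_finite_measure (distr M S X)" "sigma_finite_measure (distr M T Y)" by unfold_locales
  fix A B assume "A \<in> sets (distr M S X)" "B \<in> sets (distr M T Y)"
  then have AB: "A \<in> sets S" "B \<in> sets T" by auto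
  have "prob ((X -` A \<inter> space M) \<inter> (Y -` B \<inter> space M)) = prob (X -` A \<inter> space M) * prob (Y -` B \<inter> space M)"
    by (rule indep_setD[OF XY]) (use AB in \<open>auto simp: sets_gen_by[OF X] sets_gen_by[OF Y]\<close>)
  moreover have "(X -` A \<inter> space M) \<inter> (Y -` B \<inter> space M) = (\<lambda>\<omega>. (X \<omega>, Y \<omega>)) -` (A \<times> B) \<inter> space M" by auto
  ultimately show "emeasure (distr M S X) A * emeasure (distr M T Y) B = emeasure (distr M (S \<Otimes>\<^sub>M T) (\<lambda>\<omega>. (X \<omega>, Y \<omega>))) (A \<times> B)"
    using AB X Y by (simp add: emeasure_distr emeasure_eq_measure ennreal_mult')
qed simp

text \<open>Information independent of \<open>X\<close> does not alter conditional centring. Under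
  the product law \<open>R\<close> can be frozen at \<open>r\<close>; the section of an event at
  \<open>r\<close> is an event of \<open>u (X \<omega>)\<close>, over which \<open>z\<close>
  integrates to zero, and Fubini concludes.\<close>

lemma cond_mean_zero_indep:
  fixes z :: "'b \<Rightarrow> real"
  assumes X: "X \<in> M \<rightarrow>\<^sub>M S" and R: "R \<in> M \<rightarrow>\<^sub>M T"
    and ind: "indep_set (sets (gen_by M X S)) (sets (gen_by M R T))" and u: "u \<in> S \<rightarrow>\<^sub>M U" and zm: "z \<in> borel_measurable S"
    and z: "cond_mean_zero M (gen_by M (\<lambda>\<omega>. u (X \<omega>)) U) (\<lambda>\<omega>. z (X \<omega>))"
  shows "cond_mean_zero M (gen_by M (\<lambda>\<omega>. (u (X \<omega>), R \<omega>)) (U \<Otimes>\<^sub>M T)) (\<lambda>\<omega>. z (X \<omega>))"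
  unfolding cond_mean_zero_def
proof
  have uX: "(\<lambda>\<omega>. u (X \<omega>)) \<in> M \<rightarrow>\<^sub>M U" by (rule measurable_compose[OF X u])
  have uXR: "(\<lambda>\<omega>. (u (X \<omega>), R \<omega>)) \<in> M \<rightarrow>\<^sub>M U \<Otimes>\<^sub>M T" using uX R by simp
  show zi: "integrable M (\<lambda>\<omega>. z (X \<omega>))" using z by (simp add: cond_mean_zero_def)
  interpret DX: prob_space "distr M S X" using X by (rule prob_space_distr)
  interpret DR: prob_space "distr M T R" using R by (rule prob_space_distr)
  interpret P: pair_prob_space "distr M S X" "distr M T R" ..
  have joint: "distr M S X \<Otimes>\<^sub>M distr M T R = distr M (S \<Otimes>\<^sub>M T) (\<lambda>\<omega>. (X \<omega>, R \<omega>))"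
    by (rule joint_distr_indep_set[OF X R ind])
  show "\<forall>E\<in>sets (gen_by M (\<lambda>\<omega>. (u (X \<omega>), R \<omega>)) (U \<Otimes>\<^sub>M T)). expectation (\<lambda>\<omega>. indicator E \<omega> * z (X \<omega>)) = 0"
  proof
    fix E assume "E \<in> sets (gen_by M (\<lambda>\<omega>. (u (X \<omega>), R \<omega>)) (U \<Otimes>\<^sub>M T))"
    then obtain E' where E': "E' \<in> sets (U \<Otimes>\<^sub>M T)" "E = (\<lambda>\<omega>. (u (X \<omega>), R \<omega>)) -` E' \<inter> space M"
      unfolding sets_gen_by[OF uXR] by blast
    define g where "g w r = indicator E' (u w, r) * z w" for w r
    have gm[measurable]: "case_prod g \<in> borel_measurable (S \<Otimes>\<^sub>M T)"
    proof -
      have [measurable]: "E' \<in> sets (U \<Otimes>\<^sub>M T)" "u \<in> S \<rightarrow>\<^sub>M U" "z \<in> borel_measurable S" using E' u zm by auto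
      show ?thesis unfolding g_def case_prod_beta by measurable
    qed
    have Pm: "(\<lambda>\<omega>. (X \<omega>, R \<omega>)) \<in> M \<rightarrow>\<^sub>M S \<Otimes>\<^sub>M T" using X R by simp
    have eq: "indicator E \<omega> * z (X \<omega>) = case_prod g (X \<omega>, R \<omega>)" if "\<omega> \<in> space M" for \<omega>
      using that by (auto simp: g_def E'(2) indicator_def)
    have gi: "integrable (distr M S X \<Otimes>\<^sub>M distr M T R) (case_prod g)"
      unfolding joint
    proof (subst integrable_distr_eq[OF Pm gm])
      show "integrable M (\<lambda>\<omega>. case_prod g (X \<omega>, R \<omega>))"
        by (rule Bochner_Integration.integrable_bound[OF zi measurable_compose[OF Pm gm]])
           (auto simp: g_def indicator_def)
    qed
    have inner: "(\<integral>w. g w r \<partial>distr M S X) = 0" if r: "r \<in> space T" for r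
    proof -
      have sec: "{a \<in> space U. (a, r) \<in> E'} \<in> sets U"
      proof -
        have "{a \<in> space U. (a, r) \<in> E'} = (\<lambda>a. (a, r)) -` E'"
          using sets.sets_into_space[OF E'(1)] by (auto simp: space_pair_measure)
        then show ?thesis using sets_Pair2[OF E'(1), of r] by simp
      qed
      have "(\<integral>w. g w r \<partial>distr M S X) = expectation (\<lambda>\<omega>. g (X \<omega>) r)"
      proof (rule integral_distr[OF X])
        show "(\<lambda>w. g w r) \<in> borel_measurable S"
          using measurable_compose[OF measurable_Pair2'[OF r, of S] gm] by simp
      qed
      also have "\<dots> = expectation (\<lambda>\<omega>. indicator ((\<lambda>\<omega>. u (X \<omega>)) -` {a \<in> space U. (a, r) \<in> E'} \<inter> space M) \<omega> * z (X \<omega>))"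
        by (rule Bochner_Integration.integral_cong[OF refl])
           (use measurable_space[OF uX] in \<open>auto simp: g_def indicator_def\<close>)
      also have "\<dots> = 0" using z sec unfolding cond_mean_zero_def sets_gen_by[OF uX] by blast
      finally show ?thesis .
    qed
    have "expectation (\<lambda>\<omega>. indicator E \<omega> * z (X \<omega>)) = expectation (\<lambda>\<omega>. case_prod g (X \<omega>, R \<omega>))"
      by (rule Bochner_Integration.integral_cong[OF refl eq])
    also have "\<dots> = (\<integral>y. case_prod g y \<partial>(distr M S X \<Otimes>\<^sub>M distr M T R))"
      unfolding joint by (rule integral_distr[OF Pm gm, symmetric])
    also have "\<dots> = (\<integral>r. \<integral>w. g w r \<partial>distr M S X \<partial>distr M T R)"
      by (rule P.integral_snd[OF gi, symmetric])
    also have "\<dots> = (\<integral>r. 0 \<partial>distr M T R)"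
      by (rule Bochner_Integration.integral_cong[OF refl]) (simp add: inner)
    finally show "expectation (\<lambda>\<omega>. indicator E \<omega> * z (X \<omega>)) = 0" by simp
  qed
qed

end

text \<open>The data triples carry the Borel algebra of the product topology, so projections are
  measurable by continuity.\<close>

lemma measurable_fst_borel: "fst \<in> borel \<rightarrow>\<^sub>M (borel :: 'a::topological_space measure)"
  by (rule borel_measurable_continuous_onI) (rule continuous_on_fst[OF continuous_on_id])

lemma measurable_vec_component:
  assumes "(\<lambda>\<omega>. \<lambda>i\<in>I. X i \<omega>) \<in> F \<rightarrow>\<^sub>M PiM I K" "j \<in> I"
  shows "X j \<in> F \<rightarrow>\<^sub>M K j"
proof -
  have "(\<lambda>\<omega>. (\<lambda>i\<in>I. X i \<omega>) j) \<in> F \<rightarrow>\<^sub>M K j"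
    by (rule measurable_compose[OF assms(1) measurable_component_singleton[OF assms(2)]])
  then show ?thesis using assms(2) by simp
qed

lemma sets_gen_by_mono:
  assumes f: "f \<in> F \<rightarrow>\<^sub>M N" and F: "subalgebra M F"
  shows "sets (gen_by M f N) \<subseteq> sets F"
  using measurable_sets[OF f] F
  by (auto simp: sets_gen_by[OF measurable_from_subalg[OF F f]] subalgebra_def)

section \<open>The two-stage experiment: sampling followed by assignment\<close>

locale local_randomization = prob_space M for M :: "'w measure" +
  fixes \<psi> :: "nat \<Rightarrow> 'w \<Rightarrow> 'a::euclidean_space"
    and Y0 Y1 :: "nat \<Rightarrow> 'w \<Rightarrow> real"
    and W :: "nat \<Rightarrow> 'w \<Rightarrow> 'a \<times> real \<times> real"
    and N :: "nat \<Rightarrow> 'r measure"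
    and rnd :: "nat \<Rightarrow> 'w \<Rightarrow> 'r"
    and q p :: "'a \<Rightarrow> real"
    and lev_q lev_p :: "(nat \<times> nat) set"
    and T D :: "nat \<Rightarrow> nat \<Rightarrow> 'w \<Rightarrow> bool"
  assumes W_def: "\<And>i \<omega>. W i \<omega> = (\<psi> i \<omega>, Y0 i \<omega>, Y1 i \<omega>)"
    and W_indep: "indep_vars (\<lambda>_. borel) W {1..}"
    and W_ident: "\<And>i. i \<ge> 1 \<Longrightarrow> distr M borel (W i) = distr M borel (W 1)"
    and Y0_square: "integrable M (\<lambda>\<omega>. (Y0 1 \<omega>)\<^sup>2)" and Y1_square: "integrable M (\<lambda>\<omega>. (Y1 1 \<omega>)\<^sup>2)"
    and rnd_meas: "\<And>n. n \<ge> 1 \<Longrightarrow> rnd n \<in> M \<rightarrow>\<^sub>M N n"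
    and rnd_indep: "\<And>n. n \<ge> 1 \<Longrightarrow>
           indep_set (sets (gen_by M (vec_upto n W) (borel_upto n))) (sets (gen_by M (rnd n) (N n)))"
    and lev_q: "propensity_levels q lev_q"
    and lev_p: "propensity_levels p lev_p" and p_range: "\<And>x. p x \<in> {0<..<1}"
    and T_meas: "\<And>n i. i \<in> {1..n} \<Longrightarrow> T n i \<in> M \<rightarrow>\<^sub>M count_space UNIV"
    and D_meas: "\<And>n i. i \<in> {1..n} \<Longrightarrow> D n i \<in> M \<rightarrow>\<^sub>M count_space UNIV"
    and sampling: "Loc_sampling M W rnd N q lev_q T"
    and assignment: "Loc_assignment M W rnd N T p lev_p D"
begin

lemma fst_W: "fst (W i \<omega>) = \<psi> i \<omega>"
  by (simp add: W_def)

lemma W_meas: "i \<ge> 1 \<Longrightarrow> W i \<in> borel_measurable M"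
  using W_indep by (auto simp: indep_vars_def)

lemma \<psi>_of_W: "W i \<in> borel_measurable F \<Longrightarrow> \<psi> i \<in> borel_measurable F"
  using measurable_compose[OF _ measurable_fst_borel, of "W i" F] by (simp add: fst_W)

lemma vec_W_meas: "vec_upto n W \<in> M \<rightarrow>\<^sub>M borel_upto n"
  by (rule measurable_restrict) (use W_meas in auto)

lemma vec_T_meas: "vec_upto n (T n) \<in> M \<rightarrow>\<^sub>M bool_upto n"
  by (rule measurable_restrict) (use T_meas in auto)

definition F_W :: "nat \<Rightarrow> 'w measure" where
  "F_W n = gen_by M (\<lambda>\<omega>. (vec_upto n W \<omega>, rnd n \<omega>)) (borel_upto n \<Otimes>\<^sub>M N n)"

definition F_WT :: "nat \<Rightarrow> 'w measure" where
  "F_WT n = gen_by M (\<lambda>\<omega>. (vec_upto n W \<omega>, rnd n \<omega>, vec_upto n (T n) \<omega>)) (borel_upto n \<Otimes>\<^sub>M N n \<Otimes>\<^sub>M bool_upto n)"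

lemma info_W: "n \<ge> 1 \<Longrightarrow> (\<lambda>\<omega>. (vec_upto n W \<omega>, rnd n \<omega>)) \<in> M \<rightarrow>\<^sub>M borel_upto n \<Otimes>\<^sub>M N n"
  using vec_W_meas rnd_meas by (intro measurable_Pair)

lemma info_WT: "n \<ge> 1 \<Longrightarrow> (\<lambda>\<omega>. (vec_upto n W \<omega>, rnd n \<omega>, vec_upto n (T n) \<omega>)) \<in> M \<rightarrow>\<^sub>M borel_upto n \<Otimes>\<^sub>M N n \<Otimes>\<^sub>M bool_upto n"
  using vec_W_meas rnd_meas vec_T_meas by (intro measurable_Pair)

lemma F_W_meas:
  assumes n: "n \<ge> 1"
  shows "rnd n \<in> F_W n \<rightarrow>\<^sub>M N n" "j \<in> {1..n} \<Longrightarrow> W j \<in> borel_measurable (F_W n)"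
    "j \<in> {1..n} \<Longrightarrow> \<psi> j \<in> borel_measurable (F_W n)"
proof -
  note t = gen_by_measurable[OF info_W[OF n], folded F_W_def]
  show "rnd n \<in> F_W n \<rightarrow>\<^sub>M N n" using measurable_compose[OF t measurable_snd] by simp
  have "vec_upto n W \<in> F_W n \<rightarrow>\<^sub>M borel_upto n" using measurable_compose[OF t measurable_fst] by simp
  from measurable_vec_component[OF this] show "j \<in> {1..n} \<Longrightarrow> W j \<in> borel_measurable (F_W n)" .
  then show "j \<in> {1..n} \<Longrightarrow> \<psi> j \<in> borel_measurable (F_W n)" by (rule \<psi>_of_W)
qed

lemma F_WT_meas:
  assumes n: "n \<ge> 1"
  shows "rnd n \<in> F_WT n \<rightarrow>\<^sub>M N n" "j \<in> {1..n} \<Longrightarrow> W j \<in> borel_measurable (F_WT n)"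
    "j \<in> {1..n} \<Longrightarrow> \<psi> j \<in> borel_measurable (F_WT n)" "j \<in> {1..n} \<Longrightarrow> T n j \<in> F_WT n \<rightarrow>\<^sub>M count_space UNIV"
proof -
  note t = gen_by_measurable[OF info_WT[OF n], folded F_WT_def]
  show "rnd n \<in> F_WT n \<rightarrow>\<^sub>M N n"
    using measurable_compose[OF measurable_compose[OF t measurable_snd] measurable_fst] by simp
  have "vec_upto n W \<in> F_WT n \<rightarrow>\<^sub>M borel_upto n" using measurable_compose[OF t measurable_fst] by simp
  from measurable_vec_component[OF this] show "j \<in> {1..n} \<Longrightarrow> W j \<in> borel_measurable (F_WT n)" .
  then show "j \<in> {1..n} \<Longrightarrow> \<psi> j \<in> borel_measurable (F_WT n)" by (rule \<psi>_of_W)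
  have "vec_upto n (T n) \<in> F_WT n \<rightarrow>\<^sub>M bool_upto n"
    using measurable_compose[OF measurable_compose[OF t measurable_snd] measurable_snd] by simp
  from measurable_vec_component[OF this] show "j \<in> {1..n} \<Longrightarrow> T n j \<in> F_WT n \<rightarrow>\<^sub>M count_space UNIV" .
qed

lemma \<psi>_distr: "i \<ge> 1 \<Longrightarrow> distr M borel (\<psi> i) = distr M borel (\<psi> 1)"
proof -
  have eq: "distr M borel (\<psi> i) = distr (distr M borel (W i)) borel fst" if "i \<ge> 1" for i
    using W_meas[OF that] measurable_fst_borel by (subst distr_distr) (auto simp: comp_def fst_W[abs_def])
  assume i: "i \<ge> 1"
  show "distr M borel (\<psi> i) = distr M borel (\<psi> 1)"
    unfolding eq[OF i] eq[OF order_refl] W_ident[OF i] ..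
qed

sublocale samp: randomized_scheme M "\<lambda>n \<omega>. {1..n}" "\<lambda>n \<omega>. (vec_upto n \<psi> \<omega>, rnd n \<omega>)"
  "\<lambda>n. borel_upto n \<Otimes>\<^sub>M N n" "\<lambda>n \<omega>. (vec_upto n W \<omega>, rnd n \<omega>)" "\<lambda>n. borel_upto n \<Otimes>\<^sub>M N n" \<psi> q lev_q T
proof
  show "locally_randomized M (\<lambda>n \<omega>. {1..n}) (\<lambda>n \<omega>. (vec_upto n \<psi> \<omega>, rnd n \<omega>))
    (\<lambda>n. borel_upto n \<Otimes>\<^sub>M N n) (\<lambda>n \<omega>. (vec_upto n W \<omega>, rnd n \<omega>)) (\<lambda>n. borel_upto n \<Otimes>\<^sub>M N n) \<psi> q lev_q T"
    using sampling unfolding Loc_sampling_def fst_W .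
  show "(\<lambda>\<omega>. (vec_upto n \<psi> \<omega>, rnd n \<omega>)) \<in> gen_by M (\<lambda>\<omega>. (vec_upto n W \<omega>, rnd n \<omega>)) (borel_upto n \<Otimes>\<^sub>M N n) \<rightarrow>\<^sub>M borel_upto n \<Otimes>\<^sub>M N n"
    if n: "n \<ge> 1" for n
    unfolding F_W_def[symmetric] by (intro measurable_Pair measurable_restrict F_W_meas[OF n])
  show "\<psi> i \<in> borel_measurable (gen_by M (\<lambda>\<omega>. (vec_upto n W \<omega>, rnd n \<omega>)) (borel_upto n \<Otimes>\<^sub>M N n))"
    if "i \<in> {1..n}" for n i
    unfolding F_W_def[symmetric] using that by (intro F_W_meas) auto
  show "distr M borel (\<psi> i) = distr M borel (\<psi> 1)" if "i \<ge> 1" for i by (rule \<psi>_distr[OF that])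
qed (use lev_q info_W T_meas in auto)

sublocale assg: randomized_scheme M "\<lambda>n \<omega>. {i \<in> {1..n}. T n i \<omega>}" "\<lambda>n \<omega>. (vec_upto n \<psi> \<omega>, vec_upto n (T n) \<omega>, rnd n \<omega>)"
  "\<lambda>n. borel_upto n \<Otimes>\<^sub>M bool_upto n \<Otimes>\<^sub>M N n" "\<lambda>n \<omega>. (vec_upto n W \<omega>, rnd n \<omega>, vec_upto n (T n) \<omega>)"
  "\<lambda>n. borel_upto n \<Otimes>\<^sub>M N n \<Otimes>\<^sub>M bool_upto n" \<psi> p lev_p D
proof
  show "locally_randomized M (\<lambda>n \<omega>. {i \<in> {1..n}. T n i \<omega>}) (\<lambda>n \<omega>. (vec_upto n \<psi> \<omega>, vec_upto n (T n) \<omega>, rnd n \<omega>))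
    (\<lambda>n. borel_upto n \<Otimes>\<^sub>M bool_upto n \<Otimes>\<^sub>M N n) (\<lambda>n \<omega>. (vec_upto n W \<omega>, rnd n \<omega>, vec_upto n (T n) \<omega>))
    (\<lambda>n. borel_upto n \<Otimes>\<^sub>M N n \<Otimes>\<^sub>M bool_upto n) \<psi> p lev_p D"
    using assignment unfolding Loc_assignment_def fst_W .
  show "(\<lambda>\<omega>. (vec_upto n \<psi> \<omega>, vec_upto n (T n) \<omega>, rnd n \<omega>)) \<in> gen_by M (\<lambda>\<omega>. (vec_upto n W \<omega>, rnd n \<omega>, vec_upto n (T n) \<omega>))
      (borel_upto n \<Otimes>\<^sub>M N n \<Otimes>\<^sub>M bool_upto n) \<rightarrow>\<^sub>M borel_upto n \<Otimes>\<^sub>M bool_upto n \<Otimes>\<^sub>M N n"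
    if n: "n \<ge> 1" for n
    unfolding F_WT_def[symmetric] by (intro measurable_Pair measurable_restrict F_WT_meas[OF n])
  show "\<psi> i \<in> borel_measurable (gen_by M (\<lambda>\<omega>. (vec_upto n W \<omega>, rnd n \<omega>, vec_upto n (T n) \<omega>)) (borel_upto n \<Otimes>\<^sub>M N n \<Otimes>\<^sub>M bool_upto n))"
    if "i \<in> {1..n}" for n i
    unfolding F_WT_def[symmetric] using that by (intro F_WT_meas) auto
  show "distr M borel (\<psi> i) = distr M borel (\<psi> 1)" if "i \<ge> 1" for i by (rule \<psi>_distr[OF that])
qed (use lev_p info_WT D_meas in auto)

section \<open>Withholding the outcomes of one unit\<close>

text \<open>Together with the triple of unit \<open>i\<close> this is all the randomness that
  precedes the design.\<close>

definition rest :: "nat \<Rightarrow> nat \<Rightarrow> 'w \<Rightarrow> (nat \<Rightarrow> 'a \<times> real \<times> real) \<times> 'r" where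
  "rest n i \<omega> = ((\<lambda>j\<in>{1..n} - {i}. W j \<omega>), rnd n \<omega>)"

abbreviation rest_space :: "nat \<Rightarrow> nat \<Rightarrow> ((nat \<Rightarrow> 'a \<times> real \<times> real) \<times> 'r) measure" where
  "rest_space n i \<equiv> PiM ({1..n} - {i}) (\<lambda>_. borel) \<Otimes>\<^sub>M N n"

text \<open>The assignment scheme says nothing about \<open>D\<close> for units that are not
  sampled. The conjunction erases that part, so that the conditional law of the states is determined
  by the two group designs.\<close>

definition states :: "nat \<Rightarrow> 'w \<Rightarrow> (nat \<Rightarrow> bool) \<times> (nat \<Rightarrow> bool)" where
  "states n \<omega> = (\<lambda>j\<in>{1..n}. T n j \<omega>, \<lambda>j\<in>{1..n}. T n j \<omega> \<and> D n j \<omega>)"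

definition F_rest :: "nat \<Rightarrow> nat \<Rightarrow> 'w measure" where
  "F_rest n i = gen_by M (\<lambda>\<omega>. (\<psi> i \<omega>, rest n i \<omega>)) (borel \<Otimes>\<^sub>M rest_space n i)"

text \<open>Outcomes of the other units are included because their factors are frozen when unit
  \<open>i\<close> is exchanged; of unit \<open>i\<close> only the covariate is kept.\<close>

definition F_design :: "nat \<Rightarrow> nat \<Rightarrow> 'w measure" where
  "F_design n i = gen_by M (\<lambda>\<omega>. ((\<psi> i \<omega>, rest n i \<omega>), states n \<omega>))
     ((borel \<Otimes>\<^sub>M rest_space n i) \<Otimes>\<^sub>M (bool_upto n \<Otimes>\<^sub>M bool_upto n))"

context
  fixes n i :: nat
  assumes i: "i \<in> {1..n}"
begin

lemma n_pos: "n \<ge> 1"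
  using i by simp

lemma rest_meas: "rest n i \<in> M \<rightarrow>\<^sub>M rest_space n i"
  unfolding rest_def by (intro measurable_Pair measurable_restrict rnd_meas n_pos W_meas) auto

lemma states_meas: "states n \<in> M \<rightarrow>\<^sub>M bool_upto n \<Otimes>\<^sub>M bool_upto n"
proof -
  have "(\<lambda>\<omega>. T n j \<omega> \<and> D n j \<omega>) \<in> M \<rightarrow>\<^sub>M count_space UNIV" if "j \<in> {1..n}" for j
    using T_meas[OF that] D_meas[OF that] by measurable
  then show ?thesis unfolding states_def by (intro measurable_Pair measurable_restrict T_meas)
qed

lemma \<psi>_rest_meas: "(\<lambda>\<omega>. (\<psi> i \<omega>, rest n i \<omega>)) \<in> M \<rightarrow>\<^sub>M borel \<Otimes>\<^sub>M rest_space n i"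
  by (intro measurable_Pair rest_meas \<psi>_of_W W_meas) (use i in auto)

lemma design_meas: "(\<lambda>\<omega>. ((\<psi> i \<omega>, rest n i \<omega>), states n \<omega>))
    \<in> M \<rightarrow>\<^sub>M (borel \<Otimes>\<^sub>M rest_space n i) \<Otimes>\<^sub>M (bool_upto n \<Otimes>\<^sub>M bool_upto n)"
  by (intro measurable_Pair[OF \<psi>_rest_meas states_meas])

lemma subalgebra_F_rest: "subalgebra M (F_rest n i)"
  unfolding F_rest_def by (rule subalgebra_gen_by[OF \<psi>_rest_meas])

lemma subalgebra_F_design: "subalgebra M (F_design n i)"
  unfolding F_design_def by (rule subalgebra_gen_by[OF design_meas])

lemma rest_components:
  assumes r: "(\<lambda>\<omega>. (\<psi> i \<omega>, rest n i \<omega>)) \<in> F \<rightarrow>\<^sub>M borel \<Otimes>\<^sub>M rest_space n i"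
  shows "rnd n \<in> F \<rightarrow>\<^sub>M N n" "j \<in> {1..n} - {i} \<Longrightarrow> W j \<in> borel_measurable F"
    "j \<in> {1..n} \<Longrightarrow> \<psi> j \<in> borel_measurable F"
proof -
  have \<psi>i: "\<psi> i \<in> borel_measurable F" using measurable_compose[OF r measurable_fst] by simp
  have "rest n i \<in> F \<rightarrow>\<^sub>M rest_space n i" using measurable_compose[OF r measurable_snd] by simp
  note rest = this[unfolded rest_def]
  show "rnd n \<in> F \<rightarrow>\<^sub>M N n" using measurable_compose[OF rest measurable_snd] by simp
  have "(\<lambda>\<omega>. \<lambda>j\<in>{1..n} - {i}. W j \<omega>) \<in> F \<rightarrow>\<^sub>M PiM ({1..n} - {i}) (\<lambda>_. borel)"
    using measurable_compose[OF rest measurable_fst] by simp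
  from measurable_vec_component[OF this] show W: "j \<in> {1..n} - {i} \<Longrightarrow> W j \<in> borel_measurable F" for j .
  show "j \<in> {1..n} \<Longrightarrow> \<psi> j \<in> borel_measurable F"
    using \<psi>i \<psi>_of_W[OF W[of j]] by (cases "j = i") auto
qed

lemmas F_rest_meas = rest_components[OF gen_by_measurable[OF \<psi>_rest_meas, folded F_rest_def]]

lemma F_design_meas:
  shows "j \<in> {1..n} - {i} \<Longrightarrow> W j \<in> borel_measurable (F_design n i)"
    and "j \<in> {1..n} \<Longrightarrow> \<psi> j \<in> borel_measurable (F_design n i)"
    and "j \<in> {1..n} \<Longrightarrow> T n j \<in> F_design n i \<rightarrow>\<^sub>M count_space UNIV"
    and "j \<in> {1..n} \<Longrightarrow> (\<lambda>\<omega>. T n j \<omega> \<and> D n j \<omega>) \<in> F_design n i \<rightarrow>\<^sub>M count_space UNIV"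
proof -
  note t = gen_by_measurable[OF design_meas, folded F_design_def]
  have "(\<lambda>\<omega>. (\<psi> i \<omega>, rest n i \<omega>)) \<in> F_design n i \<rightarrow>\<^sub>M borel \<Otimes>\<^sub>M rest_space n i"
    using measurable_compose[OF t measurable_fst] by simp
  note r = rest_components(2,3)[OF this]
  show "j \<in> {1..n} - {i} \<Longrightarrow> W j \<in> borel_measurable (F_design n i)" by (rule r(1))
  show "j \<in> {1..n} \<Longrightarrow> \<psi> j \<in> borel_measurable (F_design n i)" by (rule r(2))
  have states: "states n \<in> F_design n i \<rightarrow>\<^sub>M bool_upto n \<Otimes>\<^sub>M bool_upto n"
    using measurable_compose[OF t measurable_snd] by simp
  note s = states[unfolded states_def]
  have "vec_upto n (T n) \<in> F_design n i \<rightarrow>\<^sub>M bool_upto n"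
    using measurable_compose[OF s measurable_fst] by simp
  from measurable_vec_component[OF this]
  show "j \<in> {1..n} \<Longrightarrow> T n j \<in> F_design n i \<rightarrow>\<^sub>M count_space UNIV" .
  have "(\<lambda>\<omega>. \<lambda>j\<in>{1..n}. T n j \<omega> \<and> D n j \<omega>) \<in> F_design n i \<rightarrow>\<^sub>M bool_upto n"
    using measurable_compose[OF s measurable_snd] by simp
  from measurable_vec_component[OF this]
  show "j \<in> {1..n} \<Longrightarrow> (\<lambda>\<omega>. T n j \<omega> \<and> D n j \<omega>) \<in> F_design n i \<rightarrow>\<^sub>M count_space UNIV" .
qed

text \<open>Unit \<open>i\<close> is independent of the other units, and all units jointly are
  independent of the tie-breaker. Both facts are combined by regrouping three variables.\<close>

lemma W_indep_rest: "indep_set (sets (gen_by M (W i) borel)) (sets (gen_by M (rest n i) (rest_space n i)))"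
proof -
  let ?J = "{1..n} - {i}"
  have Wi: "W i \<in> M \<rightarrow>\<^sub>M borel" using i W_meas by auto
  have WJ: "(\<lambda>\<omega>. \<lambda>j\<in>?J. W j \<omega>) \<in> M \<rightarrow>\<^sub>M PiM ?J (\<lambda>_. borel)" by (intro measurable_restrict W_meas) auto
  have "indep_var (PiM {i} (\<lambda>_. borel)) (\<lambda>\<omega>. \<lambda>j\<in>{i}. W j \<omega>) (PiM ?J (\<lambda>_. borel)) (\<lambda>\<omega>. \<lambda>j\<in>?J. W j \<omega>)"
    by (rule indep_var_restrict[OF W_indep]) (use i in auto)
  then have "indep_set (sigma_sets (space M) {(\<lambda>\<omega>. \<lambda>j\<in>{i}. W j \<omega>) -` A \<inter> space M |A. A \<in> sets (PiM {i} (\<lambda>_. borel))})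
      (sigma_sets (space M) {(\<lambda>\<omega>. \<lambda>j\<in>?J. W j \<omega>) -` A \<inter> space M |A. A \<in> sets (PiM ?J (\<lambda>_. borel))})"
    unfolding indep_var_eq by blast
  \<comment> \<open>The independence rule speaks of functions on the singleton \<open>{i}\<close>;
    evaluation at \<open>i\<close> identifies them with \<open>W i\<close>.\<close>
  moreover have "sets (gen_by M (W i) borel)
      \<subseteq> sigma_sets (space M) {(\<lambda>\<omega>. \<lambda>j\<in>{i}. W j \<omega>) -` A \<inter> space M |A. A \<in> sets (PiM {i} (\<lambda>_. borel))}"
  proof
    fix E assume "E \<in> sets (gen_by M (W i) borel)"
    then obtain A where A: "A \<in> sets borel" "E = W i -` A \<inter> space M" unfolding sets_gen_by[OF Wi] by blast
    have "(\<lambda>v. v i) -` A \<inter> space (PiM {i} (\<lambda>_. borel)) \<in> sets (PiM {i} (\<lambda>_. borel))"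
      using measurable_component_singleton[of i "{i}" "\<lambda>_. borel"] A(1) by (intro measurable_sets) auto
    moreover have "E = (\<lambda>\<omega>. \<lambda>j\<in>{i}. W j \<omega>) -` ((\<lambda>v. v i) -` A \<inter> space (PiM {i} (\<lambda>_. borel))) \<inter> space M"
      unfolding A(2) by (auto simp: space_PiM)
    ultimately show "E \<in> sigma_sets (space M) {(\<lambda>\<omega>. \<lambda>j\<in>{i}. W j \<omega>) -` A \<inter> space M |A. A \<in> sets (PiM {i} (\<lambda>_. borel))}"
      by (intro sigma_sets.Basic) blast
  qed
  moreover have "sets (gen_by M (\<lambda>\<omega>. \<lambda>j\<in>?J. W j \<omega>) (PiM ?J (\<lambda>_. borel)))
      \<subseteq> sigma_sets (space M) {(\<lambda>\<omega>. \<lambda>j\<in>?J. W j \<omega>) -` A \<inter> space M |A. A \<in> sets (PiM ?J (\<lambda>_. borel))}"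
    unfolding sets_gen_by[OF WJ] by auto
  ultimately have 1: "indep_set (sets (gen_by M (W i) borel)) (sets (gen_by M (\<lambda>\<omega>. \<lambda>j\<in>?J. W j \<omega>) (PiM ?J (\<lambda>_. borel))))"
    unfolding indep_sets2_eq by blast
  have "sets (gen_by M (\<lambda>\<omega>. (W i \<omega>, \<lambda>j\<in>?J. W j \<omega>)) (borel \<Otimes>\<^sub>M PiM ?J (\<lambda>_. borel)))
      \<subseteq> sets (gen_by M (vec_upto n W) (borel_upto n))"
  proof (rule sets_gen_by_mono[OF _ subalgebra_gen_by[OF vec_W_meas]])
    note c = measurable_vec_component[OF gen_by_measurable[OF vec_W_meas]]
    show "(\<lambda>\<omega>. (W i \<omega>, \<lambda>j\<in>?J. W j \<omega>)) \<in> gen_by M (vec_upto n W) (borel_upto n) \<rightarrow>\<^sub>M borel \<Otimes>\<^sub>M PiM ?J (\<lambda>_. borel)"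
      by (intro measurable_Pair measurable_restrict c) (use i in auto)
  qed
  then have 2: "indep_set (sets (gen_by M (\<lambda>\<omega>. (W i \<omega>, \<lambda>j\<in>?J. W j \<omega>)) (borel \<Otimes>\<^sub>M PiM ?J (\<lambda>_. borel))))
      (sets (gen_by M (rnd n) (N n)))"
    using rnd_indep[OF n_pos] unfolding indep_sets2_eq by blast
  show ?thesis
    unfolding rest_def by (rule indep_set_gen_by_pair[OF Wi WJ rnd_meas[OF n_pos] 1 2])
qed

text \<open>The hypothesis on unit 1 is carried to unit \<open>i\<close> by equality of laws, and
  then the independent remaining data are added to the conditioning.\<close>

lemma cond_mean_zero_rest:
  assumes zm: "z \<in> borel_measurable borel"
    and z: "cond_mean_zero M (gen_by M (\<psi> 1) borel) (\<lambda>\<omega>. z (W 1 \<omega>))"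
  shows "cond_mean_zero M (F_rest n i) (\<lambda>\<omega>. z (W i \<omega>))"
proof -
  have i1: "i \<ge> 1" using i by simp
  note d = distr_eq_integral[OF W_meas[OF i1] W_meas[OF order_refl] _ W_ident[OF i1]]
  have \<psi>m: "\<psi> j \<in> borel_measurable M" if "j \<ge> 1" for j using W_meas[OF that] by (rule \<psi>_of_W)
  have "cond_mean_zero M (gen_by M (\<psi> i) borel) (\<lambda>\<omega>. z (W i \<omega>))"
    unfolding cond_mean_zero_def
  proof
    show "integrable M (\<lambda>\<omega>. z (W i \<omega>))" using z d(1)[OF zm] by (simp add: cond_mean_zero_def)
    show "\<forall>E\<in>sets (gen_by M (\<psi> i) borel). expectation (\<lambda>\<omega>. indicator E \<omega> * z (W i \<omega>)) = 0"
    proof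
      fix E assume "E \<in> sets (gen_by M (\<psi> i) borel)"
      then obtain A where A: "A \<in> sets borel" "E = \<psi> i -` A \<inter> space M" unfolding sets_gen_by[OF \<psi>m[OF i1]] by blast
      have e: "expectation (\<lambda>\<omega>. indicator (\<psi> j -` A \<inter> space M) \<omega> * z (W j \<omega>)) = expectation (\<lambda>\<omega>. indicator A (fst (W j \<omega>)) * z (W j \<omega>))" for j
        by (rule Bochner_Integration.integral_cong) (auto simp: indicator_def fst_W)
      have "(\<lambda>w. indicator A (fst w) * z w) \<in> borel_measurable borel"
        by (intro borel_measurable_times zm measurable_compose[OF measurable_fst_borel]) (use A in auto)
      from d(2)[OF this] have "expectation (\<lambda>\<omega>. indicator E \<omega> * z (W i \<omega>)) = expectation (\<lambda>\<omega>. indicator (\<psi> 1 -` A \<inter> space M) \<omega> * z (W 1 \<omega>))"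
        unfolding A(2) e .
      moreover have "\<psi> 1 -` A \<inter> space M \<in> sets (gen_by M (\<psi> 1) borel)"
        unfolding sets_gen_by[OF \<psi>m[OF order_refl]] using A(1) by blast
      ultimately show "expectation (\<lambda>\<omega>. indicator E \<omega> * z (W i \<omega>)) = 0"
        using z unfolding cond_mean_zero_def by simp
    qed
  qed
  then have "cond_mean_zero M (gen_by M (\<lambda>\<omega>. fst (W i \<omega>)) borel) (\<lambda>\<omega>. z (W i \<omega>))" by (simp add: fst_W[abs_def])
  from cond_mean_zero_indep[OF W_meas[OF i1] rest_meas W_indep_rest measurable_fst_borel zm this]
  show ?thesis unfolding F_rest_def fst_W .
qed

text \<open>The sampling and treatment states of all units carry no further information on the outcomes
  of unit \<open>i\<close>: their conditional probabilities depend on the data only through the covariates. A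
  fixed vector \<open>t\<close> is substituted for the realised sampling states in the map that defines the
  assignment groups. Where the two differ, its value need not be a partition, which explains the
  guard around \<open>assign_prob\<close>.\<close>

lemma cond_mean_zero_design:
  assumes zm: "z \<in> borel_measurable borel"
    and z: "cond_mean_zero M (gen_by M (\<psi> 1) borel) (\<lambda>\<omega>. z (W 1 \<omega>))"
  shows "cond_mean_zero M (F_design n i) (\<lambda>\<omega>. z (W i \<omega>))"
  unfolding cond_mean_zero_def
proof
  note zr = cond_mean_zero_rest[OF assms]
  show zi: "integrable M (\<lambda>\<omega>. z (W i \<omega>))" using zr by (simp add: cond_mean_zero_def)
  define V where "V = ({1..n} \<rightarrow>\<^sub>E (UNIV :: bool set))"
  have finV: "finite V" by (auto simp: V_def intro!: finite_PiE)
  obtain hT GT where hT: "\<And>n. n \<ge> 1 \<Longrightarrow> hT n \<in> borel_upto n \<Otimes>\<^sub>M N n \<rightarrow>\<^sub>M count_space UNIV"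
    and GT: "\<And>n \<omega>. n \<ge> 1 \<Longrightarrow> \<omega> \<in> space M \<Longrightarrow> GT n \<omega> = hT n (vec_upto n \<psi> \<omega>, rnd n \<omega>)"
    and gT: "\<And>n. n \<ge> 1 \<Longrightarrow> randomized_groups M (F_W n) n q lev_q \<psi> (\<lambda>\<omega>. {1..n}) (GT n) (T n)"
    unfolding F_W_def by (rule samp.groups_obtain) blast
  obtain hD GD where hD: "\<And>n. n \<ge> 1 \<Longrightarrow> hD n \<in> borel_upto n \<Otimes>\<^sub>M bool_upto n \<Otimes>\<^sub>M N n \<rightarrow>\<^sub>M count_space UNIV"
    and GD: "\<And>n \<omega>. n \<ge> 1 \<Longrightarrow> \<omega> \<in> space M \<Longrightarrow> GD n \<omega> = hD n (vec_upto n \<psi> \<omega>, vec_upto n (T n) \<omega>, rnd n \<omega>)"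
    and gD: "\<And>n. n \<ge> 1 \<Longrightarrow> randomized_groups M (F_WT n) n p lev_p \<psi> (\<lambda>\<omega>. {i \<in> {1..n}. T n i \<omega>}) (GD n) (D n)"
    unfolding F_WT_def by (rule assg.groups_obtain) blast
  have F_W: "subalgebra M (F_W n)" and F_WT: "subalgebra M (F_WT n)"
    unfolding F_W_def F_WT_def using info_W[OF n_pos] info_WT[OF n_pos] by (auto intro: subalgebra_gen_by)
  have key: "expectation (\<lambda>\<omega>. of_bool (states n \<omega> = (t, d)) * (indicator E (\<psi> i \<omega>, rest n i \<omega>) * z (W i \<omega>))) = 0"
    if t: "t \<in> V" and d: "d \<in> V" and E: "E \<in> sets (borel \<Otimes>\<^sub>M rest_space n i)" for t d E
  \<comment> \<open>A unit treated but not sampled cannot occur in \<open>states\<close>. Otherwise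
    agreement with \<open>d\<close> is automatic off the sample once the sampling states equal
    \<open>t\<close>, which leaves exactly the grouped units to be compared.\<close>
  proof (cases "\<exists>j\<in>{1..n}. d j \<and> \<not> t j")
    case True
    then have "states n \<omega> \<noteq> (t, d)" for \<omega> by (auto simp: states_def dest: fun_cong)
    then show ?thesis by simp
  next
    case False
    have states_eq: "states n \<omega> = (t, d) \<longleftrightarrow> (\<forall>j\<in>{1..n}. T n j \<omega> = t j) \<and> (\<forall>j\<in>{j\<in>{1..n}. T n j \<omega>}. D n j \<omega> = d j)" for \<omega>
    proof
      assume s: "states n \<omega> = (t, d)"
      have tj: "T n j \<omega> = t j" "(T n j \<omega> \<and> D n j \<omega>) = d j" if "j \<in> {1..n}" for j
        using s that by (auto simp: states_def dest!: fun_cong[of _ _ j])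
      then show "(\<forall>j\<in>{1..n}. T n j \<omega> = t j) \<and> (\<forall>j\<in>{j\<in>{1..n}. T n j \<omega>}. D n j \<omega> = d j)" by blast
    next
      assume s: "(\<forall>j\<in>{1..n}. T n j \<omega> = t j) \<and> (\<forall>j\<in>{j\<in>{1..n}. T n j \<omega>}. D n j \<omega> = d j)"
      have "(\<lambda>j\<in>{1..n}. T n j \<omega>) = t"
        by (rule PiE_ext[OF _ t[unfolded V_def]]) (use s in auto)
      moreover have "(\<lambda>j\<in>{1..n}. T n j \<omega> \<and> D n j \<omega>) = d"
        by (rule PiE_ext[OF _ d[unfolded V_def]]) (use s False in auto)
      ultimately show "states n \<omega> = (t, d)" by (simp add: states_def)
    qed
    define hit where "hit \<omega> = (of_bool (\<forall>j\<in>{1..n}. T n j \<omega> = t j) :: real)" for \<omega>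
    define w where "w \<omega> = (indicator E (\<psi> i \<omega>, rest n i \<omega>) :: real)" for \<omega>
    define GDt where "GDt \<omega> = hD n (vec_upto n \<psi> \<omega>, t, rnd n \<omega>)" for \<omega>
    define aD where "aD \<omega> = (if GDt \<omega> \<subseteq> Pow {1..n} - {{}} then assign_prob p lev_p (GDt \<omega>) (\<lambda>i. \<psi> i \<omega>) d else 0)" for \<omega>
    define aT where "aT \<omega> = (if hT n (vec_upto n \<psi> \<omega>, rnd n \<omega>) \<subseteq> Pow {1..n} - {{}}
        then assign_prob q lev_q (hT n (vec_upto n \<psi> \<omega>, rnd n \<omega>)) (\<lambda>i. \<psi> i \<omega>) t else 0)" for \<omega>
    have t_space: "t \<in> space (bool_upto n)" using t by (simp add: V_def space_PiM)
    have aD_m: "aD \<in> borel_measurable F" if "\<And>j. j \<in> {1..n} \<Longrightarrow> \<psi> j \<in> borel_measurable F" "rnd n \<in> F \<rightarrow>\<^sub>M N n" for F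
    proof -
      have "GDt \<in> F \<rightarrow>\<^sub>M count_space UNIV"
        unfolding GDt_def
        by (rule measurable_compose[OF _ hD[OF n_pos]])
           (intro measurable_Pair measurable_restrict that measurable_const t_space)
      then show ?thesis unfolding aD_def by (rule assign_prob_measurable[OF lev_p _ that(1)])
    qed
    have aT_m: "aT \<in> borel_measurable F" if "\<And>j. j \<in> {1..n} \<Longrightarrow> \<psi> j \<in> borel_measurable F" "rnd n \<in> F \<rightarrow>\<^sub>M N n" for F
    proof -
      have "(\<lambda>\<omega>. hT n (vec_upto n \<psi> \<omega>, rnd n \<omega>)) \<in> F \<rightarrow>\<^sub>M count_space UNIV"
        by (rule measurable_compose[OF _ hT[OF n_pos]])
           (intro measurable_Pair measurable_restrict that)
      then show ?thesis unfolding aT_def by (rule assign_prob_measurable[OF lev_q _ that(1)])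
    qed
    have aD_b: "\<bar>aD \<omega>\<bar> \<le> 1" and aT_b: "\<bar>aT \<omega>\<bar> \<le> 1" for \<omega>
      by (auto simp: aD_def aT_def abs_of_nonneg[OF assign_prob_bounds(1)] assign_prob_bounds(2))
    have w_m: "w \<in> borel_measurable F" if "\<And>j. j \<in> {1..n} \<Longrightarrow> W j \<in> borel_measurable F" "rnd n \<in> F \<rightarrow>\<^sub>M N n" for F
    proof -
      have "(\<lambda>\<omega>. (\<psi> i \<omega>, rest n i \<omega>)) \<in> F \<rightarrow>\<^sub>M borel \<Otimes>\<^sub>M rest_space n i"
        unfolding rest_def by (intro measurable_Pair measurable_restrict that \<psi>_of_W) (use i in auto)
      then show ?thesis unfolding w_def by (rule measurable_compose) (use E in simp)
    qed
    have w_b: "\<bar>w \<omega>\<bar> \<le> 1" for \<omega> by (simp add: w_def indicator_def)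
    have hit_m: "hit \<in> borel_measurable (F_WT n)"
    proof -
      have "(\<lambda>\<omega>. \<Prod>j\<in>{1..n}. of_bool (T n j \<omega> = t j) :: real) \<in> borel_measurable (F_WT n)"
        by (intro borel_measurable_prod measurable_compose[OF F_WT_meas(4)[OF n_pos]]) auto
      moreover have "hit = (\<lambda>\<omega>. \<Prod>j\<in>{1..n}. of_bool (T n j \<omega> = t j))"
        unfolding hit_def by (auto simp: fun_eq_iff)
      ultimately show ?thesis by simp
    qed
    have int: "integrable M (\<lambda>\<omega>. B \<omega> * z (W i \<omega>))" if "B \<in> borel_measurable M" "\<And>\<omega>. \<bar>B \<omega>\<bar> \<le> 1" for B
      by (rule Bochner_Integration.integrable_bound[OF zi])
         (use that zi in \<open>auto simp: abs_mult intro!: mult_left_le_one_le\<close>)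
    have zWT: "(\<lambda>\<omega>. z (W i \<omega>)) \<in> borel_measurable (F_WT n)" and zW: "(\<lambda>\<omega>. z (W i \<omega>)) \<in> borel_measurable (F_W n)"
      using measurable_compose[OF F_WT_meas(2)[OF n_pos i] zm] measurable_compose[OF F_W_meas(2)[OF n_pos i] zm] by auto
    have wWT: "w \<in> borel_measurable (F_WT n)" and wW: "w \<in> borel_measurable (F_W n)"
      by (auto intro!: w_m F_WT_meas F_W_meas n_pos simp del: One_nat_def)
    have aDW: "aD \<in> borel_measurable (F_W n)" by (rule aD_m) (auto intro!: F_W_meas n_pos simp del: One_nat_def)
    have h1: "(\<lambda>\<omega>. hit \<omega> * w \<omega> * z (W i \<omega>)) \<in> borel_measurable (F_WT n)" "integrable M (\<lambda>\<omega>. hit \<omega> * w \<omega> * z (W i \<omega>))"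
    proof -
      show "integrable M (\<lambda>\<omega>. hit \<omega> * w \<omega> * z (W i \<omega>))"
        by (rule int[OF borel_measurable_times[OF measurable_from_subalg[OF F_WT hit_m] measurable_from_subalg[OF F_WT wWT]]])
           (use w_b in \<open>auto simp: abs_mult hit_def\<close>)
    qed (intro borel_measurable_times hit_m wWT zWT)
    have h2: "(\<lambda>\<omega>. aD \<omega> * w \<omega> * z (W i \<omega>)) \<in> borel_measurable (F_W n)" "integrable M (\<lambda>\<omega>. aD \<omega> * w \<omega> * z (W i \<omega>))"
    proof -
      show "integrable M (\<lambda>\<omega>. aD \<omega> * w \<omega> * z (W i \<omega>))"
        by (rule int[OF borel_measurable_times[OF measurable_from_subalg[OF F_W aDW] measurable_from_subalg[OF F_W wW]]])
           (use w_b aD_b in \<open>auto simp: abs_mult intro: mult_le_one\<close>)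
    qed (intro borel_measurable_times aDW wW zW)
    \<comment> \<open>The event is split into a sampling part \<open>hit\<close> and an assignment
      part. The assignment is integrated out with everything else, including \<open>T\<close> and
      the outcomes, as conditioning information.\<close>
    have "expectation (\<lambda>\<omega>. of_bool (states n \<omega> = (t, d)) * (indicator E (\<psi> i \<omega>, rest n i \<omega>) * z (W i \<omega>)))
        = expectation (\<lambda>\<omega>. of_bool (\<forall>j\<in>{j\<in>{1..n}. T n j \<omega>}. D n j \<omega> = d j) * (hit \<omega> * w \<omega> * z (W i \<omega>)))"
      unfolding states_eq hit_def w_def by (rule Bochner_Integration.integral_cong) auto
    also have "\<dots> = expectation (\<lambda>\<omega>. (if GD n \<omega> \<subseteq> Pow {1..n} - {{}} then assign_prob p lev_p (GD n \<omega>) (\<lambda>i. \<psi> i \<omega>) d else 0)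
        * (hit \<omega> * w \<omega> * z (W i \<omega>)))"
      by (rule randomized_groups.assignment_probability[OF gD[OF n_pos] h1])
    \<comment> \<open>Where \<open>hit\<close> is nonzero the sampling states equal
      \<open>t\<close>, so the assignment groups may be computed from \<open>t\<close>. The weight
      thereby ceases to depend on \<open>T\<close>, as is required for integrating out the
      sampling.\<close>
    also have "\<dots> = expectation (\<lambda>\<omega>. of_bool (\<forall>j\<in>{1..n}. T n j \<omega> = t j) * (aD \<omega> * w \<omega> * z (W i \<omega>)))"
    proof (rule Bochner_Integration.integral_cong[OF refl])
      fix \<omega> assume \<omega>: "\<omega> \<in> space M"
      show "(if GD n \<omega> \<subseteq> Pow {1..n} - {{}} then assign_prob p lev_p (GD n \<omega>) (\<lambda>i. \<psi> i \<omega>) d else 0) * (hit \<omega> * w \<omega> * z (W i \<omega>))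
          = of_bool (\<forall>j\<in>{1..n}. T n j \<omega> = t j) * (aD \<omega> * w \<omega> * z (W i \<omega>))"
      proof (cases "\<forall>j\<in>{1..n}. T n j \<omega> = t j")
        case True
        then have "vec_upto n (T n) \<omega> = t"
          by (intro PiE_ext[OF _ t[unfolded V_def]]) auto
        then have "GD n \<omega> = GDt \<omega>" unfolding GD[OF n_pos \<omega>] GDt_def by simp
        then show ?thesis using True by (simp add: aD_def hit_def)
      qed (simp add: hit_def)
    qed
    also have "\<dots> = expectation (\<lambda>\<omega>. (if GT n \<omega> \<subseteq> Pow {1..n} - {{}} then assign_prob q lev_q (GT n \<omega>) (\<lambda>i. \<psi> i \<omega>) t else 0)
        * (aD \<omega> * w \<omega> * z (W i \<omega>)))"
      by (rule randomized_groups.assignment_probability[OF gT[OF n_pos] h2])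
    also have "\<dots> = expectation (\<lambda>\<omega>. (aT \<omega> * aD \<omega> * w \<omega>) * z (W i \<omega>))"
      by (rule Bochner_Integration.integral_cong[OF refl]) (simp add: GT[OF n_pos] aT_def)
    \<comment> \<open>The remaining weight is bounded and involves covariates, tie-breaker and the
      data in \<open>rest\<close>, so conditional centring before the design is enough.\<close>
    also have "\<dots> = 0"
    proof (rule cond_mean_zero_mult(2)[OF subalgebra_F_rest zr])
      have "w \<in> borel_measurable (F_rest n i)"
        unfolding w_def F_rest_def
        by (rule measurable_compose[OF gen_by_measurable[OF \<psi>_rest_meas]]) (use E in simp)
      then show "(\<lambda>\<omega>. aT \<omega> * aD \<omega> * w \<omega>) \<in> borel_measurable (F_rest n i)"
        by (intro borel_measurable_times aT_m aD_m F_rest_meas)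
      show "\<bar>aT \<omega> * aD \<omega> * w \<omega>\<bar> \<le> 1" for \<omega>
        using aT_b aD_b w_b by (simp add: abs_mult mult_le_one)
    qed
    finally show ?thesis .
  qed
  show "\<forall>E\<in>sets (F_design n i). expectation (\<lambda>\<omega>. indicator E \<omega> * z (W i \<omega>)) = 0"
  proof
    fix E assume "E \<in> sets (F_design n i)"
    then obtain E' where E': "E' \<in> sets ((borel \<Otimes>\<^sub>M rest_space n i) \<Otimes>\<^sub>M (bool_upto n \<Otimes>\<^sub>M bool_upto n))"
      "E = (\<lambda>\<omega>. ((\<psi> i \<omega>, rest n i \<omega>), states n \<omega>)) -` E' \<inter> space M"
      unfolding F_design_def sets_gen_by[OF design_meas] by blast
    \<comment> \<open>An event of the design information is cut into its sections at the finitely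
      many values of \<open>states\<close>; each section is an event of the data that precede the
      design.\<close>
    define Es where "Es s = (\<lambda>y. (y, s)) -` E'" for s
    have Es: "Es s \<in> sets (borel \<Otimes>\<^sub>M rest_space n i)" for s unfolding Es_def by (rule sets_Pair2[OF E'(1)])
    have in_V: "states n \<omega> \<in> V \<times> V" for \<omega> by (auto simp: states_def V_def)
    define f where "f s \<omega> = of_bool (states n \<omega> = s) * (indicator (Es s) (\<psi> i \<omega>, rest n i \<omega>) * z (W i \<omega>))" for s \<omega>
    have f_int: "integrable M (f s)" if "s \<in> V \<times> V" for s
    proof (rule Bochner_Integration.integrable_bound[OF zi])
      have "{s} = {fst s} \<times> {snd s}" by auto
      moreover have "{x} \<in> sets (bool_upto n)" if "x \<in> V" for x
      proof -
        have "PiE {1..n} (\<lambda>j. {x j}) \<in> sets (bool_upto n)" by (rule sets_PiM_I_finite) auto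
        moreover have "x \<in> extensional {1..n}" using that by (simp add: V_def PiE_def)
        ultimately show ?thesis by (simp only: PiE_singleton)
      qed
      ultimately have "{s} \<in> sets (bool_upto n \<Otimes>\<^sub>M bool_upto n)"
        using that pair_measureI[of "{fst s}" "bool_upto n" "{snd s}" "bool_upto n"] by auto
      then have "indicator {s} \<in> borel_measurable (bool_upto n \<Otimes>\<^sub>M bool_upto n)" by simp
      from measurable_compose[OF states_meas this]
      have "(\<lambda>\<omega>. of_bool (states n \<omega> = s) :: real) \<in> borel_measurable M" by (simp add: indicator_def of_bool_def)
      moreover have "(\<lambda>\<omega>. indicator (Es s) (\<psi> i \<omega>, rest n i \<omega>) :: real) \<in> borel_measurable M"
        by (rule measurable_compose[OF \<psi>_rest_meas]) (use Es in simp)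
      ultimately show "f s \<in> borel_measurable M" unfolding f_def using zi by (intro borel_measurable_times) auto
    qed (auto simp: f_def indicator_def)
    have "indicator E \<omega> * z (W i \<omega>) = (\<Sum>s\<in>V \<times> V. f s \<omega>)" if "\<omega> \<in> space M" for \<omega>
    proof -
      have "(\<Sum>s\<in>V \<times> V. f s \<omega>) = (\<Sum>s\<in>V \<times> V. if s = states n \<omega> then f s \<omega> else 0)"
        by (rule sum.cong) (auto simp: f_def)
      also have "\<dots> = f (states n \<omega>) \<omega>" using in_V finV by simp
      finally show ?thesis using that by (auto simp: f_def E'(2) Es_def indicator_def)
    qed
    then have "expectation (\<lambda>\<omega>. indicator E \<omega> * z (W i \<omega>)) = expectation (\<lambda>\<omega>. \<Sum>s\<in>V \<times> V. f s \<omega>)"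
      by (intro Bochner_Integration.integral_cong) auto
    also have "\<dots> = (\<Sum>s\<in>V \<times> V. expectation (f s))"
      by (rule Bochner_Integration.integral_sum) (rule f_int)
    also have "\<dots> = 0"
    proof (rule sum.neutral, rule ballI)
      fix s assume "s \<in> V \<times> V"
      then show "expectation (f s) = 0"
        unfolding f_def using key[of "fst s" "snd s" "Es s"] Es by (cases s) auto
    qed
    finally show "expectation (\<lambda>\<omega>. indicator E \<omega> * z (W i \<omega>)) = 0" .
  qed
qed

end

end

subsection \<open>Gaussian replacement\<close>

text \<open>The entry \<open>y\<close> of the minimum is integrable for integrable variances, the
  entry \<open>y\<^sup>2\<close> gives the smaller order after scaling.\<close>

lemma abs_exp_minus_approx:
  fixes y :: real
  assumes "0 \<le> y"
  shows "\<bar>exp (- y) - (1 - y)\<bar> \<le> min y (y\<^sup>2)"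
proof -
  have lower: "1 - y \<le> exp (- y)" using exp_ge_add_one_self[of "- y"] by simp
  have "exp (- y) \<le> 1" using assms by simp
  moreover have "exp (- y) \<le> 1 - y + y\<^sup>2"
  proof -
    have "1 + y \<le> exp y" by (rule exp_ge_add_one_self)
    then have "exp (- y) \<le> 1 / (1 + y)" using assms by (simp add: exp_minus field_simps)
    \<comment> \<open>The product of \<open>1 - y + y\<^sup>2\<close> and \<open>1 + y\<close> is
      one plus the cube of \<open>y\<close>.\<close>
    also have "\<dots> \<le> 1 - y + y\<^sup>2"
    proof -
      have "1 \<le> (1 - y + y\<^sup>2) * (1 + y)" using assms by (simp add: algebra_simps power2_eq_square)
      then show ?thesis using assms by (simp add: divide_le_eq)
    qed
    finally show ?thesis .
  qed
  ultimately show ?thesis using lower by simp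
qed

text \<open>Thanks to the quadratic entry a finite second moment is enough; the cubic entry supplies
  convergence to zero for small arguments.\<close>

lemma norm_iexp_quadratic_approx:
  fixes x :: real
  shows "norm (iexp x - (1 + \<i> * x - x\<^sup>2 / 2)) \<le> min (x\<^sup>2) (\<bar>x\<bar> ^ 3 / 6)"
proof -
  have eq: "(\<Sum>k\<le>2. (\<i> * x) ^ k / fact k) = 1 + \<i> * x - x\<^sup>2 / 2"
    by (simp add: numeral_eq_Suc power2_eq_square) (simp add: complex_eq_iff)
  have "norm (iexp x - (1 + \<i> * x - x\<^sup>2 / 2)) \<le> \<bar>x\<bar> ^ 3 / 6"
    using iexp_approx1[of x 2] unfolding eq by (simp add: numeral_eq_Suc)
  moreover have "norm (iexp x - (1 + \<i> * x - x\<^sup>2 / 2)) \<le> x\<^sup>2"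
    using iexp_approx2[of x 2] unfolding eq by simp
  ultimately show ?thesis by simp
qed

context prob_space
begin

text \<open>Units are counted from 1, whereas the classical central limit theorem is applied to a
  sequence indexed from 0.\<close>

lemma indep_vars_shift:
  fixes X :: "nat \<Rightarrow> 'a \<Rightarrow> 'b"
  assumes "indep_vars (\<lambda>_. N) X {1..}"
  shows "indep_vars (\<lambda>_. N) (\<lambda>i. X (Suc i)) UNIV"
  unfolding indep_vars_def2
proof
  show "\<forall>i\<in>UNIV. random_variable N (X (Suc i))" using assms by (auto simp: indep_vars_def2)
  have ind: "indep_sets (\<lambda>i. {X i -` A \<inter> space M |A. A \<in> sets N}) {1..}"
    using assms by (simp add: indep_vars_def2)
  show "indep_sets (\<lambda>i. {X (Suc i) -` A \<inter> space M |A. A \<in> sets N}) UNIV"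
  proof (rule indep_setsI)
    show "{X (Suc i) -` A \<inter> space M |A. A \<in> sets N} \<subseteq> events" for i
      using ind unfolding indep_sets_def by auto
    fix A J assume J: "J \<noteq> {}" "J \<subseteq> UNIV" "finite J" and A: "\<forall>j\<in>J. A j \<in> {X (Suc j) -` A \<inter> space M |A. A \<in> sets N}"
    have "prob (\<Inter>k\<in>Suc ` J. A (k - 1)) = (\<Prod>k\<in>Suc ` J. prob (A (k - 1)))"
      by (rule indep_setsD[OF ind]) (use J A in auto)
    then show "prob (\<Inter>j\<in>J. A j) = (\<Prod>j\<in>J. prob (A j))"
      by (simp add: prod.reindex)
  qed
qed

text \<open>The classical theorem divides by the standard deviation and requires it to be positive.
  In the degenerate case the sums vanish almost surely and the characteristic function is constantly
  1.\<close>

lemma iid_sum_char_limit: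
  fixes X :: "nat \<Rightarrow> 'a \<Rightarrow> real"
  assumes indep: "indep_vars (\<lambda>_. borel) X {1..}"
    and ident: "\<And>i. i \<ge> 1 \<Longrightarrow> distr M borel (X i) = distr M borel (X 1)"
    and X2: "integrable M (\<lambda>\<omega>. (X 1 \<omega>)\<^sup>2)" and mean: "expectation (X 1) = 0"
  shows "(\<lambda>n. CLINT \<omega>|M. iexp (t * (1 / sqrt (real n) * (\<Sum>i=1..n. X i \<omega>))))
    \<longlonglongrightarrow> complex_of_real (exp (- (t\<^sup>2 * expectation (\<lambda>\<omega>. (X 1 \<omega>)\<^sup>2)) / 2))"
proof -
  define \<sigma> where "\<sigma> = sqrt (expectation (\<lambda>\<omega>. (X 1 \<omega>)\<^sup>2))"
  have \<sigma>2: "\<sigma>\<^sup>2 = expectation (\<lambda>\<omega>. (X 1 \<omega>)\<^sup>2)" unfolding \<sigma>_def by (simp add: integral_nonneg)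
  have m: "X i \<in> borel_measurable M" if "i \<ge> 1" for i
    using indep that by (auto simp: indep_vars_def)
  show ?thesis
  proof (cases "\<sigma> = 0")
    case True
    have "(CLINT \<omega>|M. iexp (t * (1 / sqrt (real n) * (\<Sum>i=1..n. X i \<omega>)))) = 1" for n
    proof -
      note sm = iid_sum_second_moment[OF indep ident X2 mean, of n]
      have "expectation (\<lambda>\<omega>. (\<Sum>i=1..n. X i \<omega>)\<^sup>2) = 0" using sm(2) True \<sigma>2 by simp
      then have "AE \<omega> in M. (\<Sum>i=1..n. X i \<omega>)\<^sup>2 = 0"
        using integral_nonneg_eq_0_iff_AE[OF sm(1)] by simp
      then have ae: "AE \<omega> in M. iexp (t * (1 / sqrt (real n) * (\<Sum>i=1..n. X i \<omega>))) = (1 :: complex)"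
      proof (rule AE_mp, intro AE_I2 impI)
        fix \<omega> assume "(\<Sum>i=1..n. X i \<omega>)\<^sup>2 = 0"
        then have "(\<Sum>i=1..n. X i \<omega>) = 0" by simp
        then show "iexp (t * (1 / sqrt (real n) * (\<Sum>i=1..n. X i \<omega>))) = (1 :: complex)" by (simp only:) simp
      qed
      have "(CLINT \<omega>|M. iexp (t * (1 / sqrt (real n) * (\<Sum>i=1..n. X i \<omega>)))) = (CLINT \<omega>|M. 1)"
      proof (rule integral_cong_AE[OF _ _ ae])
        have "(\<lambda>\<omega>. \<Sum>i=1..n. X i \<omega>) \<in> borel_measurable M" by (intro borel_measurable_sum m) auto
        then show "(\<lambda>\<omega>. iexp (t * (1 / sqrt (real n) * (\<Sum>i=1..n. X i \<omega>)))) \<in> borel_measurable M" by measurable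
      qed simp
      then show ?thesis by (simp add: prob_space)
    qed
    then show ?thesis using True \<sigma>2 by simp
  next
    case False
    then have \<sigma>_pos: "\<sigma> > 0" unfolding \<sigma>_def by (simp add: integral_nonneg order_less_le)
    define X' where "X' i = X (Suc i)" for i
    have d: "distr M borel (X' i) = distr M borel (X 1)" for i unfolding X'_def by (rule ident) simp
    have m': "X' i \<in> borel_measurable M" for i unfolding X'_def by (rule m) simp
    have e: "(integrable M (\<lambda>\<omega>. h (X' i \<omega>)) \<longleftrightarrow> integrable M (\<lambda>\<omega>. h (X 1 \<omega>)))
        \<and> expectation (\<lambda>\<omega>. h (X' i \<omega>)) = expectation (\<lambda>\<omega>. h (X 1 \<omega>))" if "h \<in> borel_measurable borel" for h :: "real \<Rightarrow> real" and i
      using distr_eq_integral[OF m' m[OF order_refl] that d] by blast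
    have mean': "expectation (X' i) = 0" for i using e[of "\<lambda>x. x" i] mean by simp
    have conv: "weak_conv_m (\<lambda>n. distr M borel (\<lambda>\<omega>. (\<Sum>i<n. X' i \<omega>) / sqrt (real n * \<sigma>\<^sup>2))) std_normal_distribution"
    proof (rule central_limit_theorem_zero_mean[OF _ mean' \<sigma>_pos _ _ d])
      show "indep_vars (\<lambda>i. borel) X' UNIV" unfolding X'_def by (rule indep_vars_shift[OF indep])
      show "integrable M (\<lambda>x. (X' n x)\<^sup>2)" for n using e[of "\<lambda>x. x\<^sup>2" n] X2 by simp
      show "variance (X' n) = \<sigma>\<^sup>2" for n using e[of "\<lambda>x. x\<^sup>2" n] by (simp add: mean' \<sigma>2)
    qed
    have m_sum: "(\<lambda>\<omega>. (\<Sum>i<n. X' i \<omega>) / sqrt (real n * \<sigma>\<^sup>2)) \<in> borel_measurable M" for n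
      using m' by measurable
    \<comment> \<open>Evaluation at \<open>t * \<sigma>\<close> undoes the normalization by the
      standard deviation.\<close>
    have "(\<lambda>n. char (distr M borel (\<lambda>\<omega>. (\<Sum>i<n. X' i \<omega>) / sqrt (real n * \<sigma>\<^sup>2))) (t * \<sigma>))
        \<longlonglongrightarrow> char std_normal_distribution (t * \<sigma>)"
      by (rule levy_continuity1[OF _ real_dist_normal_dist conv]) (rule real_distribution_distr[OF m_sum])
    moreover have "char (distr M borel (\<lambda>\<omega>. (\<Sum>i<n. X' i \<omega>) / sqrt (real n * \<sigma>\<^sup>2))) (t * \<sigma>)
        = (CLINT \<omega>|M. iexp (t * (1 / sqrt (real n) * (\<Sum>i=1..n. X i \<omega>))))" for n
    proof -
      have eq: "(\<Sum>i=1..n. X i \<omega>) = (\<Sum>i<n. X' i \<omega>)" for \<omega>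
        unfolding X'_def by (rule sum.reindex_bij_witness[of _ Suc "\<lambda>i. i - 1"]) auto
      have "t * \<sigma> * ((\<Sum>i<n. X' i \<omega>) / sqrt (real n * \<sigma>\<^sup>2)) = t * (1 / sqrt (real n) * (\<Sum>i=1..n. X i \<omega>))" for \<omega>
        unfolding eq using \<sigma>_pos by (simp add: real_sqrt_mult)
      then show ?thesis unfolding char_def
        by (subst integral_distr[OF m_sum]) (auto simp: of_real_mult[symmetric] simp del: of_real_mult)
    qed
    ultimately show ?thesis
      by (simp add: char_std_normal_distribution power_mult_distrib \<sigma>2)
  qed
qed

text \<open>Lindeberg's telescoping: the factors \<open>iexp (t * \<xi> i)\<close> are replaced by Gaussian ones one at a
  time. In the step for \<open>i\<close> the other factors are frozen in \<open>B i\<close>; orthogonality to \<open>B i\<close> plays the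
  role of independence and kills the first two Taylor terms.\<close>

lemma gaussian_replacement:
  fixes \<xi> v :: "nat \<Rightarrow> 'a \<Rightarrow> real" and C :: "'a \<Rightarrow> complex" and t :: real and n :: nat
  defines "B \<equiv> \<lambda>i \<omega>. C \<omega> * (\<Prod>j=1..<i. complex_of_real (exp (- (t\<^sup>2 * v j \<omega> / 2)))) * (\<Prod>j=Suc i..n. iexp (t * \<xi> j \<omega>))"
  assumes C[measurable]: "C \<in> borel_measurable M" and C1: "\<And>\<omega>. norm (C \<omega>) \<le> 1"
    and \<xi>m: "\<And>i. i \<in> {1..n} \<Longrightarrow> \<xi> i \<in> borel_measurable M"
    and \<xi>2: "\<And>i. i \<in> {1..n} \<Longrightarrow> integrable M (\<lambda>\<omega>. (\<xi> i \<omega>)\<^sup>2)"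
    and v: "\<And>i. i \<in> {1..n} \<Longrightarrow> integrable M (v i)" "\<And>i \<omega>. i \<in> {1..n} \<Longrightarrow> 0 \<le> v i \<omega>"
    and orth1: "\<And>i. i \<in> {1..n} \<Longrightarrow> (CLINT \<omega>|M. B i \<omega> * complex_of_real (\<xi> i \<omega>)) = 0"
    and orth2: "\<And>i. i \<in> {1..n} \<Longrightarrow> (CLINT \<omega>|M. B i \<omega> * complex_of_real ((\<xi> i \<omega>)\<^sup>2 - v i \<omega>)) = 0"
  shows "norm ((CLINT \<omega>|M. C \<omega> * (\<Prod>j=1..n. iexp (t * \<xi> j \<omega>)))
      - (CLINT \<omega>|M. C \<omega> * (\<Prod>j=1..n. complex_of_real (exp (- (t\<^sup>2 * v j \<omega> / 2))))))
    \<le> (\<Sum>i=1..n. expectation (\<lambda>\<omega>. min ((t * \<xi> i \<omega>)\<^sup>2) (\<bar>t * \<xi> i \<omega>\<bar> ^ 3 / 6))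
        + expectation (\<lambda>\<omega>. min (t\<^sup>2 * v i \<omega> / 2) ((t\<^sup>2 * v i \<omega> / 2)\<^sup>2)))"
proof -
  define u where "u j \<omega> = iexp (t * \<xi> j \<omega>)" for j \<omega>
  define e where "e j \<omega> = complex_of_real (exp (- (t\<^sup>2 * v j \<omega> / 2)))" for j \<omega>
  \<comment> \<open>In \<open>P m\<close> the first m oscillating factors have been replaced:
    \<open>P 0\<close> is the original product, \<open>P n\<close> the fully replaced one, and
    consecutive members differ in one factor.\<close>
  define P where "P m \<omega> = C \<omega> * (\<Prod>j=1..<Suc m. e j \<omega>) * (\<Prod>j=Suc m..n. u j \<omega>)" for m \<omega>
  have vm: "v i \<in> borel_measurable M" if "i \<in> {1..n}" for i using v(1)[OF that] by simp
  have um: "u j \<in> borel_measurable M" and em: "e j \<in> borel_measurable M" if "j \<in> {1..n}" for j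
  proof -
    note [measurable] = \<xi>m[OF that] vm[OF that]
    show "u j \<in> borel_measurable M" "e j \<in> borel_measurable M" unfolding u_def e_def by measurable
  qed
  have u1: "norm (u j \<omega>) = 1" for j \<omega> by (simp add: u_def del: of_real_mult)
  have e1: "norm (e j \<omega>) \<le> 1" if "j \<in> {1..n}" for j \<omega>
    using v(2)[OF that, of \<omega>] by (simp add: e_def)
  have prod_e1: "norm (\<Prod>j=1..<m. e j \<omega>) \<le> 1" if "m \<le> Suc n" for m \<omega>
    unfolding prod_norm[symmetric] by (rule prod_le_1) (use that e1 in auto)
  have prod_u1: "norm (\<Prod>j=m..n. u j \<omega>) = 1" for m \<omega>
    unfolding prod_norm[symmetric] by (simp add: u1)
  have P1: "norm (P m \<omega>) \<le> 1" if "m \<le> n" for m \<omega>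
    unfolding P_def norm_mult prod_u1 using mult_mono[OF C1 prod_e1[of "Suc m" \<omega>]] that by simp
  have Pm: "P m \<in> borel_measurable M" if "m \<le> n" for m
    unfolding P_def by (intro borel_measurable_times C borel_measurable_prod um em) (use that in auto)
  have Pi: "integrable M (P m)" if "m \<le> n" for m
    by (rule integrable_const_bound[of _ 1]) (use P1[OF that] Pm[OF that] in auto)
  have B_eq: "B i \<omega> = C \<omega> * (\<Prod>j=1..<i. e j \<omega>) * (\<Prod>j=Suc i..n. u j \<omega>)" for i \<omega>
    by (simp add: B_def u_def e_def)
  have Bm: "B i \<in> borel_measurable M" if "i \<in> {1..n}" for i
    unfolding B_eq[abs_def] by (intro borel_measurable_times C borel_measurable_prod um em) (use that in auto)
  have B1: "norm (B i \<omega>) \<le> 1" if "i \<in> {1..n}" for i \<omega>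
    unfolding B_eq norm_mult prod_u1 using mult_mono[OF C1 prod_e1[of i \<omega>]] that by simp
  have step: "norm ((CLINT \<omega>|M. P (i - 1) \<omega>) - (CLINT \<omega>|M. P i \<omega>))
    \<le> expectation (\<lambda>\<omega>. min ((t * \<xi> i \<omega>)\<^sup>2) (\<bar>t * \<xi> i \<omega>\<bar> ^ 3 / 6))
        + expectation (\<lambda>\<omega>. min (t\<^sup>2 * v i \<omega> / 2) ((t\<^sup>2 * v i \<omega> / 2)\<^sup>2))" if i: "i \<in> {1..n}" for i
  proof -
    note [measurable] = \<xi>m[OF i] vm[OF i] Bm[OF i]
    define r1 where "r1 \<omega> = u i \<omega> - (1 + \<i> * (t * \<xi> i \<omega>) - (t * \<xi> i \<omega>)\<^sup>2 / 2)" for \<omega>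
    define r2 where "r2 \<omega> = e i \<omega> - (1 - t\<^sup>2 * v i \<omega> / 2)" for \<omega>
    have r1b: "norm (r1 \<omega>) \<le> min ((t * \<xi> i \<omega>)\<^sup>2) (\<bar>t * \<xi> i \<omega>\<bar> ^ 3 / 6)" for \<omega>
      using norm_iexp_quadratic_approx[of "t * \<xi> i \<omega>"] unfolding r1_def u_def by simp
    have r2b: "norm (r2 \<omega>) \<le> min (t\<^sup>2 * v i \<omega> / 2) ((t\<^sup>2 * v i \<omega> / 2)\<^sup>2)" for \<omega>
    proof -
      have "r2 \<omega> = complex_of_real (exp (- (t\<^sup>2 * v i \<omega> / 2)) - (1 - t\<^sup>2 * v i \<omega> / 2))"
        by (simp add: r2_def e_def)
      then have "norm (r2 \<omega>) = \<bar>exp (- (t\<^sup>2 * v i \<omega> / 2)) - (1 - t\<^sup>2 * v i \<omega> / 2)\<bar>"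
        by (simp only: norm_of_real)
      then show ?thesis using abs_exp_minus_approx[of "t\<^sup>2 * v i \<omega> / 2"] v(2)[OF i, of \<omega>] by simp
    qed
    have [measurable]: "r1 \<in> borel_measurable M" "r2 \<in> borel_measurable M"
      unfolding r1_def r2_def using um[OF i] em[OF i] by measurable
    have i1: "integrable M (\<lambda>\<omega>. min ((t * \<xi> i \<omega>)\<^sup>2) (\<bar>t * \<xi> i \<omega>\<bar> ^ 3 / 6))"
      by (rule Bochner_Integration.integrable_bound[of _ "\<lambda>\<omega>. t\<^sup>2 * (\<xi> i \<omega>)\<^sup>2"])
         (use \<xi>2[OF i] in \<open>auto simp: power_mult_distrib\<close>)
    have i2: "integrable M (\<lambda>\<omega>. min (t\<^sup>2 * v i \<omega> / 2) ((t\<^sup>2 * v i \<omega> / 2)\<^sup>2))"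
      by (rule Bochner_Integration.integrable_bound[of _ "\<lambda>\<omega>. t\<^sup>2 * v i \<omega> / 2"])
         (use v(1)[OF i] v(2)[OF i] in auto)
    have Br1: "integrable M (\<lambda>\<omega>. B i \<omega> * r1 \<omega>)" "norm (CLINT \<omega>|M. B i \<omega> * r1 \<omega>) \<le> expectation (\<lambda>\<omega>. min ((t * \<xi> i \<omega>)\<^sup>2) (\<bar>t * \<xi> i \<omega>\<bar> ^ 3 / 6))"
    proof -
      have le: "norm (B i \<omega> * r1 \<omega>) \<le> min ((t * \<xi> i \<omega>)\<^sup>2) (\<bar>t * \<xi> i \<omega>\<bar> ^ 3 / 6)" for \<omega>
        using mult_mono[OF B1[OF i] r1b[of \<omega>]] by (simp add: norm_mult)
      show int: "integrable M (\<lambda>\<omega>. B i \<omega> * r1 \<omega>)"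
        by (rule Bochner_Integration.integrable_bound[OF i1])
           (measurable, intro AE_I2, subst real_norm_def, rule order_trans[OF le abs_ge_self])
      show "norm (CLINT \<omega>|M. B i \<omega> * r1 \<omega>) \<le> expectation (\<lambda>\<omega>. min ((t * \<xi> i \<omega>)\<^sup>2) (\<bar>t * \<xi> i \<omega>\<bar> ^ 3 / 6))"
        by (rule order_trans[OF integral_norm_bound integral_mono[OF integrable_norm[OF int] i1 le]])
    qed
    have Br2: "integrable M (\<lambda>\<omega>. B i \<omega> * r2 \<omega>)" "norm (CLINT \<omega>|M. B i \<omega> * r2 \<omega>) \<le> expectation (\<lambda>\<omega>. min (t\<^sup>2 * v i \<omega> / 2) ((t\<^sup>2 * v i \<omega> / 2)\<^sup>2))"
    proof -
      have le: "norm (B i \<omega> * r2 \<omega>) \<le> min (t\<^sup>2 * v i \<omega> / 2) ((t\<^sup>2 * v i \<omega> / 2)\<^sup>2)" for \<omega>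
        using mult_mono[OF B1[OF i] r2b[of \<omega>]] by (simp add: norm_mult)
      show int: "integrable M (\<lambda>\<omega>. B i \<omega> * r2 \<omega>)"
        by (rule Bochner_Integration.integrable_bound[OF i2])
           (measurable, intro AE_I2, subst real_norm_def, rule order_trans[OF le abs_ge_self])
      show "norm (CLINT \<omega>|M. B i \<omega> * r2 \<omega>) \<le> expectation (\<lambda>\<omega>. min (t\<^sup>2 * v i \<omega> / 2) ((t\<^sup>2 * v i \<omega> / 2)\<^sup>2))"
        by (rule order_trans[OF integral_norm_bound integral_mono[OF integrable_norm[OF int] i2 le]])
    qed
    have \<xi>i: "integrable M (\<xi> i)" by (rule square_integrable_imp_integrable[OF \<xi>m[OF i] \<xi>2[OF i]])
    have bounded: "integrable M (\<lambda>\<omega>. B i \<omega> * complex_of_real (f \<omega>))" if "integrable M f" for f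
      by (rule Bochner_Integration.integrable_bound[OF that])
         (use that B1[OF i] in \<open>auto simp: norm_mult intro!: mult_left_le_one_le\<close>)
    have B\<xi>: "integrable M (\<lambda>\<omega>. B i \<omega> * complex_of_real (\<xi> i \<omega>))"
      and B\<xi>2: "integrable M (\<lambda>\<omega>. B i \<omega> * complex_of_real ((\<xi> i \<omega>)\<^sup>2 - v i \<omega>))"
      using bounded[OF \<xi>i] bounded[OF Bochner_Integration.integrable_diff[OF \<xi>2[OF i] v(1)[OF i]]] by auto
    have Pdiff: "P (i - 1) \<omega> - P i \<omega> = B i \<omega> * (u i \<omega> - e i \<omega>)" for \<omega>
    proof -
      have "{i - 1 + 1..n} = insert i {Suc i..n}" "{1..<Suc i} = insert i {1..<i}" using i by auto
      then have "P (i - 1) \<omega> = C \<omega> * (\<Prod>j=1..<i. e j \<omega>) * (u i \<omega> * (\<Prod>j=Suc i..n. u j \<omega>))"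
        "P i \<omega> = C \<omega> * (e i \<omega> * (\<Prod>j=1..<i. e j \<omega>)) * (\<Prod>j=Suc i..n. u j \<omega>)"
        using i unfolding P_def by (simp_all del: prod.atLeastLessThan_Suc)
      then show ?thesis by (simp add: B_eq algebra_simps)
    qed
    have "(CLINT \<omega>|M. P (i - 1) \<omega>) - (CLINT \<omega>|M. P i \<omega>) = (CLINT \<omega>|M. B i \<omega> * (u i \<omega> - e i \<omega>))"
      unfolding Pdiff[symmetric] using i by (intro Bochner_Integration.integral_diff[symmetric] Pi) auto
    \<comment> \<open>The constants cancel. What remains besides the two Taylor remainders is linear
      in \<open>\<xi> i\<close> and in its square minus \<open>v i\<close>, and both integrate to
      zero against \<open>B i\<close>.\<close>
    also have "\<dots> = (CLINT \<omega>|M. B i \<omega> * r1 \<omega> - B i \<omega> * r2 \<omega> + (\<i> * t) * (B i \<omega> * complex_of_real (\<xi> i \<omega>))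
        - (t\<^sup>2 / 2) * (B i \<omega> * complex_of_real ((\<xi> i \<omega>)\<^sup>2 - v i \<omega>)))"
      by (rule Bochner_Integration.integral_cong[OF refl])
         (simp add: r1_def r2_def algebra_simps power_mult_distrib)
    also have "\<dots> = (CLINT \<omega>|M. B i \<omega> * r1 \<omega>) - (CLINT \<omega>|M. B i \<omega> * r2 \<omega>)
        + (\<i> * t) * (CLINT \<omega>|M. B i \<omega> * complex_of_real (\<xi> i \<omega>))
        - (t\<^sup>2 / 2) * (CLINT \<omega>|M. B i \<omega> * complex_of_real ((\<xi> i \<omega>)\<^sup>2 - v i \<omega>))"
      by (subst Bochner_Integration.integral_diff Bochner_Integration.integral_add integral_mult_right_zero |
          intro Br1(1) Br2(1) B\<xi> B\<xi>2 Bochner_Integration.integrable_diff Bochner_Integration.integrable_add integrable_mult_right)+ simp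
    also have "\<dots> = (CLINT \<omega>|M. B i \<omega> * r1 \<omega>) - (CLINT \<omega>|M. B i \<omega> * r2 \<omega>)"
      unfolding orth1[OF i] orth2[OF i] by simp
    finally have diff: "(CLINT \<omega>|M. P (i - 1) \<omega>) - (CLINT \<omega>|M. P i \<omega>)
        = (CLINT \<omega>|M. B i \<omega> * r1 \<omega>) - (CLINT \<omega>|M. B i \<omega> * r2 \<omega>)" .
    show ?thesis unfolding diff using norm_triangle_ineq4[of "CLINT \<omega>|M. B i \<omega> * r1 \<omega>" "CLINT \<omega>|M. B i \<omega> * r2 \<omega>"] Br1(2) Br2(2) by linarith
  qed
  have telescope: "norm ((CLINT \<omega>|M. P 0 \<omega>) - (CLINT \<omega>|M. P m \<omega>))
    \<le> (\<Sum>i=1..m. expectation (\<lambda>\<omega>. min ((t * \<xi> i \<omega>)\<^sup>2) (\<bar>t * \<xi> i \<omega>\<bar> ^ 3 / 6))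
        + expectation (\<lambda>\<omega>. min (t\<^sup>2 * v i \<omega> / 2) ((t\<^sup>2 * v i \<omega> / 2)\<^sup>2)))" if "m \<le> n" for m
    using that
  proof (induction m)
    case (Suc m)
    have "(CLINT \<omega>|M. P 0 \<omega>) - (CLINT \<omega>|M. P (Suc m) \<omega>)
        = ((CLINT \<omega>|M. P 0 \<omega>) - (CLINT \<omega>|M. P m \<omega>)) + ((CLINT \<omega>|M. P m \<omega>) - (CLINT \<omega>|M. P (Suc m) \<omega>))" by simp
    then show ?case
      using Suc norm_triangle_ineq[of "(CLINT \<omega>|M. P 0 \<omega>) - (CLINT \<omega>|M. P m \<omega>)" "(CLINT \<omega>|M. P m \<omega>) - (CLINT \<omega>|M. P (Suc m) \<omega>)"]
        step[of "Suc m"] by simp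
  qed simp
  have "P 0 = (\<lambda>\<omega>. C \<omega> * (\<Prod>j=1..n. iexp (t * \<xi> j \<omega>)))"
    by (simp add: P_def u_def fun_eq_iff)
  moreover have "P n = (\<lambda>\<omega>. C \<omega> * (\<Prod>j=1..n. complex_of_real (exp (- (t\<^sup>2 * v j \<omega> / 2)))))"
    by (simp add: P_def e_def fun_eq_iff atLeastLessThanSuc_atLeastAtMost)
  ultimately show ?thesis using telescope[OF order_refl] by simp
qed

lemma cond_mean_zero_mult_complex:
  fixes B :: "'a \<Rightarrow> complex"
  assumes F: "subalgebra M F" and z: "cond_mean_zero M F z"
    and B: "B \<in> borel_measurable F" "\<And>\<omega>. \<omega> \<in> space M \<Longrightarrow> norm (B \<omega>) \<le> c"
  shows "integrable M (\<lambda>\<omega>. B \<omega> * complex_of_real (z \<omega>))" "(CLINT \<omega>|M. B \<omega> * complex_of_real (z \<omega>)) = 0"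
proof -
  have Re: "(\<lambda>\<omega>. Re (B \<omega>)) \<in> borel_measurable F" "\<And>\<omega>. \<omega> \<in> space M \<Longrightarrow> \<bar>Re (B \<omega>)\<bar> \<le> c"
    and Im: "(\<lambda>\<omega>. Im (B \<omega>)) \<in> borel_measurable F" "\<And>\<omega>. \<omega> \<in> space M \<Longrightarrow> \<bar>Im (B \<omega>)\<bar> \<le> c"
    using B abs_Re_le_cmod abs_Im_le_cmod order_trans by (auto intro: order_trans)
  note re = cond_mean_zero_mult[OF F z Re] and im = cond_mean_zero_mult[OF F z Im]
  have eq: "B \<omega> * complex_of_real (z \<omega>) = complex_of_real (Re (B \<omega>) * z \<omega>) + \<i> * complex_of_real (Im (B \<omega>) * z \<omega>)" for \<omega>
    by (simp add: complex_eq_iff)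
  show "integrable M (\<lambda>\<omega>. B \<omega> * complex_of_real (z \<omega>))"
    unfolding eq by (intro Bochner_Integration.integrable_add integrable_mult_right integrable_of_real re(1) im(1))
  show "(CLINT \<omega>|M. B \<omega> * complex_of_real (z \<omega>)) = 0"
    unfolding eq using re im by (subst Bochner_Integration.integral_add) (auto simp del: of_real_mult)
qed

lemma tends_to_zero_in_prob_cmult:
  assumes "tends_to_zero_in_prob M X"
  shows "tends_to_zero_in_prob M (\<lambda>n \<omega>. c * X n \<omega>)"
  unfolding tends_to_zero_in_prob_def
proof (intro allI impI)
  fix \<epsilon> :: real assume \<epsilon>: "\<epsilon> > 0"
  show "(\<lambda>n. prob {\<omega> \<in> space M. \<epsilon> < \<bar>c * X n \<omega>\<bar>}) \<longlonglongrightarrow> 0"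
  proof (cases "c = 0")
    case False
    then have "{\<omega> \<in> space M. \<epsilon> < \<bar>c * X n \<omega>\<bar>} = {\<omega> \<in> space M. \<epsilon> / \<bar>c\<bar> < \<bar>X n \<omega>\<bar>}" for n
      by (auto simp: abs_mult field_simps)
    then show ?thesis using assms False \<epsilon> unfolding tends_to_zero_in_prob_def by simp
  qed (use \<epsilon> in simp)
qed

end

subsection \<open>Asymptotics of the estimator\<close>

lemma measurable_snd_borel: "snd \<in> borel \<rightarrow>\<^sub>M (borel :: 'a::topological_space measure)"
  by (rule borel_measurable_continuous_onI) (rule continuous_on_snd[OF continuous_on_id])

lemma finite_range_bound:
  fixes f :: "'a \<Rightarrow> real"
  assumes "finite (range f)"
  obtains K where "0 < K" "\<And>x. \<bar>f x\<bar> \<le> K"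
proof -
  have "bounded (range f)" using assms by (rule finite_imp_bounded)
  then show thesis using that unfolding bounded_pos by auto
qed

lemma (in prob_space) tends_to_zero_in_prob_mono:
  fixes X Z :: "nat \<Rightarrow> 'a \<Rightarrow> real"
  assumes X: "\<And>n. n \<ge> 1 \<Longrightarrow> X n \<in> borel_measurable M" "tends_to_zero_in_prob M X"
    and le: "\<And>n \<omega>. n \<ge> 1 \<Longrightarrow> \<omega> \<in> space M \<Longrightarrow> \<bar>Z n \<omega>\<bar> \<le> \<bar>X n \<omega>\<bar>"
  shows "tends_to_zero_in_prob M Z"
proof (rule tends_to_zero_in_prob_le_add[OF X(1) _ X(2)])
  show "tends_to_zero_in_prob M (\<lambda>_ _. 0)" by (simp add: tends_to_zero_in_prob_def)
qed (use le in auto)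

section \<open>The estimator in terms of conditional moments\<close>

text \<open>Conditional means and variances are replaced by fixed Borel functions of the covariate.
  They can be evaluated at every unit, while conditional expectations are given for unit 1 and up to
  null sets.\<close>

locale outcome_moments = local_randomization M \<psi> Y0 Y1 W N rnd q p lev_q lev_p T D
  for M :: "'w measure" and \<psi> :: "nat \<Rightarrow> 'w \<Rightarrow> 'a::euclidean_space" and Y0 Y1 W
    and N :: "nat \<Rightarrow> 'r measure" and rnd q p lev_q lev_p T D +
  fixes m0 m1 s0 s1 :: "'a \<Rightarrow> real"
  assumes m_meas: "m0 \<in> borel_measurable borel" "m1 \<in> borel_measurable borel"
    and s_meas: "s0 \<in> borel_measurable borel" "s1 \<in> borel_measurable borel"
    and s_nonneg: "\<And>x. 0 \<le> s0 x" "\<And>x. 0 \<le> s1 x"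
    and m_square: "integrable M (\<lambda>\<omega>. (m0 (\<psi> 1 \<omega>))\<^sup>2)" "integrable M (\<lambda>\<omega>. (m1 (\<psi> 1 \<omega>))\<^sup>2)"
    and s_int: "integrable M (\<lambda>\<omega>. s0 (\<psi> 1 \<omega>))" "integrable M (\<lambda>\<omega>. s1 (\<psi> 1 \<omega>))"
    and mean_0: "cond_mean_zero M (gen_by M (\<psi> 1) borel) (\<lambda>\<omega>. Y0 1 \<omega> - m0 (\<psi> 1 \<omega>))"
    and mean_1: "cond_mean_zero M (gen_by M (\<psi> 1) borel) (\<lambda>\<omega>. Y1 1 \<omega> - m1 (\<psi> 1 \<omega>))"
    and var_0: "cond_mean_zero M (gen_by M (\<psi> 1) borel) (\<lambda>\<omega>. (Y0 1 \<omega> - m0 (\<psi> 1 \<omega>))\<^sup>2 - s0 (\<psi> 1 \<omega>))"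
    and var_1: "cond_mean_zero M (gen_by M (\<psi> 1) borel) (\<lambda>\<omega>. (Y1 1 \<omega> - m1 (\<psi> 1 \<omega>))\<^sup>2 - s1 (\<psi> 1 \<omega>))"
begin

definition e0 :: "'a \<times> real \<times> real \<Rightarrow> real" where "e0 w = fst (snd w) - m0 (fst w)"
definition e1 :: "'a \<times> real \<times> real \<Rightarrow> real" where "e1 w = snd (snd w) - m1 (fst w)"
definition w0 :: "'a \<Rightarrow> real" where "w0 x = 1 / (q x * (1 - p x))"
definition w1 :: "'a \<Rightarrow> real" where "w1 x = 1 / (q x * p x)"
definition treated :: "nat \<Rightarrow> nat \<Rightarrow> 'w \<Rightarrow> real" where "treated n i \<omega> = of_bool (T n i \<omega> \<and> D n i \<omega>)"
definition control :: "nat \<Rightarrow> nat \<Rightarrow> 'w \<Rightarrow> real" where "control n i \<omega> = of_bool (T n i \<omega>) - treated n i \<omega>"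
text \<open>The inverse-probability weighted outcome error of a unit. Treated and control exclude
  each other, so its square has no mixed term.\<close>

definition \<eta> :: "nat \<Rightarrow> nat \<Rightarrow> 'w \<Rightarrow> real" where
  "\<eta> n i \<omega> = treated n i \<omega> * w1 (\<psi> i \<omega>) * e1 (W i \<omega>) - control n i \<omega> * w0 (\<psi> i \<omega>) * e0 (W i \<omega>)"
text \<open>The conditional variance of \<open>\<eta> n i\<close> given covariates and
  design.\<close>

definition \<sigma>sq :: "nat \<Rightarrow> nat \<Rightarrow> 'w \<Rightarrow> real" where
  "\<sigma>sq n i \<omega> = treated n i \<omega> * (w1 (\<psi> i \<omega>))\<^sup>2 * s1 (\<psi> i \<omega>) + control n i \<omega> * (w0 (\<psi> i \<omega>))\<^sup>2 * s0 (\<psi> i \<omega>)"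
text \<open>The factor that turns the normalization by n into the one by the sampled number. It is a
  function of the sampling states with values between 0 and 1.\<close>

definition A :: "nat \<Rightarrow> 'w \<Rightarrow> real" where
  "A n \<omega> = sqrt (n_sampled n (\<lambda>i. T n i \<omega>) / real n)"
definition c :: "'a \<Rightarrow> real" where "c x = m1 x - m0 x"
definition \<theta> :: real where "\<theta> = expectation (\<lambda>\<omega>. c (\<psi> 1 \<omega>))"
definition cov_sum :: "nat \<Rightarrow> 'w \<Rightarrow> real" where
  "cov_sum n \<omega> = 1 / sqrt (real n) * (\<Sum>i=1..n. c (\<psi> i \<omega>) - \<theta>)"

lemma q_pos: "0 < q x" and q_le_1: "q x \<le> 1" and q_meas: "q \<in> borel_measurable borel"
  using propensity_bounds[OF lev_q] by auto

lemma p_pos: "0 < p x" and p_less_1: "p x < 1" and p_meas: "p \<in> borel_measurable borel"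
  using propensity_bounds[OF lev_p] p_range by auto

lemma finite_range_qp: "finite (range (\<lambda>x. f (q x) (p x)))"
proof -
  have "finite (range q \<times> range p)"
    using propensity_bounds(3)[OF lev_q] propensity_bounds(3)[OF lev_p] by (rule finite_cartesian_product)
  moreover have "range (\<lambda>x. f (q x) (p x)) \<subseteq> case_prod f ` (range q \<times> range p)" by auto
  ultimately show ?thesis by (rule finite_surj)
qed

lemma w_meas: "w0 \<in> borel_measurable borel" "w1 \<in> borel_measurable borel"
proof -
  note [measurable] = q_meas p_meas
  show "w0 \<in> borel_measurable borel" "w1 \<in> borel_measurable borel"
    unfolding w0_def w1_def by measurable
qed

lemma e_meas: "e0 \<in> borel_measurable borel" "e1 \<in> borel_measurable borel"
proof -
  note f = measurable_fst_borel[where ?'a='a] measurable_compose[OF measurable_snd_borel measurable_fst_borel]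
    measurable_compose[OF measurable_snd_borel measurable_snd_borel]
  show "e0 \<in> borel_measurable borel" "e1 \<in> borel_measurable borel"
    unfolding e0_def e1_def
    by (intro borel_measurable_diff f measurable_compose[OF measurable_fst_borel] m_meas)+
qed

lemma c_meas: "c \<in> borel_measurable borel"
  unfolding c_def using m_meas by simp

lemma e0_W: "e0 (W i \<omega>) = Y0 i \<omega> - m0 (\<psi> i \<omega>)" and e1_W: "e1 (W i \<omega>) = Y1 i \<omega> - m1 (\<psi> i \<omega>)"
  by (simp_all add: e0_def e1_def W_def)

lemma treated_01: "treated n i \<omega> = 0 \<or> treated n i \<omega> = 1" "control n i \<omega> = 0 \<or> control n i \<omega> = 1"
    "treated n i \<omega> * control n i \<omega> = 0"
  by (auto simp: treated_def control_def)

lemma \<psi>_meas: "i \<ge> 1 \<Longrightarrow> \<psi> i \<in> borel_measurable M"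
  using W_meas by (rule \<psi>_of_W)

lemma c_square: "integrable M (\<lambda>\<omega>. (c (\<psi> 1 \<omega>))\<^sup>2)"
proof -
  note m = measurable_compose[OF \<psi>_meas[OF order_refl] m_meas(1)] measurable_compose[OF \<psi>_meas[OF order_refl] m_meas(2)]
  have "integrable M (\<lambda>\<omega>. (m1 (\<psi> 1 \<omega>) + - m0 (\<psi> 1 \<omega>))\<^sup>2)"
    by (rule integrable_square_add) (use m m_square in auto)
  then show ?thesis by (simp add: c_def)
qed

lemma c_int: "integrable M (\<lambda>\<omega>. c (\<psi> 1 \<omega>))"
  by (rule square_integrable_imp_integrable[OF measurable_compose[OF \<psi>_meas[OF order_refl] c_meas] c_square])

lemma n_sampled_le: "0 \<le> n_sampled n t" "n_sampled n t \<le> real n"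
proof -
  show "0 \<le> n_sampled n t" unfolding n_sampled_def by (rule sum_nonneg) simp
  have "n_sampled n t \<le> (\<Sum>i=1..n. 1)" unfolding n_sampled_def by (rule sum_mono) simp
  then show "n_sampled n t \<le> real n" by simp
qed

lemma A_bounds: "0 \<le> A n \<omega>" "A n \<omega> \<le> 1"
  unfolding A_def using n_sampled_le[of n "\<lambda>i. T n i \<omega>"] by (auto simp: divide_le_eq_1)

lemma A_square: "(A n \<omega>)\<^sup>2 = n_sampled n (\<lambda>i. T n i \<omega>) / real n"
  unfolding A_def using n_sampled_le[of n "\<lambda>i. T n i \<omega>"] by simp

text \<open>Stated for an arbitrary \<open>F\<close>, to be used both on the whole space and for the
  information with the outcomes of one unit withheld. Of the quantities listed only
  \<open>\<eta> n j\<close> involves outcomes, which explains its extra premise.\<close>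

lemma design_vars_meas:
  assumes \<psi>: "\<And>j. j \<in> {1..n} \<Longrightarrow> \<psi> j \<in> borel_measurable F"
    and T: "\<And>j. j \<in> {1..n} \<Longrightarrow> T n j \<in> F \<rightarrow>\<^sub>M count_space UNIV"
    and TD: "\<And>j. j \<in> {1..n} \<Longrightarrow> (\<lambda>\<omega>. T n j \<omega> \<and> D n j \<omega>) \<in> F \<rightarrow>\<^sub>M count_space UNIV"
  shows "A n \<in> borel_measurable F" "cov_sum n \<in> borel_measurable F"
    and "j \<in> {1..n} \<Longrightarrow> treated n j \<in> borel_measurable F" "j \<in> {1..n} \<Longrightarrow> control n j \<in> borel_measurable F"
    and "j \<in> {1..n} \<Longrightarrow> (\<lambda>\<omega>. w0 (\<psi> j \<omega>)) \<in> borel_measurable F" "j \<in> {1..n} \<Longrightarrow> (\<lambda>\<omega>. w1 (\<psi> j \<omega>)) \<in> borel_measurable F"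
    and "j \<in> {1..n} \<Longrightarrow> \<sigma>sq n j \<in> borel_measurable F"
    and "j \<in> {1..n} \<Longrightarrow> W j \<in> borel_measurable F \<Longrightarrow> \<eta> n j \<in> borel_measurable F"
proof -
  have ofT: "(\<lambda>\<omega>. of_bool (T n j \<omega>) :: real) \<in> borel_measurable F" if "j \<in> {1..n}" for j
    by (rule measurable_compose[OF T[OF that]]) simp
  have tr: "treated n j \<in> borel_measurable F" if "j \<in> {1..n}" for j
    unfolding treated_def by (rule measurable_compose[OF TD[OF that], of of_bool]) simp
  have co: "control n j \<in> borel_measurable F" if "j \<in> {1..n}" for j
    unfolding control_def by (intro borel_measurable_diff ofT tr that)
  have w: "(\<lambda>\<omega>. w0 (\<psi> j \<omega>)) \<in> borel_measurable F" "(\<lambda>\<omega>. w1 (\<psi> j \<omega>)) \<in> borel_measurable F"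
    "(\<lambda>\<omega>. s0 (\<psi> j \<omega>)) \<in> borel_measurable F" "(\<lambda>\<omega>. s1 (\<psi> j \<omega>)) \<in> borel_measurable F"
    "(\<lambda>\<omega>. c (\<psi> j \<omega>)) \<in> borel_measurable F" if "j \<in> {1..n}" for j
    using measurable_compose[OF \<psi>[OF that]] w_meas s_meas c_meas by auto
  show "A n \<in> borel_measurable F"
    unfolding A_def n_sampled_def
    by (intro measurable_compose[OF _ borel_measurable_sqrt] borel_measurable_divide borel_measurable_sum ofT) auto
  show "cov_sum n \<in> borel_measurable F"
    unfolding cov_sum_def
    by (intro borel_measurable_times borel_measurable_sum borel_measurable_diff w borel_measurable_const)
  show "j \<in> {1..n} \<Longrightarrow> treated n j \<in> borel_measurable F" by (rule tr)
  show "j \<in> {1..n} \<Longrightarrow> control n j \<in> borel_measurable F" by (rule co)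
  show "j \<in> {1..n} \<Longrightarrow> (\<lambda>\<omega>. w0 (\<psi> j \<omega>)) \<in> borel_measurable F" by (rule w)
  show "j \<in> {1..n} \<Longrightarrow> (\<lambda>\<omega>. w1 (\<psi> j \<omega>)) \<in> borel_measurable F" by (rule w)
  show "j \<in> {1..n} \<Longrightarrow> \<sigma>sq n j \<in> borel_measurable F"
    unfolding \<sigma>sq_def by (intro borel_measurable_add borel_measurable_times borel_measurable_power tr co w)
  assume j: "j \<in> {1..n}" and Wj: "W j \<in> borel_measurable F"
  show "\<eta> n j \<in> borel_measurable F"
    unfolding \<eta>_def
    by (intro borel_measurable_diff borel_measurable_times tr co w j measurable_compose[OF Wj] e_meas)
qed

lemma TD_meas: "j \<in> {1..n} \<Longrightarrow> (\<lambda>\<omega>. T n j \<omega> \<and> D n j \<omega>) \<in> M \<rightarrow>\<^sub>M count_space UNIV"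
proof -
  assume j: "j \<in> {1..n}"
  note [measurable] = T_meas[OF j] D_meas[OF j]
  show ?thesis by measurable
qed

lemma \<psi>_meas_upto: "j \<in> {1..n} \<Longrightarrow> \<psi> j \<in> borel_measurable M"
  using \<psi>_meas by simp

lemma vars_meas:
  shows "A n \<in> borel_measurable M" "cov_sum n \<in> borel_measurable M"
    and "j \<in> {1..n} \<Longrightarrow> \<sigma>sq n j \<in> borel_measurable M" "j \<in> {1..n} \<Longrightarrow> \<eta> n j \<in> borel_measurable M"
proof -
  show "A n \<in> borel_measurable M" "cov_sum n \<in> borel_measurable M"
    by (rule design_vars_meas[OF \<psi>_meas_upto T_meas TD_meas]; assumption)+
  assume j: "j \<in> {1..n}"
  then have Wj: "W j \<in> borel_measurable M" using W_meas by simp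
  show "\<sigma>sq n j \<in> borel_measurable M"
    by (rule design_vars_meas(7)[of n M j, OF \<psi>_meas_upto T_meas TD_meas]; (assumption | rule j))
  show "\<eta> n j \<in> borel_measurable M"
    by (rule design_vars_meas(8)[of n M j, OF \<psi>_meas_upto T_meas TD_meas]; (assumption | rule j Wj))
qed

lemma \<psi>_average:
  assumes b: "b \<in> borel_measurable borel" "integrable M (\<lambda>\<omega>. b (\<psi> 1 \<omega>))"
  shows "tends_to_zero_in_prob M (\<lambda>n \<omega>. 1 / real n * (\<Sum>i=1..n. b (\<psi> i \<omega>)) - expectation (\<lambda>\<omega>. b (\<psi> 1 \<omega>)))"
    and "n \<ge> 1 \<Longrightarrow> (\<lambda>\<omega>. 1 / real n * (\<Sum>i=1..n. b (\<psi> i \<omega>)) - expectation (\<lambda>\<omega>. b (\<psi> 1 \<omega>))) \<in> borel_measurable M"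
proof -
  have bm: "(\<lambda>\<omega>. b (\<psi> i \<omega>)) \<in> borel_measurable M" if "i \<ge> 1" for i
    by (rule measurable_compose[OF \<psi>_meas[OF that] b(1)])
  show meas: "(\<lambda>\<omega>. 1 / real n * (\<Sum>i=1..n. b (\<psi> i \<omega>)) - expectation (\<lambda>\<omega>. b (\<psi> 1 \<omega>))) \<in> borel_measurable M" for n
    by (intro borel_measurable_diff borel_measurable_times borel_measurable_sum bm) auto
  have "indep_vars (\<lambda>_. borel) (\<lambda>i \<omega>. b (fst (W i \<omega>))) {1..}"
    by (rule indep_vars_compose2[OF W_indep]) (rule measurable_compose[OF measurable_fst_borel b(1)])
  then have indep: "indep_vars (\<lambda>_. borel) (\<lambda>i \<omega>. b (\<psi> i \<omega>)) {1..}" by (simp add: fst_W)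
  have eq: "distr M borel (\<lambda>\<omega>. b (\<psi> i \<omega>)) = distr (distr M borel (\<psi> i)) borel b" if "i \<ge> 1" for i
    using \<psi>_meas[OF that] b(1) by (subst distr_distr) (auto simp: comp_def)
  have ident: "distr M borel (\<lambda>\<omega>. b (\<psi> i \<omega>)) = distr M borel (\<lambda>\<omega>. b (\<psi> 1 \<omega>))" if "i \<ge> 1" for i
    unfolding eq[OF that] eq[OF order_refl] \<psi>_distr[OF that] ..
  have int: "integrable M (\<lambda>\<omega>. b (\<psi> i \<omega>))" if "i \<ge> 1" for i
    using distr_eq_integral(1)[OF \<psi>_meas[OF that] \<psi>_meas[OF order_refl] b(1) \<psi>_distr[OF that]] b(2) by simp
  show "tends_to_zero_in_prob M (\<lambda>n \<omega>. 1 / real n * (\<Sum>i=1..n. b (\<psi> i \<omega>)) - expectation (\<lambda>\<omega>. b (\<psi> 1 \<omega>)))"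
  proof (rule tends_to_zero_in_prob_L1)
    show "integrable M (\<lambda>\<omega>. 1 / real n * (\<Sum>i=1..n. b (\<psi> i \<omega>)) - expectation (\<lambda>\<omega>. b (\<psi> 1 \<omega>)))" for n
      by (intro Bochner_Integration.integrable_diff integrable_mult_right Bochner_Integration.integrable_sum int) auto
  qed (rule L1_law_of_large_numbers[OF indep ident b(2)])
qed

section \<open>The sampled fraction\<close>

definition q_mean :: real where "q_mean = expectation (\<lambda>\<omega>. q (\<psi> 1 \<omega>))"

lemma q_int: "integrable M (\<lambda>\<omega>. q (\<psi> 1 \<omega>))"
proof (rule integrable_const_bound[of _ 1])
  show "AE \<omega> in M. norm (q (\<psi> 1 \<omega>)) \<le> 1" using q_pos q_le_1 by (auto simp: abs_of_pos)
qed (rule measurable_compose[OF \<psi>_meas[OF order_refl] q_meas])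

lemma q_mean_pos: "q_mean > 0"
proof -
  have "q_mean \<noteq> 0"
  proof
    assume "q_mean = 0"
    then have "AE \<omega> in M. q (\<psi> 1 \<omega>) = 0"
      unfolding q_mean_def using integral_nonneg_eq_0_iff_AE[OF q_int] q_pos by (auto simp: less_imp_le)
    then have "AE \<omega> in M. False" using q_pos by (auto elim!: AE_mp intro!: AE_I2 simp: less_le)
    then show False by simp
  qed
  moreover have "q_mean \<ge> 0" unfolding q_mean_def using q_pos by (simp add: integral_nonneg less_imp_le)
  ultimately show ?thesis by simp
qed

text \<open>The sampled fraction minus the average propensity is the randomization error of the
  constant integrand 1; the average propensity obeys the law of large numbers.\<close>

lemma A_square_limit: "tends_to_zero_in_prob M (\<lambda>n \<omega>. (A n \<omega>)\<^sup>2 - q_mean)"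
proof (rule tends_to_zero_in_prob_le_add)
  show "tends_to_zero_in_prob M (\<lambda>n \<omega>. 1 / real n * (\<Sum>i=1..n. (of_bool (T n i \<omega>) - q (\<psi> i \<omega>)) * 1))"
    by (rule samp.randomization_error_L1) auto
  show "(\<lambda>\<omega>. 1 / real n * (\<Sum>i=1..n. (of_bool (T n i \<omega>) - q (\<psi> i \<omega>)) * 1)) \<in> borel_measurable M" if "n \<ge> 1" for n
    using samp.sum_meas[OF that, of "\<lambda>_. 1"] by simp
  show "tends_to_zero_in_prob M (\<lambda>n \<omega>. 1 / real n * (\<Sum>i=1..n. q (\<psi> i \<omega>)) - q_mean)"
    unfolding q_mean_def by (rule \<psi>_average[OF q_meas q_int])
  show "(\<lambda>\<omega>. 1 / real n * (\<Sum>i=1..n. q (\<psi> i \<omega>)) - q_mean) \<in> borel_measurable M" if "n \<ge> 1" for n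
    unfolding q_mean_def by (rule \<psi>_average(2)[OF q_meas q_int that])
  show "\<bar>(A n \<omega>)\<^sup>2 - q_mean\<bar> \<le> \<bar>1 / real n * (\<Sum>i=1..n. (of_bool (T n i \<omega>) - q (\<psi> i \<omega>)) * 1)\<bar>
      + \<bar>1 / real n * (\<Sum>i=1..n. q (\<psi> i \<omega>)) - q_mean\<bar>" for n \<omega>
  proof -
    have "(A n \<omega>)\<^sup>2 - q_mean = 1 / real n * (\<Sum>i=1..n. (of_bool (T n i \<omega>) - q (\<psi> i \<omega>)) * 1)
        + (1 / real n * (\<Sum>i=1..n. q (\<psi> i \<omega>)) - q_mean)"
      unfolding A_square n_sampled_def by (simp add: sum_subtractf diff_divide_distrib)
    then show ?thesis by linarith
  qed
qed

text \<open>Factoring the difference of squares, \<open>A n + sqrt q_mean\<close> is at least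
  \<open>sqrt q_mean\<close>, which is positive because sampling propensities are.\<close>

lemma A_limit: "tends_to_zero_in_prob M (\<lambda>n \<omega>. A n \<omega> - sqrt q_mean)"
proof (rule tends_to_zero_in_prob_mono)
  show "tends_to_zero_in_prob M (\<lambda>n \<omega>. 1 / sqrt q_mean * ((A n \<omega>)\<^sup>2 - q_mean))"
    by (rule tends_to_zero_in_prob_cmult[OF A_square_limit])
  show "(\<lambda>\<omega>. 1 / sqrt q_mean * ((A n \<omega>)\<^sup>2 - q_mean)) \<in> borel_measurable M" for n
    by (intro borel_measurable_times borel_measurable_diff borel_measurable_power borel_measurable_const vars_meas)
  show "\<bar>A n \<omega> - sqrt q_mean\<bar> \<le> \<bar>1 / sqrt q_mean * ((A n \<omega>)\<^sup>2 - q_mean)\<bar>" for n \<omega>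
  proof -
    have pos: "sqrt q_mean > 0" using q_mean_pos by simp
    have "(A n \<omega>)\<^sup>2 - q_mean = (A n \<omega> - sqrt q_mean) * (A n \<omega> + sqrt q_mean)"
      using q_mean_pos by (simp add: algebra_simps power2_eq_square)
    then have "\<bar>1 / sqrt q_mean * ((A n \<omega>)\<^sup>2 - q_mean)\<bar> = \<bar>A n \<omega> - sqrt q_mean\<bar> * ((A n \<omega> + sqrt q_mean) / sqrt q_mean)"
      using A_bounds(1)[of n \<omega>] pos by (simp add: abs_mult)
    moreover have "1 \<le> (A n \<omega> + sqrt q_mean) / sqrt q_mean" using A_bounds(1)[of n \<omega>] pos by (simp add: le_divide_eq)
    ultimately show ?thesis using mult_left_mono[of 1 "(A n \<omega> + sqrt q_mean) / sqrt q_mean" "\<bar>A n \<omega> - sqrt q_mean\<bar>"] by simp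
  qed
qed

text \<open>Propensities with finitely many values keep \<open>q\<close> away from 0 and
  \<open>p\<close> away from 0 and 1, so overlap is uniform.\<close>

lemma weight_bound: "\<exists>K\<ge>1. (\<forall>x. 0 \<le> w0 x) \<and> (\<forall>x. w0 x \<le> K) \<and> (\<forall>x. 0 \<le> w1 x) \<and> (\<forall>x. w1 x \<le> K)"
proof -
  obtain K0 where K0: "\<And>x. \<bar>w0 x\<bar> \<le> K0"
    using finite_range_bound[OF finite_range_qp[of "\<lambda>a b. 1 / (a * (1 - b))"]] unfolding w0_def by blast
  obtain K1 where K1: "\<And>x. \<bar>w1 x\<bar> \<le> K1"
    using finite_range_bound[OF finite_range_qp[of "\<lambda>a b. 1 / (a * b)"]] unfolding w1_def by blast
  show ?thesis
  proof (intro exI[of _ "max 1 (max K0 K1)"] conjI allI)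
    show "0 \<le> w0 x" "0 \<le> w1 x" for x
      using q_pos[of x] p_pos[of x] p_less_1[of x] by (auto simp: w0_def w1_def)
    show "w0 x \<le> max 1 (max K0 K1)" "w1 x \<le> max 1 (max K0 K1)" for x
      using K0[of x] K1[of x] by (auto simp: le_max_iff_disj)
  qed simp
qed

lemma bounded_mult_int:
  fixes f g :: "'a \<Rightarrow> real"
  assumes f: "integrable M (\<lambda>\<omega>. f (\<psi> 1 \<omega>))" and g: "g \<in> borel_measurable borel" "\<And>x. \<bar>g x\<bar> \<le> K"
  shows "integrable M (\<lambda>\<omega>. g (\<psi> 1 \<omega>) * f (\<psi> 1 \<omega>))"
proof (rule Bochner_Integration.integrable_bound)
  show "integrable M (\<lambda>\<omega>. K * f (\<psi> 1 \<omega>))" using f by simp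
  show "AE \<omega> in M. norm (g (\<psi> 1 \<omega>) * f (\<psi> 1 \<omega>)) \<le> norm (K * f (\<psi> 1 \<omega>))"
    using g(2) by (intro AE_I2) (simp add: abs_mult mult_right_mono order_trans[OF g(2) abs_ge_self])
  show "(\<lambda>\<omega>. g (\<psi> 1 \<omega>) * f (\<psi> 1 \<omega>)) \<in> borel_measurable M"
    using f measurable_compose[OF \<psi>_meas[OF order_refl] g(1)] by (intro borel_measurable_times) auto
qed

section \<open>The average conditional variance\<close>

definition \<sigma>sq_mean :: real where
  "\<sigma>sq_mean = expectation (\<lambda>\<omega>. (1 / q (\<psi> 1 \<omega>)) * (s1 (\<psi> 1 \<omega>) / p (\<psi> 1 \<omega>) + s0 (\<psi> 1 \<omega>) / (1 - p (\<psi> 1 \<omega>))))"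

text \<open>With \<open>b\<close> the difference between the treated and the control value,
  \<open>H\<close> the value averaged over treatment and \<open>h = q * H\<close> the value averaged
  over both stages, each summand equals T (D - p) b + (T - q) H + h. The first two are randomization
  errors of merely integrable integrands, the third is an average over i.i.d. covariates.\<close>

lemma \<sigma>sq_average_limit: "tends_to_zero_in_prob M (\<lambda>n \<omega>. 1 / real n * (\<Sum>i=1..n. \<sigma>sq n i \<omega>) - \<sigma>sq_mean)"
proof -
  obtain K where K: "K \<ge> 1" "\<And>x. 0 \<le> w0 x" "\<And>x. w0 x \<le> K" "\<And>x. 0 \<le> w1 x" "\<And>x. w1 x \<le> K"
    using weight_bound by blast
  define b where "b x = (w1 x)\<^sup>2 * s1 x - (w0 x)\<^sup>2 * s0 x" for x
  define H where "H x = p x * (w1 x)\<^sup>2 * s1 x + (1 - p x) * (w0 x)\<^sup>2 * s0 x" for x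
  define h where "h x = q x * H x" for x
  note [measurable] = w_meas s_meas q_meas p_meas
  have bm: "b \<in> borel_measurable borel" and Hm: "H \<in> borel_measurable borel" and hm: "h \<in> borel_measurable borel"
    unfolding b_def H_def h_def by measurable
  have K2: "(w0 x)\<^sup>2 \<le> K\<^sup>2" "(w1 x)\<^sup>2 \<le> K\<^sup>2" for x using K(2-5)[of x] by (auto intro: power_mono)
  have bi: "integrable M (\<lambda>\<omega>. b (\<psi> 1 \<omega>))"
    unfolding b_def
    by (intro Bochner_Integration.integrable_diff bounded_mult_int[of _ "\<lambda>x. (w1 x)\<^sup>2" "K\<^sup>2"] bounded_mult_int[of _ "\<lambda>x. (w0 x)\<^sup>2" "K\<^sup>2"] s_int)
       (auto simp: K2)
  have pw: "\<bar>p x * (w1 x)\<^sup>2\<bar> \<le> K\<^sup>2" "\<bar>(1 - p x) * (w0 x)\<^sup>2\<bar> \<le> K\<^sup>2" for x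
    using mult_mono[of "p x" 1 "(w1 x)\<^sup>2" "K\<^sup>2"] mult_mono[of "1 - p x" 1 "(w0 x)\<^sup>2" "K\<^sup>2"] K2[of x] p_pos[of x] p_less_1[of x]
    by (auto simp: abs_mult)
  have Hi: "integrable M (\<lambda>\<omega>. H (\<psi> 1 \<omega>))"
    unfolding H_def
    by (intro Bochner_Integration.integrable_add bounded_mult_int[of _ "\<lambda>x. p x * (w1 x)\<^sup>2" "K\<^sup>2"]
        bounded_mult_int[of _ "\<lambda>x. (1 - p x) * (w0 x)\<^sup>2" "K\<^sup>2"] s_int)
       (auto simp del: abs_mult simp: pw)
  have hi: "integrable M (\<lambda>\<omega>. h (\<psi> 1 \<omega>))"
    unfolding h_def by (rule bounded_mult_int[OF Hi q_meas, of 1]) (use q_pos q_le_1 in \<open>auto simp: abs_of_pos\<close>)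
  have h_eq: "h x = (1 / q x) * (s1 x / p x + s0 x / (1 - p x))" for x
  proof -
    have "q x * (p x * (w1 x)\<^sup>2) = 1 / (q x * p x)" "q x * ((1 - p x) * (w0 x)\<^sup>2) = 1 / (q x * (1 - p x))"
      using q_pos[of x] p_pos[of x] p_less_1[of x] by (simp_all add: w0_def w1_def power2_eq_square)
    then have "h x = 1 / (q x * p x) * s1 x + 1 / (q x * (1 - p x)) * s0 x"
      unfolding h_def H_def by (simp only: distrib_left mult.assoc[symmetric])
    then show ?thesis by (simp add: distrib_left)
  qed
  have h_mean: "expectation (\<lambda>\<omega>. h (\<psi> 1 \<omega>)) = \<sigma>sq_mean" unfolding h_eq \<sigma>sq_mean_def ..
  define E1 where "E1 n \<omega> = 1 / real n * (\<Sum>i\<in>{i \<in> {1..n}. T n i \<omega>}. (of_bool (D n i \<omega>) - p (\<psi> i \<omega>)) * b (\<psi> i \<omega>))" for n \<omega>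
  define E2 where "E2 n \<omega> = 1 / real n * (\<Sum>i=1..n. (of_bool (T n i \<omega>) - q (\<psi> i \<omega>)) * H (\<psi> i \<omega>))" for n \<omega>
  define E3 where "E3 n \<omega> = 1 / real n * (\<Sum>i=1..n. h (\<psi> i \<omega>)) - \<sigma>sq_mean" for n \<omega>
  have E1: "tends_to_zero_in_prob M E1" "\<And>n. n \<ge> 1 \<Longrightarrow> E1 n \<in> borel_measurable M"
    unfolding E1_def using assg.randomization_error_L1[OF bm bi] assg.sum_meas[OF _ bm] by auto
  have E2: "tends_to_zero_in_prob M E2" "\<And>n. n \<ge> 1 \<Longrightarrow> E2 n \<in> borel_measurable M"
    unfolding E2_def using samp.randomization_error_L1[OF Hm Hi] samp.sum_meas[OF _ Hm] by auto
  have E3: "tends_to_zero_in_prob M E3" "\<And>n. n \<ge> 1 \<Longrightarrow> E3 n \<in> borel_measurable M"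
    unfolding E3_def h_mean[symmetric] using \<psi>_average[OF hm hi] by auto
  have E12: "tends_to_zero_in_prob M (\<lambda>n \<omega>. E1 n \<omega> + E2 n \<omega>)"
    by (rule tends_to_zero_in_prob_le_add[OF E1(2) E2(2) E1(1) E2(1)]) auto
  show ?thesis
  proof (rule tends_to_zero_in_prob_le_add[OF _ E3(2) E12 E3(1)])
    show "(\<lambda>\<omega>. E1 n \<omega> + E2 n \<omega>) \<in> borel_measurable M" if "n \<ge> 1" for n using E1(2) E2(2) that by simp
    fix n \<omega>
    have decomp: "\<sigma>sq n i \<omega> = of_bool (T n i \<omega>) * ((of_bool (D n i \<omega>) - p (\<psi> i \<omega>)) * b (\<psi> i \<omega>))
        + (of_bool (T n i \<omega>) - q (\<psi> i \<omega>)) * H (\<psi> i \<omega>) + h (\<psi> i \<omega>)" for i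
      unfolding \<sigma>sq_def treated_def control_def b_def H_def h_def by (cases "T n i \<omega>"; cases "D n i \<omega>") (auto simp: algebra_simps)
    have sumT: "(\<Sum>i\<in>{i \<in> {1..n}. T n i \<omega>}. (of_bool (D n i \<omega>) - p (\<psi> i \<omega>)) * b (\<psi> i \<omega>))
        = (\<Sum>i=1..n. of_bool (T n i \<omega>) * ((of_bool (D n i \<omega>) - p (\<psi> i \<omega>)) * b (\<psi> i \<omega>)))"
      by (rule sum.mono_neutral_cong_left) auto
    have "1 / real n * (\<Sum>i=1..n. \<sigma>sq n i \<omega>) - \<sigma>sq_mean = E1 n \<omega> + E2 n \<omega> + E3 n \<omega>"
      unfolding E1_def E2_def E3_def sumT decomp sum.distrib by (simp add: algebra_simps)
    then show "\<bar>1 / real n * (\<Sum>i=1..n. \<sigma>sq n i \<omega>) - \<sigma>sq_mean\<bar> \<le> \<bar>E1 n \<omega> + E2 n \<omega>\<bar> + \<bar>E3 n \<omega>\<bar>" by linarith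
  qed
qed

end

lemma norm_iexp_diff_le: "norm (iexp a - iexp b) \<le> \<bar>a - b\<bar>" "norm (iexp a - iexp b) \<le> 2" for a b :: real
proof -
  have "iexp a - iexp b = iexp b * (iexp (a - b) - 1)"
    by (simp add: algebra_simps exp_diff)
  then have "norm (iexp a - iexp b) = norm (iexp (a - b) - 1)" by (simp add: norm_mult)
  also have "\<dots> \<le> \<bar>a - b\<bar>" using iexp_approx1[of "a - b" 0] by simp
  finally show "norm (iexp a - iexp b) \<le> \<bar>a - b\<bar>" .
  show "norm (iexp a - iexp b) \<le> 2" using norm_triangle_ineq4[of "iexp a" "iexp b"] by simp
qed

lemma abs_exp_minus_diff_le:
  fixes a b :: real
  assumes "0 \<le> a" "0 \<le> b"
  shows "\<bar>exp (- a) - exp (- b)\<bar> \<le> \<bar>a - b\<bar>"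
proof -
  have *: "exp (- a) - exp (- b) \<le> b - a" if "0 \<le> a" "a \<le> b" for a b :: real
  proof -
    have "exp (- a) - exp (- b) = exp (- a) * (1 - exp (- (b - a)))" by (simp add: algebra_simps exp_diff exp_minus field_simps)
    also have "\<dots> \<le> 1 * (b - a)"
    proof (rule mult_mono)
      show "1 - exp (- (b - a)) \<le> b - a" using exp_ge_add_one_self[of "- (b - a)"] by linarith
    qed (use that in auto)
    finally show ?thesis by simp
  qed
  show ?thesis using *[of a b] *[of b a] assms by (cases "a \<le> b") auto
qed

lemma (in prob_space) expectation_diff_tendsto_zero:
  fixes f g :: "nat \<Rightarrow> 'a \<Rightarrow> complex"
  assumes "\<And>n. n \<ge> 1 \<Longrightarrow> integrable M (f n)" "\<And>n. n \<ge> 1 \<Longrightarrow> integrable M (g n)"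
    and lim: "(\<lambda>n. expectation (\<lambda>\<omega>. norm (f n \<omega> - g n \<omega>))) \<longlonglongrightarrow> 0"
  shows "(\<lambda>n. (CLINT \<omega>|M. f n \<omega>) - (CLINT \<omega>|M. g n \<omega>)) \<longlonglongrightarrow> 0"
proof (rule tendsto_norm_zero_cancel, rule tendsto_sandwich[OF _ _ tendsto_const lim])
  show "\<forall>\<^sub>F n in sequentially. norm ((CLINT \<omega>|M. f n \<omega>) - (CLINT \<omega>|M. g n \<omega>)) \<le> expectation (\<lambda>\<omega>. norm (f n \<omega> - g n \<omega>))"
  proof (rule eventually_sequentiallyI)
    fix n :: nat assume "1 \<le> n"
    then show "norm ((CLINT \<omega>|M. f n \<omega>) - (CLINT \<omega>|M. g n \<omega>)) \<le> expectation (\<lambda>\<omega>. norm (f n \<omega> - g n \<omega>))"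
      using assms(1,2)[of n] integral_norm_bound[of M "\<lambda>\<omega>. f n \<omega> - g n \<omega>"] by simp
  qed
qed simp

section \<open>Covariate sum and Gaussian replacement of the outcome errors\<close>

context outcome_moments
begin

definition c_var :: real where "c_var = expectation (\<lambda>\<omega>. (c (\<psi> 1 \<omega>) - \<theta>)\<^sup>2)"

lemma c_centered:
  shows "indep_vars (\<lambda>_. borel) (\<lambda>i \<omega>. c (\<psi> i \<omega>) - \<theta>) {1..}"
    and "i \<ge> 1 \<Longrightarrow> distr M borel (\<lambda>\<omega>. c (\<psi> i \<omega>) - \<theta>) = distr M borel (\<lambda>\<omega>. c (\<psi> 1 \<omega>) - \<theta>)"
    and "integrable M (\<lambda>\<omega>. (c (\<psi> 1 \<omega>) - \<theta>)\<^sup>2)" and "expectation (\<lambda>\<omega>. c (\<psi> 1 \<omega>) - \<theta>) = 0"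
proof -
  have cm: "(\<lambda>x. c x - \<theta>) \<in> borel_measurable borel" using c_meas by simp
  have "indep_vars (\<lambda>_. borel) (\<lambda>i \<omega>. c (fst (W i \<omega>)) - \<theta>) {1..}"
    by (rule indep_vars_compose2[OF W_indep]) (rule measurable_compose[OF measurable_fst_borel cm])
  then show "indep_vars (\<lambda>_. borel) (\<lambda>i \<omega>. c (\<psi> i \<omega>) - \<theta>) {1..}" by (simp add: fst_W)
  have eq: "distr M borel (\<lambda>\<omega>. c (\<psi> i \<omega>) - \<theta>) = distr (distr M borel (\<psi> i)) borel (\<lambda>x. c x - \<theta>)" if "i \<ge> 1" for i
    using \<psi>_meas[OF that] cm by (subst distr_distr) (auto simp: comp_def)
  show "distr M borel (\<lambda>\<omega>. c (\<psi> i \<omega>) - \<theta>) = distr M borel (\<lambda>\<omega>. c (\<psi> 1 \<omega>) - \<theta>)" if "i \<ge> 1"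
    unfolding eq[OF that] eq[OF order_refl] \<psi>_distr[OF that] ..
  have "integrable M (\<lambda>\<omega>. (c (\<psi> 1 \<omega>) + - \<theta>)\<^sup>2)"
    by (rule integrable_square_add) (use measurable_compose[OF \<psi>_meas[OF order_refl] c_meas] c_square in auto)
  then show "integrable M (\<lambda>\<omega>. (c (\<psi> 1 \<omega>) - \<theta>)\<^sup>2)" by simp
  show "expectation (\<lambda>\<omega>. c (\<psi> 1 \<omega>) - \<theta>) = 0" using c_int by (simp add: \<theta>_def prob_space)
qed

lemma cov_sum_char_limit:
  "(\<lambda>n. CLINT \<omega>|M. iexp (t * cov_sum n \<omega>)) \<longlonglongrightarrow> complex_of_real (exp (- (t\<^sup>2 * c_var) / 2))"
  unfolding cov_sum_def c_var_def by (rule iid_sum_char_limit[OF c_centered])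

lemma cov_sum_second_moment:
  assumes n: "n \<ge> 1"
  shows "integrable M (\<lambda>\<omega>. (cov_sum n \<omega>)\<^sup>2)" "expectation (\<lambda>\<omega>. (cov_sum n \<omega>)\<^sup>2) = c_var"
proof -
  note sm = iid_sum_second_moment[OF c_centered, of n]
  have eq: "(cov_sum n \<omega>)\<^sup>2 = 1 / real n * (\<Sum>i=1..n. c (\<psi> i \<omega>) - \<theta>)\<^sup>2" for \<omega>
    by (simp add: cov_sum_def power_divide)
  show "integrable M (\<lambda>\<omega>. (cov_sum n \<omega>)\<^sup>2)" unfolding eq using sm(1) by simp
  show "expectation (\<lambda>\<omega>. (cov_sum n \<omega>)\<^sup>2) = c_var"
    using sm(2) n unfolding eq by (simp add: c_var_def del: One_nat_def)
qed

lemma c_var_nonneg: "0 \<le> c_var"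
  unfolding c_var_def by (simp add: integral_nonneg)

text \<open>The sampled fraction and the covariate sum are dependent, so their product is estimated
  directly: where \<open>A n\<close> is within \<open>\<delta>\<close> of its limit, the second
  moment is at most \<open>\<delta>\<^sup>2 * c_var\<close>. The summand 1 in
  \<open>\<delta>\<close> covers \<open>c_var = 0\<close>.\<close>

lemma A_cov_sum_limit: "tends_to_zero_in_prob M (\<lambda>n \<omega>. (A n \<omega> - sqrt q_mean) * cov_sum n \<omega>)"
proof (rule tends_to_zero_in_probI)
  show "(\<lambda>\<omega>. (A n \<omega> - sqrt q_mean) * cov_sum n \<omega>) \<in> borel_measurable M" for n
    by (intro borel_measurable_times borel_measurable_diff borel_measurable_const vars_meas)
  fix \<epsilon> :: real assume \<epsilon>: "\<epsilon> > 0"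
  define \<delta> where "\<delta> = sqrt (\<epsilon> / (c_var + 1))"
  have \<delta>: "\<delta> > 0" "\<delta>\<^sup>2 * c_var \<le> \<epsilon>"
  proof -
    have "\<epsilon> / (c_var + 1) > 0" using \<epsilon> c_var_nonneg by simp
    then show "\<delta> > 0" "\<delta>\<^sup>2 * c_var \<le> \<epsilon>"
      using \<epsilon> c_var_nonneg by (simp_all add: \<delta>_def divide_le_eq distrib_left)
  qed
  define G where "G n = {\<omega> \<in> space M. \<bar>A n \<omega> - sqrt q_mean\<bar> \<le> \<delta>}" for n
  have G: "G n \<in> events" for n
    unfolding G_def
    by (intro borel_measurable_le borel_measurable_abs borel_measurable_diff borel_measurable_const vars_meas)
  have "space M - G n = {\<omega> \<in> space M. \<delta> < \<bar>A n \<omega> - sqrt q_mean\<bar>}" for n by (auto simp: G_def)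
  then have lim: "(\<lambda>n. prob (space M - G n)) \<longlonglongrightarrow> 0"
    using A_limit \<delta>(1) unfolding tends_to_zero_in_prob_def by simp
  have "integrable M (\<lambda>\<omega>. indicator (G n) \<omega> * ((A n \<omega> - sqrt q_mean) * cov_sum n \<omega>)\<^sup>2) \<and>
      expectation (\<lambda>\<omega>. indicator (G n) \<omega> * ((A n \<omega> - sqrt q_mean) * cov_sum n \<omega>)\<^sup>2) \<le> \<epsilon>" if n: "n \<ge> 1" for n
  proof
    note cs = cov_sum_second_moment[OF n]
    have le: "indicator (G n) \<omega> * ((A n \<omega> - sqrt q_mean) * cov_sum n \<omega>)\<^sup>2 \<le> \<delta>\<^sup>2 * (cov_sum n \<omega>)\<^sup>2" for \<omega>
    proof (cases "\<omega> \<in> G n")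
      case True
      then have "(A n \<omega> - sqrt q_mean)\<^sup>2 \<le> \<delta>\<^sup>2" using \<delta>(1) by (simp add: G_def abs_le_square_iff[symmetric])
      then show ?thesis using True by (simp add: power_mult_distrib mult_right_mono)
    qed simp
    have le': "norm (indicator (G n) \<omega> * ((A n \<omega> - sqrt q_mean) * cov_sum n \<omega>)\<^sup>2) \<le> norm (\<delta>\<^sup>2 * (cov_sum n \<omega>)\<^sup>2)" for \<omega>
      using le[of \<omega>] by (simp add: abs_mult)
    have i: "integrable M (\<lambda>\<omega>. \<delta>\<^sup>2 * (cov_sum n \<omega>)\<^sup>2)" using cs(1) by simp
    show int: "integrable M (\<lambda>\<omega>. indicator (G n) \<omega> * ((A n \<omega> - sqrt q_mean) * cov_sum n \<omega>)\<^sup>2)"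
    proof (rule Bochner_Integration.integrable_bound[OF i])
      show "(\<lambda>\<omega>. indicator (G n) \<omega> * ((A n \<omega> - sqrt q_mean) * cov_sum n \<omega>)\<^sup>2) \<in> borel_measurable M"
        by (intro borel_measurable_times borel_measurable_power borel_measurable_diff borel_measurable_const
            borel_measurable_indicator G vars_meas)
    qed (use le' in simp)
    have "expectation (\<lambda>\<omega>. indicator (G n) \<omega> * ((A n \<omega> - sqrt q_mean) * cov_sum n \<omega>)\<^sup>2) \<le> expectation (\<lambda>\<omega>. \<delta>\<^sup>2 * (cov_sum n \<omega>)\<^sup>2)"
      by (rule integral_mono[OF int i le])
    also have "\<dots> \<le> \<epsilon>" using cs(2) \<delta>(2) by simp
    finally show "expectation (\<lambda>\<omega>. indicator (G n) \<omega> * ((A n \<omega> - sqrt q_mean) * cov_sum n \<omega>)\<^sup>2) \<le> \<epsilon>" .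
  qed
  then show "\<exists>G. (\<forall>n\<ge>1. G n \<in> events) \<and> (\<lambda>n. prob (space M - G n)) \<longlonglongrightarrow> 0 \<and>
       (\<forall>\<^sub>F n in sequentially. integrable M (\<lambda>\<omega>. indicator (G n) \<omega> * ((A n \<omega> - sqrt q_mean) * cov_sum n \<omega>)\<^sup>2) \<and>
           expectation (\<lambda>\<omega>. indicator (G n) \<omega> * ((A n \<omega> - sqrt q_mean) * cov_sum n \<omega>)\<^sup>2) \<le> \<epsilon>)"
    using G lim by (intro exI[of _ G] conjI eventually_sequentiallyI[of 1]) auto
qed

lemma e_square: "integrable M (\<lambda>\<omega>. (e0 (W 1 \<omega>))\<^sup>2)" "integrable M (\<lambda>\<omega>. (e1 (W 1 \<omega>))\<^sup>2)"
proof -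
  note Bochner_Integration.integrable_add[OF conjunct1[OF var_0[unfolded cond_mean_zero_def]] s_int(1)]
    Bochner_Integration.integrable_add[OF conjunct1[OF var_1[unfolded cond_mean_zero_def]] s_int(2)]
  then show "integrable M (\<lambda>\<omega>. (e0 (W 1 \<omega>))\<^sup>2)" "integrable M (\<lambda>\<omega>. (e1 (W 1 \<omega>))\<^sup>2)"
    unfolding e0_W e1_W by simp_all
qed

lemma \<eta>_square: "(\<eta> n i \<omega>)\<^sup>2 = treated n i \<omega> * (w1 (\<psi> i \<omega>))\<^sup>2 * (e1 (W i \<omega>))\<^sup>2 + control n i \<omega> * (w0 (\<psi> i \<omega>))\<^sup>2 * (e0 (W i \<omega>))\<^sup>2"
  unfolding \<eta>_def using treated_01[where n=n and i=i and \<omega>=\<omega>] by (auto simp: power_mult_distrib)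

lemma \<sigma>sq_nonneg: "0 \<le> \<sigma>sq n i \<omega>"
  unfolding \<sigma>sq_def using treated_01[where n=n and i=i and \<omega>=\<omega>] s_nonneg by auto

lemma bound_01:
  assumes "0 \<le> a" "a \<le> 1" "x = 0 \<or> x = 1" "0 \<le> w" "w \<le> K" "n \<ge> (1::nat)" "(1::real) \<le> K"
  shows "\<bar>a * x * w / sqrt (real n)\<bar> \<le> K" "\<bar>a\<^sup>2 * x * w\<^sup>2 / real n\<bar> \<le> K\<^sup>2"
proof -
  have sn: "1 \<le> sqrt (real n)" using assms(6) by simp
  have "0 \<le> a * x * w" using assms by auto
  then have "a * x * w / sqrt (real n) \<le> a * x * w"
    using sn divide_left_mono[of 1 "sqrt (real n)" "a * x * w"] by simp
  also have "\<dots> \<le> 1 * w" using assms by (intro mult_right_mono) auto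
  finally have "a * x * w / sqrt (real n) \<le> K" using assms by simp
  moreover have "0 \<le> a * x * w / sqrt (real n)" using assms by auto
  ultimately show "\<bar>a * x * w / sqrt (real n)\<bar> \<le> K" by simp
  then have "\<bar>a * x * w / sqrt (real n)\<bar>\<^sup>2 \<le> K\<^sup>2" by (rule power_mono) simp
  moreover have "\<bar>a * x * w / sqrt (real n)\<bar>\<^sup>2 = a\<^sup>2 * x * w\<^sup>2 / real n"
    using assms(3) by (auto simp: power_mult_distrib power_divide)
  moreover have "0 \<le> a\<^sup>2 * x * w\<^sup>2 / real n" using assms(3) by auto
  ultimately show "\<bar>a\<^sup>2 * x * w\<^sup>2 / real n\<bar> \<le> K\<^sup>2" by simp
qed

text \<open>Both \<open>\<xi> i\<close> and its square minus \<open>v i\<close> are combinations of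
  the centred variables e_d and \<open>e_d\<^sup>2 - s_d\<close> of unit \<open>i\<close>. The
  coefficients are bounded and, like \<open>B\<close>, known from the design information: earlier
  units enter \<open>B\<close> through their variances, later ones through outcomes other than those
  of \<open>i\<close>, and \<open>A n\<close> through the sampling states.\<close>

lemma gaussian_replacement_orthogonal:
  fixes t :: real
  assumes i: "i \<in> {1..n}"
  defines "\<xi> \<equiv> \<lambda>j \<omega>. A n \<omega> * \<eta> n j \<omega> / sqrt (real n)" and "v \<equiv> \<lambda>j \<omega>. (A n \<omega>)\<^sup>2 * \<sigma>sq n j \<omega> / real n"
  defines "B \<equiv> \<lambda>\<omega>. iexp (t * (A n \<omega> * cov_sum n \<omega>)) * (\<Prod>j=1..<i. complex_of_real (exp (- (t\<^sup>2 * v j \<omega> / 2)))) * (\<Prod>j=Suc i..n. iexp (t * \<xi> j \<omega>))"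
  shows "(CLINT \<omega>|M. B \<omega> * complex_of_real (\<xi> i \<omega>)) = 0"
    and "(CLINT \<omega>|M. B \<omega> * complex_of_real ((\<xi> i \<omega>)\<^sup>2 - v i \<omega>)) = 0"
proof -
  have n: "n \<ge> 1" using i by simp
  obtain K where K: "K \<ge> 1" "\<And>x. 0 \<le> w0 x" "\<And>x. w0 x \<le> K" "\<And>x. 0 \<le> w1 x" "\<And>x. w1 x \<le> K"
    using weight_bound by blast
  define F where "F = F_design n i"
  have F: "subalgebra M F" unfolding F_def by (rule subalgebra_F_design[OF i])
  note fm = F_design_meas[OF i, folded F_def]
  have dm: "A n \<in> borel_measurable F" "cov_sum n \<in> borel_measurable F"
    "\<And>j. j \<in> {1..n} \<Longrightarrow> treated n j \<in> borel_measurable F" "\<And>j. j \<in> {1..n} \<Longrightarrow> control n j \<in> borel_measurable F"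
    "\<And>j. j \<in> {1..n} \<Longrightarrow> (\<lambda>\<omega>. w0 (\<psi> j \<omega>)) \<in> borel_measurable F" "\<And>j. j \<in> {1..n} \<Longrightarrow> (\<lambda>\<omega>. w1 (\<psi> j \<omega>)) \<in> borel_measurable F"
    "\<And>j. j \<in> {1..n} \<Longrightarrow> \<sigma>sq n j \<in> borel_measurable F"
    "\<And>j. j \<in> {1..n} \<Longrightarrow> W j \<in> borel_measurable F \<Longrightarrow> \<eta> n j \<in> borel_measurable F"
    by (rule design_vars_meas[OF fm(2,3,4)]; assumption)+
  have B1: "norm (B \<omega>) \<le> 1" for \<omega>
  proof -
    have v0: "0 \<le> v j \<omega>" for j unfolding v_def by (simp add: \<sigma>sq_nonneg)
    have "norm (\<Prod>j=1..<i. complex_of_real (exp (- (t\<^sup>2 * v j \<omega> / 2)))) \<le> 1"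
      unfolding prod_norm[symmetric] by (rule prod_le_1) (use v0 in auto)
    moreover have "norm (\<Prod>j=Suc i..n. iexp (t * \<xi> j \<omega>)) = 1"
      unfolding prod_norm[symmetric] by (simp del: of_real_mult)
    ultimately show ?thesis unfolding B_def by (simp add: norm_mult del: of_real_mult)
  qed
  have Bm: "B \<in> borel_measurable F"
    unfolding B_def
  proof (intro borel_measurable_times borel_measurable_prod)
    note [measurable] = dm(1,2)
    show "(\<lambda>\<omega>. iexp (t * (A n \<omega> * cov_sum n \<omega>))) \<in> borel_measurable F" by measurable
  next
    fix j assume "j \<in> {1..<i}"
    then have j: "j \<in> {1..n}" using i by auto
    note [measurable] = dm(1) dm(7)[OF j]
    show "(\<lambda>\<omega>. complex_of_real (exp (- (t\<^sup>2 * v j \<omega> / 2)))) \<in> borel_measurable F" unfolding v_def by measurable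
  next
    fix j assume "j \<in> {Suc i..n}"
    then have j: "j \<in> {1..n}" "j \<in> {1..n} - {i}" using i by auto
    note [measurable] = dm(1) dm(8)[OF j(1) fm(1)[OF j(2)]]
    show "(\<lambda>\<omega>. iexp (t * \<xi> j \<omega>)) \<in> borel_measurable F" unfolding \<xi>_def by measurable
  qed
  have cmz: "cond_mean_zero M F (\<lambda>\<omega>. z (W i \<omega>))"
    if "z \<in> borel_measurable borel" "cond_mean_zero M (gen_by M (\<psi> 1) borel) (\<lambda>\<omega>. z (W 1 \<omega>))" for z
    unfolding F_def by (rule cond_mean_zero_design[OF i that])
  note mult = cond_mean_zero_mult_complex[OF F cmz]
  have sm: "(\<lambda>w. s0 (fst w)) \<in> borel_measurable borel" "(\<lambda>w. s1 (fst w)) \<in> borel_measurable borel"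
    by (auto intro: measurable_compose[OF measurable_fst_borel] s_meas)
  \<comment> \<open>The bounded coefficients, already multiplied by \<open>B\<close>:
    \<open>G1\<close> and \<open>G0\<close> belong to the linear term, \<open>H1\<close> and
    \<open>H0\<close> to the quadratic one.\<close>
  define G1 where "G1 \<omega> = B \<omega> * complex_of_real (A n \<omega> * treated n i \<omega> * w1 (\<psi> i \<omega>) / sqrt (real n))" for \<omega>
  define G0 where "G0 \<omega> = B \<omega> * complex_of_real (A n \<omega> * control n i \<omega> * w0 (\<psi> i \<omega>) / sqrt (real n))" for \<omega>
  define H1 where "H1 \<omega> = B \<omega> * complex_of_real ((A n \<omega>)\<^sup>2 * treated n i \<omega> * (w1 (\<psi> i \<omega>))\<^sup>2 / real n)" for \<omega>
  define H0 where "H0 \<omega> = B \<omega> * complex_of_real ((A n \<omega>)\<^sup>2 * control n i \<omega> * (w0 (\<psi> i \<omega>))\<^sup>2 / real n)" for \<omega>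
  note [measurable] = Bm dm(1) dm(3)[OF i] dm(4)[OF i] dm(5)[OF i] dm(6)[OF i]
  have Gm: "G1 \<in> borel_measurable F" "G0 \<in> borel_measurable F" "H1 \<in> borel_measurable F" "H0 \<in> borel_measurable F"
    unfolding G1_def G0_def H1_def H0_def by measurable
  have nb: "norm (B \<omega> * complex_of_real x) \<le> b" if "\<bar>x\<bar> \<le> b" for \<omega> x b
    using mult_mono[OF B1[of \<omega>] that] by (simp add: norm_mult)
  note bd1 = bound_01[OF A_bounds treated_01(1) K(4,5) n K(1)]
  note bd0 = bound_01[OF A_bounds treated_01(2) K(2,3) n K(1)]
  have Gb: "norm (G1 \<omega>) \<le> K" "norm (G0 \<omega>) \<le> K" "norm (H1 \<omega>) \<le> K\<^sup>2" "norm (H0 \<omega>) \<le> K\<^sup>2" for \<omega>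
    unfolding G1_def G0_def H1_def H0_def by (rule nb, rule bd1 bd0)+
  have e1z: "cond_mean_zero M (gen_by M (\<psi> 1) borel) (\<lambda>\<omega>. e1 (W 1 \<omega>))"
    and e0z: "cond_mean_zero M (gen_by M (\<psi> 1) borel) (\<lambda>\<omega>. e0 (W 1 \<omega>))"
    and v1z: "cond_mean_zero M (gen_by M (\<psi> 1) borel) (\<lambda>\<omega>. (e1 (W 1 \<omega>))\<^sup>2 - s1 (fst (W 1 \<omega>)))"
    and v0z: "cond_mean_zero M (gen_by M (\<psi> 1) borel) (\<lambda>\<omega>. (e0 (W 1 \<omega>))\<^sup>2 - s0 (fst (W 1 \<omega>)))"
    unfolding e0_W e1_W fst_W by (rule mean_1 mean_0 var_1 var_0)+
  have vm: "(\<lambda>w. (e1 w)\<^sup>2 - s1 (fst w)) \<in> borel_measurable borel" "(\<lambda>w. (e0 w)\<^sup>2 - s0 (fst w)) \<in> borel_measurable borel"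
    by (intro borel_measurable_diff borel_measurable_power e_meas sm)+
  note g1 = mult[OF e_meas(2) e1z Gm(1) Gb(1)] and g0 = mult[OF e_meas(1) e0z Gm(2) Gb(2)]
    and h1 = mult[OF vm(1) v1z Gm(3) Gb(3)] and h0 = mult[OF vm(2) v0z Gm(4) Gb(4)]
  have eq1: "B \<omega> * complex_of_real (\<xi> i \<omega>) = G1 \<omega> * complex_of_real (e1 (W i \<omega>)) - G0 \<omega> * complex_of_real (e0 (W i \<omega>))" for \<omega>
  proof -
    have "\<xi> i \<omega> = A n \<omega> * treated n i \<omega> * w1 (\<psi> i \<omega>) / sqrt (real n) * e1 (W i \<omega>)
        - A n \<omega> * control n i \<omega> * w0 (\<psi> i \<omega>) / sqrt (real n) * e0 (W i \<omega>)"
      by (simp add: \<xi>_def \<eta>_def right_diff_distrib diff_divide_distrib mult.assoc)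
    then show ?thesis unfolding G1_def G0_def by (simp only: of_real_diff of_real_mult right_diff_distrib mult.assoc)
  qed
  have eq2: "B \<omega> * complex_of_real ((\<xi> i \<omega>)\<^sup>2 - v i \<omega>)
      = H1 \<omega> * complex_of_real ((e1 (W i \<omega>))\<^sup>2 - s1 (fst (W i \<omega>))) + H0 \<omega> * complex_of_real ((e0 (W i \<omega>))\<^sup>2 - s0 (fst (W i \<omega>)))" for \<omega>
  proof -
    have "(\<xi> i \<omega>)\<^sup>2 - v i \<omega> = (A n \<omega>)\<^sup>2 / real n * ((\<eta> n i \<omega>)\<^sup>2 - \<sigma>sq n i \<omega>)"
      by (simp add: \<xi>_def v_def power_mult_distrib power_divide right_diff_distrib)
    also have "\<dots> = (A n \<omega>)\<^sup>2 * treated n i \<omega> * (w1 (\<psi> i \<omega>))\<^sup>2 / real n * ((e1 (W i \<omega>))\<^sup>2 - s1 (fst (W i \<omega>)))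
        + (A n \<omega>)\<^sup>2 * control n i \<omega> * (w0 (\<psi> i \<omega>))\<^sup>2 / real n * ((e0 (W i \<omega>))\<^sup>2 - s0 (fst (W i \<omega>)))"
      unfolding \<eta>_square \<sigma>sq_def fst_W using n by (simp add: field_simps)
    finally show ?thesis unfolding H1_def H0_def by (simp only: of_real_add of_real_mult distrib_left mult.assoc)
  qed
  show "(CLINT \<omega>|M. B \<omega> * complex_of_real (\<xi> i \<omega>)) = 0"
    unfolding eq1 using g1 g0 by simp
  show "(CLINT \<omega>|M. B \<omega> * complex_of_real ((\<xi> i \<omega>)\<^sup>2 - v i \<omega>)) = 0"
    unfolding eq2 by (subst Bochner_Integration.integral_add[OF h1(1) h0(1)]) (simp only: h1(2) h0(2) add_0)
qed

definition design_sum :: "nat \<Rightarrow> 'w \<Rightarrow> real" where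
  "design_sum n \<omega> = cov_sum n \<omega> + 1 / sqrt (real n) * (\<Sum>i=1..n. \<eta> n i \<omega>)"

lemma design_sum_meas: "design_sum n \<in> borel_measurable M"
proof -
  show ?thesis
    unfolding design_sum_def
    by (intro borel_measurable_add borel_measurable_times borel_measurable_const borel_measurable_sum vars_meas)
qed

text \<open>A Lindeberg argument: \<open>\<eta>\<close> and \<open>\<sigma>sq\<close> are dominated
  by functions of the unit's own data, free of the design, so the n Taylor errors are bounded by n
  copies of one expectation. Rescaled by n it vanishes by dominated convergence under second
  moments.\<close>

lemma gaussian_replacement_error:
  "(\<lambda>n. (CLINT \<omega>|M. iexp (t * (A n \<omega> * design_sum n \<omega>)))
      - (CLINT \<omega>|M. iexp (t * (A n \<omega> * cov_sum n \<omega>)) * complex_of_real (exp (- (t\<^sup>2 * ((A n \<omega>)\<^sup>2 * (1 / real n * (\<Sum>i=1..n. \<sigma>sq n i \<omega>))) / 2)))))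
    \<longlonglongrightarrow> 0"
proof -
  obtain K where K: "K \<ge> 1" "\<And>x. 0 \<le> w0 x" "\<And>x. w0 x \<le> K" "\<And>x. 0 \<le> w1 x" "\<And>x. w1 x \<le> K"
    using weight_bound by blast
  define \<zeta> where "\<zeta> w = K * (\<bar>e1 w\<bar> + \<bar>e0 w\<bar>)" for w
  define \<tau> where "\<tau> x = K\<^sup>2 * (s1 x + s0 x)" for x
  \<comment> \<open>\<open>g n\<close> and \<open>h n\<close> are n times the Taylor bounds, taken
    at the envelopes \<open>\<zeta> / sqrt n\<close> for the error and \<open>\<tau> / n\<close> for
    the variance. Their first entries do not depend on n and serve as dominating functions.\<close>
  define g where "g n x = min (t\<^sup>2 * x\<^sup>2) (\<bar>t\<bar> ^ 3 * x ^ 3 / (6 * sqrt (real n)))" for n :: nat and x :: real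
  define h where "h n x = min (t\<^sup>2 * x / 2) ((t\<^sup>2 * x / 2)\<^sup>2 / real n)" for n :: nat and x :: real
  have \<zeta>m: "\<zeta> \<in> borel_measurable borel" unfolding \<zeta>_def using e_meas by simp
  have \<tau>m: "\<tau> \<in> borel_measurable borel" unfolding \<tau>_def using s_meas by simp
  have gm: "g n \<in> borel_measurable borel" and hm: "h n \<in> borel_measurable borel" for n unfolding g_def h_def by measurable
  have \<zeta>0: "0 \<le> \<zeta> w" for w using K(1) by (simp add: \<zeta>_def)
  have \<tau>0: "0 \<le> \<tau> x" for x using s_nonneg by (simp add: \<tau>_def)
  have g_b: "0 \<le> g n (\<zeta> w)" "g n (\<zeta> w) \<le> t\<^sup>2 * (\<zeta> w)\<^sup>2" for n w using \<zeta>0 by (auto simp: g_def)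
  have h_b: "0 \<le> h n (\<tau> x)" "h n (\<tau> x) \<le> t\<^sup>2 * \<tau> x / 2" for n x
  proof -
    show "0 \<le> h n (\<tau> x)" unfolding h_def using \<tau>0[of x] by simp
    show "h n (\<tau> x) \<le> t\<^sup>2 * \<tau> x / 2" unfolding h_def by (rule min.cobounded1)
  qed
  have Wm: "W i \<in> borel_measurable M" if "i \<ge> 1" for i using W_meas that .
  have \<zeta>2: "integrable M (\<lambda>\<omega>. (\<zeta> (W 1 \<omega>))\<^sup>2)"
  proof -
    note em = measurable_compose[OF Wm[OF order_refl] e_meas(1)] measurable_compose[OF Wm[OF order_refl] e_meas(2)]
    have "integrable M (\<lambda>\<omega>. (\<bar>e1 (W 1 \<omega>)\<bar> + \<bar>e0 (W 1 \<omega>)\<bar>)\<^sup>2)"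
      by (rule integrable_square_add) (use em e_square in auto)
    then show ?thesis unfolding \<zeta>_def power_mult_distrib by simp
  qed
  have \<tau>i: "integrable M (\<lambda>\<omega>. \<tau> (\<psi> 1 \<omega>))" unfolding \<tau>_def using s_int by simp
  have g_int: "integrable M (\<lambda>\<omega>. g n (\<zeta> (W 1 \<omega>)))" for n
    by (rule Bochner_Integration.integrable_bound[of _ "\<lambda>\<omega>. t\<^sup>2 * (\<zeta> (W 1 \<omega>))\<^sup>2"])
       (use \<zeta>2 g_b measurable_compose[OF measurable_compose[OF Wm[OF order_refl] \<zeta>m] gm] in simp_all)
  have h_int: "integrable M (\<lambda>\<omega>. h n (\<tau> (\<psi> 1 \<omega>)))" for n
    by (rule Bochner_Integration.integrable_bound[of _ "\<lambda>\<omega>. t\<^sup>2 * \<tau> (\<psi> 1 \<omega>) / 2"])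
       (use \<tau>i h_b \<tau>0 measurable_compose[OF measurable_compose[OF \<psi>_meas[OF order_refl] \<tau>m] hm] in simp_all)
  have g_lim: "(\<lambda>n. expectation (\<lambda>\<omega>. g n (\<zeta> (W 1 \<omega>)))) \<longlonglongrightarrow> 0"
  proof -
    have "(\<lambda>n. expectation (\<lambda>\<omega>. g n (\<zeta> (W 1 \<omega>)))) \<longlonglongrightarrow> expectation (\<lambda>_. 0)"
    proof (rule integral_dominated_convergence[where w="\<lambda>\<omega>. t\<^sup>2 * (\<zeta> (W 1 \<omega>))\<^sup>2"])
      show "AE \<omega> in M. (\<lambda>n. g n (\<zeta> (W 1 \<omega>))) \<longlonglongrightarrow> 0"
      proof (rule AE_I2)
        fix \<omega>
        have "filterlim (\<lambda>n. sqrt (real n)) at_top sequentially"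
          by (rule filterlim_compose[OF sqrt_at_top filterlim_real_sequentially])
        from tendsto_divide_0[OF tendsto_const filterlim_at_top_imp_at_infinity[OF this]]
        have "(\<lambda>n. (\<bar>t\<bar> ^ 3 * (\<zeta> (W 1 \<omega>)) ^ 3 / 6) / sqrt (real n)) \<longlonglongrightarrow> 0" .
        then have "(\<lambda>n. min (t\<^sup>2 * (\<zeta> (W 1 \<omega>))\<^sup>2) ((\<bar>t\<bar> ^ 3 * (\<zeta> (W 1 \<omega>)) ^ 3 / 6) / sqrt (real n))) \<longlonglongrightarrow> min (t\<^sup>2 * (\<zeta> (W 1 \<omega>))\<^sup>2) 0"
          by (intro tendsto_min tendsto_const)
        then show "(\<lambda>n. g n (\<zeta> (W 1 \<omega>))) \<longlonglongrightarrow> 0" by (simp add: g_def)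
      qed
    qed (use \<zeta>2 g_b measurable_compose[OF measurable_compose[OF Wm[OF order_refl] \<zeta>m] gm] in simp_all)
    then show ?thesis by simp
  qed
  have h_lim: "(\<lambda>n. expectation (\<lambda>\<omega>. h n (\<tau> (\<psi> 1 \<omega>)))) \<longlonglongrightarrow> 0"
  proof -
    have "(\<lambda>n. expectation (\<lambda>\<omega>. h n (\<tau> (\<psi> 1 \<omega>)))) \<longlonglongrightarrow> expectation (\<lambda>_. 0)"
    proof (rule integral_dominated_convergence[where w="\<lambda>\<omega>. t\<^sup>2 * \<tau> (\<psi> 1 \<omega>) / 2"])
      show "AE \<omega> in M. (\<lambda>n. h n (\<tau> (\<psi> 1 \<omega>))) \<longlonglongrightarrow> 0"
      proof (rule AE_I2)
        fix \<omega>
        have "(\<lambda>n. min (t\<^sup>2 * \<tau> (\<psi> 1 \<omega>) / 2) ((t\<^sup>2 * \<tau> (\<psi> 1 \<omega>) / 2)\<^sup>2 / real n)) \<longlonglongrightarrow> min (t\<^sup>2 * \<tau> (\<psi> 1 \<omega>) / 2) 0"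
          by (intro tendsto_min tendsto_const lim_const_over_n)
        then show "(\<lambda>n. h n (\<tau> (\<psi> 1 \<omega>))) \<longlonglongrightarrow> 0" using \<tau>0[of "\<psi> 1 \<omega>"] by (simp add: h_def)
      qed
    qed (use \<tau>i h_b measurable_compose[OF measurable_compose[OF \<psi>_meas[OF order_refl] \<tau>m] hm] in simp_all)
    then show ?thesis by simp
  qed
  have \<eta>_le: "\<bar>\<eta> n i \<omega>\<bar> \<le> \<zeta> (W i \<omega>)" for n i \<omega>
  proof -
    have "\<bar>treated n i \<omega> * w1 (\<psi> i \<omega>) * e1 (W i \<omega>)\<bar> \<le> K * \<bar>e1 (W i \<omega>)\<bar>"
      "\<bar>control n i \<omega> * w0 (\<psi> i \<omega>) * e0 (W i \<omega>)\<bar> \<le> K * \<bar>e0 (W i \<omega>)\<bar>"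
      using treated_01(1,2)[of n i \<omega>] K by (auto simp: abs_mult intro!: mult_right_mono)
    then show ?thesis unfolding \<eta>_def \<zeta>_def by (simp only: distrib_left)
  qed
  have \<sigma>_le: "\<sigma>sq n i \<omega> \<le> \<tau> (\<psi> i \<omega>)" for n i \<omega>
  proof -
    have "(w1 (\<psi> i \<omega>))\<^sup>2 \<le> K\<^sup>2" "(w0 (\<psi> i \<omega>))\<^sup>2 \<le> K\<^sup>2" using K by (auto intro: power_mono)
    then have "treated n i \<omega> * (w1 (\<psi> i \<omega>))\<^sup>2 * s1 (\<psi> i \<omega>) \<le> K\<^sup>2 * s1 (\<psi> i \<omega>)"
      "control n i \<omega> * (w0 (\<psi> i \<omega>))\<^sup>2 * s0 (\<psi> i \<omega>) \<le> K\<^sup>2 * s0 (\<psi> i \<omega>)"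
      using treated_01(1,2)[of n i \<omega>] s_nonneg by (auto intro!: mult_right_mono)
    then show ?thesis unfolding \<sigma>sq_def \<tau>_def distrib_left by linarith
  qed
  have bound: "norm ((CLINT \<omega>|M. iexp (t * (A n \<omega> * design_sum n \<omega>)))
      - (CLINT \<omega>|M. iexp (t * (A n \<omega> * cov_sum n \<omega>)) * complex_of_real (exp (- (t\<^sup>2 * ((A n \<omega>)\<^sup>2 * (1 / real n * (\<Sum>i=1..n. \<sigma>sq n i \<omega>))) / 2)))))
    \<le> expectation (\<lambda>\<omega>. g n (\<zeta> (W 1 \<omega>))) + expectation (\<lambda>\<omega>. h n (\<tau> (\<psi> 1 \<omega>)))" if n: "n \<ge> 1" for n
  proof -
    define \<xi> where "\<xi> j \<omega> = A n \<omega> * \<eta> n j \<omega> / sqrt (real n)" for j \<omega>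
    define v where "v j \<omega> = (A n \<omega>)\<^sup>2 * \<sigma>sq n j \<omega> / real n" for j \<omega>
    have Am: "A n \<in> borel_measurable M" and cm: "cov_sum n \<in> borel_measurable M"
      by (rule vars_meas)+
    have \<eta>m: "\<eta> n j \<in> borel_measurable M" and \<sigma>m: "\<sigma>sq n j \<in> borel_measurable M" if "j \<in> {1..n}" for j
      using that by (auto intro: vars_meas simp del: One_nat_def)
    have \<xi>m: "\<xi> j \<in> borel_measurable M" and vm: "v j \<in> borel_measurable M" if "j \<in> {1..n}" for j
    proof -
      note [measurable] = Am \<eta>m[OF that] \<sigma>m[OF that]
      show "\<xi> j \<in> borel_measurable M" "v j \<in> borel_measurable M" unfolding \<xi>_def v_def by measurable
    qed
    have A2: "(A n \<omega>)\<^sup>2 \<le> 1" for \<omega> using A_bounds[of n \<omega>] by (simp add: abs_square_le_1)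
    have \<xi>_le: "\<bar>\<xi> j \<omega>\<bar> \<le> \<zeta> (W j \<omega>) / sqrt (real n)" for j \<omega>
    proof -
      have "A n \<omega> * \<bar>\<eta> n j \<omega>\<bar> \<le> 1 * \<zeta> (W j \<omega>)" using A_bounds[of n \<omega>] \<eta>_le[of n j \<omega>] by (intro mult_mono) auto
      then show ?thesis using A_bounds[of n \<omega>] by (simp add: \<xi>_def abs_mult divide_right_mono)
    qed
    have v_le: "v j \<omega> \<le> \<tau> (\<psi> j \<omega>) / real n" and v0: "0 \<le> v j \<omega>" for j \<omega>
    proof -
      have "(A n \<omega>)\<^sup>2 * \<sigma>sq n j \<omega> \<le> 1 * \<tau> (\<psi> j \<omega>)" using A2[of \<omega>] \<sigma>_le[of n j \<omega>] \<sigma>sq_nonneg[of n j \<omega>] by (intro mult_mono) auto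
      then show "v j \<omega> \<le> \<tau> (\<psi> j \<omega>) / real n" by (simp add: v_def divide_right_mono)
      show "0 \<le> v j \<omega>" using \<sigma>sq_nonneg[of n j \<omega>] by (simp add: v_def)
    qed
    have \<zeta>2j: "integrable M (\<lambda>\<omega>. (\<zeta> (W j \<omega>))\<^sup>2)" if "j \<in> {1..n}" for j
      using distr_eq_integral(1)[OF Wm Wm[OF order_refl] _ W_ident, of j "\<lambda>w. (\<zeta> w)\<^sup>2"] \<zeta>m \<zeta>2 that by simp
    have \<tau>j: "integrable M (\<lambda>\<omega>. \<tau> (\<psi> j \<omega>))" if "j \<in> {1..n}" for j
      using distr_eq_integral(1)[OF \<psi>_meas \<psi>_meas[OF order_refl] \<tau>m \<psi>_distr, of j] \<tau>i that by simp
    have \<xi>2: "integrable M (\<lambda>\<omega>. (\<xi> j \<omega>)\<^sup>2)" if "j \<in> {1..n}" for j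
    proof (rule Bochner_Integration.integrable_bound)
      show "integrable M (\<lambda>\<omega>. (\<zeta> (W j \<omega>))\<^sup>2 / real n)" using \<zeta>2j[OF that] by simp
      have "(\<xi> j \<omega>)\<^sup>2 \<le> (\<zeta> (W j \<omega>))\<^sup>2 / real n" for \<omega>
        using power_mono[OF \<xi>_le[of j \<omega>], of 2] by (simp add: power_divide)
      then show "AE \<omega> in M. norm ((\<xi> j \<omega>)\<^sup>2) \<le> norm ((\<zeta> (W j \<omega>))\<^sup>2 / real n)" by simp
    qed (use \<xi>m[OF that] in simp)
    have vi: "integrable M (v j)" if "j \<in> {1..n}" for j
    proof (rule Bochner_Integration.integrable_bound)
      show "integrable M (\<lambda>\<omega>. \<tau> (\<psi> j \<omega>) / real n)" using \<tau>j[OF that] by simp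
      show "AE \<omega> in M. norm (v j \<omega>) \<le> norm (\<tau> (\<psi> j \<omega>) / real n)"
        using v_le v0 \<tau>0 by (intro AE_I2) simp
    qed (rule vm[OF that])
    have Cm: "(\<lambda>\<omega>. iexp (t * (A n \<omega> * cov_sum n \<omega>))) \<in> borel_measurable M"
      using Am cm by measurable
    have main: "norm ((CLINT \<omega>|M. iexp (t * (A n \<omega> * cov_sum n \<omega>)) * (\<Prod>j=1..n. iexp (t * \<xi> j \<omega>)))
      - (CLINT \<omega>|M. iexp (t * (A n \<omega> * cov_sum n \<omega>)) * (\<Prod>j=1..n. complex_of_real (exp (- (t\<^sup>2 * v j \<omega> / 2))))))
      \<le> (\<Sum>i=1..n. expectation (\<lambda>\<omega>. min ((t * \<xi> i \<omega>)\<^sup>2) (\<bar>t * \<xi> i \<omega>\<bar> ^ 3 / 6))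
        + expectation (\<lambda>\<omega>. min (t\<^sup>2 * v i \<omega> / 2) ((t\<^sup>2 * v i \<omega> / 2)\<^sup>2)))"
    proof (rule gaussian_replacement[OF Cm _ \<xi>m \<xi>2 vi v0])
      fix i assume i: "i \<in> {1..n}"
      note o = gaussian_replacement_orthogonal[OF i, of t, folded \<xi>_def v_def]
      show "(CLINT \<omega>|M. iexp (t * (A n \<omega> * cov_sum n \<omega>)) * (\<Prod>j=1..<i. complex_of_real (exp (- (t\<^sup>2 * v j \<omega> / 2)))) * (\<Prod>j=Suc i..n. iexp (t * \<xi> j \<omega>)) * complex_of_real (\<xi> i \<omega>)) = 0"
        by (rule o(1))
      show "(CLINT \<omega>|M. iexp (t * (A n \<omega> * cov_sum n \<omega>)) * (\<Prod>j=1..<i. complex_of_real (exp (- (t\<^sup>2 * v j \<omega> / 2)))) * (\<Prod>j=Suc i..n. iexp (t * \<xi> j \<omega>)) * complex_of_real ((\<xi> i \<omega>)\<^sup>2 - v i \<omega>)) = 0"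
        by (rule o(2))
    qed (simp del: of_real_mult)
    have e1: "iexp (t * (A n \<omega> * cov_sum n \<omega>)) * (\<Prod>j=1..n. iexp (t * \<xi> j \<omega>)) = iexp (t * (A n \<omega> * design_sum n \<omega>))" for \<omega>
    proof -
      have "(\<Prod>j=1..n. iexp (t * \<xi> j \<omega>)) = iexp (\<Sum>j=1..n. t * \<xi> j \<omega>)"
        by (simp add: exp_sum sum_distrib_left)
      also have "(\<Sum>j=1..n. t * \<xi> j \<omega>) = t * (A n \<omega> * (1 / sqrt (real n) * (\<Sum>i=1..n. \<eta> n i \<omega>)))"
        by (simp add: \<xi>_def sum_distrib_left sum_divide_distrib)
      finally show ?thesis by (simp add: design_sum_def exp_add[symmetric] distrib_left)
    qed
    \<comment> \<open>The Gaussian factors depend on the design only through an exponent, in which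
      the n variances merge into their average.\<close>
    have e2: "(\<Prod>j=1..n. complex_of_real (exp (- (t\<^sup>2 * v j \<omega> / 2))))
        = complex_of_real (exp (- (t\<^sup>2 * ((A n \<omega>)\<^sup>2 * (1 / real n * (\<Sum>i=1..n. \<sigma>sq n i \<omega>))) / 2)))" for \<omega>
    proof -
      have "(\<Prod>j=1..n. complex_of_real (exp (- (t\<^sup>2 * v j \<omega> / 2)))) = complex_of_real (exp (\<Sum>j=1..n. - (t\<^sup>2 * v j \<omega> / 2)))"
        by (simp only: exp_sum finite_atLeastAtMost of_real_prod)
      also have "(\<Sum>j=1..n. - (t\<^sup>2 * v j \<omega> / 2)) = - (t\<^sup>2 * ((A n \<omega>)\<^sup>2 * (1 / real n * (\<Sum>i=1..n. \<sigma>sq n i \<omega>))) / 2)"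
        by (simp add: v_def sum_negf sum_distrib_left sum_divide_distrib)
      finally show ?thesis .
    qed
    have "(\<Sum>i=1..n. expectation (\<lambda>\<omega>. min ((t * \<xi> i \<omega>)\<^sup>2) (\<bar>t * \<xi> i \<omega>\<bar> ^ 3 / 6))
        + expectation (\<lambda>\<omega>. min (t\<^sup>2 * v i \<omega> / 2) ((t\<^sup>2 * v i \<omega> / 2)\<^sup>2)))
      \<le> (\<Sum>i=1..n. 1 / real n * expectation (\<lambda>\<omega>. g n (\<zeta> (W 1 \<omega>))) + 1 / real n * expectation (\<lambda>\<omega>. h n (\<tau> (\<psi> 1 \<omega>))))"
    proof (intro sum_mono add_mono)
      fix i assume i: "i \<in> {1..n}"
      then have i1: "i \<ge> 1" by simp
      note dg = distr_eq_integral[OF Wm[OF i1] Wm[OF order_refl] _ W_ident[OF i1], of "\<lambda>w. g n (\<zeta> w)"]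
      have gz: "(\<lambda>w. g n (\<zeta> w)) \<in> borel_measurable borel" by (rule measurable_compose[OF \<zeta>m gm])
      have le: "min ((t * \<xi> i \<omega>)\<^sup>2) (\<bar>t * \<xi> i \<omega>\<bar> ^ 3 / 6) \<le> 1 / real n * g n (\<zeta> (W i \<omega>))" for \<omega>
      proof -
        have "\<bar>t * \<xi> i \<omega>\<bar> \<le> \<bar>t\<bar> * (\<zeta> (W i \<omega>) / sqrt (real n))"
          unfolding abs_mult by (intro mult_left_mono \<xi>_le) simp
        then have le: "\<bar>t * \<xi> i \<omega>\<bar> ^ k \<le> (\<bar>t\<bar> * (\<zeta> (W i \<omega>) / sqrt (real n))) ^ k" for k by (rule power_mono) simp
        have 2: "(t * \<xi> i \<omega>)\<^sup>2 \<le> 1 / real n * (t\<^sup>2 * (\<zeta> (W i \<omega>))\<^sup>2)"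
          using le[of 2] by (simp add: power_mult_distrib power_divide)
        have "(sqrt (real n)) ^ 3 = real n * sqrt (real n)" by (simp add: power3_eq_cube)
        then have 3: "\<bar>t * \<xi> i \<omega>\<bar> ^ 3 / 6 \<le> 1 / real n * (\<bar>t\<bar> ^ 3 * (\<zeta> (W i \<omega>)) ^ 3 / (6 * sqrt (real n)))"
          using le[of 3] by (simp add: power_mult_distrib power_divide mult.commute mult.left_commute)
        have "1 / real n * g n (\<zeta> (W i \<omega>)) = min (1 / real n * (t\<^sup>2 * (\<zeta> (W i \<omega>))\<^sup>2)) (1 / real n * (\<bar>t\<bar> ^ 3 * (\<zeta> (W i \<omega>)) ^ 3 / (6 * sqrt (real n))))"
          unfolding g_def by (rule mult_min_right) simp
        then show ?thesis using min.mono[OF 2 3] by simp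
      qed
      have "expectation (\<lambda>\<omega>. min ((t * \<xi> i \<omega>)\<^sup>2) (\<bar>t * \<xi> i \<omega>\<bar> ^ 3 / 6)) \<le> expectation (\<lambda>\<omega>. 1 / real n * g n (\<zeta> (W i \<omega>)))"
      proof (rule integral_mono_AE')
        show "integrable M (\<lambda>\<omega>. 1 / real n * g n (\<zeta> (W i \<omega>)))" using dg(1)[OF gz] g_int by simp
        show "AE \<omega> in M. 0 \<le> 1 / real n * g n (\<zeta> (W i \<omega>))" using g_b by simp
      qed (use le in auto)
      also have "\<dots> = 1 / real n * expectation (\<lambda>\<omega>. g n (\<zeta> (W 1 \<omega>)))"
        unfolding integral_mult_right_zero dg(2)[OF gz] ..
      finally show "expectation (\<lambda>\<omega>. min ((t * \<xi> i \<omega>)\<^sup>2) (\<bar>t * \<xi> i \<omega>\<bar> ^ 3 / 6)) \<le> 1 / real n * expectation (\<lambda>\<omega>. g n (\<zeta> (W 1 \<omega>)))" .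
      note dh = distr_eq_integral[OF \<psi>_meas[OF i1] \<psi>_meas[OF order_refl] _ \<psi>_distr[OF i1], of "\<lambda>x. h n (\<tau> x)"]
      have hz: "(\<lambda>x. h n (\<tau> x)) \<in> borel_measurable borel" by (rule measurable_compose[OF \<tau>m hm])
      have le2: "min (t\<^sup>2 * v i \<omega> / 2) ((t\<^sup>2 * v i \<omega> / 2)\<^sup>2) \<le> 1 / real n * h n (\<tau> (\<psi> i \<omega>))" for \<omega>
      proof -
        have "t\<^sup>2 * v i \<omega> / 2 \<le> t\<^sup>2 * (\<tau> (\<psi> i \<omega>) / real n) / 2" by (intro divide_right_mono mult_left_mono v_le) auto
        then have 1: "t\<^sup>2 * v i \<omega> / 2 \<le> 1 / real n * (t\<^sup>2 * \<tau> (\<psi> i \<omega>) / 2)" by simp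
        have "0 \<le> t\<^sup>2 * v i \<omega> / 2" using v0[of i \<omega>] by simp
        from power_mono[OF 1 this, of 2]
        have 2: "(t\<^sup>2 * v i \<omega> / 2)\<^sup>2 \<le> 1 / real n * ((t\<^sup>2 * \<tau> (\<psi> i \<omega>) / 2)\<^sup>2 / real n)"
          by (simp add: power_mult_distrib power_divide power2_eq_square)
        have "1 / real n * h n (\<tau> (\<psi> i \<omega>)) = min (1 / real n * (t\<^sup>2 * \<tau> (\<psi> i \<omega>) / 2)) (1 / real n * ((t\<^sup>2 * \<tau> (\<psi> i \<omega>) / 2)\<^sup>2 / real n))"
          unfolding h_def by (rule mult_min_right) simp
        then show ?thesis using min.mono[OF 1 2] by simp
      qed
      have "expectation (\<lambda>\<omega>. min (t\<^sup>2 * v i \<omega> / 2) ((t\<^sup>2 * v i \<omega> / 2)\<^sup>2)) \<le> expectation (\<lambda>\<omega>. 1 / real n * h n (\<tau> (\<psi> i \<omega>)))"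
      proof (rule integral_mono_AE')
        show "integrable M (\<lambda>\<omega>. 1 / real n * h n (\<tau> (\<psi> i \<omega>)))" using dh(1)[OF hz] h_int by simp
        show "AE \<omega> in M. 0 \<le> 1 / real n * h n (\<tau> (\<psi> i \<omega>))" using h_b by simp
      qed (use le2 in auto)
      also have "\<dots> = 1 / real n * expectation (\<lambda>\<omega>. h n (\<tau> (\<psi> 1 \<omega>)))"
        unfolding integral_mult_right_zero dh(2)[OF hz] ..
      finally show "expectation (\<lambda>\<omega>. min (t\<^sup>2 * v i \<omega> / 2) ((t\<^sup>2 * v i \<omega> / 2)\<^sup>2)) \<le> 1 / real n * expectation (\<lambda>\<omega>. h n (\<tau> (\<psi> 1 \<omega>)))" .
    qed
    also have "\<dots> = expectation (\<lambda>\<omega>. g n (\<zeta> (W 1 \<omega>))) + expectation (\<lambda>\<omega>. h n (\<tau> (\<psi> 1 \<omega>)))"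
      using n by (simp add: sum.distrib distrib_left)
    finally show ?thesis using main unfolding e1 e2 by linarith
  qed
  have "(\<lambda>n. expectation (\<lambda>\<omega>. g n (\<zeta> (W 1 \<omega>))) + expectation (\<lambda>\<omega>. h n (\<tau> (\<psi> 1 \<omega>)))) \<longlonglongrightarrow> 0"
    by (rule tendsto_add_zero[OF g_lim h_lim])
  then show ?thesis
    by (rule Lim_null_comparison[rotated]) (rule eventually_sequentiallyI[of 1], rule bound)
qed

end

section \<open>Conditional expectations as functions of the covariate, and the limit law\<close>

text \<open>The version supplied by \<open>real_cond_exp\<close> is itself measurable for the
  generated algebra, so the factorization holds at every point and not only almost surely.\<close>

lemma real_cond_exp_factor:
  assumes "X \<in> space M \<rightarrow> space N"
  obtains g where "g \<in> borel_measurable N" "\<And>\<omega>. \<omega> \<in> space M \<Longrightarrow> real_cond_exp M (gen_by M X N) f \<omega> = g (X \<omega>)"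
proof -
  have "real_cond_exp M (gen_by M X N) f \<in> borel_measurable (vimage_algebra (space M) X N)"
    using borel_measurable_cond_exp[of M "gen_by M X N" f] by (simp add: gen_by_def)
  from vimage_algebra_real_factor[OF this assms] show thesis using that by blast
qed

lemma char_normal_law: "char (normal_law 0 v) t = complex_of_real (exp (- (t\<^sup>2 * v) / 2))" if "0 \<le> v"
proof -
  have "char (normal_law 0 v) t = char std_normal_distribution (t * sqrt v)"
    unfolding char_def normal_law_def by (subst integral_distr) (auto simp: mult.assoc)
  also have "\<dots> = complex_of_real (exp (- (t\<^sup>2 * v) / 2))"
    using that by (simp add: char_std_normal_distribution power_mult_distrib)
  finally show ?thesis .
qed

lemma real_distribution_normal_law: "real_distribution (normal_law m v)"
proof -
  interpret real_distribution std_normal_distribution by (rule real_dist_normal_dist)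
  show ?thesis unfolding normal_law_def by (rule real_distribution_distr) simp
qed

lemma (in prob_space) cond_mean_zero_real_cond_exp:
  assumes F: "subalgebra M F" and X: "integrable M X"
    and g: "AE \<omega> in M. real_cond_exp M F X \<omega> = g \<omega>" "g \<in> borel_measurable M"
  shows "cond_mean_zero M F (\<lambda>\<omega>. X \<omega> - g \<omega>)" "integrable M g"
proof -
  interpret sigma_finite_subalgebra M F using F by (rule subalgebra_sigma_finite)
  have ci: "integrable M (real_cond_exp M F X)" by (rule real_cond_exp_int(1)[OF X])
  have eq: "AE \<omega> in M. g \<omega> = real_cond_exp M F X \<omega>" using g(1) by auto
  show gi: "integrable M g"
    by (rule integrable_cong_AE_imp[OF ci g(2)]) (use g(1) in auto)
  show "cond_mean_zero M F (\<lambda>\<omega>. X \<omega> - g \<omega>)"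
    unfolding cond_mean_zero_def
  proof
    show "\<forall>E\<in>sets F. expectation (\<lambda>\<omega>. indicator E \<omega> * (X \<omega> - g \<omega>)) = 0"
    proof
      fix E assume E: "E \<in> sets F"
      then have EM: "E \<in> events" using F by (auto simp: subalgebra_def)
      have i: "integrable M (\<lambda>\<omega>. indicator E \<omega> * f \<omega>)" if "integrable M f" for f :: "'a \<Rightarrow> real"
        by (rule Bochner_Integration.integrable_bound[OF that]) (use that EM in \<open>auto simp: indicator_def\<close>)
      have "expectation (\<lambda>\<omega>. indicator E \<omega> * g \<omega>) = expectation (\<lambda>\<omega>. indicator E \<omega> * real_cond_exp M F X \<omega>)"
        by (rule integral_cong_AE) (use eq g(2) EM in auto)
      also have "\<dots> = expectation (\<lambda>\<omega>. indicator E \<omega> * X \<omega>)"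
        by (rule real_cond_exp_intg(2)[OF i[OF X]]) (use E X in auto)
      finally show "expectation (\<lambda>\<omega>. indicator E \<omega> * (X \<omega> - g \<omega>)) = 0"
        unfolding right_diff_distrib using i[OF X] i[OF gi] by simp
    qed
  qed (use X gi in simp)
qed

text \<open>The algebra of a sampled control, with \<open>r\<close> in place of
  \<open>1 - p\<close>. The relation between \<open>p\<close> and \<open>r\<close> enters only as
  \<open>a = p * a + r * a\<close>; the rest is arithmetic of fractions.\<close>

lemma untreated_unit_identity:
  fixes q p r y a b \<theta> :: real
  assumes "q \<noteq> 0" "p \<noteq> 0" "r \<noteq> 0" "p + r = 1"
  shows "- y / (q * r) - \<theta> = (b - a - \<theta>) - 1 / (q * r) * (y - a) + (1 - q) * ((b - a) / q) - p * ((b / p + a / r) / q)"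
proof -
  have "a = p * a + r * a" using assms(4) by (metis distrib_right mult_1)
  then have "a / (q * r) = (p * a + r * a) / (q * r)" by simp
  also have "\<dots> = p * a / (q * r) + a / q" using assms by (simp add: add_divide_distrib)
  finally have 1: "a / (q * r) = p * a / (q * r) + a / q" .
  have 2: "(1 - q) * ((b - a) / q) = b / q - a / q - (b - a)" using assms by (simp add: field_simps)
  have 3: "p * ((b / p + a / r) / q) = b / q + p * a / (q * r)" using assms by (simp add: field_simps)
  have 4: "1 / (q * r) * (y - a) = y / (q * r) - a / (q * r)" by (simp add: diff_divide_distrib)
  show ?thesis using 1 unfolding 2 3 4 by simp
qed

section \<open>Decomposition of the statistic and the limit of its characteristic function\<close>

context outcome_moments
begin

definition matching_error :: "nat \<Rightarrow> 'w \<Rightarrow> real" where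
  "matching_error n \<omega> = 1 / sqrt (real n) * (\<Sum>i=1..n. (of_bool (T n i \<omega>) - q (\<psi> i \<omega>)) * (c (\<psi> i \<omega>) / q (\<psi> i \<omega>)))
    + 1 / sqrt (real n) * (\<Sum>i\<in>{i \<in> {1..n}. T n i \<omega>}. (of_bool (D n i \<omega>) - p (\<psi> i \<omega>))
        * ((m1 (\<psi> i \<omega>) / p (\<psi> i \<omega>) + m0 (\<psi> i \<omega>) / (1 - p (\<psi> i \<omega>))) / q (\<psi> i \<omega>)))"

text \<open>Dividing by propensities with finitely many values preserves square integrability, so
  the strong form of the randomization error applies to both stages.\<close>

lemma matching_error_limit:
  shows "tends_to_zero_in_prob M matching_error" and "n \<ge> 1 \<Longrightarrow> matching_error n \<in> borel_measurable M"
proof -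
  define b where "b x = c x / q x" for x
  define b' where "b' x = (m1 x / p x + m0 x / (1 - p x)) / q x" for x
  have bm: "b \<in> borel_measurable borel" and bm': "b' \<in> borel_measurable borel"
    unfolding b_def b'_def using c_meas m_meas q_meas p_meas by measurable
  have sq: "integrable M (\<lambda>\<omega>. (g (\<psi> 1 \<omega>) * f (\<psi> 1 \<omega>))\<^sup>2)"
    if f: "integrable M (\<lambda>\<omega>. (f (\<psi> 1 \<omega>))\<^sup>2)" and g: "g \<in> borel_measurable borel" "finite (range g)" for f g :: "'a \<Rightarrow> real"
  proof -
    obtain K where K: "\<And>x. \<bar>g x\<bar> \<le> K" using finite_range_bound[OF g(2)] by blast
    show ?thesis unfolding power_mult_distrib
    proof (rule bounded_mult_int[OF f])
      show "(\<lambda>x. (g x)\<^sup>2) \<in> borel_measurable borel" using g(1) by simp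
      show "\<bar>(g x)\<^sup>2\<bar> \<le> K\<^sup>2" for x using power_mono[OF K[of x], of 2] by simp
    qed
  qed
  note [measurable] = q_meas p_meas m_meas c_meas \<psi>_meas[OF order_refl]
  have "integrable M (\<lambda>\<omega>. ((1 / q (\<psi> 1 \<omega>)) * c (\<psi> 1 \<omega>))\<^sup>2)"
    by (rule sq[OF c_square]) (use finite_range_qp[of "\<lambda>a _. 1 / a"] in auto)
  then have b2: "integrable M (\<lambda>\<omega>. (b (\<psi> 1 \<omega>))\<^sup>2)" by (simp add: b_def)
  have "integrable M (\<lambda>\<omega>. ((1 / (p (\<psi> 1 \<omega>) * q (\<psi> 1 \<omega>))) * m1 (\<psi> 1 \<omega>) + (1 / ((1 - p (\<psi> 1 \<omega>)) * q (\<psi> 1 \<omega>))) * m0 (\<psi> 1 \<omega>))\<^sup>2)"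
  proof (rule integrable_square_add)
    show "integrable M (\<lambda>\<omega>. ((1 / (p (\<psi> 1 \<omega>) * q (\<psi> 1 \<omega>))) * m1 (\<psi> 1 \<omega>))\<^sup>2)"
      by (rule sq[OF m_square(2)]) (use finite_range_qp[of "\<lambda>a b. 1 / (b * a)"] in auto)
    show "integrable M (\<lambda>\<omega>. ((1 / ((1 - p (\<psi> 1 \<omega>)) * q (\<psi> 1 \<omega>))) * m0 (\<psi> 1 \<omega>))\<^sup>2)"
      by (rule sq[OF m_square(1)]) (use finite_range_qp[of "\<lambda>a b. 1 / ((1 - b) * a)"] in auto)
  qed measurable
  then have b2': "integrable M (\<lambda>\<omega>. (b' (\<psi> 1 \<omega>))\<^sup>2)" by (simp add: b'_def add_divide_distrib)
  note e1 = samp.randomization_error_tends_to_zero[OF bm b2] and e2 = assg.randomization_error_tends_to_zero[OF bm' b2']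
  have m: "(\<lambda>\<omega>. 1 / sqrt (real n) * (\<Sum>i=1..n. (of_bool (T n i \<omega>) - q (\<psi> i \<omega>)) * b (\<psi> i \<omega>))) \<in> borel_measurable M"
    "(\<lambda>\<omega>. 1 / sqrt (real n) * (\<Sum>i\<in>{i \<in> {1..n}. T n i \<omega>}. (of_bool (D n i \<omega>) - p (\<psi> i \<omega>)) * b' (\<psi> i \<omega>))) \<in> borel_measurable M"
    if "n \<ge> 1" for n
    using samp.sum_meas[OF that bm] assg.sum_meas[OF that bm'] by (auto intro: borel_measurable_times)
  have eq: "matching_error n \<omega> = 1 / sqrt (real n) * (\<Sum>i=1..n. (of_bool (T n i \<omega>) - q (\<psi> i \<omega>)) * b (\<psi> i \<omega>))
     + 1 / sqrt (real n) * (\<Sum>i\<in>{i \<in> {1..n}. T n i \<omega>}. (of_bool (D n i \<omega>) - p (\<psi> i \<omega>)) * b' (\<psi> i \<omega>))" for n \<omega>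
    by (simp only: matching_error_def b_def b'_def)
  show "tends_to_zero_in_prob M matching_error"
    by (rule tends_to_zero_in_prob_le_add[OF m e1 e2]) (simp_all only: eq abs_triangle_ineq)
  show "n \<ge> 1 \<Longrightarrow> matching_error n \<in> borel_measurable M"
    unfolding eq[abs_def] by (intro borel_measurable_add m)
qed

text \<open>An exact identity, checked for units not sampled, treated and control. The prefactor is
  the square root of the sampled number over n, that is \<open>A n / sqrt n\<close>.\<close>

lemma statistic_decomposition:
  assumes n: "n \<ge> 1"
  shows "sqrt (n_sampled n (\<lambda>i. T n i \<omega>)) *
        (theta_hat n q p (\<lambda>i. \<psi> i \<omega>) (\<lambda>i. T n i \<omega>) (\<lambda>i. D n i \<omega>) (\<lambda>i. obs_outcome (T n i \<omega>) (D n i \<omega>) (Y0 i \<omega>) (Y1 i \<omega>)) - \<theta>)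
      = A n \<omega> * (design_sum n \<omega> + matching_error n \<omega>)"
proof -
  define u where "u i = (of_bool (T n i \<omega>) / q (\<psi> i \<omega>)) *
        (of_bool (D n i \<omega>) * obs_outcome (T n i \<omega>) (D n i \<omega>) (Y0 i \<omega>) (Y1 i \<omega>) / p (\<psi> i \<omega>)
          - (1 - of_bool (D n i \<omega>)) * obs_outcome (T n i \<omega>) (D n i \<omega>) (Y0 i \<omega>) (Y1 i \<omega>) / (1 - p (\<psi> i \<omega>)))" for i
  have unit: "u i - \<theta> = (c (\<psi> i \<omega>) - \<theta>) + \<eta> n i \<omega>
      + (of_bool (T n i \<omega>) - q (\<psi> i \<omega>)) * (c (\<psi> i \<omega>) / q (\<psi> i \<omega>))
      + of_bool (T n i \<omega>) * ((of_bool (D n i \<omega>) - p (\<psi> i \<omega>))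
        * ((m1 (\<psi> i \<omega>) / p (\<psi> i \<omega>) + m0 (\<psi> i \<omega>) / (1 - p (\<psi> i \<omega>))) / q (\<psi> i \<omega>)))" for i
  proof -
    have pos: "q (\<psi> i \<omega>) \<noteq> 0" "p (\<psi> i \<omega>) \<noteq> 0" "1 - p (\<psi> i \<omega>) \<noteq> 0"
      using q_pos[of "\<psi> i \<omega>"] p_pos[of "\<psi> i \<omega>"] p_less_1[of "\<psi> i \<omega>"] by auto
    consider "\<not> T n i \<omega>" | "T n i \<omega>" "D n i \<omega>" | "T n i \<omega>" "\<not> D n i \<omega>" by blast
    then show ?thesis
    proof cases
      case 1
      then show ?thesis using pos by (simp add: u_def \<eta>_def treated_def control_def)
    next
      case 2
      then have "u i - \<theta> = Y1 i \<omega> / (q (\<psi> i \<omega>) * p (\<psi> i \<omega>)) - \<theta>" by (simp add: u_def obs_outcome_def mult.commute)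
      with 2 show ?thesis using pos
        by (simp add: \<eta>_def treated_def control_def e1_W w1_def c_def) (simp add: field_simps)
    next
      case 3
      then have "u i - \<theta> = - Y0 i \<omega> / (q (\<psi> i \<omega>) * (1 - p (\<psi> i \<omega>))) - \<theta>" by (simp add: u_def obs_outcome_def mult.commute)
      also have "\<dots> = (c (\<psi> i \<omega>) - \<theta>) - 1 / (q (\<psi> i \<omega>) * (1 - p (\<psi> i \<omega>))) * (Y0 i \<omega> - m0 (\<psi> i \<omega>))
          + (1 - q (\<psi> i \<omega>)) * (c (\<psi> i \<omega>) / q (\<psi> i \<omega>))
          - p (\<psi> i \<omega>) * ((m1 (\<psi> i \<omega>) / p (\<psi> i \<omega>) + m0 (\<psi> i \<omega>) / (1 - p (\<psi> i \<omega>))) / q (\<psi> i \<omega>))"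
        unfolding c_def by (rule untreated_unit_identity[OF pos]) simp
      finally show ?thesis using 3 by (simp add: \<eta>_def treated_def control_def e0_W w0_def)
    qed
  qed
  have sumT: "(\<Sum>i\<in>{i \<in> {1..n}. T n i \<omega>}. h i) = (\<Sum>i=1..n. of_bool (T n i \<omega>) * h i)" for h :: "nat \<Rightarrow> real"
    by (rule sum.mono_neutral_cong_left) auto
  have "design_sum n \<omega> + matching_error n \<omega> = 1 / sqrt (real n) * (\<Sum>i=1..n. u i - \<theta>)"
    unfolding design_sum_def cov_sum_def matching_error_def sumT unit sum.distrib by (simp add: algebra_simps)
  moreover have "theta_hat n q p (\<lambda>i. \<psi> i \<omega>) (\<lambda>i. T n i \<omega>) (\<lambda>i. D n i \<omega>) (\<lambda>i. obs_outcome (T n i \<omega>) (D n i \<omega>) (Y0 i \<omega>) (Y1 i \<omega>)) - \<theta>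
      = 1 / real n * (\<Sum>i=1..n. u i - \<theta>)"
    using n unfolding theta_hat_def u_def[symmetric] by (simp add: sum_subtractf field_simps)
  moreover have "sqrt (n_sampled n (\<lambda>i. T n i \<omega>)) * (1 / real n) = A n \<omega> * (1 / sqrt (real n))"
    unfolding A_def using n by (simp add: real_sqrt_divide)
  ultimately show ?thesis by (simp only: mult.assoc[symmetric])
qed

lemma \<sigma>sq_mean_nonneg: "0 \<le> \<sigma>sq_mean"
  unfolding \<sigma>sq_mean_def
  by (intro Bochner_Integration.integral_nonneg mult_nonneg_nonneg add_nonneg_nonneg divide_nonneg_nonneg)
     (use q_pos p_pos p_less_1 s_nonneg in \<open>auto simp: less_imp_le\<close>)

text \<open>Since \<open>A n\<close> depends on covariates and sampling, it cannot be split off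
  beforehand. It stays inside until the outcome errors have turned into a Gaussian exponent; only
  then are \<open>A n\<close> and the average variance replaced by their limits, which leaves a
  constant times the characteristic function of the covariate sum.\<close>

theorem statistic_char_limit:
  "(\<lambda>n. CLINT \<omega>|M. iexp (t * (A n \<omega> * (design_sum n \<omega> + matching_error n \<omega>))))
    \<longlonglongrightarrow> complex_of_real (exp (- (t\<^sup>2 * (q_mean * (c_var + \<sigma>sq_mean))) / 2))"
proof -
  define a where "a = sqrt q_mean"
  define S where "S n \<omega> = 1 / real n * (\<Sum>i=1..n. \<sigma>sq n i \<omega>)" for n \<omega>
  have a2: "a\<^sup>2 = q_mean" using q_mean_pos by (simp add: a_def)
  have Am: "A n \<in> borel_measurable M" and cm: "cov_sum n \<in> borel_measurable M" for n by (rule vars_meas)+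
  have Sm: "S n \<in> borel_measurable M" for n
    unfolding S_def by (intro borel_measurable_times borel_measurable_const borel_measurable_sum vars_meas)
  have S0: "0 \<le> S n \<omega>" for n \<omega> unfolding S_def by (intro mult_nonneg_nonneg sum_nonneg \<sigma>sq_nonneg) simp
  note sm0 = \<sigma>sq_mean_nonneg
  have iexp_int: "integrable M (\<lambda>\<omega>. iexp (f \<omega>))" if "f \<in> borel_measurable M" for f
    by (rule integrable_const_bound[of _ 1]) (use that in \<open>auto simp del: of_real_mult\<close>)
  define \<Phi> where "\<Phi> n \<omega> = iexp (t * (A n \<omega> * cov_sum n \<omega>)) * complex_of_real (exp (- (t\<^sup>2 * ((A n \<omega>)\<^sup>2 * S n \<omega>) / 2)))" for n \<omega>
  define \<Psi> where "\<Psi> n \<omega> = iexp (t * (a * cov_sum n \<omega>)) * complex_of_real (exp (- (t\<^sup>2 * (a\<^sup>2 * \<sigma>sq_mean) / 2)))" for n \<omega>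
  have d1: "(\<lambda>n. (CLINT \<omega>|M. iexp (t * (A n \<omega> * (design_sum n \<omega> + matching_error n \<omega>)))) - (CLINT \<omega>|M. iexp (t * (A n \<omega> * design_sum n \<omega>)))) \<longlonglongrightarrow> 0"
  proof (rule expectation_diff_tendsto_zero)
    note [measurable] = Am design_sum_meas matching_error_limit(2)
    show "integrable M (\<lambda>\<omega>. iexp (t * (A n \<omega> * (design_sum n \<omega> + matching_error n \<omega>))))" if "n \<ge> 1" for n
      by (rule iexp_int) (use that in measurable)
    show "integrable M (\<lambda>\<omega>. iexp (t * (A n \<omega> * design_sum n \<omega>)))" for n by (rule iexp_int) measurable
    show "(\<lambda>n. expectation (\<lambda>\<omega>. norm (iexp (t * (A n \<omega> * (design_sum n \<omega> + matching_error n \<omega>))) - iexp (t * (A n \<omega> * design_sum n \<omega>))))) \<longlonglongrightarrow> 0"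
    proof (rule tends_to_zero_in_prob_expectation[OF matching_error_limit(2) _ matching_error_limit(1)])
      show "(\<lambda>\<omega>. iexp (t * (A n \<omega> * (design_sum n \<omega> + matching_error n \<omega>))) - iexp (t * (A n \<omega> * design_sum n \<omega>))) \<in> borel_measurable M"
        if "n \<ge> 1" for n using that by measurable
      show "norm (iexp (t * (A n \<omega> * (design_sum n \<omega> + matching_error n \<omega>))) - iexp (t * (A n \<omega> * design_sum n \<omega>))) \<le> \<bar>t\<bar> * \<bar>matching_error n \<omega>\<bar>" for n \<omega>
      proof -
        have "norm (iexp (t * (A n \<omega> * (design_sum n \<omega> + matching_error n \<omega>))) - iexp (t * (A n \<omega> * design_sum n \<omega>)))
            \<le> \<bar>t * (A n \<omega> * (design_sum n \<omega> + matching_error n \<omega>)) - t * (A n \<omega> * design_sum n \<omega>)\<bar>"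
          by (rule norm_iexp_diff_le)
        also have "\<dots> = \<bar>t\<bar> * (A n \<omega> * \<bar>matching_error n \<omega>\<bar>)"
          using A_bounds(1)[of n \<omega>] by (simp add: abs_mult right_diff_distrib[symmetric])
        also have "\<dots> \<le> \<bar>t\<bar> * \<bar>matching_error n \<omega>\<bar>"
          using A_bounds[of n \<omega>] by (intro mult_left_mono mult_left_le_one_le) auto
        finally show ?thesis .
      qed
      show "norm (iexp (t * (A n \<omega> * (design_sum n \<omega> + matching_error n \<omega>))) - iexp (t * (A n \<omega> * design_sum n \<omega>))) \<le> 2" for n \<omega>
        by (rule norm_iexp_diff_le(2))
    qed simp_all
  qed
  have d2: "(\<lambda>n. (CLINT \<omega>|M. iexp (t * (A n \<omega> * design_sum n \<omega>))) - (CLINT \<omega>|M. \<Phi> n \<omega>)) \<longlonglongrightarrow> 0"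
    unfolding \<Phi>_def S_def by (rule gaussian_replacement_error)
  have d3: "(\<lambda>n. (CLINT \<omega>|M. \<Phi> n \<omega>) - (CLINT \<omega>|M. \<Psi> n \<omega>)) \<longlonglongrightarrow> 0"
  proof (rule expectation_diff_tendsto_zero)
    \<comment> \<open>\<open>X\<close> measures the error of freezing \<open>A n\<close> in the
      phase, \<open>Y\<close> that of freezing the exponent. Both vanish in probability.\<close>
    define X where "X n \<omega> = (A n \<omega> - a) * cov_sum n \<omega>" for n \<omega>
    define Y where "Y n \<omega> = (A n \<omega>)\<^sup>2 * S n \<omega> - a\<^sup>2 * \<sigma>sq_mean" for n \<omega>
    note [measurable] = Am cm Sm
    have Xm[measurable]: "X n \<in> borel_measurable M" and Ym[measurable]: "Y n \<in> borel_measurable M" for n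
      unfolding X_def Y_def by measurable
    have X: "tends_to_zero_in_prob M X" unfolding X_def a_def by (rule A_cov_sum_limit)
    have Y: "tends_to_zero_in_prob M Y"
    proof (rule tends_to_zero_in_prob_le_add)
      show "tends_to_zero_in_prob M (\<lambda>n \<omega>. S n \<omega> - \<sigma>sq_mean)" unfolding S_def by (rule \<sigma>sq_average_limit)
      show "tends_to_zero_in_prob M (\<lambda>n \<omega>. \<sigma>sq_mean * ((A n \<omega>)\<^sup>2 - q_mean))"
        by (rule tends_to_zero_in_prob_cmult[OF A_square_limit])
      show "\<bar>Y n \<omega>\<bar> \<le> \<bar>S n \<omega> - \<sigma>sq_mean\<bar> + \<bar>\<sigma>sq_mean * ((A n \<omega>)\<^sup>2 - q_mean)\<bar>" for n \<omega>
      proof -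
        have "Y n \<omega> = (A n \<omega>)\<^sup>2 * (S n \<omega> - \<sigma>sq_mean) + \<sigma>sq_mean * ((A n \<omega>)\<^sup>2 - q_mean)"
          unfolding Y_def a2 by (simp add: algebra_simps)
        moreover have "\<bar>(A n \<omega>)\<^sup>2 * (S n \<omega> - \<sigma>sq_mean)\<bar> \<le> \<bar>S n \<omega> - \<sigma>sq_mean\<bar>"
          using A_bounds[of n \<omega>] by (simp add: abs_mult mult_left_le_one_le power_le_one)
        ultimately show ?thesis by linarith
      qed
    qed measurable
    have \<Phi>m: "\<Phi> n \<in> borel_measurable M" and \<Psi>m: "\<Psi> n \<in> borel_measurable M" for n unfolding \<Phi>_def \<Psi>_def by measurable
    have \<Phi>1: "norm (\<Phi> n \<omega>) \<le> 1" and \<Psi>1: "norm (\<Psi> n \<omega>) \<le> 1" for n \<omega>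
      using S0[of n \<omega>] sm0 unfolding \<Phi>_def \<Psi>_def norm_mult norm_of_real
      by (simp_all del: of_real_mult)
    show "integrable M (\<Phi> n)" "integrable M (\<Psi> n)" for n
      using \<Phi>1 \<Psi>1 \<Phi>m \<Psi>m by (auto intro!: integrable_const_bound[of _ 1])
    have sum_X_Y: "tends_to_zero_in_prob M (\<lambda>n \<omega>. \<bar>t\<bar> * \<bar>X n \<omega>\<bar> + t\<^sup>2 / 2 * \<bar>Y n \<omega>\<bar>)"
    proof (rule tends_to_zero_in_prob_le_add)
      show "tends_to_zero_in_prob M (\<lambda>n \<omega>. \<bar>t\<bar> * X n \<omega>)" "tends_to_zero_in_prob M (\<lambda>n \<omega>. t\<^sup>2 / 2 * Y n \<omega>)"
        by (rule tends_to_zero_in_prob_cmult[OF X] tends_to_zero_in_prob_cmult[OF Y])+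
    qed (auto simp: abs_mult)
    show "(\<lambda>n. expectation (\<lambda>\<omega>. norm (\<Phi> n \<omega> - \<Psi> n \<omega>))) \<longlonglongrightarrow> 0"
    proof (rule tends_to_zero_in_prob_expectation[OF _ _ sum_X_Y])
      show "norm (\<Phi> n \<omega> - \<Psi> n \<omega>) \<le> 2" for n \<omega>
        using norm_triangle_ineq4[of "\<Phi> n \<omega>" "\<Psi> n \<omega>"] \<Phi>1[of n \<omega>] \<Psi>1[of n \<omega>] by linarith
      fix n \<omega>
      define x y where "x = t\<^sup>2 * ((A n \<omega>)\<^sup>2 * S n \<omega>) / 2" and "y = t\<^sup>2 * (a\<^sup>2 * \<sigma>sq_mean) / 2"
      have xy: "0 \<le> x" "0 \<le> y" using S0[of n \<omega>] sm0 by (auto simp: x_def y_def)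
      \<comment> \<open>Phase and damping are exchanged one after the other. All factors have
        modulus at most 1, and both \<open>iexp\<close> and the decaying exponential are
        1-Lipschitz.\<close>
      have "\<Phi> n \<omega> - \<Psi> n \<omega> = (iexp (t * (A n \<omega> * cov_sum n \<omega>)) - iexp (t * (a * cov_sum n \<omega>))) * complex_of_real (exp (- x))
          + iexp (t * (a * cov_sum n \<omega>)) * complex_of_real (exp (- x) - exp (- y))"
        unfolding \<Phi>_def \<Psi>_def x_def y_def by (simp add: algebra_simps)
      then have "norm (\<Phi> n \<omega> - \<Psi> n \<omega>) \<le> norm (iexp (t * (A n \<omega> * cov_sum n \<omega>)) - iexp (t * (a * cov_sum n \<omega>))) * exp (- x)
          + \<bar>exp (- x) - exp (- y)\<bar>"
        by (metis (no_types, lifting) norm_triangle_ineq norm_mult norm_of_real abs_exp_cancel norm_exp_i_times mult_1)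
      also have "\<dots> \<le> \<bar>t * (A n \<omega> * cov_sum n \<omega>) - t * (a * cov_sum n \<omega>)\<bar> * 1 + \<bar>x - y\<bar>"
        using xy by (intro add_mono mult_mono norm_iexp_diff_le abs_exp_minus_diff_le) auto
      also have "\<dots> = \<bar>t\<bar> * \<bar>X n \<omega>\<bar> + t\<^sup>2 / 2 * \<bar>Y n \<omega>\<bar>"
      proof -
        have X_eq: "t * (A n \<omega> * cov_sum n \<omega>) - t * (a * cov_sum n \<omega>) = t * X n \<omega>" by (simp add: X_def algebra_simps)
        have Y_eq: "x - y = t\<^sup>2 / 2 * Y n \<omega>" by (simp add: x_def y_def Y_def algebra_simps diff_divide_distrib)
        show ?thesis unfolding X_eq Y_eq abs_mult by simp
      qed
      finally show "norm (\<Phi> n \<omega> - \<Psi> n \<omega>) \<le> 1 * \<bar>\<bar>t\<bar> * \<bar>X n \<omega>\<bar> + t\<^sup>2 / 2 * \<bar>Y n \<omega>\<bar>\<bar>" by simp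
    qed (use \<Phi>m \<Psi>m in auto)
  qed
  have "(\<lambda>n. (CLINT \<omega>|M. iexp ((t * a) * cov_sum n \<omega>)) * complex_of_real (exp (- (t\<^sup>2 * (a\<^sup>2 * \<sigma>sq_mean) / 2))))
      \<longlonglongrightarrow> complex_of_real (exp (- ((t * a)\<^sup>2 * c_var) / 2)) * complex_of_real (exp (- (t\<^sup>2 * (a\<^sup>2 * \<sigma>sq_mean) / 2)))"
    by (intro tendsto_mult cov_sum_char_limit tendsto_const)
  moreover have "(CLINT \<omega>|M. \<Psi> n \<omega>) = (CLINT \<omega>|M. iexp ((t * a) * cov_sum n \<omega>)) * complex_of_real (exp (- (t\<^sup>2 * (a\<^sup>2 * \<sigma>sq_mean) / 2)))" for n
    unfolding \<Psi>_def by (subst integral_mult_left_zero[symmetric]) (simp add: mult.assoc)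
  moreover have "complex_of_real (exp (- ((t * a)\<^sup>2 * c_var) / 2)) * complex_of_real (exp (- (t\<^sup>2 * (a\<^sup>2 * \<sigma>sq_mean) / 2)))
      = complex_of_real (exp (- (t\<^sup>2 * (q_mean * (c_var + \<sigma>sq_mean))) / 2))"
    unfolding of_real_mult[symmetric] exp_add[symmetric] power_mult_distrib a2
    by (rule arg_cong[where f="\<lambda>x. complex_of_real (exp x)"]) (simp add: field_simps)
  ultimately have d4: "(\<lambda>n. CLINT \<omega>|M. \<Psi> n \<omega>) \<longlonglongrightarrow> complex_of_real (exp (- (t\<^sup>2 * (q_mean * (c_var + \<sigma>sq_mean))) / 2))"
    by (simp only:)
  from tendsto_add[OF d1 tendsto_add[OF d2 tendsto_add[OF d3 d4]]] show ?thesis by simp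
qed

end

subsection \<open>The central limit theorem\<close>

text \<open>The conditional Jensen inequality for the square.\<close>

lemma (in prob_space) real_cond_exp_square_integrable:
  assumes F: "subalgebra M F" and [measurable]: "X \<in> borel_measurable M" and X2: "integrable M (\<lambda>\<omega>. (X \<omega>)\<^sup>2)"
  shows "integrable M (\<lambda>\<omega>. (real_cond_exp M F X \<omega>)\<^sup>2)"
proof -
  interpret finite_measure_subalgebra M F
    using F by (simp add: finite_measure_subalgebra_def finite_measure_subalgebra_axioms_def finite_measure_axioms)
  have X: "integrable M X" by (rule square_integrable_imp_integrable[OF assms(2,3)])
  show ?thesis
    by (rule integrable_convex_cond_exp[OF X, where q="\<lambda>x. x\<^sup>2" and I=UNIV])
       (use X2 convex_power2 in \<open>auto simp: emeasure_eq_measure\<close>)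
qed

lemma (in prob_space) conditional_moments:
  fixes X :: "'a \<Rightarrow> real" and Z :: "'a \<Rightarrow> 'b"
  assumes Z: "Z \<in> M \<rightarrow>\<^sub>M N" and X: "X \<in> borel_measurable M" "integrable M (\<lambda>\<omega>. (X \<omega>)\<^sup>2)"
  defines "F \<equiv> gen_by M Z N"
  obtains m s where "m \<in> borel_measurable N" "s \<in> borel_measurable N" "\<And>x. 0 \<le> s x"
    and "\<And>\<omega>. \<omega> \<in> space M \<Longrightarrow> real_cond_exp M F X \<omega> = m (Z \<omega>)"
    and "AE \<omega> in M. real_cond_var M F X \<omega> = s (Z \<omega>)"
    and "integrable M (\<lambda>\<omega>. (m (Z \<omega>))\<^sup>2)" "integrable M (\<lambda>\<omega>. s (Z \<omega>))"
    and "cond_mean_zero M F (\<lambda>\<omega>. X \<omega> - m (Z \<omega>))"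
    and "cond_mean_zero M F (\<lambda>\<omega>. (X \<omega> - m (Z \<omega>))\<^sup>2 - s (Z \<omega>))"
proof -
  have F: "subalgebra M F" unfolding F_def by (rule subalgebra_gen_by[OF Z])
  interpret sigma_finite_subalgebra M F using F by (rule subalgebra_sigma_finite)
  note [measurable] = X(1)
  have Z': "Z \<in> space M \<rightarrow> space N" using measurable_space[OF Z] by auto
  have Xi: "integrable M X" by (rule square_integrable_imp_integrable[OF X])
  obtain m where m: "m \<in> borel_measurable N" "\<And>\<omega>. \<omega> \<in> space M \<Longrightarrow> real_cond_exp M F X \<omega> = m (Z \<omega>)"
    unfolding F_def using real_cond_exp_factor[OF Z', of X] by blast
  define X' where "X' \<omega> = (X \<omega> - m (Z \<omega>))\<^sup>2" for \<omega>
  obtain s' where s': "s' \<in> borel_measurable N" "\<And>\<omega>. \<omega> \<in> space M \<Longrightarrow> real_cond_exp M F X' \<omega> = s' (Z \<omega>)"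
    unfolding F_def using real_cond_exp_factor[OF Z', of X'] by blast
  \<comment> \<open>The factor of the conditional variance is nonnegative only almost surely along
    \<open>Z\<close>. Cutting it off at 0 makes it nonnegative everywhere without changing it
    outside a null set.\<close>
  define s where "s x = max 0 (s' x)" for x
  have sm: "s \<in> borel_measurable N" unfolding s_def using s'(1) by simp
  have mZ: "(\<lambda>\<omega>. m (Z \<omega>)) \<in> borel_measurable M" and sZ: "(\<lambda>\<omega>. s (Z \<omega>)) \<in> borel_measurable M"
    using measurable_compose[OF Z m(1)] measurable_compose[OF Z sm] by auto
  have m2: "integrable M (\<lambda>\<omega>. (m (Z \<omega>))\<^sup>2)"
    using real_cond_exp_square_integrable[OF F X] by (subst (asm) Bochner_Integration.integrable_cong[OF refl]) (auto simp: m(2))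
  have X'i: "integrable M X'"
    using integrable_square_add[of X M "\<lambda>\<omega>. - m (Z \<omega>)"] X m2 mZ by (simp add: X'_def[abs_def])
  have pos: "AE \<omega> in M. 0 \<le> real_cond_exp M F X' \<omega>"
    by (rule real_cond_exp_pos) (use X'i in \<open>auto simp: X'_def\<close>)
  have ce_s: "AE \<omega> in M. real_cond_exp M F X' \<omega> = s (Z \<omega>)"
    using pos by (rule AE_mp) (auto intro!: AE_I2 simp: s'(2) s_def)
  have ce_m: "AE \<omega> in M. real_cond_exp M F X \<omega> = m (Z \<omega>)"
    using m(2) by auto
  have var: "AE \<omega> in M. real_cond_var M F X \<omega> = s (Z \<omega>)"
  proof -
    have "AE \<omega> in M. real_cond_exp M F (\<lambda>\<omega>. (X \<omega> - real_cond_exp M F X \<omega>)\<^sup>2) \<omega> = real_cond_exp M F X' \<omega>"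
    proof (rule real_cond_exp_cong)
      show "AE \<omega> in M. (X \<omega> - real_cond_exp M F X \<omega>)\<^sup>2 = X' \<omega>" using m(2) by (auto simp: X'_def)
      show "(\<lambda>\<omega>. (X \<omega> - real_cond_exp M F X \<omega>)\<^sup>2) \<in> borel_measurable M" by measurable
    qed (use X'i in auto)
    with ce_s show ?thesis unfolding real_cond_var_def by auto
  qed
  show thesis
  proof (rule that[OF m(1) sm _ m(2) var m2])
    show "0 \<le> s x" for x by (simp add: s_def)
    show "integrable M (\<lambda>\<omega>. s (Z \<omega>))" by (rule cond_mean_zero_real_cond_exp(2)[OF F X'i ce_s sZ])
    show "cond_mean_zero M F (\<lambda>\<omega>. X \<omega> - m (Z \<omega>))" by (rule cond_mean_zero_real_cond_exp(1)[OF F Xi ce_m mZ])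
    show "cond_mean_zero M F (\<lambda>\<omega>. (X \<omega> - m (Z \<omega>))\<^sup>2 - s (Z \<omega>))"
      using cond_mean_zero_real_cond_exp(1)[OF F X'i ce_s sZ] by (simp add: X'_def[abs_def])
  qed
qed

text \<open>What remains is to pass from conditional expectations to Borel functions of the
  covariate and from characteristic functions to weak convergence by Levy's theorem. The limit may
  be degenerate: \<open>V = 0\<close> yields a point mass with characteristic function 1.\<close>

theorem theorem4p2:
  fixes M :: "'w measure"
    and \<psi> :: "nat \<Rightarrow> 'w \<Rightarrow> 'a::euclidean_space"
    and Y0 Y1 :: "nat \<Rightarrow> 'w \<Rightarrow> real"
    and W :: "nat \<Rightarrow> 'w \<Rightarrow> 'a \<times> real \<times> real"
    and N :: "nat \<Rightarrow> 'r measure"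
    and rnd :: "nat \<Rightarrow> 'w \<Rightarrow> 'r"
    and q p :: "'a \<Rightarrow> real"
    and lev_q lev_p :: "(nat \<times> nat) set"
    and T D :: "nat \<Rightarrow> nat \<Rightarrow> 'w \<Rightarrow> bool"
    and Y :: "nat \<Rightarrow> nat \<Rightarrow> 'w \<Rightarrow> real"
    and ATE V :: real
    and c \<sigma>0sq \<sigma>1sq :: "'w \<Rightarrow> real"
  assumes "prob_space M"
    and W_def: "\<And>i \<omega>. W i \<omega> = (\<psi> i \<omega>, Y0 i \<omega>, Y1 i \<omega>)"
    and indep: "prob_space.indep_vars M (\<lambda>_. borel) W {1..}"
    and ident: "\<And>i. i \<ge> 1 \<Longrightarrow> distr M borel (W i) = distr M borel (W 1)"
    and "integrable M (\<lambda>\<omega>. (Y0 1 \<omega>)\<^sup>2)" and "integrable M (\<lambda>\<omega>. (Y1 1 \<omega>)\<^sup>2)"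
    and "\<And>n. n \<ge> 1 \<Longrightarrow> rnd n \<in> measurable M (N n)"
    and "\<And>n. n \<ge> 1 \<Longrightarrow> prob_space.indep_set M
           (sets (gen_by M (vec_upto n W) (borel_upto n))) (sets (gen_by M (rnd n) (N n)))"
    and "propensity_levels q lev_q" and "\<And>x. q x \<in> {0<..1}"
    and "propensity_levels p lev_p" and "\<And>x. p x \<in> {0<..<1}"
    and "\<And>n i. i \<in> {1..n} \<Longrightarrow> T n i \<in> measurable M (count_space UNIV)"
    and "\<And>n i. i \<in> {1..n} \<Longrightarrow> D n i \<in> measurable M (count_space UNIV)"
    and "Loc_sampling M W rnd N q lev_q T"
    and "Loc_assignment M W rnd N T p lev_p D"
    and Y_def: "\<And>n i \<omega>. Y n i \<omega> = obs_outcome (T n i \<omega>) (D n i \<omega>) (Y0 i \<omega>) (Y1 i \<omega>)"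
    and ATE_def: "ATE = (\<integral>\<omega>. Y1 1 \<omega> - Y0 1 \<omega> \<partial>M)"
    and c_def: "c = real_cond_exp M (gen_by M (\<psi> 1) borel) (\<lambda>\<omega>. Y1 1 \<omega> - Y0 1 \<omega>)"
    and s1_def: "\<sigma>1sq = real_cond_var M (gen_by M (\<psi> 1) borel) (Y1 1)"
    and s0_def: "\<sigma>0sq = real_cond_var M (gen_by M (\<psi> 1) borel) (Y0 1)"
    and V_def: "V = (\<integral>\<omega>. q (\<psi> 1 \<omega>) \<partial>M) *
          ((\<integral>\<omega>. (c \<omega> - (\<integral>\<omega>'. c \<omega>' \<partial>M))\<^sup>2 \<partial>M)
           + (\<integral>\<omega>. (1 / q (\<psi> 1 \<omega>)) *
                 (\<sigma>1sq \<omega> / p (\<psi> 1 \<omega>) + \<sigma>0sq \<omega> / (1 - p (\<psi> 1 \<omega>))) \<partial>M))"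
  shows "weak_conv_m
    (\<lambda>n. distr M borel (\<lambda>\<omega>. sqrt (n_sampled n (\<lambda>i. T n i \<omega>)) *
        (theta_hat n q p (\<lambda>i. \<psi> i \<omega>) (\<lambda>i. T n i \<omega>) (\<lambda>i. D n i \<omega>) (\<lambda>i. Y n i \<omega>) - ATE)))
    (normal_law 0 V)"
proof -
  interpret local_randomization M \<psi> Y0 Y1 W N rnd q p lev_q lev_p T D
    using assms unfolding local_randomization_def local_randomization_axioms_def by blast
  define F where "F = gen_by M (\<psi> 1) borel"
  have \<psi>1: "\<psi> 1 \<in> M \<rightarrow>\<^sub>M borel" by (rule \<psi>_of_W[OF W_meas[OF order_refl]])
  have F: "subalgebra M F" unfolding F_def by (rule subalgebra_gen_by[OF \<psi>1])
  interpret cond: sigma_finite_subalgebra M F using F by (rule subalgebra_sigma_finite)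
  have snd_W: "(\<lambda>\<omega>. snd (W 1 \<omega>)) \<in> M \<rightarrow>\<^sub>M borel"
    by (rule measurable_compose[OF W_meas[OF order_refl] measurable_snd_borel])
  have Y0_meas: "Y0 1 \<in> borel_measurable M" and Y1_meas: "Y1 1 \<in> borel_measurable M"
    using measurable_compose[OF snd_W measurable_fst_borel] measurable_compose[OF snd_W measurable_snd_borel]
    by (simp_all add: W_def)
  obtain m0 s0 where "m0 \<in> borel_measurable borel" "s0 \<in> borel_measurable borel" "\<And>x. 0 \<le> s0 x"
    and ce0: "\<And>\<omega>. \<omega> \<in> space M \<Longrightarrow> real_cond_exp M F (Y0 1) \<omega> = m0 (\<psi> 1 \<omega>)"
    and cv0: "AE \<omega> in M. real_cond_var M F (Y0 1) \<omega> = s0 (\<psi> 1 \<omega>)"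
    and "integrable M (\<lambda>\<omega>. (m0 (\<psi> 1 \<omega>))\<^sup>2)" "integrable M (\<lambda>\<omega>. s0 (\<psi> 1 \<omega>))"
    and "cond_mean_zero M F (\<lambda>\<omega>. Y0 1 \<omega> - m0 (\<psi> 1 \<omega>))"
    and "cond_mean_zero M F (\<lambda>\<omega>. (Y0 1 \<omega> - m0 (\<psi> 1 \<omega>))\<^sup>2 - s0 (\<psi> 1 \<omega>))"
    unfolding F_def using conditional_moments[OF \<psi>1 Y0_meas Y0_square] by blast
  note moments0 = this
  obtain m1 s1 where "m1 \<in> borel_measurable borel" "s1 \<in> borel_measurable borel" "\<And>x. 0 \<le> s1 x"
    and ce1: "\<And>\<omega>. \<omega> \<in> space M \<Longrightarrow> real_cond_exp M F (Y1 1) \<omega> = m1 (\<psi> 1 \<omega>)"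
    and cv1: "AE \<omega> in M. real_cond_var M F (Y1 1) \<omega> = s1 (\<psi> 1 \<omega>)"
    and "integrable M (\<lambda>\<omega>. (m1 (\<psi> 1 \<omega>))\<^sup>2)" "integrable M (\<lambda>\<omega>. s1 (\<psi> 1 \<omega>))"
    and "cond_mean_zero M F (\<lambda>\<omega>. Y1 1 \<omega> - m1 (\<psi> 1 \<omega>))"
    and "cond_mean_zero M F (\<lambda>\<omega>. (Y1 1 \<omega> - m1 (\<psi> 1 \<omega>))\<^sup>2 - s1 (\<psi> 1 \<omega>))"
    unfolding F_def using conditional_moments[OF \<psi>1 Y1_meas Y1_square] by blast
  note moments1 = this
  interpret om: outcome_moments M \<psi> Y0 Y1 W N rnd q p lev_q lev_p T D m0 m1 s0 s1
    using moments0 moments1 by unfold_locales (simp_all add: F_def)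
  have Y0i: "integrable M (Y0 1)" and Y1i: "integrable M (Y1 1)"
    using square_integrable_imp_integrable[OF Y0_meas Y0_square] square_integrable_imp_integrable[OF Y1_meas Y1_square] by auto
  \<comment> \<open>The conditional expectation of a difference equals the difference of the
    conditional expectations almost surely only, which suffices because \<open>c\<close> enters
    through integrals.\<close>
  have c_AE: "AE \<omega> in M. c \<omega> = om.c (\<psi> 1 \<omega>)"
    using cond.real_cond_exp_diff[OF Y1i Y0i] AE_space
    unfolding c_def F_def[symmetric]
    by eventually_elim (simp add: ce0 ce1 om.c_def del: One_nat_def)
  have c_meas: "c \<in> borel_measurable M" unfolding c_def F_def[symmetric] by simp
  have omc: "(\<lambda>\<omega>. om.c (\<psi> 1 \<omega>)) \<in> borel_measurable M" by (rule measurable_compose[OF \<psi>1 om.c_meas])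
  have c_mean: "(\<integral>\<omega>. c \<omega> \<partial>M) = om.\<theta>"
    unfolding om.\<theta>_def by (rule integral_cong_AE[OF c_meas omc c_AE])
  have c_variance: "(\<integral>\<omega>. (c \<omega> - (\<integral>\<omega>'. c \<omega>' \<partial>M))\<^sup>2 \<partial>M) = om.c_var"
    unfolding c_mean om.c_var_def by (rule integral_cong_AE) (use c_meas omc c_AE in auto)
  have ATE: "ATE = om.\<theta>"
    unfolding ATE_def c_mean[symmetric] c_def F_def[symmetric]
    by (rule cond.real_cond_exp_int(2)[symmetric]) (use Y0i Y1i in auto)
  have "(\<integral>\<omega>. (1 / q (\<psi> 1 \<omega>)) * (\<sigma>1sq \<omega> / p (\<psi> 1 \<omega>) + \<sigma>0sq \<omega> / (1 - p (\<psi> 1 \<omega>))) \<partial>M) = om.\<sigma>sq_mean"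
    unfolding om.\<sigma>sq_mean_def
  proof (rule integral_cong_AE)
    have [measurable]: "\<sigma>1sq \<in> borel_measurable M" "\<sigma>0sq \<in> borel_measurable M"
      unfolding s1_def s0_def F_def[symmetric] real_cond_var_def by simp_all
    note [measurable] = om.q_meas om.p_meas om.s_meas \<psi>1
    show "(\<lambda>\<omega>. 1 / q (\<psi> 1 \<omega>) * (\<sigma>1sq \<omega> / p (\<psi> 1 \<omega>) + \<sigma>0sq \<omega> / (1 - p (\<psi> 1 \<omega>)))) \<in> borel_measurable M"
      "(\<lambda>\<omega>. 1 / q (\<psi> 1 \<omega>) * (s1 (\<psi> 1 \<omega>) / p (\<psi> 1 \<omega>) + s0 (\<psi> 1 \<omega>) / (1 - p (\<psi> 1 \<omega>)))) \<in> borel_measurable M"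
      by measurable
    show "AE \<omega> in M. 1 / q (\<psi> 1 \<omega>) * (\<sigma>1sq \<omega> / p (\<psi> 1 \<omega>) + \<sigma>0sq \<omega> / (1 - p (\<psi> 1 \<omega>)))
        = 1 / q (\<psi> 1 \<omega>) * (s1 (\<psi> 1 \<omega>) / p (\<psi> 1 \<omega>) + s0 (\<psi> 1 \<omega>) / (1 - p (\<psi> 1 \<omega>)))"
      using cv0 cv1 unfolding s1_def s0_def F_def[symmetric] by eventually_elim simp
  qed
  then have V: "V = om.q_mean * (om.c_var + om.\<sigma>sq_mean)"
    unfolding V_def c_variance om.q_mean_def by simp
  have V_nonneg: "0 \<le> V"
    unfolding V using om.q_mean_pos om.c_var_nonneg om.\<sigma>sq_mean_nonneg by simp
  define U where "U n \<omega> = sqrt (n_sampled n (\<lambda>i. T n i \<omega>)) *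
        (theta_hat n q p (\<lambda>i. \<psi> i \<omega>) (\<lambda>i. T n i \<omega>) (\<lambda>i. D n i \<omega>) (\<lambda>i. Y n i \<omega>) - ATE)" for n \<omega>
  have U_eq: "U n \<omega> = om.A n \<omega> * (om.design_sum n \<omega> + om.matching_error n \<omega>)" if "n \<ge> 1" for n \<omega>
    unfolding U_def ATE Y_def by (rule om.statistic_decomposition[OF that])
  have U_meas: "U n \<in> borel_measurable M" for n
  \<comment> \<open>The decomposition needs at least one unit. For \<open>n = 0\<close> nobody is
    sampled and the statistic is 0.\<close>
  proof (cases "n = 0")
    case True
    then have "U n = (\<lambda>_. 0)" by (simp add: U_def n_sampled_def fun_eq_iff)
    then show ?thesis by simp
  next
    case False
    then have "U n = (\<lambda>\<omega>. om.A n \<omega> * (om.design_sum n \<omega> + om.matching_error n \<omega>))" using U_eq by (simp add: fun_eq_iff)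
    moreover have "om.matching_error n \<in> borel_measurable M" by (rule om.matching_error_limit(2)) (use False in simp)
    ultimately show ?thesis
      by (simp only: borel_measurable_times borel_measurable_add om.vars_meas(1) om.design_sum_meas)
  qed
  have "weak_conv_m (\<lambda>n. distr M borel (U n)) (normal_law 0 V)"
  proof (rule levy_continuity[OF real_distribution_distr[OF U_meas] real_distribution_normal_law])
    fix t :: real
    have "char (distr M borel (U n)) t = (CLINT \<omega>|M. iexp (t * U n \<omega>))" for n
      unfolding char_def by (rule integral_distr[OF U_meas]) measurable
    moreover have "(\<lambda>n. CLINT \<omega>|M. iexp (t * U n \<omega>)) \<longlonglongrightarrow> char (normal_law 0 V) t"
      unfolding char_normal_law[OF V_nonneg] unfolding V
      by (rule Lim_transform_eventually[OF om.statistic_char_limit])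
         (rule eventually_sequentiallyI[of 1], simp add: U_eq)
    ultimately show "(\<lambda>n. char (distr M borel (U n)) t) \<longlonglongrightarrow> char (normal_law 0 V) t" by simp
  qed
  then show ?thesis unfolding U_def[abs_def] .
qed

end
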